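(* Let $R$ be a left Noetherian algebra over a field, and let $N=\operatorname{Nil}(R)$ be its nilradical. Suppose that $R$ contains a weakly Noetherian subalgebra $W\subseteq R$ such that $R/N$ is finitely generated as a left module over $\overline{W}$, the image of $W$ in $R/N$. Let $C=\operatorname{Cent}(W)$ be the center of $W$, and suppose that there is an element $c\in C$ which is regular in $R$ and such that the localization $W[c^{-1}]$ is finite over its center. Then $R$ is representable.
   Context: Algebras are associative with unit. $\operatorname{Nil}(R)$ denotes the nilradical of $R$; it is nilpotent when $R$ is left Noetherian. A ring is weakly Noetherian if it satisfies the ascending chain condition on two-sided ideals. An element of $R$ is regular in $R$ if it is neither a left nor a right zero divisor in $R$. "Finite over its center" means finitely generated as a module over its center. An algebra $R$ is representable if it embeds (as a ring) into a matrix ring $M_n(K)$ for some $n\geq 1$ and some field $K$. *)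

theory Defs
  imports "HOL-Algebra.Module" "HOL-Algebra.Subrings" "HOL-Algebra.QuotRing"
    "HOL-Algebra.Weak_Morphisms"
begin

text \<open>The library locale \<^locale>\<open>algebra\<close> requires the algebra to be commutative.\<close>

locale assoc_algebra = F?: field F + module F R + R?: ring R
  for F (structure) and R (structure) +
  assumes smult_mult_left:
      "\<lbrakk>a \<in> carrier F; x \<in> carrier R; y \<in> carrier R\<rbrakk>
        \<Longrightarrow> (a \<odot>\<^bsub>R\<^esub> x) \<otimes>\<^bsub>R\<^esub> y = a \<odot>\<^bsub>R\<^esub> (x \<otimes>\<^bsub>R\<^esub> y)"
    and smult_mult_right:
      "\<lbrakk>a \<in> carrier F; x \<in> carrier R; y \<in> carrier R\<rbrakk>
        \<Longrightarrow> x \<otimes>\<^bsub>R\<^esub> (a \<odot>\<^bsub>R\<^esub> y) = a \<odot>\<^bsub>R\<^esub> (x \<otimes>\<^bsub>R\<^esub> y)"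

definition assoc_subalgebra ::
    "'a set \<Rightarrow> ('f, 'c) ring_scheme \<Rightarrow> ('f, 'a, 'm) module_scheme \<Rightarrow> bool"
  where "assoc_subalgebra W F R \<longleftrightarrow>
    subring W R \<and> (\<forall>a\<in>carrier F. \<forall>w\<in>W. a \<odot>\<^bsub>R\<^esub> w \<in> W)"

definition left_ideal :: "'a set \<Rightarrow> ('a, 'm) ring_scheme \<Rightarrow> bool"
  where "left_ideal I R \<longleftrightarrow>
    additive_subgroup I R \<and> (\<forall>r\<in>carrier R. \<forall>x\<in>I. r \<otimes>\<^bsub>R\<^esub> x \<in> I)"

definition ascending_chain_condition :: "'a set set \<Rightarrow> bool"
  where "ascending_chain_condition \<I> \<longleftrightarrow>
    (\<forall>I :: nat \<Rightarrow> 'a set. (\<forall>n. I n \<in> \<I> \<and> I n \<subseteq> I (Suc n)) \<longrightarrow>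
      (\<exists>m. \<forall>n\<ge>m. I n = I m))"

definition left_noetherian :: "('a, 'm) ring_scheme \<Rightarrow> bool"
  where "left_noetherian R \<longleftrightarrow> ascending_chain_condition {I. left_ideal I R}"

definition weakly_noetherian :: "('a, 'm) ring_scheme \<Rightarrow> bool"
  where "weakly_noetherian R \<longleftrightarrow> ascending_chain_condition {I. ideal I R}"

definition nil_ideal :: "'a set \<Rightarrow> ('a, 'm) ring_scheme \<Rightarrow> bool"
  where "nil_ideal I R \<longleftrightarrow>
    ideal I R \<and> (\<forall>x\<in>I. \<exists>n::nat. x [^]\<^bsub>R\<^esub> n = \<zero>\<^bsub>R\<^esub>)"

text \<open>The (upper) nilradical: the sum of all nil two-sided ideals.  For left Noetherian
  rings it coincides with the prime radical (Levitzki).\<close>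

definition nilradical :: "('a, 'm) ring_scheme \<Rightarrow> 'a set"
  where "nilradical R = genideal R (\<Union>{I. nil_ideal I R})"

definition ring_center :: "('a, 'm) ring_scheme \<Rightarrow> 'a set"
  where "ring_center R =
    {z \<in> carrier R. \<forall>x\<in>carrier R. z \<otimes>\<^bsub>R\<^esub> x = x \<otimes>\<^bsub>R\<^esub> z}"

definition regular_element :: "('a, 'm) ring_scheme \<Rightarrow> 'a \<Rightarrow> bool"
  where "regular_element R c \<longleftrightarrow> c \<in> carrier R \<and>
    (\<forall>x\<in>carrier R. (c \<otimes>\<^bsub>R\<^esub> x = \<zero>\<^bsub>R\<^esub> \<longrightarrow> x = \<zero>\<^bsub>R\<^esub>) \<and>
                   (x \<otimes>\<^bsub>R\<^esub> c = \<zero>\<^bsub>R\<^esub> \<longrightarrow> x = \<zero>\<^bsub>R\<^esub>))"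

text \<open>The ring \<open>R\<close> is finitely generated as a left module over its subring \<open>S\<close>.\<close>

definition fin_gen_left :: "'a set \<Rightarrow> ('a, 'm) ring_scheme \<Rightarrow> bool"
  where "fin_gen_left S R \<longleftrightarrow>
    (\<exists>X. finite X \<and> X \<subseteq> carrier R \<and>
      (\<forall>r\<in>carrier R. \<exists>s. s \<in> X \<rightarrow> S \<and>
         r = (\<Oplus>\<^bsub>R\<^esub>x\<in>X. s x \<otimes>\<^bsub>R\<^esub> x)))"

definition finite_over_center :: "('a, 'm) ring_scheme \<Rightarrow> bool"
  where "finite_over_center R \<longleftrightarrow> fin_gen_left (ring_center R) R"

text \<open>For \<open>c\<close> central in \<open>R\<close>, the fraction \<open>c\<^sup>-\<^sup>n w\<close> is the class of the pair \<open>(w, n)\<close>.\<close>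

definition fraction :: "('a, 'm) ring_scheme \<Rightarrow> 'a \<Rightarrow> 'a \<Rightarrow> nat \<Rightarrow> ('a \<times> nat) set"
  where "fraction R c w n =
    {(v, m). v \<in> carrier R \<and>
      (\<exists>k. c [^]\<^bsub>R\<^esub> (k + n) \<otimes>\<^bsub>R\<^esub> v = c [^]\<^bsub>R\<^esub> (k + m) \<otimes>\<^bsub>R\<^esub> w)}"

definition localization :: "('a, 'm) ring_scheme \<Rightarrow> 'a \<Rightarrow> ('a \<times> nat) set ring"
  where "localization R c =
    \<lparr> carrier = {fraction R c w n |w n. w \<in> carrier R},
      mult = (\<lambda>X Y. \<Union>(w, n)\<in>X. \<Union>(v, m)\<in>Y. fraction R c (w \<otimes>\<^bsub>R\<^esub> v) (n + m)),
      one = fraction R c \<one>\<^bsub>R\<^esub> 0,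
      zero = fraction R c \<zero>\<^bsub>R\<^esub> 0,
      add = (\<lambda>X Y. \<Union>(w, n)\<in>X. \<Union>(v, m)\<in>Y.
        fraction R c (c [^]\<^bsub>R\<^esub> m \<otimes>\<^bsub>R\<^esub> w \<oplus>\<^bsub>R\<^esub> c [^]\<^bsub>R\<^esub> n \<otimes>\<^bsub>R\<^esub> v) (n + m)) \<rparr>"

text \<open>The facts characterizing the localization: it is a ring, \<open>w \<mapsto> w/1\<close> is a ring
  homomorphism (injective for regular \<open>c\<close>) sending \<open>c\<close> to a central unit, and every element
  is a fraction.\<close>

locale central_element = ring R for R (structure) and c +
  assumes central: "c \<in> ring_center R"
begin

lemma c_closed [simp, intro]: "c \<in> carrier R"
  using central by (simp add: ring_center_def)

lemma c_comm: "x \<in> carrier R \<Longrightarrow> c \<otimes> x = x \<otimes> c"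
  using central by (simp add: ring_center_def)

lemma pow_comm: "x \<in> carrier R \<Longrightarrow> c [^] (n::nat) \<otimes> x = x \<otimes> c [^] n"
proof (induction n)
  case (Suc n)
  have "c [^] Suc n \<otimes> x = c [^] n \<otimes> (x \<otimes> c)"
    using Suc.prems by (simp add: m_assoc c_comm)
  also have "\<dots> = x \<otimes> c [^] Suc n"
    using Suc by (simp add: m_assoc [symmetric])
  finally show ?case .
qed simp

lemma pow_pow: "x \<in> carrier R \<Longrightarrow> c [^] (n::nat) \<otimes> (c [^] m \<otimes> x) = c [^] (n + m) \<otimes> x"
  by (simp add: m_assoc [symmetric] nat_pow_mult)

lemma pow_lift:
  assumes "c [^] (n::nat) \<otimes> x = c [^] (m::nat) \<otimes> y" "x \<in> carrier R" "y \<in> carrier R"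
    and "n' = j + n" "m' = j + m"
  shows "c [^] n' \<otimes> x = c [^] m' \<otimes> y"
  using assms pow_pow [of x j n] pow_pow [of y j m] by simp

abbreviation "eqf w n v m \<equiv> \<exists>k::nat. c [^] (k + n) \<otimes> v = c [^] (k + m) \<otimes> w"

lemma eqf_refl: "eqf w n w n"
  by blast

lemma eqf_sym: "eqf w n v m \<Longrightarrow> eqf v m w n"
  by metis

lemma eqf_trans:
  assumes "eqf w n v m" "eqf v m u q" "w \<in> carrier R" "v \<in> carrier R" "u \<in> carrier R"
  shows "eqf w n u q"
proof -
  obtain k l where k: "c [^] (k + n) \<otimes> v = c [^] (k + m) \<otimes> w"
    and l: "c [^] (l + m) \<otimes> u = c [^] (l + q) \<otimes> v"
    using assms by blast
  have 1: "c [^] (k + l + m + n) \<otimes> u = c [^] (k + n + l + q) \<otimes> v"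
    by (rule pow_lift [OF l, of _ "k + n"]) (use assms in auto)
  have 2: "c [^] (k + n + l + q) \<otimes> v = c [^] (k + l + m + q) \<otimes> w"
    by (rule pow_lift [OF k, of _ "l + q"]) (use assms in auto)
  show ?thesis
    using 1 2 by metis
qed

lemma fraction_eq_iff:
  assumes "w \<in> carrier R" "v \<in> carrier R"
  shows "fraction R c w n = fraction R c v m \<longleftrightarrow>
    (\<exists>k. c [^] (k + n) \<otimes> v = c [^] (k + m) \<otimes> w)"
proof
  assume "fraction R c w n = fraction R c v m"
  moreover have "(v, m) \<in> fraction R c v m"
    using assms by (auto simp: fraction_def)
  ultimately have "(v, m) \<in> fraction R c w n"
    by simp
  then show "eqf w n v m"
    by (auto simp: fraction_def)
next
  assume h: "eqf w n v m"
  show "fraction R c w n = fraction R c v m"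
  proof (rule Set.set_eqI)
    fix p :: "'a \<times> nat"
    obtain u q where p: "p = (u, q)" by (cases p)
    have "eqf w n u q \<longleftrightarrow> eqf v m u q" if "u \<in> carrier R"
      using eqf_trans [OF h, of u q] eqf_trans [OF eqf_sym [OF h], of u q] assms that by blast
    then show "p \<in> fraction R c w n \<longleftrightarrow> p \<in> fraction R c v m"
      by (auto simp: p fraction_def)
  qed
qed

lemma mem_fraction:
  "w \<in> carrier R \<Longrightarrow>
    (v, m) \<in> fraction R c w n \<longleftrightarrow> v \<in> carrier R \<and> fraction R c v m = fraction R c w n"
  using fraction_eq_iff [of w v n m] by (auto simp: fraction_def)

lemma fraction_mem: "w \<in> carrier R \<Longrightarrow> (w, n) \<in> fraction R c w n"
  by (simp add: mem_fraction)

lemma fraction_nonempty: "w \<in> carrier R \<Longrightarrow> fraction R c w n \<noteq> {}"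
  using fraction_mem by blast

lemma mult_wd:
  assumes "w \<in> carrier R" "w' \<in> carrier R" "v \<in> carrier R" "v' \<in> carrier R"
    and "fraction R c w n = fraction R c w' n'" "fraction R c v m = fraction R c v' m'"
  shows "fraction R c (w \<otimes> v) (n + m) = fraction R c (w' \<otimes> v') (n' + m')"
proof -
  obtain k l where k: "c [^] (k + n) \<otimes> w' = c [^] (k + n') \<otimes> w"
    and l: "c [^] (l + m) \<otimes> v' = c [^] (l + m') \<otimes> v"
    using assms by (metis fraction_eq_iff)
  have split: "c [^] (i + j) \<otimes> (x \<otimes> y) = (c [^] i \<otimes> x) \<otimes> (c [^] j \<otimes> y)"
    if "x \<in> carrier R" "y \<in> carrier R" for x y and i j :: nat
  proof -
    have "c [^] (i + j) \<otimes> (x \<otimes> y) = c [^] i \<otimes> ((c [^] j \<otimes> x) \<otimes> y)"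
      using that by (simp add: nat_pow_mult [symmetric] m_assoc)
    also have "\<dots> = c [^] i \<otimes> ((x \<otimes> c [^] j) \<otimes> y)"
      using that by (simp add: pow_comm)
    finally show ?thesis
      using that by (simp add: m_assoc)
  qed
  have "c [^] ((k + l) + (n + m)) \<otimes> (w' \<otimes> v') = c [^] ((k + n) + (l + m)) \<otimes> (w' \<otimes> v')"
    by (simp add: ac_simps)
  also have "\<dots> = c [^] ((k + n') + (l + m')) \<otimes> (w \<otimes> v)"
    using k l assms by (simp only: split)
  also have "\<dots> = c [^] ((k + l) + (n' + m')) \<otimes> (w \<otimes> v)"
    by (simp add: ac_simps)
  finally show ?thesis
    using assms by (auto simp: fraction_eq_iff)
qed

lemma add_wd:
  assumes "w \<in> carrier R" "w' \<in> carrier R" "v \<in> carrier R" "v' \<in> carrier R"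
    and "fraction R c w n = fraction R c w' n'" "fraction R c v m = fraction R c v' m'"
  shows "fraction R c (c [^] m \<otimes> w \<oplus> c [^] n \<otimes> v) (n + m) =
    fraction R c (c [^] m' \<otimes> w' \<oplus> c [^] n' \<otimes> v') (n' + m')"
proof -
  obtain k l where k: "c [^] (k + n) \<otimes> w' = c [^] (k + n') \<otimes> w"
    and l: "c [^] (l + m) \<otimes> v' = c [^] (l + m') \<otimes> v"
    using assms by (metis fraction_eq_iff)
  have 1: "c [^] (k + l + n + m + m') \<otimes> w' = c [^] (k + l + n' + m' + m) \<otimes> w"
    by (rule pow_lift [OF k, of _ "l + m + m'"]) (use assms in auto)
  have 2: "c [^] (k + l + n + m + n') \<otimes> v' = c [^] (k + l + n' + m' + n) \<otimes> v"
    by (rule pow_lift [OF l, of _ "k + n + n'"]) (use assms in auto)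
  have "c [^] ((k + l) + (n + m)) \<otimes> (c [^] m' \<otimes> w' \<oplus> c [^] n' \<otimes> v') =
      c [^] (k + l + n + m + m') \<otimes> w' \<oplus> c [^] (k + l + n + m + n') \<otimes> v'"
    using assms by (simp add: r_distr pow_pow ac_simps)
  also have "\<dots> = c [^] ((k + l) + (n' + m')) \<otimes> (c [^] m \<otimes> w \<oplus> c [^] n \<otimes> v)"
    using assms by (simp only: 1 2) (simp add: r_distr pow_pow ac_simps)
  finally show ?thesis
    using assms by (subst fraction_eq_iff) blast+
qed

abbreviation "L \<equiv> localization R c"

lemma carrier_localization: "carrier L = {fraction R c w n |w n. w \<in> carrier R}"
  and one_localization: "\<one>\<^bsub>L\<^esub> = fraction R c \<one> 0"
  and zero_localization: "\<zero>\<^bsub>L\<^esub> = fraction R c \<zero> 0"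
  by (simp_all add: localization_def)

lemma mult_fraction:
  assumes "w \<in> carrier R" "v \<in> carrier R"
  shows "fraction R c w n \<otimes>\<^bsub>L\<^esub> fraction R c v m = fraction R c (w \<otimes> v) (n + m)"
proof -
  have "(case p of (w', n') \<Rightarrow> \<Union>(v', m')\<in>fraction R c v m. fraction R c (w' \<otimes> v') (n' + m'))
      = fraction R c (w \<otimes> v) (n + m)" if p: "p \<in> fraction R c w n" for p
  proof -
    obtain w' n' where p': "p = (w', n')" by (cases p)
    have "(case q of (v', m') \<Rightarrow> fraction R c (w' \<otimes> v') (n' + m')) = fraction R c (w \<otimes> v) (n + m)"
      if "q \<in> fraction R c v m" for q
      using that p assms mult_wd [of w' w _ v n' n _ m] by (cases q) (auto simp: p' mem_fraction)
    then show ?thesis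
      unfolding p' prod.case using assms by (intro SUP_eq_const fraction_nonempty) auto
  qed
  then show ?thesis
    using assms by (simp only: localization_def ring.simps monoid.simps)
      (intro SUP_eq_const fraction_nonempty, auto)
qed

lemma add_fraction:
  assumes "w \<in> carrier R" "v \<in> carrier R"
  shows "fraction R c w n \<oplus>\<^bsub>L\<^esub> fraction R c v m =
    fraction R c (c [^] m \<otimes> w \<oplus> c [^] n \<otimes> v) (n + m)"
proof -
  have "(case p of (w', n') \<Rightarrow> \<Union>(v', m')\<in>fraction R c v m.
        fraction R c (c [^] m' \<otimes> w' \<oplus> c [^] n' \<otimes> v') (n' + m'))
      = fraction R c (c [^] m \<otimes> w \<oplus> c [^] n \<otimes> v) (n + m)" if p: "p \<in> fraction R c w n" for p
  proof -
    obtain w' n' where p': "p = (w', n')" by (cases p)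
    have "(case q of (v', m') \<Rightarrow> fraction R c (c [^] m' \<otimes> w' \<oplus> c [^] n' \<otimes> v') (n' + m'))
        = fraction R c (c [^] m \<otimes> w \<oplus> c [^] n \<otimes> v) (n + m)"
      if "q \<in> fraction R c v m" for q
      using that p assms add_wd [of w' w _ v n' n _ m] by (cases q) (auto simp: p' mem_fraction)
    then show ?thesis
      unfolding p' prod.case using assms by (intro SUP_eq_const fraction_nonempty) auto
  qed
  then show ?thesis
    using assms by (simp only: localization_def ring.simps monoid.simps)
      (intro SUP_eq_const fraction_nonempty, auto)
qed

lemma fraction_cong: "w = v \<Longrightarrow> n = m \<Longrightarrow> fraction R c w n = fraction R c v m"
  by simp

lemma fraction_cancel:
  assumes "w \<in> carrier R"
  shows "fraction R c (c [^] k \<otimes> w) (n + k) = fraction R c w n"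
  using assms by (subst fraction_eq_iff) (auto simp: pow_pow ac_simps)

lemma localizationE:
  assumes "X \<in> carrier L"
  obtains w n where "w \<in> carrier R" "X = fraction R c w n"
  using assms by (auto simp: carrier_localization)

lemma fraction_closed [simp, intro]: "w \<in> carrier R \<Longrightarrow> fraction R c w n \<in> carrier L"
  by (auto simp: carrier_localization)

lemma pow_comm_left:
  "x \<in> carrier R \<Longrightarrow> y \<in> carrier R \<Longrightarrow> x \<otimes> (c [^] (n::nat) \<otimes> y) = c [^] n \<otimes> (x \<otimes> y)"
  by (metis m_assoc nat_pow_closed c_closed pow_comm)

lemma localization_is_ring: "ring L"
proof (rule ringI)
  show "abelian_group L"
  proof (rule abelian_groupI)
    fix X Y assume "X \<in> carrier L" "Y \<in> carrier L"
    then show "X \<oplus>\<^bsub>L\<^esub> Y \<in> carrier L" "X \<oplus>\<^bsub>L\<^esub> Y = Y \<oplus>\<^bsub>L\<^esub> X"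
      by (auto elim!: localizationE simp: add_fraction a_comm add.commute)
  next
    fix X Y Z assume "X \<in> carrier L" "Y \<in> carrier L" "Z \<in> carrier L"
    then show "X \<oplus>\<^bsub>L\<^esub> Y \<oplus>\<^bsub>L\<^esub> Z = X \<oplus>\<^bsub>L\<^esub> (Y \<oplus>\<^bsub>L\<^esub> Z)"
      by (auto elim!: localizationE simp: add_fraction r_distr pow_pow a_assoc ac_simps)
  next
    show "\<zero>\<^bsub>L\<^esub> \<in> carrier L"
      by (simp add: zero_localization)
  next
    fix X assume "X \<in> carrier L"
    then obtain w n where w: "w \<in> carrier R" and X: "X = fraction R c w n"
      by (rule localizationE)
    then show "\<zero>\<^bsub>L\<^esub> \<oplus>\<^bsub>L\<^esub> X = X"
      by (simp add: zero_localization add_fraction)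
    have "fraction R c (\<ominus> w) n \<oplus>\<^bsub>L\<^esub> X = fraction R c \<zero> (n + n)"
      using w by (simp add: X add_fraction r_distr [symmetric] l_neg)
    also have "\<dots> = \<zero>\<^bsub>L\<^esub>"
      by (auto simp: zero_localization fraction_eq_iff)
    finally show "\<exists>Y\<in>carrier L. Y \<oplus>\<^bsub>L\<^esub> X = \<zero>\<^bsub>L\<^esub>"
      using w by blast
  qed
next
  show "monoid L"
  proof (rule monoidI)
    fix X Y assume "X \<in> carrier L" "Y \<in> carrier L"
    then show "X \<otimes>\<^bsub>L\<^esub> Y \<in> carrier L"
      by (auto elim!: localizationE simp: mult_fraction)
  next
    show "\<one>\<^bsub>L\<^esub> \<in> carrier L"
      by (simp add: one_localization)
  next
    fix X Y Z assume "X \<in> carrier L" "Y \<in> carrier L" "Z \<in> carrier L"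
    then show "X \<otimes>\<^bsub>L\<^esub> Y \<otimes>\<^bsub>L\<^esub> Z = X \<otimes>\<^bsub>L\<^esub> (Y \<otimes>\<^bsub>L\<^esub> Z)"
      by (auto elim!: localizationE simp: mult_fraction m_assoc ac_simps)
  next
    fix X assume "X \<in> carrier L"
    then show "\<one>\<^bsub>L\<^esub> \<otimes>\<^bsub>L\<^esub> X = X" "X \<otimes>\<^bsub>L\<^esub> \<one>\<^bsub>L\<^esub> = X"
      by (auto elim!: localizationE simp: mult_fraction one_localization)
  qed
next
  fix X Y Z assume "X \<in> carrier L" "Y \<in> carrier L" "Z \<in> carrier L"
  then obtain x i y j z k
    where x: "x \<in> carrier R" "X = fraction R c x i" and y: "y \<in> carrier R" "Y = fraction R c y j"
      and z: "z \<in> carrier R" "Z = fraction R c z k"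
    by (meson localizationE)
  have "X \<otimes>\<^bsub>L\<^esub> Z \<oplus>\<^bsub>L\<^esub> Y \<otimes>\<^bsub>L\<^esub> Z =
      fraction R c (c [^] k \<otimes> (c [^] j \<otimes> (x \<otimes> z) \<oplus> c [^] i \<otimes> (y \<otimes> z))) ((i + j + k) + k)"
    using x y z by (simp add: mult_fraction add_fraction r_distr pow_pow ac_simps)
  also have "\<dots> = fraction R c (c [^] j \<otimes> (x \<otimes> z) \<oplus> c [^] i \<otimes> (y \<otimes> z)) (i + j + k)"
    using x y z by (intro fraction_cancel) auto
  also have "\<dots> = (X \<oplus>\<^bsub>L\<^esub> Y) \<otimes>\<^bsub>L\<^esub> Z"
    using x y z by (simp add: mult_fraction add_fraction l_distr m_assoc)
  finally show "(X \<oplus>\<^bsub>L\<^esub> Y) \<otimes>\<^bsub>L\<^esub> Z = X \<otimes>\<^bsub>L\<^esub> Z \<oplus>\<^bsub>L\<^esub> Y \<otimes>\<^bsub>L\<^esub> Z" ..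
  have "Z \<otimes>\<^bsub>L\<^esub> X \<oplus>\<^bsub>L\<^esub> Z \<otimes>\<^bsub>L\<^esub> Y =
      fraction R c (c [^] k \<otimes> (c [^] j \<otimes> (z \<otimes> x) \<oplus> c [^] i \<otimes> (z \<otimes> y))) ((i + j + k) + k)"
    using x y z by (simp add: mult_fraction add_fraction r_distr pow_pow ac_simps)
  also have "\<dots> = fraction R c (c [^] j \<otimes> (z \<otimes> x) \<oplus> c [^] i \<otimes> (z \<otimes> y)) (i + j + k)"
    using x y z by (intro fraction_cancel) auto
  also have "\<dots> = Z \<otimes>\<^bsub>L\<^esub> (X \<oplus>\<^bsub>L\<^esub> Y)"
    using x y z by (simp add: mult_fraction add_fraction r_distr pow_comm_left ac_simps)
  finally show "Z \<otimes>\<^bsub>L\<^esub> (X \<oplus>\<^bsub>L\<^esub> Y) = Z \<otimes>\<^bsub>L\<^esub> X \<oplus>\<^bsub>L\<^esub> Z \<otimes>\<^bsub>L\<^esub> Y" ..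
qed

lemma localization_hom: "(\<lambda>w. fraction R c w 0) \<in> ring_hom R L"
  by (rule ring_hom_memI) (auto simp: mult_fraction add_fraction one_localization)

lemma localization_unit: "fraction R c c 0 \<in> Units L" and
  localization_central: "fraction R c c 0 \<in> ring_center L"
proof -
  have "fraction R c c 1 = fraction R c \<one> 0"
    by (subst fraction_eq_iff) auto
  then have "fraction R c \<one> 1 \<otimes>\<^bsub>L\<^esub> fraction R c c 0 = \<one>\<^bsub>L\<^esub>"
    "fraction R c c 0 \<otimes>\<^bsub>L\<^esub> fraction R c \<one> 1 = \<one>\<^bsub>L\<^esub>"
    by (simp_all add: mult_fraction one_localization)
  then show "fraction R c c 0 \<in> Units L"
    unfolding Units_def by blast
  show "fraction R c c 0 \<in> ring_center L"
    by (auto simp: ring_center_def mult_fraction c_comm elim!: localizationE)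
qed

lemma localization_fraction:
  assumes "w \<in> carrier R"
  shows "fraction R c w n \<otimes>\<^bsub>L\<^esub> fraction R c c 0 [^]\<^bsub>L\<^esub> n = fraction R c w 0"
proof -
  interpret L: ring L by (rule localization_is_ring)
  have "fraction R c c 0 [^]\<^bsub>L\<^esub> n = fraction R c (c [^] n) 0"
    by (induction n) (simp_all add: one_localization mult_fraction)
  then show ?thesis
    using assms fraction_cancel [of w n 0] by (simp add: mult_fraction pow_comm)
qed

lemma localization_inj:
  assumes "regular_element R c"
  shows "inj_on (\<lambda>w. fraction R c w 0) (carrier R)"
proof (rule inj_onI)
  fix w v assume w: "w \<in> carrier R" and v: "v \<in> carrier R"
    and "fraction R c w 0 = fraction R c v 0"
  then obtain k :: nat where k: "c [^] k \<otimes> v = c [^] k \<otimes> w"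
    using fraction_eq_iff [of w v 0 0] by auto
  have cancel: "x = \<zero>" if "c [^] k \<otimes> x = \<zero>" "x \<in> carrier R" for x and k :: nat
    using that
  proof (induction k)
    case (Suc k)
    then have "c \<otimes> (c [^] k \<otimes> x) = \<zero>"
      by (simp add: m_assoc [symmetric] nat_pow_Suc2 [symmetric] del: nat_pow_Suc)
    then have "c [^] k \<otimes> x = \<zero>"
      using assms Suc.prems(2) unfolding regular_element_def by blast
    then show ?case
      using Suc.IH Suc.prems(2) by blast
  qed simp
  have "c [^] k \<otimes> (v \<ominus> w) = \<zero>"
    using k w v by (simp add: a_minus_def r_distr r_minus r_neg)
  then have "v \<ominus> w = \<zero>"
    using cancel w v minus_closed by blast
  then show "w = v"
    using w v r_right_minus_eq by blast
qed

end

definition matrix_ring :: "('k, 'm) ring_scheme \<Rightarrow> nat \<Rightarrow> (nat \<times> nat \<Rightarrow> 'k) ring"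
  where "matrix_ring K n =
    \<lparr> carrier = {..<n} \<times> {..<n} \<rightarrow>\<^sub>E carrier K,
      mult = (\<lambda>A B. \<lambda>(i, j)\<in>{..<n} \<times> {..<n}. \<Oplus>\<^bsub>K\<^esub>k\<in>{..<n}. A (i, k) \<otimes>\<^bsub>K\<^esub> B (k, j)),
      one = (\<lambda>(i, j)\<in>{..<n} \<times> {..<n}. if i = j then \<one>\<^bsub>K\<^esub> else \<zero>\<^bsub>K\<^esub>),
      zero = (\<lambda>(i, j)\<in>{..<n} \<times> {..<n}. \<zero>\<^bsub>K\<^esub>),
      add = (\<lambda>A B. \<lambda>(i, j)\<in>{..<n} \<times> {..<n}. A (i, j) \<oplus>\<^bsub>K\<^esub> B (i, j)) \<rparr>"

lemma (in abelian_monoid) finsum_swap: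
  assumes "finite A" "finite B" "\<And>i j. i \<in> A \<Longrightarrow> j \<in> B \<Longrightarrow> f i j \<in> carrier G"
  shows "(\<Oplus>i\<in>A. \<Oplus>j\<in>B. f i j) = (\<Oplus>j\<in>B. \<Oplus>i\<in>A. f i j)"
  using assms(1,3)
proof (induction A)
  case (insert a A)
  have "(\<Oplus>i\<in>insert a A. \<Oplus>j\<in>B. f i j) = (\<Oplus>j\<in>B. f a j) \<oplus> (\<Oplus>i\<in>A. \<Oplus>j\<in>B. f i j)"
    using insert by (subst finsum_insert) (auto intro!: finsum_closed)
  also have "\<dots> = (\<Oplus>j\<in>B. f a j) \<oplus> (\<Oplus>j\<in>B. \<Oplus>i\<in>A. f i j)"
    using insert by simp
  also have "\<dots> = (\<Oplus>j\<in>B. f a j \<oplus> (\<Oplus>i\<in>A. f i j))"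
    using insert.prems by (subst finsum_addf) (auto intro!: finsum_closed)
  also have "\<dots> = (\<Oplus>j\<in>B. \<Oplus>i\<in>insert a A. f i j)"
    using insert by (intro finsum_cong') (auto intro!: finsum_closed simp: Pi_def)
  finally show ?case .
qed simp

lemma (in ring) matrix_ring_is_ring: "ring (matrix_ring R n)"
proof -
  let ?M = "matrix_ring R n"
  let ?I = "{..<n}"
  have cl: "A (i, j) \<in> carrier R" if "A \<in> carrier ?M" "i < n" "j < n" for A i j
    using that by (auto simp: matrix_ring_def)
  have fs: "(\<Oplus>k\<in>?I. f k) \<in> carrier R" if "\<And>k. k < n \<Longrightarrow> f k \<in> carrier R" for f
    using that by (auto intro!: finsum_closed)
  have eqI: "A = B" if "A \<in> carrier ?M" "B \<in> carrier ?M"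
    "\<And>i j. i < n \<Longrightarrow> j < n \<Longrightarrow> A (i, j) = B (i, j)" for A B
    using that by (intro PiE_ext [of A "?I \<times> ?I" _ B]) (auto simp: matrix_ring_def)
  have add: "(A \<oplus>\<^bsub>?M\<^esub> B) (i, j) = A (i, j) \<oplus> B (i, j)" if "i < n" "j < n" for A B i j
    using that by (simp add: matrix_ring_def)
  have mult: "(A \<otimes>\<^bsub>?M\<^esub> B) (i, j) = (\<Oplus>k\<in>?I. A (i, k) \<otimes> B (k, j))" if "i < n" "j < n" for A B i j
    using that by (simp add: matrix_ring_def)
  have one: "\<one>\<^bsub>?M\<^esub> (i, j) = (if i = j then \<one> else \<zero>)" if "i < n" "j < n" for i j
    using that by (simp add: matrix_ring_def)
  have zero: "\<zero>\<^bsub>?M\<^esub> (i, j) = \<zero>" if "i < n" "j < n" for i j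
    using that by (simp add: matrix_ring_def)
  have addM: "A \<oplus>\<^bsub>?M\<^esub> B \<in> carrier ?M" if "A \<in> carrier ?M" "B \<in> carrier ?M" for A B
    using that by (auto simp: matrix_ring_def)
  have multM: "A \<otimes>\<^bsub>?M\<^esub> B \<in> carrier ?M" if "A \<in> carrier ?M" "B \<in> carrier ?M" for A B
    using that by (auto simp: matrix_ring_def PiE_iff intro!: fs)
  have oneM: "\<one>\<^bsub>?M\<^esub> \<in> carrier ?M" and zeroM: "\<zero>\<^bsub>?M\<^esub> \<in> carrier ?M"
    by (auto simp: matrix_ring_def)
  show ?thesis
  proof (rule ringI)
    show "abelian_group ?M"
    proof (rule abelian_groupI)
      fix A assume A: "A \<in> carrier ?M"
      define B where "B = (\<lambda>(i, j)\<in>?I \<times> ?I. \<ominus> A (i, j))"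
      have "B \<in> carrier ?M"
        using A by (auto simp: matrix_ring_def B_def)
      moreover have "B (i, j) = \<ominus> A (i, j)" if "i < n" "j < n" for i j
        using that by (simp add: B_def)
      ultimately show "\<exists>B\<in>carrier ?M. B \<oplus>\<^bsub>?M\<^esub> A = \<zero>\<^bsub>?M\<^esub>"
        using A by (intro bexI [of _ B] eqI addM zeroM) (auto simp: add zero cl l_neg)
    qed (auto intro!: eqI addM zeroM simp: add zero cl a_ac)
    show "monoid ?M"
    proof (rule monoidI)
      fix A B C assume ABC: "A \<in> carrier ?M" "B \<in> carrier ?M" "C \<in> carrier ?M"
      show "A \<otimes>\<^bsub>?M\<^esub> B \<otimes>\<^bsub>?M\<^esub> C = A \<otimes>\<^bsub>?M\<^esub> (B \<otimes>\<^bsub>?M\<^esub> C)"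
      proof (intro eqI multM ABC)
        fix i j assume ij: "i < n" "j < n"
        have "(A \<otimes>\<^bsub>?M\<^esub> B \<otimes>\<^bsub>?M\<^esub> C) (i, j) =
            (\<Oplus>k\<in>?I. (\<Oplus>l\<in>?I. A (i, l) \<otimes> B (l, k)) \<otimes> C (k, j))"
          using ij ABC by (simp only: mult) (auto intro!: finsum_cong' simp: mult cl fs)
        also have "\<dots> = (\<Oplus>k\<in>?I. \<Oplus>l\<in>?I. A (i, l) \<otimes> B (l, k) \<otimes> C (k, j))"
          using ij ABC by (intro finsum_cong' finsum_ldistr) (auto simp: fs cl)
        also have "\<dots> = (\<Oplus>l\<in>?I. \<Oplus>k\<in>?I. A (i, l) \<otimes> B (l, k) \<otimes> C (k, j))"
          using ij ABC by (intro finsum_swap) (auto simp: cl)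
        also have "\<dots> = (\<Oplus>l\<in>?I. \<Oplus>k\<in>?I. A (i, l) \<otimes> (B (l, k) \<otimes> C (k, j)))"
          using ij ABC by (intro finsum_cong') (auto simp: fs cl m_assoc)
        also have "\<dots> = (\<Oplus>l\<in>?I. A (i, l) \<otimes> (\<Oplus>k\<in>?I. B (l, k) \<otimes> C (k, j)))"
          using ij ABC by (intro finsum_cong' finsum_rdistr [symmetric]) (auto simp: fs cl)
        also have "\<dots> = (A \<otimes>\<^bsub>?M\<^esub> (B \<otimes>\<^bsub>?M\<^esub> C)) (i, j)"
          using ij ABC by (simp only: mult) (auto intro!: finsum_cong' simp: mult cl fs)
        finally show "(A \<otimes>\<^bsub>?M\<^esub> B \<otimes>\<^bsub>?M\<^esub> C) (i, j) = (A \<otimes>\<^bsub>?M\<^esub> (B \<otimes>\<^bsub>?M\<^esub> C)) (i, j)" .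
      qed
    next
      fix A assume A: "A \<in> carrier ?M"
      show "\<one>\<^bsub>?M\<^esub> \<otimes>\<^bsub>?M\<^esub> A = A"
      proof (intro eqI multM oneM A)
        fix i j assume ij: "i < n" "j < n"
        have "(\<one>\<^bsub>?M\<^esub> \<otimes>\<^bsub>?M\<^esub> A) (i, j) = (\<Oplus>k\<in>?I. if i = k then A (k, j) else \<zero>)"
          using ij A by (simp only: mult) (auto intro!: finsum_cong' simp: one cl)
        also have "\<dots> = A (i, j)"
          using ij A by (intro finsum_singleton) (auto simp: cl)
        finally show "(\<one>\<^bsub>?M\<^esub> \<otimes>\<^bsub>?M\<^esub> A) (i, j) = A (i, j)" .
      qed
      show "A \<otimes>\<^bsub>?M\<^esub> \<one>\<^bsub>?M\<^esub> = A"
      proof (intro eqI multM oneM A)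
        fix i j assume ij: "i < n" "j < n"
        have "(A \<otimes>\<^bsub>?M\<^esub> \<one>\<^bsub>?M\<^esub>) (i, j) = (\<Oplus>k\<in>?I. if j = k then A (i, k) else \<zero>)"
          using ij A by (simp only: mult) (auto intro!: finsum_cong' simp: one cl)
        also have "\<dots> = A (i, j)"
          using ij A by (intro finsum_singleton) (auto simp: cl)
        finally show "(A \<otimes>\<^bsub>?M\<^esub> \<one>\<^bsub>?M\<^esub>) (i, j) = A (i, j)" .
      qed
    qed (auto intro!: multM oneM)
  next
    fix A B C assume ABC: "A \<in> carrier ?M" "B \<in> carrier ?M" "C \<in> carrier ?M"
    show "(A \<oplus>\<^bsub>?M\<^esub> B) \<otimes>\<^bsub>?M\<^esub> C = A \<otimes>\<^bsub>?M\<^esub> C \<oplus>\<^bsub>?M\<^esub> B \<otimes>\<^bsub>?M\<^esub> C"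
    proof (intro eqI multM addM ABC)
      fix i j assume ij: "i < n" "j < n"
      have "((A \<oplus>\<^bsub>?M\<^esub> B) \<otimes>\<^bsub>?M\<^esub> C) (i, j) =
          (\<Oplus>k\<in>?I. A (i, k) \<otimes> C (k, j) \<oplus> B (i, k) \<otimes> C (k, j))"
        using ij ABC by (simp only: mult) (intro finsum_cong', auto simp: add l_distr cl)
      also have "\<dots> = (\<Oplus>k\<in>?I. A (i, k) \<otimes> C (k, j)) \<oplus> (\<Oplus>k\<in>?I. B (i, k) \<otimes> C (k, j))"
        using ij ABC by (intro finsum_addf) (auto simp: cl)
      finally show "((A \<oplus>\<^bsub>?M\<^esub> B) \<otimes>\<^bsub>?M\<^esub> C) (i, j) = (A \<otimes>\<^bsub>?M\<^esub> C \<oplus>\<^bsub>?M\<^esub> B \<otimes>\<^bsub>?M\<^esub> C) (i, j)"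
        using ij by (simp add: add mult)
    qed
    show "C \<otimes>\<^bsub>?M\<^esub> (A \<oplus>\<^bsub>?M\<^esub> B) = C \<otimes>\<^bsub>?M\<^esub> A \<oplus>\<^bsub>?M\<^esub> C \<otimes>\<^bsub>?M\<^esub> B"
    proof (intro eqI multM addM ABC)
      fix i j assume ij: "i < n" "j < n"
      have "(C \<otimes>\<^bsub>?M\<^esub> (A \<oplus>\<^bsub>?M\<^esub> B)) (i, j) =
          (\<Oplus>k\<in>?I. C (i, k) \<otimes> A (k, j) \<oplus> C (i, k) \<otimes> B (k, j))"
        using ij ABC by (simp only: mult) (intro finsum_cong', auto simp: add r_distr cl)
      also have "\<dots> = (\<Oplus>k\<in>?I. C (i, k) \<otimes> A (k, j)) \<oplus> (\<Oplus>k\<in>?I. C (i, k) \<otimes> B (k, j))"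
        using ij ABC by (intro finsum_addf) (auto simp: cl)
      finally show "(C \<otimes>\<^bsub>?M\<^esub> (A \<oplus>\<^bsub>?M\<^esub> B)) (i, j) = (C \<otimes>\<^bsub>?M\<^esub> A \<oplus>\<^bsub>?M\<^esub> C \<otimes>\<^bsub>?M\<^esub> B) (i, j)"
        using ij by (simp add: add mult)
    qed
  qed
qed

text \<open>Embeddings are injective unital ring homomorphisms.  In HOL the quantified field must
  have a fixed carrier type; the lemma \<open>representableI\<close> below shows that \<open>'a list\<close> is no
  restriction.\<close>

definition representable :: "('a, 'm) ring_scheme \<Rightarrow> bool"
  where "representable R \<longleftrightarrow>
    (\<exists>(K :: 'a list ring) n. field K \<and> n \<ge> 1 \<and>
      (\<exists>\<phi>. \<phi> \<in> ring_hom R (matrix_ring K n) \<and> inj_on \<phi> (carrier R)))"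

text \<open>An embedding into matrices over any field \<open>K\<close> can be moved to the subfield generated by
  the matrix entries, whose cardinality is at most that of \<open>'a list\<close>.\<close>

lemma finite_ordLeq_infinite:
  includes cardinal_syntax
  assumes "finite A" "infinite B"
  shows "|A| \<le>o |B|"
  using ordLeq_total [OF card_of_Well_order [of A] card_of_Well_order [of B]]
    card_of_ordLeq_finite [of B A] assms by auto

lemma (in field) small_subfield:
  includes cardinal_syntax
  assumes "E \<subseteq> carrier R" "|E| \<le>o |U|" "infinite U"
  obtains L where "subfield L R" "E \<subseteq> L" "|L| \<le>o |U|"
proof -
  define step where "step S = S \<union> (\<lambda>(x, y). x \<oplus> y) ` (S \<times> S) \<union> (\<lambda>(x, y). x \<otimes> y) ` (S \<times> S)
    \<union> (\<lambda>x. \<ominus> x) ` S \<union> (\<lambda>x. inv x) ` (S - {\<zero>})" for S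
  define lev where "lev n = (step ^^ n) (insert \<one> E)" for n :: nat
  have lev_Suc: "lev (Suc n) = step (lev n)" for n
    by (simp add: lev_def)
  have small_Un: "|A \<union> B| \<le>o |U|" if "|A| \<le>o |U|" "|B| \<le>o |U|" for A B :: "'a set"
    using card_of_Un_ordLeq_infinite_Field [of "|U|" A B] assms(3) that
      card_of_Card_order [of U] by (simp add: Field_card_of)
  have small_image: "|f ` A| \<le>o |U|" if "|A| \<le>o |U|" for f :: "'a \<Rightarrow> 'a" and A
    using ordLeq_transitive [OF card_of_image that] .
  have small_image2: "|f ` A| \<le>o |U|" if "|A| \<le>o |U|" for f :: "'a \<times> 'a \<Rightarrow> 'a" and A
    using ordLeq_transitive [OF card_of_image that] .
  have small_times: "|A \<times> B| \<le>o |U|" if "|A| \<le>o |U|" "|B| \<le>o |U|" for A B :: "'a set"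
    using card_of_Times_ordLeq_infinite_Field [of "|U|" A B] assms(3) that
      card_of_Card_order [of U] by (simp add: Field_card_of)
  have small_sub: "|A| \<le>o |U|" if "|B| \<le>o |U|" "A \<subseteq> B" for A B :: "'a set"
    using ordLeq_transitive [OF card_of_mono1 [OF that(2)] that(1)] .
  have "|{\<one>}| \<le>o |U|"
    using assms(3) by (intro finite_ordLeq_infinite) auto
  then have small_lev0: "|lev 0| \<le>o |U|"
    using small_Un [of "{\<one>}" E] assms(2) by (simp add: lev_def)
  have small_lev: "|lev n| \<le>o |U|" for n
  proof (induction n)
    case 0
    show ?case by (rule small_lev0)
  next
    case (Suc n)
    moreover from Suc have "|lev n - {\<zero>}| \<le>o |U|"
      by (rule small_sub) auto
    ultimately show ?case
      unfolding lev_Suc step_def by (intro small_Un small_image small_image2 small_times)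
  qed
  have lev_carrier: "lev n \<subseteq> carrier R" for n
  proof (induction n)
    case 0
    then show ?case using assms(1) by (auto simp: lev_def)
  next
    case (Suc n)
    have "inv x \<in> carrier R" if "x \<in> lev n" "x \<noteq> \<zero>" for x
      using Suc that by (intro Units_inv_closed) (auto simp: field_Units)
    then show ?case
      using Suc by (auto simp: lev_Suc step_def)
  qed
  have lev_mono: "lev m \<subseteq> lev n" if "m \<le> n" for m n
    using that by (rule lift_Suc_mono_le [rotated]) (auto simp: lev_Suc step_def)
  define L where "L = (\<Union>n. lev n)"
  have common: "\<exists>n. x \<in> lev n \<and> y \<in> lev n" if "x \<in> L" "y \<in> L" for x y
  proof -
    obtain k l where "x \<in> lev k" "y \<in> lev l"
      using \<open>x \<in> L\<close> \<open>y \<in> L\<close> by (auto simp: L_def)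
    then show ?thesis
      using lev_mono [of k "max k l"] lev_mono [of l "max k l"] by auto
  qed
  have stepL: "step (lev n) \<subseteq> L" for n
    unfolding L_def lev_Suc [symmetric] by blast
  have "subring L R"
  proof (rule subringI)
    show "L \<subseteq> carrier R"
      using lev_carrier by (auto simp: L_def)
    have "\<one> \<in> lev 0"
      by (simp add: lev_def)
    then show "\<one> \<in> L"
      unfolding L_def by blast
  next
    fix x assume "x \<in> L"
    then obtain n where "x \<in> lev n"
      by (auto simp: L_def)
    then show "\<ominus> x \<in> L"
      using stepL [of n] by (auto simp: step_def)
  next
    fix x y assume "x \<in> L" "y \<in> L"
    then obtain n where "x \<in> lev n" "y \<in> lev n"
      using common by blast
    then have "x \<otimes> y \<in> step (lev n)" "x \<oplus> y \<in> step (lev n)"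
      unfolding step_def by force+
    then show "x \<otimes> y \<in> L" "x \<oplus> y \<in> L"
      using stepL by blast+
  qed
  moreover have "inv x \<in> L" if "x \<in> L - {\<zero>}" for x
  proof -
    obtain n where "x \<in> lev n"
      using \<open>x \<in> L - {\<zero>}\<close> by (auto simp: L_def)
    then show ?thesis
      using stepL [of n] that by (auto simp: step_def)
  qed
  ultimately have "subfield L R"
    by (rule subfieldI')
  moreover have "E \<subseteq> L"
  proof -
    have "E \<subseteq> lev 0"
      by (auto simp: lev_def)
    then show ?thesis
      unfolding L_def by blast
  qed
  moreover have "|L| \<le>o |U|"
    unfolding L_def using assms(3) small_lev
    by (intro card_of_UNION_ordLeq_infinite) (auto simp: infinite_iff_card_of_nat)
  ultimately show thesis
    using that by blast
qed

lemma matrix_ring_hom_map: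
  assumes K: "ring K" and L: "subring L K" and h: "inj_on h L"
    and \<phi>: "\<phi> \<in> ring_hom R (matrix_ring K n)"
    and entries: "\<And>r i j. r \<in> carrier R \<Longrightarrow> i < n \<Longrightarrow> j < n \<Longrightarrow> \<phi> r (i, j) \<in> L"
  defines "K' \<equiv> image_ring h (K\<lparr>carrier := L\<rparr>)"
  shows "(\<lambda>r. \<lambda>p\<in>{..<n} \<times> {..<n}. h (\<phi> r p)) \<in> ring_hom R (matrix_ring K' n)"
proof -
  interpret K: ring K by fact
  interpret L: ring "K\<lparr>carrier := L\<rparr>"
    using K.subring_is_ring [OF L] .
  interpret K': ring K'
    unfolding K'_def using h by (intro L.inj_imp_image_ring_is_ring) simp
  have "h \<in> ring_hom (K\<lparr>carrier := L\<rparr>) K'"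
    using inj_imp_image_ring_iso [of h "K\<lparr>carrier := L\<rparr>"] h by (simp add: K'_def ring_iso_def)
  then interpret h: ring_hom_ring "K\<lparr>carrier := L\<rparr>" K' h
    by (intro ring_hom_ringI2 L.ring_axioms K'.ring_axioms)
  have LK: "L \<subseteq> carrier K"
    using L subringE(1) by blast
  have sum: "finsum K f A \<in> L \<and> h (finsum K f A) = finsum K' (\<lambda>k. h (f k)) A"
    if "finite A" "f \<in> A \<rightarrow> L" for f and A :: "nat set"
    using that
  proof (induction A)
    case empty
    then show ?case
      using h.hom_zero L.zero_closed by simp
  next
    case (insert a A)
    have "h x \<in> carrier K'" if "x \<in> L" for x
      using h.hom_closed that by simp
    then have "f \<in> insert a A \<rightarrow> carrier K" "(\<lambda>k. h (f k)) \<in> insert a A \<rightarrow> carrier K'"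
      using insert.prems LK by (auto simp: Pi_iff)
    then have "finsum K f (insert a A) = f a \<oplus>\<^bsub>K\<^esub> finsum K f A"
      "finsum K' (\<lambda>k. h (f k)) (insert a A) = h (f a) \<oplus>\<^bsub>K'\<^esub> finsum K' (\<lambda>k. h (f k)) A"
      using insert.hyps by (auto intro!: K.finsum_insert K'.finsum_insert)
    then show ?case
      using insert L.a_closed h.hom_add by simp
  qed
  have mult: "x \<otimes>\<^bsub>K\<^esub> y \<in> L \<and> h (x \<otimes>\<^bsub>K\<^esub> y) = h x \<otimes>\<^bsub>K'\<^esub> h y" if "x \<in> L" "y \<in> L" for x y
    using that L.m_closed h.hom_mult by simp
  show ?thesis
  proof (rule ring_hom_memI)
    fix r assume "r \<in> carrier R"
    then show "(\<lambda>p\<in>{..<n} \<times> {..<n}. h (\<phi> r p)) \<in> carrier (matrix_ring K' n)"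
      using entries h.hom_closed by (auto simp: matrix_ring_def)
  next
    fix r s assume rs: "r \<in> carrier R" "s \<in> carrier R"
    have "h (\<phi> (r \<otimes>\<^bsub>R\<^esub> s) (i, j)) = finsum K' (\<lambda>k. h (\<phi> r (i, k)) \<otimes>\<^bsub>K'\<^esub> h (\<phi> s (k, j))) {..<n}"
      if ij: "i < n" "j < n" for i j
    proof -
      have "\<phi> (r \<otimes>\<^bsub>R\<^esub> s) (i, j) = finsum K (\<lambda>k. \<phi> r (i, k) \<otimes>\<^bsub>K\<^esub> \<phi> s (k, j)) {..<n}"
        using ring_hom_mult [OF \<phi> rs] ij by (simp add: matrix_ring_def)
      then have "h (\<phi> (r \<otimes>\<^bsub>R\<^esub> s) (i, j)) =
          finsum K' (\<lambda>k. h (\<phi> r (i, k) \<otimes>\<^bsub>K\<^esub> \<phi> s (k, j))) {..<n}"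
        using sum [of "{..<n}" "\<lambda>k. \<phi> r (i, k) \<otimes>\<^bsub>K\<^esub> \<phi> s (k, j)"] mult entries rs ij by auto
      also have "\<dots> = finsum K' (\<lambda>k. h (\<phi> r (i, k)) \<otimes>\<^bsub>K'\<^esub> h (\<phi> s (k, j))) {..<n}"
        using mult entries rs ij h.hom_closed by (intro K'.finsum_cong') auto
      finally show ?thesis .
    qed
    moreover have "finsum K' (\<lambda>k. h (\<phi> r (i, k)) \<otimes>\<^bsub>K'\<^esub> h (\<phi> s (k, j))) {..<n} =
        finsum K' (\<lambda>k. (\<lambda>p\<in>{..<n} \<times> {..<n}. h (\<phi> r p)) (i, k) \<otimes>\<^bsub>K'\<^esub>
          (\<lambda>p\<in>{..<n} \<times> {..<n}. h (\<phi> s p)) (k, j)) {..<n}"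
      if ij: "i < n" "j < n" for i j
      using entries rs ij h.hom_closed by (intro K'.finsum_cong') auto
    ultimately show "(\<lambda>p\<in>{..<n} \<times> {..<n}. h (\<phi> (r \<otimes>\<^bsub>R\<^esub> s) p)) =
        (\<lambda>p\<in>{..<n} \<times> {..<n}. h (\<phi> r p)) \<otimes>\<^bsub>matrix_ring K' n\<^esub> (\<lambda>p\<in>{..<n} \<times> {..<n}. h (\<phi> s p))"
      unfolding matrix_ring_def monoid.simps by (intro restrict_ext) (clarsimp simp del: restrict_apply)
    have "\<phi> (r \<oplus>\<^bsub>R\<^esub> s) (i, j) = \<phi> r (i, j) \<oplus>\<^bsub>K\<^esub> \<phi> s (i, j)" if "i < n" "j < n" for i j
      using ring_hom_add [OF \<phi> rs] that by (simp add: matrix_ring_def)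
    then show "(\<lambda>p\<in>{..<n} \<times> {..<n}. h (\<phi> (r \<oplus>\<^bsub>R\<^esub> s) p)) =
        (\<lambda>p\<in>{..<n} \<times> {..<n}. h (\<phi> r p)) \<oplus>\<^bsub>matrix_ring K' n\<^esub> (\<lambda>p\<in>{..<n} \<times> {..<n}. h (\<phi> s p))"
      using entries rs h.hom_add by (auto simp: matrix_ring_def intro!: restrict_ext)
  next
    have "\<phi> \<one>\<^bsub>R\<^esub> (i, j) = (if i = j then \<one>\<^bsub>K\<^esub> else \<zero>\<^bsub>K\<^esub>)" if "i < n" "j < n" for i j
      using ring_hom_one [OF \<phi>] that by (simp add: matrix_ring_def)
    then show "(\<lambda>p\<in>{..<n} \<times> {..<n}. h (\<phi> \<one>\<^bsub>R\<^esub> p)) = \<one>\<^bsub>matrix_ring K' n\<^esub>"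
      using h.hom_one h.hom_zero by (auto simp: matrix_ring_def intro!: restrict_ext)
  qed
qed

lemma representableI:
  includes cardinal_syntax
  fixes K :: "('k, 'c) ring_scheme" and R :: "('a, 'm) ring_scheme"
  assumes "field K" "n \<ge> 1" "\<phi> \<in> ring_hom R (matrix_ring K n)" "inj_on \<phi> (carrier R)"
  shows "representable R"
proof -
  interpret K: field K by fact
  let ?U = "UNIV :: 'a list set"
  define E where "E = (\<Union>p\<in>{..<n} \<times> {..<n}. (\<lambda>r. \<phi> r p) ` carrier R)"
  have inf: "infinite ?U"
    by (rule infinite_UNIV_listI)
  have "E \<subseteq> carrier K"
    using ring_hom_closed [OF assms(3)] by (fastforce simp: E_def matrix_ring_def)
  moreover have "|E| \<le>o |?U|"
    unfolding E_def
  proof (rule card_of_UNION_ordLeq_infinite [OF inf])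
    show "|{..<n} \<times> {..<n}| \<le>o |?U|"
      using inf by (intro finite_ordLeq_infinite) auto
    have "|carrier R| \<le>o |?U|"
      by (rule card_of_ordLeqI [of "\<lambda>x. [x]"]) (auto simp: inj_on_def)
    then show "\<forall>p\<in>{..<n} \<times> {..<n}. |(\<lambda>r. \<phi> r p) ` carrier R| \<le>o |?U|"
      using ordLeq_transitive [OF card_of_image] by blast
  qed
  ultimately obtain L where L: "subfield L K" "E \<subseteq> L" "|L| \<le>o |?U|"
    using K.small_subfield inf by blast
  then obtain h :: "'k \<Rightarrow> 'a list" where h: "inj_on h L"
    by (auto simp: card_of_ordLeq [symmetric])
  have subL: "subring L K"
    using L(1) by (simp add: subfield_def subdomain_def subcring_def)
  define K' where "K' = image_ring h (K\<lparr>carrier := L\<rparr>)"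
  have "field (K\<lparr>carrier := L\<rparr>)"
    using K.subfield_iff(2) [OF L(1)] .
  then have "field K'"
    unfolding K'_def using h by (intro field.inj_imp_image_ring_is_field) simp_all
  have entries: "\<phi> r (i, j) \<in> L" if "r \<in> carrier R" "i < n" "j < n" for r i j
    using that L(2) by (auto simp: E_def)
  define \<psi> where "\<psi> = (\<lambda>r. \<lambda>p\<in>{..<n} \<times> {..<n}. h (\<phi> r p))"
  have "\<psi> \<in> ring_hom R (matrix_ring K' n)"
    unfolding \<psi>_def K'_def by (rule matrix_ring_hom_map) (use K.ring_axioms subL h assms(3) entries in auto)
  moreover have "inj_on \<psi> (carrier R)"
  proof (rule inj_onI)
    fix r s assume rs: "r \<in> carrier R" "s \<in> carrier R" and eq: "\<psi> r = \<psi> s"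
    have "\<phi> r (i, j) = \<phi> s (i, j)" if "i < n" "j < n" for i j
      using fun_cong [OF eq, of "(i, j)"] that rs entries inj_onD [OF h]
      by (simp add: \<psi>_def)
    moreover have "\<phi> r \<in> {..<n} \<times> {..<n} \<rightarrow>\<^sub>E carrier K" "\<phi> s \<in> {..<n} \<times> {..<n} \<rightarrow>\<^sub>E carrier K"
      using ring_hom_closed [OF assms(3)] rs by (simp_all add: matrix_ring_def)
    ultimately have "\<phi> r = \<phi> s"
      by (intro PiE_ext) auto
    then show "r = s"
      using assms(4) rs by (simp add: inj_on_def)
  qed
  ultimately show ?thesis
    unfolding representable_def using \<open>field K'\<close> assms(2) by blast
qed

end

theory Submission
  imports Defs "HOL-Algebra.Divisibility" "HOL-Algebra.Embedded_Algebras"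
    "HOL-Computational_Algebra.Primes"
begin

text \<open>
  The ring \<open>R\<close> is finitely generated modulo its nilradical over \<open>W\<close>, hence finitely generated over
  \<open>W\<close>, and therefore, up to powers of \<open>c\<close>, over the center \<open>C\<close> of \<open>W\<close>. Since \<open>W\<close> is weakly
  Noetherian, a relative form of the Eakin-Nagata-Formanek theorem shows that \<open>R\<close> has the ascending
  chain condition on those \<open>C\<close>-submodules that are saturated with respect to \<open>c\<close>. Right multiplication
  embeds \<open>R\<close> into the ring \<open>E\<close> of its \<open>C\<close>-linear endomorphisms, where \<open>C\<close> becomes central and the
  chain condition is inherited. In \<open>E\<close>, zero is a finite intersection of irreducible saturated ideals,
  and modulo such an ideal every element of \<open>C\<close> is nilpotent or regular by Fitting's argument.
  Inverting the regular ones makes the central subring Artinian local; being of equal characteristic,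
  it contains a coefficient field, over which the quotient is finite-dimensional and so has a regular
  representation. The representations of the finitely many quotients live over different fields and
  are put together over a compositum of these fields.\<close>

section \<open>Saturated submodules\<close>

text \<open>The obstacle is that \<open>c\<close> and \<open>C\<close> are central only in
  \<open>W\<close>, so that \<open>R\<close> is merely a left \<open>C\<close>-module and its
  finiteness over \<open>C\<close> gives no direct hold on a ring of matrices. Left multiplications
  by \<open>C\<close> do commute with right multiplications by \<open>R\<close>, which is why
  endomorphisms are used. An endomorphism is determined by its values on the finitely many
  generators, so the new ring is a submodule of a finite power of \<open>R\<close> and the chain
  condition survives. Irreducibility is what produces a local central subring: a central element
  that is neither nilpotent nor regular would split zero by the annihilator and the image of one of
  its powers. The base field is remembered only as the statement that each integer multiple of 1 is
  zero or invertible. This passes to quotients, fractions and endomorphism rings, excludes mixed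
  characteristic such as Z/4, and forces all fields over which the pieces are represented to have
  the same characteristic.\<close>

lemma acc_maximal:
  assumes acc: "ascending_chain_condition \<I>" and F: "\<F> \<subseteq> \<I>" "\<F> \<noteq> {}"
  shows "\<exists>M\<in>\<F>. \<forall>X\<in>\<F>. M \<subseteq> X \<longrightarrow> X = M"
proof (rule ccontr)
  assume "\<not> ?thesis"
  then have step: "\<exists>X. X \<in> \<F> \<and> M \<subset> X" if "M \<in> \<F>" for M
    using that by blast
  obtain M0 where "M0 \<in> \<F>" using F by blast
  then obtain f :: "nat \<Rightarrow> 'a set" where f: "\<And>n. f n \<in> \<F> \<and> f n \<subset> f (Suc n)"
    using dependent_nat_choice [of "\<lambda>_ X. X \<in> \<F>" "\<lambda>_ X Y. X \<subset> Y"] step by blast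
  then obtain m where "\<forall>n\<ge>m. f n = f m"
    using acc F(1) unfolding ascending_chain_condition_def by (metis psubset_imp_subset subsetD)
  then have "f (Suc m) = f m" by (metis le_SucI order_refl)
  then show False using f [of m] by blast
qed

text \<open>Saturated submodules replace the submodules of a localization: \<open>c\<close> need not be central in \<open>R\<close>,
  so that \<open>R[c\<^sup>-\<^sup>1]\<close> is only a left module over \<open>Z[c\<^sup>-\<^sup>1]\<close>.\<close>

definition saturated_submodule :: "'a set \<Rightarrow> 'a \<Rightarrow> ('a, 'm) ring_scheme \<Rightarrow> 'a set \<Rightarrow> bool"
  where "saturated_submodule Z c R U \<longleftrightarrow> U \<subseteq> carrier R \<and> \<zero>\<^bsub>R\<^esub> \<in> U \<and>
    (\<forall>x\<in>U. \<forall>y\<in>U. x \<oplus>\<^bsub>R\<^esub> y \<in> U) \<and> (\<forall>z\<in>Z. \<forall>x\<in>U. z \<otimes>\<^bsub>R\<^esub> x \<in> U) \<and>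
    (\<forall>x\<in>carrier R. c \<otimes>\<^bsub>R\<^esub> x \<in> U \<longrightarrow> x \<in> U)"

lemma saturated_submoduleD:
  assumes "saturated_submodule Z c R U"
  shows "U \<subseteq> carrier R" "\<zero>\<^bsub>R\<^esub> \<in> U" "\<And>x y. x \<in> U \<Longrightarrow> y \<in> U \<Longrightarrow> x \<oplus>\<^bsub>R\<^esub> y \<in> U"
    "\<And>z x. z \<in> Z \<Longrightarrow> x \<in> U \<Longrightarrow> z \<otimes>\<^bsub>R\<^esub> x \<in> U"
    "\<And>x. x \<in> carrier R \<Longrightarrow> c \<otimes>\<^bsub>R\<^esub> x \<in> U \<Longrightarrow> x \<in> U"
  using assms by (simp_all add: saturated_submodule_def)

lemma saturated_submoduleI:
  assumes "U \<subseteq> carrier R" "\<zero>\<^bsub>R\<^esub> \<in> U" "\<And>x y. x \<in> U \<Longrightarrow> y \<in> U \<Longrightarrow> x \<oplus>\<^bsub>R\<^esub> y \<in> U"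
    "\<And>z x. z \<in> Z \<Longrightarrow> x \<in> U \<Longrightarrow> z \<otimes>\<^bsub>R\<^esub> x \<in> U"
    "\<And>x. x \<in> carrier R \<Longrightarrow> c \<otimes>\<^bsub>R\<^esub> x \<in> U \<Longrightarrow> x \<in> U"
  shows "saturated_submodule Z c R U"
  using assms by (simp add: saturated_submodule_def)

context ring
begin

lemma saturated_submodule_uminus:
  assumes "saturated_submodule Z c R U" "subring Z R" "x \<in> U"
  shows "\<ominus> x \<in> U"
proof -
  have "\<ominus> \<one> \<in> Z" using subringE(3,5) [OF assms(2)] by blast
  moreover have "\<ominus> \<one> \<otimes> x = \<ominus> x"
    using saturated_submoduleD(1) [OF assms(1)] assms(3) l_minus by auto
  ultimately show ?thesis using saturated_submoduleD(4) [OF assms(1)] assms(3) by metis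
qed

lemma saturated_submodule_minus:
  assumes "saturated_submodule Z c R U" "subring Z R" "x \<in> U" "y \<in> U"
  shows "x \<ominus> y \<in> U"
  using saturated_submodule_uminus [OF assms(1,2,4)] saturated_submoduleD(3) [OF assms(1,3)]
  by (simp add: minus_eq)

lemma saturated_submodule_pow:
  assumes U: "saturated_submodule Z c R U" and c: "c \<in> carrier R" and x: "x \<in> carrier R"
    and "c [^] (n::nat) \<otimes> x \<in> U"
  shows "x \<in> U"
  using assms(4)
proof (induction n)
  case (Suc n)
  have "c \<otimes> (c [^] n \<otimes> x) = c [^] Suc n \<otimes> x"
    unfolding nat_pow_Suc2 [OF c] using c x by (intro m_assoc [symmetric]) auto
  then have "c \<otimes> (c [^] n \<otimes> x) \<in> U"
    using Suc.prems by simp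
  then have "c [^] n \<otimes> x \<in> U"
    by (rule saturated_submoduleD(5) [OF U, rotated]) (use c x in simp)
  then show ?case by (rule Suc.IH)
qed (use x in simp)

lemma saturated_submodule_carrier:
  "Z \<subseteq> carrier R \<Longrightarrow> saturated_submodule Z c R (carrier R)"
  by (intro saturated_submoduleI) auto

end

section \<open>Coefficient fields\<close>

text \<open>A commutative local ring whose maximal ideal is nil. The last condition is equal
  characteristic: it excludes rings such as Z/9, which contain no field.\<close>

locale local_nil_ring = cring +
  assumes one_nz: "\<one> \<noteq> \<zero>"
    and nilpotent_or_unit: "x \<in> carrier R \<Longrightarrow> (\<exists>n::nat. x [^] n = \<zero>) \<or> x \<in> Units R"
    and nat_zero_or_unit: "[(n::nat)] \<cdot> \<one> = \<zero> \<or> [n] \<cdot> \<one> \<in> Units R"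
begin

definition nils :: "'a set"
  where "nils = {x \<in> carrier R. \<exists>n::nat. x [^] n = \<zero>}"

lemma nils_carrier: "x \<in> nils \<Longrightarrow> x \<in> carrier R"
  by (simp add: nils_def)

lemma zero_not_unit: "\<zero> \<notin> Units R"
  using one_nz by (auto simp: Units_def)

lemma nils_not_unit: "x \<in> nils \<Longrightarrow> x \<notin> Units R"
proof
  assume "x \<in> nils" and u: "x \<in> Units R"
  then obtain n :: nat where "x [^] n = \<zero>" by (auto simp: nils_def)
  then show False using Units_pow_closed [OF u, of n] zero_not_unit by simp
qed

lemma nils_iff: "x \<in> nils \<longleftrightarrow> x \<in> carrier R \<and> x \<notin> Units R"
  using nils_not_unit nilpotent_or_unit by (auto simp: nils_def)

lemma zero_nils: "\<zero> \<in> nils"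
  using zero_not_unit by (simp add: nils_iff)

lemma nils_mult: "x \<in> nils \<Longrightarrow> a \<in> carrier R \<Longrightarrow> a \<otimes> x \<in> nils"
  unfolding nils_iff using unit_factor [of x a] by (auto simp: m_comm)

lemma nils_mult': "x \<in> nils \<Longrightarrow> a \<in> carrier R \<Longrightarrow> x \<otimes> a \<in> nils"
  using nils_mult [of x a] by (simp add: m_comm nils_carrier)

lemma one_minus_pow_dvd:
  assumes "x \<in> carrier R"
  shows "\<exists>y\<in>carrier R. (\<one> \<ominus> x) \<otimes> y = \<one> \<ominus> x [^] (n::nat)"
proof (induction n)
  case 0
  then show ?case using assms by (intro bexI [of _ \<zero>]) (auto simp: minus_eq r_neg)
next
  case (Suc n)
  then obtain y where y: "y \<in> carrier R" "(\<one> \<ominus> x) \<otimes> y = \<one> \<ominus> x [^] n" by blast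
  have "(\<one> \<ominus> x) \<otimes> (y \<oplus> x [^] n) = (\<one> \<ominus> x) \<otimes> y \<oplus> (\<one> \<ominus> x) \<otimes> x [^] n"
    using assms y by (simp add: r_distr)
  also have "\<dots> = (\<one> \<ominus> x [^] n) \<oplus> (x [^] n \<ominus> x [^] n \<otimes> x)"
    unfolding y(2) using assms nat_pow_closed [of x n] by algebra
  also have "\<dots> = \<one> \<ominus> x [^] n \<otimes> x"
    using assms nat_pow_closed [of x n] by algebra
  finally show ?case using assms y by (intro bexI [of _ "y \<oplus> x [^] n"]) auto
qed

lemma one_minus_nil_unit:
  assumes "x \<in> nils"
  shows "\<one> \<ominus> x \<in> Units R"
proof -
  obtain n :: nat where "x [^] n = \<zero>" "x \<in> carrier R"
    using assms by (auto simp: nils_def)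
  then obtain y where "y \<in> carrier R" "(\<one> \<ominus> x) \<otimes> y = \<one>"
    using one_minus_pow_dvd [of x n] by (auto simp: minus_eq)
  then show ?thesis
    using \<open>x \<in> carrier R\<close> unit_factor [of "\<one> \<ominus> x" y] by auto
qed

text \<open>If the sum were a unit with inverse v, then y v = 1 - x v. The right side is a unit
  because x v is nil, whereas the left side is nil.\<close>

lemma nils_add:
  assumes "x \<in> nils" "y \<in> nils"
  shows "x \<oplus> y \<in> nils"
proof (rule ccontr)
  assume "x \<oplus> y \<notin> nils"
  note c = assms [THEN nils_carrier]
  then have u: "x \<oplus> y \<in> Units R"
    using \<open>x \<oplus> y \<notin> nils\<close> by (simp add: nils_iff)
  define v where "v = inv (x \<oplus> y)"
  have v: "v \<in> carrier R" "(x \<oplus> y) \<otimes> v = \<one>"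
    using u by (simp_all add: v_def)
  have "\<one> \<ominus> x \<otimes> v = (x \<oplus> y) \<otimes> v \<ominus> x \<otimes> v"
    by (simp add: v)
  also have "\<dots> = y \<otimes> v"
    using c v(1) by algebra
  finally have "y \<otimes> v \<in> Units R"
    using one_minus_nil_unit nils_mult' assms(1) v by metis
  then show False
    using nils_mult' assms(2) v nils_not_unit by blast
qed

lemma nils_uminus: "x \<in> nils \<Longrightarrow> \<ominus> x \<in> nils"
  using nils_mult [of x "\<ominus> \<one>"] by (simp add: l_minus nils_carrier)

lemma nils_minus: "x \<in> nils \<Longrightarrow> y \<in> nils \<Longrightarrow> x \<ominus> y \<in> nils"
  by (simp add: minus_eq nils_add nils_uminus)

text \<open>The k-th step is the annihilator of the k-th power of the maximal ideal. Thus
  \<open>loewy n = carrier R\<close> expresses that the n-th power of this ideal is zero, without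
  products of ideals being formed.\<close>

fun loewy :: "nat \<Rightarrow> 'a set" where
  "loewy 0 = {\<zero>}"
| "loewy (Suc k) = {x \<in> carrier R. \<forall>a\<in>nils. a \<otimes> x \<in> loewy k}"

lemma loewy_carrier: "x \<in> loewy k \<Longrightarrow> x \<in> carrier R"
  by (cases k) auto

lemma loewy_zero: "\<zero> \<in> loewy k"
  by (induction k) (auto simp: nils_carrier)

lemma loewy_add: "x \<in> loewy k \<Longrightarrow> y \<in> loewy k \<Longrightarrow> x \<oplus> y \<in> loewy k"
  by (induction k arbitrary: x y) (auto simp: nils_carrier r_distr)

lemma loewy_mult: "x \<in> loewy k \<Longrightarrow> a \<in> carrier R \<Longrightarrow> a \<otimes> x \<in> loewy k"
proof (induction k arbitrary: x)
  case (Suc k)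
  have "b \<otimes> (a \<otimes> x) \<in> loewy k" if "b \<in> nils" for b
    using Suc that by (simp add: m_lcomm [of b a x] nils_carrier)
  then show ?case using Suc.prems by simp
qed auto

lemma loewy_mult': "x \<in> loewy k \<Longrightarrow> a \<in> carrier R \<Longrightarrow> x \<otimes> a \<in> loewy k"
  using loewy_mult [of x k a] by (simp add: m_comm loewy_carrier)

lemma loewy_nils_mult: "x \<in> loewy (Suc k) \<Longrightarrow> a \<in> nils \<Longrightarrow> a \<otimes> x \<in> loewy k"
  by simp

end

section \<open>Polynomials as coefficient lists: evaluation, derivative, adjunction of an
  element\<close>

context cring
begin

text \<open>Polynomials are lists with the constant coefficient first, trailing zeros allowed. Only
  values at a point matter, so no polynomial ring is formed. A monic polynomial is given by its
  lower coefficients \<open>fs\<close> and evaluated as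
  \<open>horner fs a \<oplus> a [^] length fs\<close>.\<close>

fun horner :: "'a list \<Rightarrow> 'a \<Rightarrow> 'a" where
  "horner [] a = \<zero>"
| "horner (b # p) a = b \<oplus> a \<otimes> horner p a"

fun horner_deriv :: "'a list \<Rightarrow> 'a \<Rightarrow> 'a" where
  "horner_deriv [] a = \<zero>"
| "horner_deriv (b # p) a = horner p a \<oplus> a \<otimes> horner_deriv p a"

text \<open>The number n is the exponent belonging to the head of the list, so the derivative of
  \<open>b # p\<close> has the coefficients \<open>deriv_coeffs 1 p\<close>.\<close>

fun deriv_coeffs :: "nat \<Rightarrow> 'a list \<Rightarrow> 'a list" where
  "deriv_coeffs n [] = []"
| "deriv_coeffs n (b # p) = [n] \<cdot> b # deriv_coeffs (Suc n) p"

lemma horner_closed: "set p \<subseteq> carrier R \<Longrightarrow> a \<in> carrier R \<Longrightarrow> horner p a \<in> carrier R"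
  by (induction p) auto

lemma horner_deriv_closed:
  "set p \<subseteq> carrier R \<Longrightarrow> a \<in> carrier R \<Longrightarrow> horner_deriv p a \<in> carrier R"
  by (induction p) (auto simp: horner_closed)

lemma horner_snoc:
  "set p \<subseteq> carrier R \<Longrightarrow> t \<in> carrier R \<Longrightarrow> a \<in> carrier R \<Longrightarrow>
    horner (p @ [t]) a = horner p a \<oplus> t \<otimes> a [^] length p"
proof (induction p)
  case (Cons b p)
  have "horner ((b # p) @ [t]) a = b \<oplus> a \<otimes> (horner p a \<oplus> t \<otimes> a [^] length p)"
    using Cons by simp
  also have "\<dots> = b \<oplus> a \<otimes> horner p a \<oplus> t \<otimes> (a [^] length p \<otimes> a)"
    using Cons.prems horner_closed [of p a] nat_pow_closed [of a "length p"]
    by (simp add: r_distr a_assoc m_lcomm m_comm)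
  finally show ?case using Cons by simp
qed simp

lemma horner_smult:
  "set p \<subseteq> carrier R \<Longrightarrow> a \<in> carrier R \<Longrightarrow> d \<in> carrier R \<Longrightarrow>
    horner (map (\<lambda>x. d \<otimes> x) p) a = d \<otimes> horner p a"
proof (induction p)
  case (Cons b p)
  then have "horner p a \<in> carrier R" by (simp add: horner_closed)
  then show ?case using Cons by simp algebra
qed simp

lemma horner_add:
  "length p = length q \<Longrightarrow> set p \<subseteq> carrier R \<Longrightarrow> set q \<subseteq> carrier R \<Longrightarrow> a \<in> carrier R \<Longrightarrow>
    horner (map2 (\<oplus>) p q) a = horner p a \<oplus> horner q a"
proof (induction p q rule: list_induct2)
  case (Cons b p c q)
  then have "horner p a \<in> carrier R" "horner q a \<in> carrier R" by (simp_all add: horner_closed)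
  then show ?case using Cons by simp algebra
qed simp

text \<open>Taylor expansion to second order. The remainder is recorded only as a multiple of the
  square of \<open>h\<close>, since in the Hensel step that square drops one level in the Loewy
  series.\<close>

lemma horner_newton:
  assumes "set p \<subseteq> carrier R" "a \<in> carrier R" "h \<in> carrier R"
  shows "\<exists>e\<in>carrier R. horner p (a \<oplus> h) =
    horner p a \<oplus> h \<otimes> horner_deriv p a \<oplus> (h \<otimes> h) \<otimes> e"
  using assms(1)
proof (induction p)
  case Nil
  show ?case using assms by (intro bexI [of _ \<zero>]) auto
next
  case (Cons b p)
  then obtain e where e: "e \<in> carrier R"
    "horner p (a \<oplus> h) = horner p a \<oplus> h \<otimes> horner_deriv p a \<oplus> (h \<otimes> h) \<otimes> e"
    by auto
  have c: "b \<in> carrier R" "horner p a \<in> carrier R" "horner_deriv p a \<in> carrier R"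
    using Cons.prems assms by (auto simp: horner_closed horner_deriv_closed)
  show ?case
  proof (rule bexI)
    show "horner (b # p) (a \<oplus> h) = horner (b # p) a \<oplus> h \<otimes> horner_deriv (b # p) a \<oplus>
        (h \<otimes> h) \<otimes> (a \<otimes> e \<oplus> h \<otimes> e \<oplus> horner_deriv p a)"
      using c e(1) assms by (simp add: e(2)) algebra
  qed (use c e assms in auto)
qed

lemma length_deriv_coeffs [simp]: "length (deriv_coeffs n p) = length p"
  by (induction p arbitrary: n) auto

lemma nth_deriv_coeffs: "i < length p \<Longrightarrow> deriv_coeffs n p ! i = [(n + i)] \<cdot>  (p ! i)"
  by (induction p arbitrary: n i) (auto simp: nth_Cons split: nat.splits)

text \<open>By the product rule the derivative of x^n p is n p + x p' up to the factor x^(n-1). A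
  general n is carried along because the exponent grows in the induction.\<close>

lemma horner_deriv_coeffs:
  "set p \<subseteq> carrier R \<Longrightarrow> a \<in> carrier R \<Longrightarrow>
    horner (deriv_coeffs n p) a = [n] \<cdot> horner p a \<oplus> a \<otimes> horner_deriv p a"
proof (induction p arbitrary: n)
  case (Cons b p)
  have c: "b \<in> carrier R" "horner p a \<in> carrier R" "horner_deriv p a \<in> carrier R"
    "[n] \<cdot> b \<in> carrier R" "[n] \<cdot> horner p a \<in> carrier R"
    using Cons.prems by (auto simp: horner_closed horner_deriv_closed)
  have "[n] \<cdot> (a \<otimes> horner p a) = a \<otimes> [n] \<cdot> horner p a"
    using c Cons.prems add_pow_rdistr by simp
  moreover have "[n] \<cdot> (b \<oplus> a \<otimes> horner p a) = [n] \<cdot> b \<oplus> [n] \<cdot> (a \<otimes> horner p a)"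
    using c Cons.prems add.nat_pow_distrib by simp
  ultimately show ?case
    using Cons c by (simp add: r_distr a_ac)
qed (simp add: add.nat_pow_one)

lemma horner_deriv_Cons:
  assumes "set p \<subseteq> carrier R" "a \<in> carrier R"
  shows "horner_deriv (b # p) a = horner (deriv_coeffs 1 p) a"
  using assms horner_closed [of p a] by (simp add: horner_deriv_coeffs)


lemma horner_replicate_zero: "a \<in> carrier R \<Longrightarrow> horner (replicate n \<zero>) a = \<zero>"
  by (induction n) auto

lemma horner_add_ex:
  assumes D: "subring D R" and a: "a \<in> carrier R"
    and "set p \<subseteq> D" "set q \<subseteq> D"
  shows "\<exists>r. set r \<subseteq> D \<and> horner r a = horner p a \<oplus> horner q a"
  using assms(3,4)
proof (induction p arbitrary: q)
  case Nil
  then show ?case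
    using a subringE(1) [OF D] by (intro exI [of _ q]) (simp add: horner_closed subset_trans)
next
  case (Cons b p)
  note DR = subringE(1) [OF D]
  show ?case
  proof (cases q)
    case Nil
    have "horner (b # p) a \<in> carrier R"
      using Cons.prems DR a by (intro horner_closed) auto
    then show ?thesis using Nil Cons.prems by (intro exI [of _ "b # p"]) auto
  next
    case q: (Cons c q')
    then obtain r where r: "set r \<subseteq> D" "horner r a = horner p a \<oplus> horner q' a"
      using Cons by (metis insert_subset list.simps(15))
    have "horner p a \<in> carrier R" "horner q' a \<in> carrier R" "b \<in> carrier R" "c \<in> carrier R"
      using Cons.prems q DR a by (auto intro!: horner_closed)
    then have "horner ((b \<oplus> c) # r) a = horner (b # p) a \<oplus> horner q a"
      unfolding q horner.simps r(2) using a by algebra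
    moreover have "set ((b \<oplus> c) # r) \<subseteq> D"
      using Cons.prems q r subringE(7) [OF D] by auto
    ultimately show ?thesis by blast
  qed
qed

lemma horner_mult_ex:
  assumes D: "subring D R" and a: "a \<in> carrier R"
    and "set p \<subseteq> D" "set q \<subseteq> D"
  shows "\<exists>r. set r \<subseteq> D \<and> horner r a = horner p a \<otimes> horner q a"
  using assms(3)
proof (induction p)
  case Nil
  have "horner q a \<in> carrier R"
    using assms subringE(1) [OF D] by (intro horner_closed) auto
  then show ?case by (intro exI [of _ "[]"]) auto
next
  case (Cons b p)
  note DR = subringE(1) [OF D]
  obtain r where r: "set r \<subseteq> D" "horner r a = horner p a \<otimes> horner q a"
    using Cons by auto
  have c: "horner p a \<in> carrier R" "horner q a \<in> carrier R" "b \<in> carrier R" "set q \<subseteq> carrier R"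
    using Cons.prems assms DR by (auto intro!: horner_closed)
  have "set (\<zero> # r) \<subseteq> D" "set (map (\<lambda>x. b \<otimes> x) q) \<subseteq> D"
    using r Cons.prems assms subringE(2,6) [OF D] by auto
  then obtain s where "set s \<subseteq> D" "horner s a = horner (map (\<lambda>x. b \<otimes> x) q) a \<oplus> horner (\<zero> # r) a"
    using horner_add_ex [OF D a] by blast
  moreover have "\<dots> = horner (b # p) a \<otimes> horner q a"
    using c a by (simp add: horner_smult r(2) l_distr m_assoc)
  ultimately show ?case by auto
qed

lemma subring_adjoin:
  assumes D: "subring D R" and a: "a \<in> carrier R"
  shows "subring {horner p a |p. set p \<subseteq> D} R" (is "subring ?D' R")
proof (rule subringI)
  note DR = subringE(1) [OF D]
  show "?D' \<subseteq> carrier R"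
    using DR a horner_closed by blast
  show "\<one> \<in> ?D'"
    using subringE(3) [OF D] a by (intro CollectI exI [of _ "[\<one>]"]) auto
  fix x y assume "x \<in> ?D'" "y \<in> ?D'"
  then obtain p q where pq: "set p \<subseteq> D" "x = horner p a" "set q \<subseteq> D" "y = horner q a"
    by blast
  show "x \<oplus> y \<in> ?D'" "x \<otimes> y \<in> ?D'"
    using horner_add_ex [OF D a pq(1,3)] horner_mult_ex [OF D a pq(1,3)] pq by force+
next
  fix x assume "x \<in> ?D'"
  then obtain p where p: "set p \<subseteq> D" "x = horner p a" by blast
  then have "horner (map (\<lambda>y. \<ominus> \<one> \<otimes> y) p) a = \<ominus> \<one> \<otimes> x"
    using subringE(1) [OF D] a by (simp add: horner_smult)
  then have "horner (map (\<lambda>y. \<ominus> \<one> \<otimes> y) p) a = \<ominus> x"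
    using p subringE(1) [OF D] a horner_closed [of p a] by (simp add: l_minus subset_trans)
  moreover have "set (map (\<lambda>y. \<ominus> \<one> \<otimes> y) p) \<subseteq> D"
    using p subringE(3,5,6) [OF D] by auto
  ultimately show "\<ominus> x \<in> ?D'"
    by (metis (mono_tags, lifting) mem_Collect_eq)
qed

lemma subring_Union_chain:
  assumes "\<C> \<noteq> {}" "\<And>D. D \<in> \<C> \<Longrightarrow> subring D R" "\<And>D E. D \<in> \<C> \<Longrightarrow> E \<in> \<C> \<Longrightarrow> D \<subseteq> E \<or> E \<subseteq> D"
  shows "subring (\<Union>\<C>) R"
proof (rule subringI)
  show "\<Union>\<C> \<subseteq> carrier R"
    using subringE(1) [OF assms(2)] by blast
  show "\<one> \<in> \<Union>\<C>"
    using subringE(3) [OF assms(2)] assms(1) by blast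
  fix x y assume "x \<in> \<Union>\<C>" "y \<in> \<Union>\<C>"
  then obtain D where "D \<in> \<C>" "x \<in> D" "y \<in> D"
    using assms(3) by (meson UnionE subsetD)
  then show "x \<oplus> y \<in> \<Union>\<C>" "x \<otimes> y \<in> \<Union>\<C>"
    using subringE(6,7) [OF assms(2)] by (meson UnionI)+
next
  fix x assume "x \<in> \<Union>\<C>"
  then show "\<ominus> x \<in> \<Union>\<C>"
    using subringE(5) [OF assms(2)] by (meson UnionE UnionI)
qed

section \<open>The binomial theorem and prime characteristic\<close>

lemma binomial_expansion:
  assumes a: "a \<in> carrier R" and b: "b \<in> carrier R"
  shows "(a \<oplus> b) [^] (n::nat) = (\<Oplus>k\<in>{..n}. [(n choose k)] \<cdot> (a [^] k \<otimes> b [^] (n - k)))"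
proof (induction n)
  case 0
  then show ?case by simp
next
  case (Suc n)
  define s where "s k = a [^] Suc k \<otimes> b [^] (n - k)" for k
  define t where "t k = a [^] k \<otimes> b [^] (Suc n - k)" for k
  have st: "s k \<in> carrier R" "t k \<in> carrier R" for k
    using a b by (simp_all add: s_def t_def)
  have ts: "t (Suc k) = s k" for k
    by (simp add: s_def t_def)
  let ?u = "\<lambda>k. a [^] k \<otimes> b [^] (n - k)"
  have u: "?u k \<in> carrier R" for k using a b by simp
  have us: "a \<otimes> [(n choose k)] \<cdot> ?u k = [(n choose k)] \<cdot> s k" for k
  proof -
    have "a \<otimes> [(n choose k)] \<cdot> ?u k = [(n choose k)] \<cdot> (a \<otimes> ?u k)"
      using a u add_pow_rdistr by simp
    also have "a \<otimes> ?u k = s k"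
      using a b by (simp add: s_def m_ac)
    finally show ?thesis .
  qed
  have ut: "b \<otimes> [(n choose k)] \<cdot> ?u k = [(n choose k)] \<cdot> t k" if "k \<le> n" for k
  proof -
    have "b \<otimes> [(n choose k)] \<cdot> ?u k = [(n choose k)] \<cdot> (b \<otimes> ?u k)"
      using b u add_pow_rdistr by simp
    also have "b \<otimes> ?u k = t k"
      using a b that by (simp add: t_def m_ac Suc_diff_le)
    finally show ?thesis .
  qed
  have "(a \<oplus> b) [^] Suc n = (a \<oplus> b) \<otimes> (\<Oplus>k\<in>{..n}. [(n choose k)] \<cdot> ?u k)"
    using a b by (simp add: Suc.IH m_comm)
  also have "\<dots> = a \<otimes> (\<Oplus>k\<in>{..n}. [(n choose k)] \<cdot> ?u k) \<oplus> b \<otimes> (\<Oplus>k\<in>{..n}. [(n choose k)] \<cdot> ?u k)"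
    using a b u by (intro l_distr) (auto intro!: finsum_closed)
  also have "\<dots> = (\<Oplus>k\<in>{..n}. [(n choose k)] \<cdot> s k) \<oplus> (\<Oplus>k\<in>{..n}. [(n choose k)] \<cdot> t k)"
    using a b u st us ut by (subst (1 2) finsum_rdistr) (auto intro!: arg_cong2 [of _ _ _ _ "(\<oplus>)"] finsum_cong')
  also have "(\<Oplus>k\<in>{..n}. [(n choose k)] \<cdot> t k) = (\<Oplus>k\<in>{..Suc n}. [(n choose k)] \<cdot> t k)"
    using st finsum_closed [of "\<lambda>k. [(n choose k)] \<cdot> t k" "{..n}"]
    by (simp add: finsum_Suc Pi_def binomial_eq_0)
  also have "\<dots> = (\<Oplus>k\<in>{..n}. [(n choose Suc k)] \<cdot> s k) \<oplus> t 0"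
    using st by (subst finsum_Suc2) (auto simp: ts)
  also have "(\<Oplus>k\<in>{..n}. [(n choose k)] \<cdot> s k) \<oplus> \<dots> =
      (\<Oplus>k\<in>{..n}. [(n choose k)] \<cdot> s k) \<oplus> (\<Oplus>k\<in>{..n}. [(n choose Suc k)] \<cdot> s k) \<oplus> t 0"
    using st by (intro a_assoc [symmetric] finsum_closed) auto
  also have "\<dots> = (\<Oplus>k\<in>{..n}. [(Suc n choose Suc k)] \<cdot> s k) \<oplus> t 0"
    using st by (subst finsum_addf [symmetric]) (auto intro!: arg_cong2 [of _ _ _ _ "(\<oplus>)"] finsum_cong' simp: add.nat_pow_mult)
  also have "\<dots> = (\<Oplus>k\<in>{..Suc n}. [(Suc n choose k)] \<cdot> t k)"
    using st by (subst finsum_Suc2) (auto simp: ts)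
  finally show ?case by (simp add: t_def)
qed

lemma frobenius_add:
  assumes p: "prime p" "[p] \<cdot> \<one> = \<zero>" and a: "a \<in> carrier R" and b: "b \<in> carrier R"
  shows "(a \<oplus> b) [^] p = a [^] p \<oplus> b [^] (p::nat)"
proof -
  let ?t = "\<lambda>k. [(p choose k)] \<cdot> (a [^] k \<otimes> b [^] (p - k))"
  have p0: "0 < p" using p by (simp add: prime_gt_0_nat)
  have "?t k = \<zero>" if "k \<in> {..p} - {0, p}" for k
  proof -
    have "p dvd (p choose k)"
      using that p by (intro dvd_choose_prime) auto
    then obtain q where q: "(p choose k) = p * q" by blast
    have "?t k = [p] \<cdot> \<one> \<otimes> [q] \<cdot> (a [^] k \<otimes> b [^] (p - k))"
      using a b unfolding q
      by (subst add_pow_ldistr) (auto simp: add.nat_pow_pow mult.commute)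
    then show ?thesis using p a b by simp
  qed
  then have "(\<Oplus>k\<in>{..p}. ?t k) = (\<Oplus>k\<in>{0, p}. ?t k)"
    using a b by (intro add.finprod_mono_neutral_cong_right) auto
  also have "\<dots> = b [^] p \<oplus> a [^] p"
    using a b p0 by simp
  finally show ?thesis
    using a b by (simp add: binomial_expansion a_comm)
qed

text \<open>A prime divisor p of n whose multiple of 1 is invertible can be cancelled from n = p q,
  and the induction continues with the smaller q.\<close>

lemma char_prime:
  assumes "\<one> \<noteq> \<zero>" "\<And>n::nat. [n] \<cdot> \<one> = \<zero> \<or> [n] \<cdot> \<one> \<in> Units R"
    and n: "0 < n" "[(n::nat)] \<cdot> \<one> = \<zero>"
  shows "\<exists>p. prime p \<and> p dvd n \<and> [p] \<cdot> \<one> = \<zero>"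
  using n
proof (induction n rule: less_induct)
  case (less n)
  have "n \<noteq> 1" using less.prems assms(1) by auto
  then obtain p where p: "prime p" "p dvd n" using prime_factor_nat by blast
  then obtain q where q: "n = p * q" by blast
  show ?case
  proof (cases "[p] \<cdot> \<one> = \<zero>")
    case False
    then have "[p] \<cdot> \<one> \<in> Units R" using assms(2) by blast
    moreover have "[p] \<cdot> \<one> \<otimes> [q] \<cdot> \<one> = \<zero>"
      using less.prems(2) q by (subst add_pow_ldistr) (auto simp: add.nat_pow_pow mult.commute)
    ultimately have "[q] \<cdot> \<one> = \<zero>"
      using Units_l_cancel [of "[p] \<cdot> \<one>" "[q] \<cdot> \<one>" \<zero>] by simp
    moreover have "0 < q" "q < n"
      using q less.prems p prime_gt_1_nat [of p] by auto
    ultimately obtain r where "prime r" "r dvd q" "[r] \<cdot> \<one> = \<zero>"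
      using less.IH [of q] by blast
    then show ?thesis using q by (intro exI [of _ r]) auto
  qed (use p in blast)
qed

end

section \<open>Cohen's structure theorem for local rings with nilpotent maximal ideal\<close>

context local_nil_ring
begin

text \<open>Subrings that represent all residue classes are shrunk step by step along the Loewy series;
  at \<open>k = 0\<close> no nonzero nilpotent is left and the subring is a coefficient field.\<close>

definition coeff_subring :: "nat \<Rightarrow> 'a set \<Rightarrow> bool"
  where "coeff_subring k B \<longleftrightarrow> subring B R \<and> (\<forall>b\<in>B. b \<in> Units R \<longrightarrow> inv b \<in> B) \<and>
    (\<forall>a\<in>carrier R. \<exists>b\<in>B. a \<ominus> b \<in> nils) \<and> B \<inter> nils \<subseteq> loewy k"

text \<open>Candidates for the next subring, to be maximized by Zorn's lemma; that residue classes
  are represented will follow from maximality. In characteristic p they contain all p-th powers of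
  \<open>B\<close>, which takes care of inseparable residue extensions.\<close>

definition subring_lift :: "nat \<Rightarrow> 'a set \<Rightarrow> 'a set \<Rightarrow> bool"
  where "subring_lift k B D \<longleftrightarrow> subring D R \<and> D \<subseteq> B \<and> D \<inter> nils \<subseteq> loewy k \<and>
    (\<forall>p::nat. prime p \<and> [p] \<cdot> \<one> = \<zero> \<longrightarrow> (\<forall>b\<in>B. b [^] p \<in> D))"

lemma loewy_sq:
  assumes "x \<in> nils" "x \<in> loewy (Suc k)" "y \<in> carrier R"
  shows "(x \<otimes> x) \<otimes> y \<in> loewy k"
  using assms loewy_nils_mult loewy_mult' by blast

lemma nils_powD: "x \<in> carrier R \<Longrightarrow> x [^] (n::nat) \<in> nils \<Longrightarrow> x \<in> nils"
  by (auto simp: nils_def nat_pow_pow)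

lemma int_multiple_zero:
  assumes "[(m::nat)] \<cdot> \<one> = \<zero>"
  shows "[(u * int m)] \<cdot> \<one> = \<zero>"
proof -
  have "[(int m * u)] \<cdot> \<one> = [u] \<cdot> ([(int m)] \<cdot> \<one>)"
    using add.int_pow_pow [of \<one> u "int m"] by simp
  also have "[(int m)] \<cdot> \<one> = \<zero>"
    using assms add_pow_int_ge [of "int m" R \<one>] by simp
  finally show ?thesis by (simp add: mult.commute)
qed

lemma prime_char_unique:
  assumes "prime (p::nat)" "[p] \<cdot> \<one> = \<zero>" "prime (q::nat)" "[q] \<cdot> \<one> = \<zero>"
  shows "p = q"
proof (rule ccontr)
  assume "p \<noteq> q"
  then have "coprime (int p) (int q)"
    using assms primes_coprime by auto
  then obtain u v where uv: "u * int p + v * int q = 1"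
    by (metis coprime_iff_gcd_eq_1 bezout_int)
  have "[(u * int p + v * int q)] \<cdot> \<one> = [(u * int p)] \<cdot> \<one> \<oplus> [(v * int q)] \<cdot> \<one>"
    by (simp add: add.int_pow_mult)
  moreover have "[(u * int p)] \<cdot> \<one> = \<zero>" "[(v * int q)] \<cdot> \<one> = \<zero>"
    using assms by (simp_all add: int_multiple_zero)
  ultimately show False
    using uv one_nz by (simp add: add_pow_int_ge)
qed

text \<open>In characteristic p the p-th powers of \<open>B\<close> form a subring by Frobenius. A
  nil one has a nil base b in \<open>loewy (Suc k)\<close>, and since p \<ge> 2 its factor b b
  already lies in \<open>loewy k\<close>. Without such a p the integer multiples of 1 serve: a nil
  one is not a unit, hence zero.\<close>

lemma subring_lift_exists:
  assumes B: "coeff_subring (Suc k) B"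
  shows "\<exists>D. subring_lift k B D"
proof (cases "\<exists>p::nat. prime p \<and> [p] \<cdot> \<one> = \<zero>")
  case True
  then obtain p :: nat where p: "prime p" "[p] \<cdot> \<one> = \<zero>" by blast
  have sB: "subring B R" and BN: "B \<inter> nils \<subseteq> loewy (Suc k)"
    using B by (simp_all add: coeff_subring_def)
  note BR = subringE(1) [OF sB]
  have p0: "0 < p" "1 < p" using prime_gt_0_nat [OF p(1)] prime_gt_1_nat [OF p(1)] by auto
  let ?D = "(\<lambda>b. b [^] p) ` B"
  have powB: "b [^] n \<in> B" if "b \<in> B" for b and n :: nat
    using that subringE(3,6) [OF sB] by (induction n) auto
  have "subring ?D R"
  proof (rule subringI)
    show "?D \<subseteq> carrier R" using BR by auto
    show "\<one> \<in> ?D" using subringE(3) [OF sB] by (intro image_eqI [of _ _ \<one>]) auto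
    fix x y assume "x \<in> ?D" "y \<in> ?D"
    then obtain a b where ab: "a \<in> B" "x = a [^] p" "b \<in> B" "y = b [^] p" by blast
    moreover have "a \<in> carrier R" "b \<in> carrier R" using ab BR by auto
    ultimately have "x \<oplus> y = (a \<oplus> b) [^] p" "x \<otimes> y = (a \<otimes> b) [^] p"
      using p by (simp_all add: frobenius_add nat_pow_distrib)
    then show "x \<oplus> y \<in> ?D" "x \<otimes> y \<in> ?D"
      using ab subringE(6,7) [OF sB] by blast+
  next
    fix x assume "x \<in> ?D"
    then obtain a where a: "a \<in> B" "x = a [^] p" "a \<in> carrier R" using BR by blast
    have "x \<oplus> (\<ominus> a) [^] p = (a \<oplus> \<ominus> a) [^] p"
      using a p by (simp add: frobenius_add)
    also have "\<dots> = \<zero>" using a p0 by (simp add: r_neg nat_pow_zero)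
    finally have "\<ominus> x = (\<ominus> a) [^] p"
      using a by (metis a_inv_closed minus_equality nat_pow_closed a_comm)
    then show "\<ominus> x \<in> ?D" using a subringE(5) [OF sB] by blast
  qed
  moreover have "?D \<subseteq> B" using powB by blast
  moreover have "?D \<inter> nils \<subseteq> loewy k"
  proof
    fix x assume "x \<in> ?D \<inter> nils"
    then obtain b where b: "b \<in> B" "x = b [^] p" "b \<in> carrier R" "x \<in> nils" using BR by auto
    then have "b \<in> nils" using nils_powD by blast
    moreover have "b [^] p = (b \<otimes> b) \<otimes> b [^] (p - 2)"
    proof -
      have "b [^] p = b [^] (2 + (p - 2))"
        by (subst le_add_diff_inverse) (use p0 in auto)
      also have "\<dots> = b [^] (2::nat) \<otimes> b [^] (p - 2)"
        by (rule nat_pow_mult [OF b(3), symmetric])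
      also have "b [^] (2::nat) = b \<otimes> b" using b by (simp add: numeral_2_eq_2)
      finally show ?thesis .
    qed
    ultimately show "x \<in> loewy k"
      using b BN loewy_sq [of b k "b [^] (p - 2)"] by auto
  qed
  moreover have "b [^] q \<in> ?D" if "prime q" "[q] \<cdot> \<one> = \<zero>" "b \<in> B" for q :: nat and b
    using prime_char_unique [OF p that(1,2)] that(3) by blast
  ultimately show ?thesis
    unfolding subring_lift_def by blast
next
  case False
  have sB: "subring B R" using B by (simp add: coeff_subring_def)
  let ?D = "range (\<lambda>z::int. [z] \<cdot> \<one>)"
  have natB: "[n] \<cdot> \<one> \<in> B" for n :: nat
    using subringE(2,3,7) [OF sB] by (induction n) auto
  have "?D \<subseteq> B"
  proof clarify
    fix z :: int
    show "[z] \<cdot> \<one> \<in> B"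
      using natB subringE(5) [OF sB] add_pow_int_ge [of z R \<one>] add_pow_int_lt [of z R \<one>]
      by (cases "z \<ge> 0") auto
  qed
  moreover have "subring ?D R"
  proof (rule subringI)
    show "\<one> \<in> ?D" by (rule range_eqI [of _ _ 1]) simp
    fix x y assume "x \<in> ?D" "y \<in> ?D"
    then obtain u v :: int where uv: "x = [u] \<cdot> \<one>" "y = [v] \<cdot> \<one>" by blast
    have "x \<oplus> y = [(u + v)] \<cdot> \<one>" using uv by (simp add: add.int_pow_mult)
    moreover have "x \<otimes> y = [(u * v)] \<cdot> \<one>"
      using uv by (simp add: add_pow_ldistr_int add.int_pow_pow mult.commute)
    ultimately show "x \<oplus> y \<in> ?D" "x \<otimes> y \<in> ?D" by blast+
  next
    fix x assume "x \<in> ?D"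
    then obtain u :: int where "x = [u] \<cdot> \<one>" by blast
    then have "\<ominus> x = [(- u)] \<cdot> \<one>" by (simp add: add.int_pow_neg)
    then show "\<ominus> x \<in> ?D" by blast
  qed auto
  moreover have "?D \<inter> nils \<subseteq> loewy k"
  proof clarify
    fix z :: int assume z: "[z] \<cdot> \<one> \<in> nils"
    have "[(nat \<bar>z\<bar>)] \<cdot> \<one> = [z] \<cdot> \<one> \<or> [(nat \<bar>z\<bar>)] \<cdot> \<one> = \<ominus> ([z] \<cdot> \<one>)"
      using add_pow_int_ge [of z R \<one>] add_pow_int_lt [of z R \<one>] by (cases "z \<ge> 0") auto
    then have "[(nat \<bar>z\<bar>)] \<cdot> \<one> \<in> nils" using z nils_uminus by auto
    then have "[(nat \<bar>z\<bar>)] \<cdot> \<one> = \<zero>" using nat_zero_or_unit nils_not_unit by blast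
    then have "nat \<bar>z\<bar> = 0"
      using False char_prime [OF one_nz nat_zero_or_unit, of "nat \<bar>z\<bar>"] by auto
    then have "z = 0" by simp
    then show "[z] \<cdot> \<one> \<in> loewy k"
      using add_pow_int_ge [of 0 R \<one>] loewy_zero by simp
  qed
  ultimately show ?thesis
    unfolding subring_lift_def using False by blast
qed

lemma subring_lift_maximal:
  assumes "coeff_subring (Suc k) B"
  obtains D where "subring_lift k B D" "\<And>D'. subring_lift k B D' \<Longrightarrow> D \<subseteq> D' \<Longrightarrow> D' = D"
proof -
  let ?F = "{D. subring_lift k B D}"
  have "\<exists>M\<in>?F. \<forall>X\<in>?F. M \<subseteq> X \<longrightarrow> X = M"
  proof (rule subset_Zorn_nonempty)
    show "?F \<noteq> {}" using subring_lift_exists [OF assms] by blast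
    fix \<C> assume C: "\<C> \<noteq> {}" "subset.chain ?F \<C>"
    then have CF: "subring_lift k B D" if "D \<in> \<C>" for D
      using that by (auto simp: subset.chain_def)
    have "D \<subseteq> E \<or> E \<subseteq> D" if "D \<in> \<C>" "E \<in> \<C>" for D E
      using C(2) that by (auto simp: subset_chain_def)
    then have "subring (\<Union>\<C>) R"
      using C(1) CF by (intro subring_Union_chain) (auto simp: subring_lift_def)
    moreover obtain D0 where "D0 \<in> \<C>" using C(1) by blast
    ultimately show "\<Union>\<C> \<in> ?F"
      using CF unfolding subring_lift_def mem_Collect_eq by (blast 10)
  qed
  then show thesis using that by blast
qed


text \<open>The fractions b/u, with u in \<open>D\<close> invertible in the ring, form a candidate
  again, since b/u is nil only if b is. Maximality of \<open>D\<close> then absorbs them.\<close>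

lemma subring_lift_inv:
  assumes B: "coeff_subring (Suc k) B" and D: "subring_lift k B D"
    and max: "\<And>D'. subring_lift k B D' \<Longrightarrow> D \<subseteq> D' \<Longrightarrow> D' = D"
    and d: "d \<in> D" "d \<in> Units R"
  shows "inv d \<in> D"
proof -
  have sD: "subring D R" and DB: "D \<subseteq> B" and DN: "D \<inter> nils \<subseteq> loewy k"
    and T: "\<And>p b. prime (p::nat) \<Longrightarrow> [p] \<cdot> \<one> = \<zero> \<Longrightarrow> b \<in> B \<Longrightarrow> b [^] p \<in> D"
    using D by (simp_all add: subring_lift_def)
  have sB: "subring B R" and Binv: "\<And>b. b \<in> B \<Longrightarrow> b \<in> Units R \<Longrightarrow> inv b \<in> B"
    using B by (simp_all add: coeff_subring_def)
  note DR = subringE(1) [OF sD]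
  note closed = subringE(3,5,6,7) [OF sD]
  let ?D = "{b \<otimes> inv u |b u. b \<in> D \<and> u \<in> D \<and> u \<in> Units R}"
  have sub: "D \<subseteq> ?D"
  proof
    fix b assume "b \<in> D"
    moreover have "b = b \<otimes> inv \<one>" using \<open>b \<in> D\<close> DR by auto
    ultimately show "b \<in> ?D" using closed(1) by blast
  qed
  have "subring ?D R"
  proof (rule subringI)
    show "?D \<subseteq> carrier R" using DR by auto
    show "\<one> \<in> ?D" using sub closed(1) by blast
    fix x y assume "x \<in> ?D" "y \<in> ?D"
    then obtain b u c v where bu: "b \<in> D" "u \<in> D" "u \<in> Units R" "x = b \<otimes> inv u"
      and cv: "c \<in> D" "v \<in> D" "v \<in> Units R" "y = c \<otimes> inv v" by blast
    define u' v' where "u' = inv u" and "v' = inv v"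
    have iv: "u \<otimes> u' = \<one>" "v \<otimes> v' = \<one>" "u' \<in> carrier R" "v' \<in> carrier R"
      using bu cv by (simp_all add: u'_def v'_def)
    have c: "b \<in> carrier R" "u \<in> carrier R" "c \<in> carrier R" "v \<in> carrier R"
      using bu cv DR by auto
    have uv: "u \<otimes> v \<in> Units R" "u \<otimes> v \<in> D" using bu cv closed by auto
    have i: "inv (u \<otimes> v) = u' \<otimes> v'"
    proof (rule comm_inv_char)
      have "u \<otimes> v \<otimes> (u' \<otimes> v') = (u \<otimes> u') \<otimes> (v \<otimes> v')"
        using c iv(3,4) by algebra
      then show "u \<otimes> v \<otimes> (u' \<otimes> v') = \<one>" using iv by simp
    qed (use c iv in auto)
    have "x \<otimes> y = (b \<otimes> c) \<otimes> inv (u \<otimes> v)"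
      unfolding i bu(4) cv(4) u'_def [symmetric] v'_def [symmetric] using c iv(3,4) by algebra
    moreover have "x \<oplus> y = (b \<otimes> v \<oplus> c \<otimes> u) \<otimes> inv (u \<otimes> v)"
    proof -
      have "(b \<otimes> v \<oplus> c \<otimes> u) \<otimes> (u' \<otimes> v') = b \<otimes> u' \<otimes> (v \<otimes> v') \<oplus> c \<otimes> v' \<otimes> (u \<otimes> u')"
        using c iv(3,4) by algebra
      then show ?thesis
        unfolding i bu(4) cv(4) u'_def [symmetric] v'_def [symmetric] using c iv by simp
    qed
    moreover have "b \<otimes> c \<in> D" "b \<otimes> v \<oplus> c \<otimes> u \<in> D" using bu cv closed by auto
    ultimately show "x \<oplus> y \<in> ?D" "x \<otimes> y \<in> ?D" using uv by blast+
  next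
    fix x assume "x \<in> ?D"
    then obtain b u where bu: "b \<in> D" "u \<in> D" "u \<in> Units R" "x = b \<otimes> inv u" by blast
    then have "\<ominus> x = (\<ominus> b) \<otimes> inv u" using DR by (auto simp: l_minus)
    then show "\<ominus> x \<in> ?D" using bu closed by blast
  qed
  moreover have "?D \<subseteq> B" using DB Binv subringE(6) [OF sB] by blast
  moreover have "?D \<inter> nils \<subseteq> loewy k"
  proof clarify
    fix b u assume bu: "b \<in> D" "u \<in> D" "u \<in> Units R" "b \<otimes> inv u \<in> nils"
    have bc: "b \<in> carrier R" using bu DR by blast
    have "b \<otimes> inv u \<otimes> u \<in> nils" using bu nils_mult' Units_closed by blast
    moreover have "b \<otimes> inv u \<otimes> u = b" using bu bc by (simp add: m_assoc Units_closed)
    ultimately have "b \<in> nils" by simp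
    then show "b \<otimes> inv u \<in> loewy k" using bu DN loewy_mult' Units_inv_closed by blast
  qed
  ultimately have "subring_lift k B ?D"
    unfolding subring_lift_def using T sub by (meson subsetD)
  then have "?D = D" using max sub by blast
  moreover have "inv d = \<one> \<otimes> inv d" using d by simp
  ultimately show ?thesis using d closed(1) by blast
qed

text \<open>Hypothesis \<open>h\<close> is the one condition on D[a] that is not inherited from
  \<open>D\<close> and \<open>B\<close>. With it D[a] is a candidate, so it equals
  \<open>D\<close>.\<close>

lemma subring_lift_adjoin:
  assumes B: "coeff_subring (Suc k) B" and D: "subring_lift k B D"
    and max: "\<And>D'. subring_lift k B D' \<Longrightarrow> D \<subseteq> D' \<Longrightarrow> D' = D"
    and a: "a \<in> B" and h: "\<And>p. set p \<subseteq> D \<Longrightarrow> horner p a \<in> nils \<Longrightarrow> horner p a \<in> loewy k"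
  shows "a \<in> D"
proof -
  have sD: "subring D R" and DB: "D \<subseteq> B"
    and T: "\<And>p b. prime (p::nat) \<Longrightarrow> [p] \<cdot> \<one> = \<zero> \<Longrightarrow> b \<in> B \<Longrightarrow> b [^] p \<in> D"
    using D by (simp_all add: subring_lift_def)
  have sB: "subring B R" using B by (simp add: coeff_subring_def)
  have ac: "a \<in> carrier R" using a subringE(1) [OF sB] by blast
  let ?D = "{horner p a |p. set p \<subseteq> D}"
  have sub: "D \<subseteq> ?D"
  proof
    fix b assume "b \<in> D"
    moreover have "b = horner [b] a" using \<open>b \<in> D\<close> subringE(1) [OF sD] ac by auto
    moreover have "set [b] \<subseteq> D" using \<open>b \<in> D\<close> by simp
    ultimately show "b \<in> ?D" by blast
  qed
  have "horner p a \<in> B" if "set p \<subseteq> D" for p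
    using that DB a subringE(2,6,7) [OF sB] by (induction p) auto
  then have "?D \<subseteq> B" by blast
  then have "subring_lift k B ?D"
    unfolding subring_lift_def using T sub h subring_adjoin [OF sD ac] by (safe; blast)
  then have "?D = D" using max sub by blast
  moreover have "a = horner [\<zero>, \<one>] a" using ac by simp
  moreover have "set [\<zero>, \<one>] \<subseteq> D" using subringE(2,3) [OF sD] by simp
  ultimately show ?thesis by blast
qed

lemma low_degree_coeffs:
  assumes sD: "subring D R" and Dinv: "\<And>d. d \<in> D \<Longrightarrow> d \<in> Units R \<Longrightarrow> inv d \<in> D"
    and a: "a \<in> carrier R"
    and no: "\<And>fs. set fs \<subseteq> D \<Longrightarrow> length fs < d \<Longrightarrow> horner fs a \<oplus> a [^] length fs \<notin> nils"
  shows "set r \<subseteq> D \<Longrightarrow> length r \<le> d \<Longrightarrow> horner r a \<in> nils \<Longrightarrow> set r \<subseteq> nils"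
proof (induction r rule: rev_induct)
  case (snoc t r)
  note DR = subringE(1) [OF sD]
  have c: "t \<in> D" "t \<in> carrier R" "set r \<subseteq> D" "set r \<subseteq> carrier R" "horner r a \<in> carrier R"
    using snoc.prems DR a by (auto intro!: horner_closed)
  have eq: "horner (r @ [t]) a = horner r a \<oplus> t \<otimes> a [^] length r"
    using c a by (simp add: horner_snoc)
  show ?case
  proof (cases "t \<in> nils")
    case True
    have "horner r a = horner (r @ [t]) a \<ominus> t \<otimes> a [^] length r"
      unfolding eq using c(2,5) a nat_pow_closed [OF a, of "length r"] by algebra
    moreover have "t \<otimes> a [^] length r \<in> nils" using True a by (simp add: nils_mult')
    ultimately have "horner r a \<in> nils" using snoc.prems nils_minus by metis
    then show ?thesis using snoc True c by auto
  next
    case False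
    then have u: "t \<in> Units R" using c by (simp add: nils_iff)
    define s where "s = inv t"
    have s: "s \<in> D" "s \<in> carrier R" "s \<otimes> t = \<one>"
      using u c Dinv by (simp_all add: s_def)
    let ?f = "map (\<lambda>x. s \<otimes> x) r"
    have "s \<otimes> horner (r @ [t]) a = s \<otimes> horner r a \<oplus> (s \<otimes> t) \<otimes> a [^] length r"
      unfolding eq using c(2,5) s(2) nat_pow_closed [OF a, of "length r"] by algebra
    also have "\<dots> = horner ?f a \<oplus> a [^] length ?f"
      using s c a by (simp add: horner_smult)
    finally have "horner ?f a \<oplus> a [^] length ?f \<in> nils"
      using snoc.prems s nils_mult by metis
    moreover have "set ?f \<subseteq> D" "length ?f < d"
      using s c snoc.prems subringE(6) [OF sD] by auto
    ultimately show ?thesis using no by blast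
  qed
qed simp

text \<open>Division with remainder by the monic polynomial of \<open>fs\<close>. Its value at
  \<open>a\<close> is not zero but lies in \<open>loewy k \<inter> nils\<close>, which is where the
  error n comes from. In each Horner step the top term of a times the previous remainder is
  rewritten through this polynomial, so the remainder keeps the length of \<open>fs\<close>.\<close>

lemma horner_reduce:
  assumes sD: "subring D R" and a: "a \<in> carrier R" and fs: "set fs \<subseteq> D" "fs \<noteq> []"
    and f: "horner fs a \<oplus> a [^] length fs \<in> loewy k \<inter> nils"
    and "set p \<subseteq> D"
  shows "\<exists>r n. set r \<subseteq> D \<and> length r = length fs \<and> n \<in> loewy k \<inter> nils \<and> horner p a = horner r a \<oplus> n"
  using assms(6)
proof (induction p)
  case Nil
  then show ?case
    using subringE(2) [OF sD] a loewy_zero zero_nils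
    by (intro exI [of _ "replicate (length fs) \<zero>"] exI [of _ \<zero>]) (auto simp: horner_replicate_zero)
next
  case (Cons b p)
  note DR = subringE(1) [OF sD]
  define l where "l = length fs"
  obtain r n where r: "set r \<subseteq> D" "length r = l" "n \<in> loewy k \<inter> nils" "horner p a = horner r a \<oplus> n"
    using Cons by (auto simp: l_def)
  obtain r0 t where r0: "r = r0 @ [t]"
    using r(2) fs(2) by (metis l_def length_0_conv rev_exhaust)
  have c: "t \<in> D" "t \<in> carrier R" "b \<in> D" "b \<in> carrier R" "set r0 \<subseteq> carrier R" "set fs \<subseteq> carrier R"
      "set r0 \<subseteq> D" "n \<in> carrier R"
    using Cons.prems r r0 DR fs nils_carrier by auto
  have hc: "horner r0 a \<in> carrier R" "horner fs a \<in> carrier R"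
    using c a by (auto intro!: horner_closed)
  define f where "f = horner fs a \<oplus> a [^] l"
  have fc: "f \<in> carrier R" using hc a by (simp add: f_def)
  let ?s = "map2 (\<oplus>) (b # r0) (map (\<lambda>x. \<ominus> t \<otimes> x) fs)"
  have len: "length (b # r0) = length (map (\<lambda>x. \<ominus> t \<otimes> x) fs)" using r r0 by (simp add: l_def)
  have sset: "set (map (\<lambda>x. \<ominus> t \<otimes> x) fs) \<subseteq> D" "set (b # r0) \<subseteq> D"
    using c fs subringE(5,6) [OF sD] by auto
  have hs: "horner ?s a = (b \<oplus> a \<otimes> horner r0 a) \<oplus> \<ominus> t \<otimes> horner fs a"
    using c a sset DR by (subst horner_add [OF len]) (auto simp: horner_smult)
  have "horner (b # p) a = b \<oplus> a \<otimes> (horner r0 a \<oplus> t \<otimes> a [^] length r0 \<oplus> n)"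
    using c a by (simp add: r(4) r0 horner_snoc)
  also have "\<dots> = (b \<oplus> a \<otimes> horner r0 a) \<oplus> t \<otimes> a [^] l \<oplus> a \<otimes> n"
    using c hc a r r0 by (simp add: r_distr a_assoc m_lcomm m_comm flip: r(2))
  also have "a [^] l = f \<ominus> horner fs a"
    unfolding f_def using hc a nat_pow_closed [OF a, of l] by algebra
  also have "(b \<oplus> a \<otimes> horner r0 a) \<oplus> t \<otimes> (f \<ominus> horner fs a) \<oplus> a \<otimes> n =
      horner ?s a \<oplus> (t \<otimes> f \<oplus> a \<otimes> n)"
    unfolding hs using c(2,4,8) hc a fc by algebra
  finally have eq: "horner (b # p) a = horner ?s a \<oplus> (t \<otimes> f \<oplus> a \<otimes> n)" .
  have "set ?s \<subseteq> D"
  proof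
    fix y assume "y \<in> set ?s"
    then obtain u v where "(u, v) \<in> set (zip (b # r0) (map (\<lambda>x. \<ominus> t \<otimes> x) fs))" "y = u \<oplus> v" by auto
    then show "y \<in> D"
      using sset subringE(7) [OF sD] by (meson set_zip_leftD set_zip_rightD subsetD)
  qed
  moreover have "length ?s = length fs" using len by simp
  moreover have "t \<otimes> f \<oplus> a \<otimes> n \<in> loewy k \<inter> nils"
    using f r c a by (auto simp: f_def l_def intro!: loewy_add nils_add loewy_mult nils_mult)
  ultimately show ?case using eq by blast
qed


text \<open>Terms whose power of \<open>a\<close> lies in \<open>D\<close> go into d. Terms with nil
  coefficient go into v, because nil elements of \<open>D\<close> lie in \<open>loewy k\<close>. The
  shift by n tracks the exponent while the list is consumed.\<close>

lemma horner_split: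
  assumes sD: "subring D R" and a: "a \<in> carrier R" and DN: "D \<inter> nils \<subseteq> loewy k"
  shows "set r \<subseteq> D \<Longrightarrow> (\<And>i. i < length r \<Longrightarrow> a [^] (n + i) \<in> D \<or> r ! i \<in> nils) \<Longrightarrow>
    \<exists>d\<in>D. \<exists>v\<in>loewy k \<inter> nils. a [^] n \<otimes> horner r a = d \<oplus> v"
proof (induction r arbitrary: n)
  case Nil
  then show ?case
    using subringE(2) [OF sD] a loewy_zero zero_nils by (intro bexI [of _ \<zero>]) auto
next
  case (Cons b r)
  note DR = subringE(1) [OF sD]
  have "a [^] (Suc n + i) \<in> D \<or> r ! i \<in> nils" if "i < length r" for i
    using Cons.prems(2) [of "Suc i"] that by simp
  then obtain d v where dv: "d \<in> D" "v \<in> loewy k \<inter> nils" "a [^] Suc n \<otimes> horner r a = d \<oplus> v"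
    using Cons by (metis insert_subset list.simps(15))
  have c: "b \<in> D" "b \<in> carrier R" "horner r a \<in> carrier R" "d \<in> carrier R" "v \<in> carrier R"
    using Cons.prems dv DR a loewy_carrier by (auto intro!: horner_closed)
  have p: "a [^] n \<in> carrier R" using a by simp
  have "a [^] n \<otimes> horner (b # r) a = a [^] n \<otimes> b \<oplus> a [^] Suc n \<otimes> horner r a"
    using c a p by (simp add: r_distr m_assoc)
  then have eq: "a [^] n \<otimes> horner (b # r) a = a [^] n \<otimes> b \<oplus> (d \<oplus> v)"
    by (simp only: dv(3))
  show ?case
  proof (cases "b \<in> nils")
    case True
    then have "a [^] n \<otimes> b \<oplus> v \<in> loewy k \<inter> nils"
      using c dv DN p by (auto intro!: loewy_add nils_add loewy_mult nils_mult)
    moreover have "a [^] n \<otimes> b \<oplus> (d \<oplus> v) = d \<oplus> (a [^] n \<otimes> b \<oplus> v)"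
      using c p by algebra
    ultimately show ?thesis using eq dv by metis
  next
    case False
    then have "a [^] n \<otimes> b \<oplus> d \<in> D"
      using Cons.prems(2) [of 0] c dv subringE(6,7) [OF sD] by auto
    moreover have "a [^] n \<otimes> b \<oplus> (d \<oplus> v) = (a [^] n \<otimes> b \<oplus> d) \<oplus> v"
      using c p by algebra
    ultimately show ?thesis using eq dv by metis
  qed
qed

lemma horner_nils_cong:
  assumes "set p \<subseteq> carrier R" "a \<in> carrier R" "b \<in> carrier R" "a \<ominus> b \<in> nils"
  shows "horner p a \<ominus> horner p b \<in> nils"
  using assms(1)
proof (induction p)
  case Nil
  then show ?case using zero_nils by (simp add: minus_eq)
next
  case (Cons c p)
  have h: "c \<in> carrier R" "horner p a \<in> carrier R" "horner p b \<in> carrier R"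
    using Cons.prems assms by (auto intro!: horner_closed)
  then have "horner (c # p) a \<ominus> horner (c # p) b =
      a \<otimes> (horner p a \<ominus> horner p b) \<oplus> (a \<ominus> b) \<otimes> horner p b"
    unfolding horner.simps using assms(2,3) by algebra
  then show ?case using Cons h assms by (simp add: nils_add nils_mult nils_mult')
qed

text \<open>Hensel's lemma, unless the derivative vanishes at the root; then the minimal polynomial is
  a polynomial in the \<open>p\<close>-th power, whose value already lies in \<open>D\<close>.\<close>

lemma lift_root:
  assumes B: "coeff_subring (Suc k) B" and D: "subring_lift k B D"
    and max: "\<And>D'. subring_lift k B D' \<Longrightarrow> D \<subseteq> D' \<Longrightarrow> D' = D"
    and a: "a \<in> B" and fs: "set fs \<subseteq> D" "horner fs a \<oplus> a [^] length fs \<in> nils"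
    and no: "\<And>gs. set gs \<subseteq> D \<Longrightarrow> length gs < length fs \<Longrightarrow> horner gs a \<oplus> a [^] length gs \<notin> nils"
  shows "\<exists>b\<in>B. a \<ominus> b \<in> nils \<and> horner fs b \<oplus> b [^] length fs \<in> loewy k \<inter> nils"
proof -
  have sD: "subring D R" and DB: "D \<subseteq> B" and DN: "D \<inter> nils \<subseteq> loewy k"
    and T: "\<And>p b. prime (p::nat) \<Longrightarrow> [p] \<cdot> \<one> = \<zero> \<Longrightarrow> b \<in> B \<Longrightarrow> b [^] p \<in> D"
    using D by (simp_all add: subring_lift_def)
  have sB: "subring B R" and Binv: "\<And>b. b \<in> B \<Longrightarrow> b \<in> Units R \<Longrightarrow> inv b \<in> B"
    and BN: "B \<inter> nils \<subseteq> loewy (Suc k)"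
    using B by (simp_all add: coeff_subring_def)
  note DR = subringE(1) [OF sD] and BR = subringE(1) [OF sB]
  have ac: "a \<in> carrier R" using a BR by blast
  have powB: "b [^] n \<in> B" if "b \<in> B" for b and n :: nat
    using that subringE(3,6) [OF sB] by (induction n) auto
  have hornB: "horner p b \<in> B" if "set p \<subseteq> B" "b \<in> B" for p b
    using that subringE(2,6,7) [OF sB] by (induction p) auto
  define F where "F = fs @ [\<one>]"
  have F: "set F \<subseteq> D" "length F = Suc (length fs)" "set F \<subseteq> carrier R"
    using fs subringE(3) [OF sD] DR by (auto simp: F_def)
  have hF: "horner F b = horner fs b \<oplus> b [^] length fs" if "b \<in> carrier R" for b
    using that fs DR by (simp add: F_def horner_snoc)
  have FB: "horner F a \<in> B" using hornB F DB a by blast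
  have Fn: "horner F a \<in> nils" using fs(2) hF ac by simp
  obtain f0 F' where F': "F = f0 # F'" using F(2) by (cases F) auto
  have len: "length F' = length fs" using F(2) F' by simp
  have Fc: "f0 \<in> carrier R" "set F' \<subseteq> carrier R" "set F' \<subseteq> D" using F F' by auto
  let ?d = "horner_deriv F a"
  have derB: "set (deriv_coeffs n p) \<subseteq> D" if "set p \<subseteq> D" for n p
  proof -
    have "[m] \<cdot> b \<in> D" if "b \<in> D" for b and m :: nat
      using that subringE(2,7) [OF sD] by (induction m) auto
    then show ?thesis using that by (induction p arbitrary: n) auto
  qed
  have deq: "?d = horner (deriv_coeffs 1 F') a"
    unfolding F' using Fc ac by (intro horner_deriv_Cons)
  have dB: "?d \<in> B" unfolding deq using hornB derB [OF Fc(3)] DB a by blast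
  have dc: "?d \<in> carrier R" using dB BR by blast
  show ?thesis
  proof (cases "?d \<in> nils")
    case False
    then have u: "?d \<in> Units R" using dc by (simp add: nils_iff)
    define v where "v = inv ?d"
    have v: "v \<in> B" "v \<in> carrier R" "?d \<otimes> v = \<one>"
      using u dB Binv by (simp_all add: v_def)
    \<comment> \<open>The Newton correction: the constant and linear terms of the expansion cancel,
      and only a multiple of h h remains.\<close>
    define h where "h = \<ominus> (horner F a \<otimes> v)"
    have Fac: "horner F a \<in> carrier R" using FB BR by blast
    have hB: "h \<in> B" and hn: "h \<in> nils"
      unfolding h_def using FB v Fn subringE(5,6) [OF sB] by (auto intro!: nils_uminus nils_mult')
    have hc: "h \<in> carrier R" using hB BR by blast
    obtain e where e: "e \<in> carrier R"
      "horner F (a \<oplus> h) = horner F a \<oplus> h \<otimes> ?d \<oplus> (h \<otimes> h) \<otimes> e"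
      using horner_newton [OF F(3) ac hc] by blast
    have "h \<otimes> ?d = \<ominus> (horner F a \<otimes> (?d \<otimes> v))"
      unfolding h_def using Fac v(2) dc by algebra
    then have "horner F (a \<oplus> h) = (h \<otimes> h) \<otimes> e"
      using e Fac v hc by (simp add: r_neg)
    moreover have "(h \<otimes> h) \<otimes> e \<in> loewy k"
      using loewy_sq hn hB BN e by blast
    moreover have "(h \<otimes> h) \<otimes> e \<in> nils"
      using hn hc e by (intro nils_mult' nils_mult) auto
    ultimately have "horner fs (a \<oplus> h) \<oplus> (a \<oplus> h) [^] length fs \<in> loewy k \<inter> nils"
      using hF [of "a \<oplus> h"] ac hc by simp
    moreover have "a \<ominus> (a \<oplus> h) = \<ominus> h" using ac hc by algebra
    then have "a \<ominus> (a \<oplus> h) \<in> nils" using hn nils_uminus by simp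
    moreover have "a \<oplus> h \<in> B" using a hB subringE(7) [OF sB] by simp
    ultimately show ?thesis by blast
  next
    case True
    have Dinv: "inv d \<in> D" if "d \<in> D" "d \<in> Units R" for d
      using subring_lift_inv [OF B D max that] .
    \<comment> \<open>The derivative has degree below \<open>length fs\<close>, and by
      \<open>no\<close> this is the least degree of a monic polynomial over \<open>D\<close> with
      nil value at \<open>a\<close>. A nil value of the derivative therefore forces all its
      coefficients to be nil.\<close>
    have nils: "set (deriv_coeffs 1 F') \<subseteq> nils"
      by (rule low_degree_coeffs [where d = "length fs", OF sD Dinv ac no])
        (use True deq derB [OF Fc(3)] len in auto)
    \<comment> \<open>The product of i with the i-th coefficient is nil. Either i is invertible and
      the coefficient is nil, or i vanishes in the ring; then i is a multiple of the characteristic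
      p, and the i-th power of \<open>a\<close> is a p-th power of an element of
      \<open>B\<close>.\<close>
    have coeff: "a [^] i \<in> D \<or> F ! i \<in> nils" if i: "i < length F" for i
    proof (cases i)
      case 0
      then show ?thesis using subringE(3) [OF sD] by simp
    next
      case (Suc j)
      have j: "j < length F'" using i F' Suc by simp
      have "[(1 + j)] \<cdot> (F' ! j) \<in> nils"
        using nils j nth_mem [of j "deriv_coeffs 1 F'"] unfolding nth_deriv_coeffs [OF j, of 1, symmetric]
        by (metis length_deriv_coeffs subsetD)
      moreover have Fj: "F' ! j \<in> carrier R" using Fc(2) j nth_mem by blast
      moreover have "[(1 + j)] \<cdot> (F' ! j) = [(1 + j)] \<cdot> \<one> \<otimes> F' ! j"
        using Fj by (subst add_pow_ldistr) auto
      ultimately have n1: "[(1 + j)] \<cdot> \<one> \<otimes> F' ! j \<in> nils" by simp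
      show ?thesis
      proof (cases "[(1 + j)] \<cdot> \<one> = \<zero>")
        case False
        then have w: "[(1 + j)] \<cdot> \<one> \<in> Units R" using nat_zero_or_unit by blast
        then have "inv ([(1 + j)] \<cdot> \<one>) \<otimes> ([(1 + j)] \<cdot> \<one> \<otimes> F' ! j) \<in> nils"
          using n1 nils_mult Units_inv_closed by blast
        moreover have "inv ([(1 + j)] \<cdot> \<one>) \<otimes> ([(1 + j)] \<cdot> \<one> \<otimes> F' ! j) = F' ! j"
          using w Fj by (subst m_assoc [symmetric]) (auto simp del: add.nat_pow_Suc)
        ultimately show ?thesis using F' Suc by simp
      next
        case True
        then obtain p where p: "prime p" "p dvd 1 + j" "[p] \<cdot> \<one> = \<zero>"
          using char_prime [OF one_nz nat_zero_or_unit, of "1 + j"] by auto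
        then obtain q where "i = q * p" using Suc by (metis dvdE mult.commute plus_1_eq_Suc)
        then have "a [^] i = (a [^] q) [^] p" using ac by (simp add: nat_pow_pow)
        then show ?thesis using T [OF p(1,3)] powB a by simp
      qed
    qed
    \<comment> \<open>The value at \<open>a\<close> is thus an element of \<open>D\<close> up to an
      error in \<open>loewy k\<close>. That element is nil, so it lies in \<open>loewy k\<close> as
      well, and \<open>a\<close> itself is the lifted root.\<close>
    have "\<exists>d\<in>D. \<exists>v\<in>loewy k \<inter> nils. a [^] (0::nat) \<otimes> horner F a = d \<oplus> v"
      by (rule horner_split [OF sD ac DN]) (use F coeff in auto)
    then obtain d v where dv: "d \<in> D" "v \<in> loewy k" "v \<in> nils" "horner F a = d \<oplus> v"
      using ac FB BR by auto
    have c: "d \<in> carrier R" "v \<in> carrier R" using dv DR loewy_carrier by auto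
    have "d = horner F a \<ominus> v" unfolding dv(4) using c by algebra
    then have "d \<in> nils" using Fn dv(3) nils_minus by metis
    then have "horner F a \<in> loewy k" using dv DN loewy_add by auto
    moreover have "a \<ominus> a \<in> nils" using zero_nils ac by (simp add: minus_eq r_neg)
    ultimately show ?thesis using a Fn hF ac by auto
  qed
qed

text \<open>A maximal candidate \<open>D\<close> represents every residue class. If \<open>a\<close>
  is transcendental over \<open>D\<close> modulo \<open>nils\<close>, then \<open>a\<close> itself
  can be adjoined. If it is algebraic, it is first moved within its class to a root, up to
  \<open>loewy k\<close>, of a monic polynomial of least degree, and that root can be
  adjoined.\<close>

lemma coeff_subring_step:
  assumes B: "coeff_subring (Suc k) B"
  shows "\<exists>D. coeff_subring k D"
proof -
  obtain D where D: "subring_lift k B D" and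
    max: "\<And>D'. subring_lift k B D' \<Longrightarrow> D \<subseteq> D' \<Longrightarrow> D' = D"
    using subring_lift_maximal [OF B] by metis
  have sD: "subring D R" and DB: "D \<subseteq> B" and DN: "D \<inter> nils \<subseteq> loewy k"
    using D by (simp_all add: subring_lift_def)
  have sB: "subring B R" and Bn: "\<And>a. a \<in> carrier R \<Longrightarrow> \<exists>b\<in>B. a \<ominus> b \<in> nils"
    using B by (simp_all add: coeff_subring_def)
  note DR = subringE(1) [OF sD] and BR = subringE(1) [OF sB]
  have Dinv: "inv d \<in> D" if "d \<in> D" "d \<in> Units R" for d
    using subring_lift_inv [OF B D max that] .
  have setloewy: "horner p b \<in> loewy k" if "set p \<subseteq> D" "set p \<subseteq> nils" "b \<in> carrier R" for p b
    using that DN by (induction p) (auto intro!: loewy_zero loewy_add loewy_mult)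
  have main: "\<exists>d\<in>D. a \<ominus> d \<in> nils" if a: "a \<in> B" for a
  proof (cases "\<exists>fs. set fs \<subseteq> D \<and> horner fs a \<oplus> a [^] length fs \<in> nils")
    case False
    have ac: "a \<in> carrier R" using a BR by blast
    have "a \<in> D"
    proof (rule subring_lift_adjoin [OF B D max a])
      fix p assume p: "set p \<subseteq> D" "horner p a \<in> nils"
      have "set p \<subseteq> nils"
        by (rule low_degree_coeffs [where d = "length p", OF sD Dinv ac]) (use False p in auto)
      then show "horner p a \<in> loewy k" using setloewy p ac by blast
    qed
    then show ?thesis using zero_nils ac by (intro bexI [of _ a]) (auto simp: minus_eq r_neg)
  next
    case True
    have ac: "a \<in> carrier R" using a BR by blast
    define P where "P n \<longleftrightarrow> (\<exists>fs. set fs \<subseteq> D \<and> length fs = n \<and> horner fs a \<oplus> a [^] length fs \<in> nils)" for n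
    have "\<exists>n. P n" using True by (auto simp: P_def)
    then have "P (LEAST n. P n)" by (rule LeastI_ex)
    then obtain fs where fs: "set fs \<subseteq> D" "length fs = (LEAST n. P n)"
      "horner fs a \<oplus> a [^] length fs \<in> nils" unfolding P_def by blast
    have no: "horner gs a \<oplus> a [^] length gs \<notin> nils"
      if "set gs \<subseteq> D" "length gs < length fs" for gs
    proof
      assume "horner gs a \<oplus> a [^] length gs \<in> nils"
      then have "P (length gs)" using that by (auto simp: P_def)
      then show False using that fs(2) not_less_Least by metis
    qed
    have "fs \<noteq> []"
    proof
      assume "fs = []"
      then have "\<one> \<in> nils" using fs(3) by simp
      then show False using nils_not_unit by blast
    qed
    obtain b where b: "b \<in> B" "a \<ominus> b \<in> nils" "horner fs b \<oplus> b [^] length fs \<in> loewy k \<inter> nils"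
      using lift_root [OF B D max a fs(1,3) no] by blast
    have bc: "b \<in> carrier R" using b BR by blast
    have "b \<in> D"
    proof (rule subring_lift_adjoin [OF B D max b(1)])
      \<comment> \<open>Division by the monic polynomial leaves a remainder of smaller degree. Its
        value at \<open>b\<close>, hence also at the congruent point \<open>a\<close>, is nil, so
        minimality of the degree makes its coefficients nil.\<close>
      fix p assume p: "set p \<subseteq> D" "horner p b \<in> nils"
      obtain r n where r: "set r \<subseteq> D" "length r = length fs" "n \<in> loewy k" "n \<in> nils"
        "horner p b = horner r b \<oplus> n"
        using horner_reduce [OF sD bc fs(1) \<open>fs \<noteq> []\<close> b(3) p(1)] by auto
      have rc: "set r \<subseteq> carrier R" using r DR by blast
      have c: "horner r a \<in> carrier R" "horner r b \<in> carrier R" "n \<in> carrier R"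
        using rc ac bc r nils_carrier by (auto intro!: horner_closed)
      have "horner r b = horner p b \<ominus> n" unfolding r(5) using c by algebra
      then have "horner r b \<in> nils" using p(2) r(4) nils_minus by metis
      moreover have "horner r a \<ominus> horner r b \<in> nils" using horner_nils_cong [OF rc ac bc b(2)] .
      moreover have "horner r a = (horner r a \<ominus> horner r b) \<oplus> horner r b" using c by algebra
      ultimately have "horner r a \<in> nils" using nils_add by metis
      then have "set r \<subseteq> nils"
        by (intro low_degree_coeffs [where d = "length fs", OF sD Dinv ac no]) (use r in auto)
      then show "horner p b \<in> loewy k" unfolding r(5) using setloewy r bc loewy_add by blast
    qed
    then show ?thesis using b by blast
  qed
  have "\<exists>d\<in>D. a \<ominus> d \<in> nils" if a: "a \<in> carrier R" for a
  proof -
    obtain b where b: "b \<in> B" "a \<ominus> b \<in> nils" using Bn a by blast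
    then obtain d where d: "d \<in> D" "b \<ominus> d \<in> nils" using main by blast
    have c: "b \<in> carrier R" "d \<in> carrier R" using b d BR DR by auto
    have "a \<ominus> d = (a \<ominus> b) \<oplus> (b \<ominus> d)" using a c by algebra
    then show ?thesis using b d nils_add by metis
  qed
  then show ?thesis using sD Dinv DN unfolding coeff_subring_def by blast
qed

text \<open>The descent starts with the whole ring at level \<open>n\<close> and reaches level 0,
  where zero is the only nil element of the subring. All other elements are then units whose
  inverses belong to the subring.\<close>

theorem coefficient_field_exists:
  assumes "loewy n = carrier R"
  shows "\<exists>L. subfield L R \<and> (\<forall>a\<in>carrier R. \<exists>l\<in>L. a \<ominus> l \<in> nils)"
proof -
  have "coeff_subring n (carrier R)"
    using assms carrier_is_subring zero_nils
    by (auto simp: coeff_subring_def nils_carrier minus_eq r_neg intro!: bexI)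
  moreover have "\<exists>D. coeff_subring 0 D" if "coeff_subring n B" for n B
    using that by (induction n arbitrary: B) (blast dest: coeff_subring_step)+
  ultimately obtain L where L: "coeff_subring 0 L" by blast
  then have sL: "subring L R" by (simp add: coeff_subring_def)
  note LR = subringE(1) [OF sL]
  have linv: "l \<in> Units R" "inv l \<in> L" if "l \<in> L - {\<zero>}" for l
  proof -
    show "l \<in> Units R" using that L LR nils_iff [of l] by (auto simp: coeff_subring_def)
    then show "inv l \<in> L" using that L by (auto simp: coeff_subring_def)
  qed
  have "Units (R\<lparr>carrier := L\<rparr>) = L - {\<zero>}"
  proof
    show "Units (R\<lparr>carrier := L\<rparr>) \<subseteq> L - {\<zero>}"
      using one_nz LR by (auto simp: Units_def)
    show "L - {\<zero>} \<subseteq> Units (R\<lparr>carrier := L\<rparr>)"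
    proof
      fix l assume l: "l \<in> L - {\<zero>}"
      then have "inv l \<otimes> l = \<one>" "l \<otimes> inv l = \<one>" using linv by auto
      then show "l \<in> Units (R\<lparr>carrier := L\<rparr>)" using linv(2) [OF l] l by (auto simp: Units_def)
    qed
  qed
  moreover have "subcring L R"
    using subcringI [OF sL] m_comm LR by auto
  ultimately have "subfield L R" by (intro subfieldI)
  then show ?thesis using L by (auto simp: coeff_subring_def)
qed

end

section \<open>Representability over a local central subring\<close>

context ring
begin

lemma finsum_subring:
  assumes S: "subring S R" and fin: "finite A" and f: "f \<in> A \<rightarrow> S"
  shows "finsum (R\<lparr>carrier := S\<rparr>) f A = finsum R f A"
proof -
  interpret S: ring "R\<lparr>carrier := S\<rparr>" by (rule subring_is_ring [OF S])
  show ?thesis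
    using fin f
  proof (induction A)
    case empty
    have "finsum (R\<lparr>carrier := S\<rparr>) f {} = \<zero>\<^bsub>R\<lparr>carrier := S\<rparr>\<^esub>" by (rule S.finsum_empty)
    then show ?case by simp
  next
    case (insert a A)
    have "f \<in> A \<rightarrow> carrier R" "f a \<in> carrier R" using insert.prems subringE(1) [OF S] by auto
    moreover have "finsum (R\<lparr>carrier := S\<rparr>) f (insert a A) = f a \<oplus> finsum (R\<lparr>carrier := S\<rparr>) f A"
      using insert by (subst S.finsum_insert) auto
    ultimately show ?case using insert by simp
  qed
qed

lemma combine_eq_finsum:
  assumes "length Ks = length Us" "set Ks \<subseteq> carrier R" "set Us \<subseteq> carrier R"
  shows "combine Ks Us = (\<Oplus>i\<in>{..<length Us}. Ks ! i \<otimes> Us ! i)"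
  using assms
proof (induction Ks Us rule: list_induct2)
  case (Cons k Ks u Us)
  let ?f = "\<lambda>i. (k # Ks) ! i \<otimes> (u # Us) ! i"
  have c: "?f i \<in> carrier R" if "i < Suc (length Us)" for i
    using Cons.hyps Cons.prems that by (cases i) (auto intro!: m_closed subsetD [OF _ nth_mem])
  have "(\<Oplus>i\<in>{..<length (u # Us)}. ?f i) = (\<Oplus>i\<in>insert 0 (Suc ` {..<length Us}). ?f i)"
    by (simp add: lessThan_Suc_eq_insert_0)
  also have "\<dots> = ?f 0 \<oplus> (\<Oplus>i\<in>Suc ` {..<length Us}. ?f i)"
    using c Cons.prems by (subst finsum_insert) auto
  also have "(\<Oplus>i\<in>Suc ` {..<length Us}. ?f i) = (\<Oplus>i\<in>{..<length Us}. ?f (Suc i))"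
    using c by (subst finsum_reindex) auto
  finally show ?case using Cons by simp
qed simp

text \<open>Left multiplication written in a basis v over \<open>K\<close>: column j of the matrix
  of x holds the coordinates of x v_j. Centrality of \<open>K\<close> makes this multiplication
  \<open>K\<close>-linear.\<close>

lemma regular_representation:
  assumes K: "subfield K R" and cent: "K \<subseteq> ring_center R" and nz: "\<one> \<noteq> \<zero>"
    and Us: "set Us \<subseteq> carrier R" "Span K Us = carrier R"
  shows "\<exists>n \<phi>. n \<ge> 1 \<and> \<phi> \<in> ring_hom R (matrix_ring (R\<lparr>carrier := K\<rparr>) n) \<and> inj_on \<phi> (carrier R)"
proof -
  note KR = subfieldE(3) [OF K] and sK = subfieldE(1) [OF K]
  obtain Vs where Vs: "set Vs \<subseteq> carrier R" "independent K Vs" "Span K Vs = carrier R"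
    using filter_base [OF K Us(1)] Us(2) by metis
  define n where "n = length Vs"
  have "n \<noteq> 0" using Vs nz by (auto simp: n_def)
  define v where "v i = Vs ! i" for i
  have v: "v i \<in> carrier R" if "i < n" for i using that Vs by (auto simp: v_def n_def)
  have comm: "k \<otimes> x = x \<otimes> k" if "k \<in> K" "x \<in> carrier R" for k x
    using cent that by (auto simp: ring_center_def)
  have comb: "combine (map g [0..<n]) Vs = (\<Oplus>i\<in>{..<n}. g i \<otimes> v i)" if "g \<in> {..<n} \<rightarrow> K" for g
    using that Vs KR by (subst combine_eq_finsum)
      (auto simp: n_def v_def intro!: finsum_cong' m_closed subsetD [OF _ nth_mem])
  define P where "P x g \<longleftrightarrow> g \<in> {..<n} \<rightarrow> K \<and> x = (\<Oplus>i\<in>{..<n}. g i \<otimes> v i)" for x and g :: "nat \<Rightarrow> 'a"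
  have ex: "\<exists>g. P x g" if x: "x \<in> carrier R" for x
  proof -
    obtain Ks where Ks: "set Ks \<subseteq> K" "length Ks = n" "x = combine Ks Vs"
      using Span_mem_iff_length_version [OF K Vs(1), of x] x unfolding Vs(3) n_def by blast
    then have "map ((!) Ks) [0..<n] = Ks" by (metis map_nth)
    moreover have g: "(!) Ks \<in> {..<n} \<rightarrow> K" using Ks by (auto intro: subsetD [OF _ nth_mem])
    ultimately show ?thesis
      using Ks comb [OF g] unfolding P_def by metis
  qed
  have uniq: "g i = h i" if "P x g" "P x h" "i < n" for x g h i
  proof -
    have gh: "g \<in> {..<n} \<rightarrow> K" "h \<in> {..<n} \<rightarrow> K" using that by (auto simp: P_def)
    have xg: "x = combine (map g [0..<n]) Vs" "x = combine (map h [0..<n]) Vs"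
      using that comb by (auto simp: P_def)
    moreover have "x \<in> Span K Vs"
      using that gh v KR unfolding Vs(3) P_def by (auto intro!: finsum_closed)
    ultimately have "\<exists>!Ks. set Ks \<subseteq> K \<and> length Ks = length Vs \<and> x = combine Ks Vs"
      by (intro unique_decomposition [OF K Vs(2)])
    moreover have "set (map f [0..<n]) \<subseteq> K \<and> length (map f [0..<n]) = length Vs"
      if "f \<in> {..<n} \<rightarrow> K" for f
      using that by (auto simp: n_def)
    ultimately have "map g [0..<n] = map h [0..<n]"
      using gh xg by blast
    then have "map g [0..<n] ! i = map h [0..<n] ! i" by (rule arg_cong)
    then show ?thesis using that(3) by simp
  qed
  define cf where "cf x = (SOME g. P x g)" for x
  have cf: "P x (cf x)" if "x \<in> carrier R" for x
    unfolding cf_def using someI_ex [OF ex [OF that]] .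
  have cfK: "cf x i \<in> K" "cf x i \<in> carrier R" if "x \<in> carrier R" "i < n" for x i
    using cf that KR by (auto simp: P_def Pi_def)
  have cfsum: "(\<Oplus>i\<in>{..<n}. cf x i \<otimes> v i) = x" if "x \<in> carrier R" for x
    using cf that by (simp add: P_def)
  have cfI: "cf x i = g i" if "P x g" "x \<in> carrier R" "i < n" for x g i
    using uniq [OF cf that(1)] that by blast
  have add: "cf (x \<oplus> y) i = cf x i \<oplus> cf y i" if "x \<in> carrier R" "y \<in> carrier R" "i < n" for x y i
  proof (rule cfI)
    have "(\<Oplus>i\<in>{..<n}. (cf x i \<oplus> cf y i) \<otimes> v i) = (\<Oplus>i\<in>{..<n}. cf x i \<otimes> v i \<oplus> cf y i \<otimes> v i)"
      using that cfK v by (intro finsum_cong') (auto simp: l_distr)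
    also have "\<dots> = x \<oplus> y"
      using that cfK v by (subst finsum_addf) (auto simp: cfsum)
    finally show "P (x \<oplus> y) (\<lambda>i. cf x i \<oplus> cf y i)"
      using that cfK subringE(7) [OF sK] by (auto simp: P_def)
  qed (use that in auto)
  define \<phi> where "\<phi> x = (\<lambda>(i, j)\<in>{..<n} \<times> {..<n}. cf (x \<otimes> v j) i)" for x
  have mult: "cf ((x \<otimes> y) \<otimes> v j) i = (\<Oplus>k\<in>{..<n}. cf (x \<otimes> v k) i \<otimes> cf (y \<otimes> v j) k)"
    if "x \<in> carrier R" "y \<in> carrier R" "i < n" "j < n" for x y i j
  proof (rule cfI)
    define a where "a k = cf (y \<otimes> v j) k" for k
    define b where "b k i = cf (x \<otimes> v k) i" for k i
    have ab: "a k \<in> K" "a k \<in> carrier R" "b k i \<in> K" "b k i \<in> carrier R" if "k < n" "i < n" for k i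
      using that cfK \<open>x \<in> _\<close> \<open>y \<in> _\<close> \<open>j < n\<close> v by (auto simp: a_def b_def)
    have "(x \<otimes> y) \<otimes> v j = x \<otimes> (\<Oplus>k\<in>{..<n}. a k \<otimes> v k)"
      using that v cfsum [of "y \<otimes> v j"] by (simp add: m_assoc a_def)
    also have "\<dots> = (\<Oplus>k\<in>{..<n}. x \<otimes> (a k \<otimes> v k))"
      using that v ab by (intro finsum_rdistr) auto
    also have "\<dots> = (\<Oplus>k\<in>{..<n}. a k \<otimes> (x \<otimes> v k))"
      using that v ab comm by (intro finsum_cong') (auto simp flip: m_assoc)
    also have "\<dots> = (\<Oplus>k\<in>{..<n}. a k \<otimes> (\<Oplus>i\<in>{..<n}. b k i \<otimes> v i))"
      using that v ab cfsum by (intro finsum_cong') (auto simp: b_def)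
    also have "\<dots> = (\<Oplus>k\<in>{..<n}. \<Oplus>i\<in>{..<n}. a k \<otimes> (b k i \<otimes> v i))"
      using that v ab by (intro finsum_cong' finsum_rdistr) (auto intro!: finsum_closed)
    also have "\<dots> = (\<Oplus>i\<in>{..<n}. \<Oplus>k\<in>{..<n}. a k \<otimes> (b k i \<otimes> v i))"
      using that v ab by (intro finsum_swap) auto
    also have "\<dots> = (\<Oplus>i\<in>{..<n}. \<Oplus>k\<in>{..<n}. (b k i \<otimes> a k) \<otimes> v i)"
    proof (intro finsum_cong' refl)
      fix i k assume "i \<in> {..<n}" "k \<in> {..<n}"
      then show "a k \<otimes> (b k i \<otimes> v i) = (b k i \<otimes> a k) \<otimes> v i"
        using ab v comm [of "a k" "b k i"] by (simp add: m_assoc [symmetric])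
    qed (use ab v in \<open>auto intro!: finsum_closed\<close>)
    also have "\<dots> = (\<Oplus>i\<in>{..<n}. (\<Oplus>k\<in>{..<n}. b k i \<otimes> a k) \<otimes> v i)"
      using that v ab by (intro finsum_cong' finsum_ldistr [symmetric]) (auto intro!: finsum_closed)
    finally have eq: "(x \<otimes> y) \<otimes> v j = (\<Oplus>i\<in>{..<n}. (\<Oplus>k\<in>{..<n}. b k i \<otimes> a k) \<otimes> v i)" .
    have "(\<Oplus>k\<in>{..<n}. b k i \<otimes> a k) \<in> K" if "i < n" for i
    proof -
      interpret S: ring "R\<lparr>carrier := K\<rparr>" by (rule subring_is_ring [OF sK])
      have "(\<lambda>k. b k i \<otimes> a k) \<in> {..<n} \<rightarrow> K" using ab that subringE(6) [OF sK] by auto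
      then show ?thesis
        using finsum_subring [OF sK, of "{..<n}"] S.finsum_closed [of "\<lambda>k. b k i \<otimes> a k" "{..<n}"] by simp
    qed
    then show "P (x \<otimes> y \<otimes> v j) (\<lambda>i. \<Oplus>k\<in>{..<n}. cf (x \<otimes> v k) i \<otimes> cf (y \<otimes> v j) k)"
      using eq by (auto simp: P_def a_def b_def)
  qed (use that v in auto)
  have one: "cf (\<one> \<otimes> v j) i = (if i = j then \<one> else \<zero>)" if "i < n" "j < n" for i j
  proof (rule cfI)
    have "(\<Oplus>i\<in>{..<n}. (if i = j then \<one> else \<zero>) \<otimes> v i) = (\<Oplus>i\<in>{..<n}. if j = i then v i else \<zero>)"
      using v by (intro finsum_cong') auto
    also have "\<dots> = v j" using that v by (intro finsum_singleton) auto
    finally show "P (\<one> \<otimes> v j) (\<lambda>i. if i = j then \<one> else \<zero>)"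
      using that v subringE(2,3) [OF sK] by (auto simp: P_def)
  qed (use that v in auto)
  have hom: "\<phi> \<in> ring_hom R (matrix_ring (R\<lparr>carrier := K\<rparr>) n)"
  proof (rule ring_hom_memI)
    fix x assume "x \<in> carrier R"
    then show "\<phi> x \<in> carrier (matrix_ring (R\<lparr>carrier := K\<rparr>) n)"
      using cfK v by (auto simp: matrix_ring_def \<phi>_def)
  next
    fix x y assume xy: "x \<in> carrier R" "y \<in> carrier R"
    have "finsum (R\<lparr>carrier := K\<rparr>) (\<lambda>k. \<phi> x (i, k) \<otimes> \<phi> y (k, j)) {..<n} = cf (x \<otimes> y \<otimes> v j) i"
      if ij: "i < n" "j < n" for i j
    proof -
      have "finsum (R\<lparr>carrier := K\<rparr>) (\<lambda>k. \<phi> x (i, k) \<otimes> \<phi> y (k, j)) {..<n} =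
          (\<Oplus>k\<in>{..<n}. \<phi> x (i, k) \<otimes> \<phi> y (k, j))"
        using ij xy cfK v subringE(6) [OF sK] by (intro finsum_subring [OF sK]) (auto simp: \<phi>_def)
      also have "\<dots> = (\<Oplus>k\<in>{..<n}. cf (x \<otimes> v k) i \<otimes> cf (y \<otimes> v j) k)"
        using ij xy cfK v by (intro finsum_cong') (auto simp: \<phi>_def)
      finally show ?thesis using mult ij xy by simp
    qed
    then show "\<phi> (x \<otimes> y) = \<phi> x \<otimes>\<^bsub>matrix_ring (R\<lparr>carrier := K\<rparr>) n\<^esub> \<phi> y"
      unfolding \<phi>_def [of "x \<otimes> y"] by (auto simp: matrix_ring_def)
    show "\<phi> (x \<oplus> y) = \<phi> x \<oplus>\<^bsub>matrix_ring (R\<lparr>carrier := K\<rparr>) n\<^esub> \<phi> y"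
      using xy v by (auto simp: matrix_ring_def \<phi>_def l_distr add)
  next
    show "\<phi> \<one> = \<one>\<^bsub>matrix_ring (R\<lparr>carrier := K\<rparr>) n\<^esub>"
      using one unfolding \<phi>_def by (auto simp: matrix_ring_def)
  qed
  \<comment> \<open>An element x is recovered from the products x v_j, because 1 is a combination of
    the v_j with central coefficients.\<close>
  have inj: "inj_on \<phi> (carrier R)"
  proof (rule inj_onI)
    fix x y assume xy: "x \<in> carrier R" "y \<in> carrier R" and eq: "\<phi> x = \<phi> y"
    have xv: "x \<otimes> v j = y \<otimes> v j" if "j < n" for j
    proof -
      have "cf (x \<otimes> v j) i = cf (y \<otimes> v j) i" if "i < n" for i
        using fun_cong [OF eq, of "(i, j)"] that \<open>j < n\<close> by (simp add: \<phi>_def)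
      then have "(\<Oplus>i\<in>{..<n}. cf (x \<otimes> v j) i \<otimes> v i) = (\<Oplus>i\<in>{..<n}. cf (y \<otimes> v j) i \<otimes> v i)"
        using xy v cfK that by (intro finsum_cong') auto
      then show ?thesis using cfsum xy v that by simp
    qed
    have swap: "w \<otimes> (cf \<one> i \<otimes> v i) = cf \<one> i \<otimes> (w \<otimes> v i)" if "w \<in> carrier R" "i < n" for w i
      using that cfK [of \<one> i] v comm [of "cf \<one> i" w] by (simp add: m_assoc [symmetric])
    have "x = x \<otimes> (\<Oplus>i\<in>{..<n}. cf \<one> i \<otimes> v i)" using cfsum [of \<one>] xy by simp
    also have "\<dots> = (\<Oplus>i\<in>{..<n}. x \<otimes> (cf \<one> i \<otimes> v i))"
      using xy v cfK by (intro finsum_rdistr) auto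
    also have "\<dots> = (\<Oplus>i\<in>{..<n}. y \<otimes> (cf \<one> i \<otimes> v i))"
      using xy v cfK swap xv by (intro finsum_cong') auto
    also have "\<dots> = y \<otimes> (\<Oplus>i\<in>{..<n}. cf \<one> i \<otimes> v i)"
      using xy v cfK by (intro finsum_rdistr [symmetric]) auto
    also have "\<dots> = y" using cfsum [of \<one>] xy by simp
    finally show "x = y" .
  qed
  show ?thesis using hom inj \<open>n \<noteq> 0\<close> by (intro exI [of _ n] exI [of _ \<phi>]) auto
qed

end

section \<open>From the chain condition over a local central subring to a finite-dimensional
  algebra\<close>

context ring
begin

text \<open>Saturation with respect to \<open>\<one>\<close> is automatic, so the chain condition
  concerns all \<open>A\<close>-submodules. It is used twice: it makes the maximal ideal of
  \<open>A\<close> nilpotent, which provides a coefficient field, and it makes \<open>R\<close>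
  finite-dimensional over that field.\<close>

theorem central_local_representable:
  assumes sA: "subring A R" and cent: "A \<subseteq> ring_center R" and nz: "\<one> \<noteq> \<zero>"
    and dich: "\<And>a. a \<in> A \<Longrightarrow> (\<exists>n::nat. a [^] n = \<zero>) \<or> (\<exists>b\<in>A. a \<otimes> b = \<one>)"
    and nat: "\<And>n::nat. [n] \<cdot> \<one> = \<zero> \<or> [n] \<cdot> \<one> \<in> Units R"
    and acc: "ascending_chain_condition {U. saturated_submodule A \<one> R U}"
  shows "representable R"
proof -
  note AR = subringE(1) [OF sA]
  have comm: "a \<otimes> x = x \<otimes> a" if "a \<in> A" "x \<in> carrier R" for a x
    using cent that by (auto simp: ring_center_def)
  have "subcring A R"
    using sA comm AR by (intro subcringI) auto
  then interpret A: cring "R\<lparr>carrier := A\<rparr>"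
    using subcring_iff [OF AR] by simp
  have pow: "x [^]\<^bsub>R\<lparr>carrier := A\<rparr>\<^esub> (n::nat) = x [^] n" for x n
    by (rule nat_pow_consistent [symmetric])
  have addpow: "[n] \<cdot>\<^bsub>R\<lparr>carrier := A\<rparr>\<^esub> x = [(n::nat)] \<cdot> x" for x n
    by (simp add: add_pow_def nat_pow_def)
  have unitA: "a \<in> Units (R\<lparr>carrier := A\<rparr>)" if "a \<in> A" "b \<in> A" "a \<otimes> b = \<one>" for a b
    using that comm [of b a] AR by (auto simp: Units_def)
  have natA: "[(n::nat)] \<cdot> \<one> \<in> A" for n
    using subringE(2,3,7) [OF sA] by (induction n) auto
  interpret A: local_nil_ring "R\<lparr>carrier := A\<rparr>"
  proof
    show "\<one>\<^bsub>R\<lparr>carrier := A\<rparr>\<^esub> \<noteq> \<zero>\<^bsub>R\<lparr>carrier := A\<rparr>\<^esub>" using nz by simp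
    fix x assume "x \<in> carrier (R\<lparr>carrier := A\<rparr>)"
    then show "(\<exists>n::nat. x [^]\<^bsub>R\<lparr>carrier := A\<rparr>\<^esub> n = \<zero>\<^bsub>R\<lparr>carrier := A\<rparr>\<^esub>) \<or> x \<in> Units (R\<lparr>carrier := A\<rparr>)"
      using dich [of x] unitA unfolding pow by auto
  next
    fix n :: nat
    have "[n] \<cdot> \<one> \<in> Units (R\<lparr>carrier := A\<rparr>)" if u: "[n] \<cdot> \<one> \<in> Units R"
    proof -
      have "([n] \<cdot> \<one>) [^] (m::nat) \<noteq> \<zero>" for m
        using Units_pow_closed [OF u, of m] nz by (auto simp: Units_def)
      then show ?thesis using dich [OF natA, of n] unitA natA by blast
    qed
    then show "[n] \<cdot>\<^bsub>R\<lparr>carrier := A\<rparr>\<^esub> \<one>\<^bsub>R\<lparr>carrier := A\<rparr>\<^esub> = \<zero>\<^bsub>R\<lparr>carrier := A\<rparr>\<^esub> \<or>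
        [n] \<cdot>\<^bsub>R\<lparr>carrier := A\<rparr>\<^esub> \<one>\<^bsub>R\<lparr>carrier := A\<rparr>\<^esub> \<in> Units (R\<lparr>carrier := A\<rparr>)"
      using nat [of n] unfolding addpow by auto
  qed
  define sub where "sub = saturated_submodule A \<one> R"
  have nilsA: "a \<in> A" if "a \<in> A.nils" for a using A.nils_carrier [OF that] by simp
  \<comment> \<open>Choose x in \<open>M\<close> outside \<open>N\<close> with maximal annihilator
    modulo \<open>N\<close>. If a x were outside \<open>N\<close> for a nil a, let y be the product
    of x with the largest power of a that leaves it outside \<open>N\<close>. The annihilator of y
    contains that of x, so they agree; but a kills y modulo \<open>N\<close>.\<close>
  have key: "\<exists>x\<in>M - N. \<forall>a\<in>A.nils. a \<otimes> x \<in> N" if N: "sub N" and M: "sub M" and MN: "\<not> M \<subseteq> N" for M N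
  proof -
    note N = saturated_submoduleD(1-4) [OF N [unfolded sub_def]]
    note M = saturated_submoduleD(1-4) [OF M [unfolded sub_def]]
    let ?ann = "\<lambda>x. {a \<in> A. a \<otimes> x \<in> N}"
    have "saturated_submodule A \<one> R (?ann x)" if "x \<in> M" for x
      using that N M AR subringE(2,6,7) [OF sA]
      by (intro saturated_submoduleI) (auto simp: l_distr m_assoc subset_iff)
    then have "?ann ` (M - N) \<subseteq> {U. saturated_submodule A \<one> R U}" by blast
    moreover have "?ann ` (M - N) \<noteq> {}" using MN by blast
    ultimately have "\<exists>U\<in>?ann ` (M - N). \<forall>X\<in>?ann ` (M - N). U \<subseteq> X \<longrightarrow> X = U"
      by (rule acc_maximal [OF acc])
    then obtain U where "U \<in> ?ann ` (M - N)" and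
      U: "\<And>X. X \<in> ?ann ` (M - N) \<Longrightarrow> U \<subseteq> X \<Longrightarrow> X = U" by blast
    then obtain x where x: "x \<in> M - N" "U = ?ann x" by blast
    have xR: "x \<in> carrier R" using x M by blast
    have "a \<otimes> x \<in> N" if a: "a \<in> A.nils" for a
    proof (rule ccontr)
      assume ax: "a \<otimes> x \<notin> N"
      have aA: "a \<in> A" "a \<in> carrier R" using nilsA [OF a] AR by auto
      have powA: "a [^] (j::nat) \<in> A" for j
        using aA subringE(3,6) [OF sA] by (induction j) auto
      obtain n :: nat where "a [^] n = \<zero>" using a unfolding A.nils_def pow by auto
      then have "a [^] n \<otimes> x \<in> N" using xR N by simp
      then have L: "a [^] (LEAST k::nat. a [^] k \<otimes> x \<in> N) \<otimes> x \<in> N"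
        by (rule LeastI [where P = "\<lambda>k::nat. a [^] k \<otimes> x \<in> N"])
      have "(LEAST k::nat. a [^] k \<otimes> x \<in> N) \<noteq> 0" using L x xR by (intro notI) simp
      then obtain j where j: "(LEAST k::nat. a [^] k \<otimes> x \<in> N) = Suc j" using not0_implies_Suc by blast
      define y where "y = a [^] j \<otimes> x"
      have "y \<notin> N" unfolding y_def using j by (metis lessI not_less_Least)
      moreover have "y \<in> M" unfolding y_def using x M powA by blast
      moreover have "U \<subseteq> ?ann y"
      proof
        fix b assume b: "b \<in> U"
        then have "b \<in> A" "b \<otimes> x \<in> N" by (auto simp: x(2))
        moreover have "b \<otimes> y = a [^] j \<otimes> (b \<otimes> x)"
          unfolding y_def using comm [of b "a [^] j"] \<open>b \<in> A\<close> AR aA xR by (auto simp flip: m_assoc)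
        ultimately show "b \<in> ?ann y" using N powA by auto
      qed
      ultimately have "?ann y = U" using U by blast
      moreover have "a \<otimes> y = a [^] Suc j \<otimes> x"
        unfolding y_def nat_pow_Suc2 [OF aA(2)] using aA xR by (intro m_assoc [symmetric]) auto
      then have "a \<in> ?ann y" using L j aA by simp
      ultimately show False using ax x by blast
    qed
    then show ?thesis using x by blast
  qed
  have subcar: "sub (carrier R)" "sub A"
    using AR subringE(2,6,7) [OF sA] unfolding sub_def by (auto intro!: saturated_submoduleI)
  have loewy_sub: "sub (A.loewy k)" for k
  proof -
    have "A.loewy k \<subseteq> A" using A.loewy_carrier by auto
    then show ?thesis
      unfolding sub_def using A.loewy_zero [of k] A.loewy_add [of _ k] A.loewy_mult [of _ k] AR
      by (intro saturated_submoduleI) auto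
  qed
  have loewy_mono: "A.loewy k \<subseteq> A.loewy (Suc k)" for k
    using A.loewy_carrier A.loewy_mult A.nils_carrier by auto
  \<comment> \<open>If the stable term of the Loewy series were proper, \<open>key\<close> would
    give an element of the next term outside it.\<close>
  obtain m where "\<forall>n\<ge>m. A.loewy n = A.loewy m"
    using acc loewy_sub loewy_mono unfolding ascending_chain_condition_def sub_def by blast
  then have m: "A.loewy (Suc m) = A.loewy m" by (metis le_SucI order_refl)
  have "A.loewy m = carrier (R\<lparr>carrier := A\<rparr>)"
  proof (rule ccontr)
    assume "A.loewy m \<noteq> carrier (R\<lparr>carrier := A\<rparr>)"
    then have "\<not> A \<subseteq> A.loewy m" using A.loewy_carrier by auto
    then obtain x where "x \<in> A - A.loewy m" "\<forall>a\<in>A.nils. a \<otimes> x \<in> A.loewy m"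
      using key [OF loewy_sub subcar(2)] by blast
    then have "x \<in> A.loewy (Suc m)" by simp
    then show False using m \<open>x \<in> A - A.loewy m\<close> by blast
  qed
  from A.coefficient_field_exists [OF this]
  obtain L where L: "subfield L (R\<lparr>carrier := A\<rparr>)"
    "\<And>a. a \<in> A \<Longrightarrow> \<exists>l\<in>L. a \<ominus>\<^bsub>R\<lparr>carrier := A\<rparr>\<^esub> l \<in> A.nils"
    by auto
  have LA: "L \<subseteq> A" using subfieldE(3) [OF L(1)] by simp
  have fL: "field (R\<lparr>carrier := L\<rparr>)" using A.subfield_iff(2) [OF L(1)] by simp
  then have sL: "subfield L R" using subfield_iff(1) LA AR by blast
  have split: "\<exists>l\<in>L. \<exists>n\<in>A.nils. a = l \<oplus> n" if a: "a \<in> A" for a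
  proof -
    obtain l where l: "l \<in> L" "a \<ominus>\<^bsub>R\<lparr>carrier := A\<rparr>\<^esub> l \<in> A.nils" using L(2) a by blast
    have "a = l \<oplus>\<^bsub>R\<lparr>carrier := A\<rparr>\<^esub> (a \<ominus>\<^bsub>R\<lparr>carrier := A\<rparr>\<^esub> l)"
      using a l LA A.minus_eq A.a_lcomm [of l a "\<ominus>\<^bsub>R\<lparr>carrier := A\<rparr>\<^esub> l"] A.r_neg [of l] A.r_zero [of a] A.a_inv_closed [of l] by auto
    then show ?thesis using l by auto
  qed
  \<comment> \<open>The \<open>A\<close>-submodules that are finite-dimensional over
    \<open>L\<close>. A maximal one is everything: otherwise \<open>key\<close> gives x outside it
    that the maximal ideal sends into it, and since A = L + nils, adding the line L x yields another
    \<open>A\<close>-submodule.\<close>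
  define FF where "FF = {U. sub U \<and> (\<exists>Us. set Us \<subseteq> carrier R \<and> U = Span L Us)}"
  have "sub {\<zero>}" using AR unfolding sub_def by (auto intro!: saturated_submoduleI)
  then have "{\<zero>} \<in> FF" unfolding FF_def by (auto intro!: exI [of _ "[]"])
  then have F: "FF \<noteq> {}" "FF \<subseteq> {U. saturated_submodule A \<one> R U}"
    by (auto simp: sub_def FF_def)
  have "\<exists>U\<in>FF. \<forall>X\<in>FF. U \<subseteq> X \<longrightarrow> X = U"
    by (rule acc_maximal [OF acc F(2,1)])
  then obtain U where "U \<in> FF" and Umax: "\<And>X. X \<in> FF \<Longrightarrow> U \<subseteq> X \<Longrightarrow> X = U" by blast
  then obtain Us where Us: "sub U" "set Us \<subseteq> carrier R" "U = Span L Us"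
    unfolding FF_def by blast
  have "U = carrier R"
  proof (rule ccontr)
    note U = saturated_submoduleD(1-4) [OF Us(1) [unfolded sub_def]]
    assume "U \<noteq> carrier R"
    then have "\<not> carrier R \<subseteq> U" using U(1) by blast
    then obtain x where x: "x \<in> carrier R - U" "\<forall>a\<in>A.nils. a \<otimes> x \<in> U"
      using key [OF Us(1) subcar(1)] by blast
    have eq: "Span L (x # Us) = line_extension L x U" by (simp add: Us(3))
    have sx: "set (x # Us) \<subseteq> carrier R" using x Us by simp
    note props = Span_subgroup_props [OF sL sx]
    have "a \<otimes> w \<in> Span L (x # Us)" if a: "a \<in> A" and w: "w \<in> Span L (x # Us)" for a w
    proof -
      obtain l u where lu: "l \<in> L" "u \<in> U" "w = l \<otimes> x \<oplus> u"
        using w unfolding eq line_extension_mem_iff by blast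
      then have "a \<otimes> l \<in> A" using a LA subringE(6) [OF sA] by blast
      then obtain l' n where ln: "l' \<in> L" "n \<in> A.nils" "a \<otimes> l = l' \<oplus> n" using split by blast
      have c: "a \<in> carrier R" "l \<in> carrier R" "u \<in> carrier R" "l' \<in> carrier R" "n \<in> carrier R" "x \<in> carrier R"
        using a lu ln x LA AR U nilsA by auto
      have "a \<otimes> w = (a \<otimes> l) \<otimes> x \<oplus> a \<otimes> u" using c lu by (simp add: r_distr m_assoc)
      also have "\<dots> = l' \<otimes> x \<oplus> (n \<otimes> x \<oplus> a \<otimes> u)" using c ln by (simp add: l_distr a_assoc)
      finally have "a \<otimes> w = l' \<otimes> x \<oplus> (n \<otimes> x \<oplus> a \<otimes> u)" .
      moreover have "n \<otimes> x \<oplus> a \<otimes> u \<in> U" using U(3,4) x ln a lu by blast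
      ultimately show ?thesis unfolding eq line_extension_mem_iff using ln by blast
    qed
    then have "sub (Span L (x # Us))"
      unfolding sub_def using props by (intro saturated_submoduleI) auto
    then have "Span L (x # Us) \<in> FF" unfolding FF_def using sx by blast
    moreover have "U \<subseteq> Span L (x # Us)"
    proof
      fix u assume "u \<in> U"
      moreover have "u = \<zero> \<otimes> x \<oplus> u" using \<open>u \<in> U\<close> U(1) x by auto
      moreover have "\<zero> \<in> L" using subringE(2) [OF subfieldE(1) [OF sL]] .
      ultimately show "u \<in> Span L (x # Us)" unfolding eq line_extension_mem_iff by blast
    qed
    ultimately have "Span L (x # Us) = U" using Umax by blast
    moreover have "x \<in> Span L (x # Us)" using Span_base_incl [OF sL sx] by simp
    ultimately show False using x by blast
  qed
  then have "Span L Us = carrier R" using Us(3) by simp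
  moreover have "L \<subseteq> ring_center R" using LA cent by blast
  ultimately obtain n \<phi> where "n \<ge> 1" "\<phi> \<in> ring_hom R (matrix_ring (R\<lparr>carrier := L\<rparr>) n)"
    "inj_on \<phi> (carrier R)"
    using regular_representation [OF sL _ nz Us(2)] by metis
  then show ?thesis using representableI [OF fL] by blast
qed

end

section \<open>Central fractions\<close>

locale central_denominators = ring +
  fixes S
  assumes S_center: "S \<subseteq> ring_center R" and S_one: "\<one> \<in> S"
    and S_mult: "s \<in> S \<Longrightarrow> t \<in> S \<Longrightarrow> s \<otimes> t \<in> S"
    and S_regular: "s \<in> S \<Longrightarrow> x \<in> carrier R \<Longrightarrow> s \<otimes> x = \<zero> \<Longrightarrow> x = \<zero>"
begin

lemma S_closed: "s \<in> S \<Longrightarrow> s \<in> carrier R"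
  using S_center by (auto simp: ring_center_def)

lemma S_comm: "s \<in> S \<Longrightarrow> x \<in> carrier R \<Longrightarrow> x \<otimes> s = s \<otimes> x"
  using S_center by (auto simp: ring_center_def)

lemma S_lcomm: "s \<in> S \<Longrightarrow> x \<in> carrier R \<Longrightarrow> y \<in> carrier R \<Longrightarrow> x \<otimes> (s \<otimes> y) = s \<otimes> (x \<otimes> y)"
  using S_comm [of s x] by (simp add: m_assoc [symmetric] S_closed)

lemma S_cancel:
  assumes "s \<in> S" "x \<in> carrier R" "y \<in> carrier R" "s \<otimes> x = s \<otimes> y"
  shows "x = y"
proof -
  have "s \<otimes> (x \<ominus> y) = \<zero>"
    using assms by (simp add: minus_eq r_distr r_minus r_neg S_closed)
  then show ?thesis using assms S_regular [of s "x \<ominus> y"] by simp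
qed

text \<open>Since the denominators are regular, the cross-multiplied relation is transitive, and
  equality of fractions is a single equation in \<open>R\<close>. The operations below are computed
  on representatives picked by choice; \<open>mult_fr\<close> and \<open>add_fr\<close> show
  independence of that choice.\<close>

definition fr :: "'a \<Rightarrow> 'a \<Rightarrow> ('a \<times> 'a) set"
  where "fr x s = {(y, t). y \<in> carrier R \<and> t \<in> S \<and> t \<otimes> x = s \<otimes> y}"

definition rep :: "('a \<times> 'a) set \<Rightarrow> 'a \<times> 'a"
  where "rep X = (SOME p. p \<in> X)"

definition fractions :: "('a \<times> 'a) set ring"
  where "fractions = \<lparr> carrier = {fr x s |x s. x \<in> carrier R \<and> s \<in> S},
    monoid.mult = (\<lambda>X Y. fr (fst (rep X) \<otimes> fst (rep Y)) (snd (rep X) \<otimes> snd (rep Y))),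
    one = fr \<one> \<one>, zero = fr \<zero> \<one>,
    add = (\<lambda>X Y. fr (snd (rep Y) \<otimes> fst (rep X) \<oplus> snd (rep X) \<otimes> fst (rep Y))
      (snd (rep X) \<otimes> snd (rep Y))) \<rparr>"

lemma fr_eq_iff:
  assumes "x \<in> carrier R" "s \<in> S" "y \<in> carrier R" "t \<in> S"
  shows "fr x s = fr y t \<longleftrightarrow> t \<otimes> x = s \<otimes> y"
proof
  assume "fr x s = fr y t"
  moreover have "(y, t) \<in> fr y t" using assms by (simp add: fr_def)
  ultimately show "t \<otimes> x = s \<otimes> y" by (auto simp: fr_def)
next
  have *: "u \<otimes> x = s \<otimes> z"
    if "t \<otimes> x = s \<otimes> y" "u \<otimes> y = t \<otimes> z" "x \<in> carrier R" "s \<in> S" "y \<in> carrier R" "t \<in> S" "z \<in> carrier R" "u \<in> S"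
    for x y z s t u
  proof (rule S_cancel [OF \<open>t \<in> S\<close>])
    have "t \<otimes> (u \<otimes> x) = u \<otimes> (t \<otimes> x)"
      by (rule S_lcomm) (use that S_closed in auto)
    also have "\<dots> = u \<otimes> (s \<otimes> y)" by (simp only: that(1))
    also have "\<dots> = s \<otimes> (u \<otimes> y)" by (rule S_lcomm) (use that S_closed in auto)
    also have "\<dots> = s \<otimes> (t \<otimes> z)" by (simp only: that(2))
    also have "\<dots> = t \<otimes> (s \<otimes> z)" by (rule S_lcomm) (use that S_closed in auto)
    finally show "t \<otimes> (u \<otimes> x) = t \<otimes> (s \<otimes> z)" .
  qed (use that S_closed in auto)
  assume "t \<otimes> x = s \<otimes> y"
  then have "u \<otimes> x = s \<otimes> z \<longleftrightarrow> u \<otimes> y = t \<otimes> z" if "z \<in> carrier R" "u \<in> S" for z u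
    using *[of t x s y u z] *[of s y t x u z] assms that by metis
  then show "fr x s = fr y t"
    unfolding fr_def by blast
qed

lemma rep_fr:
  assumes "x \<in> carrier R" "s \<in> S"
  shows "fst (rep (fr x s)) \<in> carrier R" "snd (rep (fr x s)) \<in> S"
    "snd (rep (fr x s)) \<otimes> x = s \<otimes> fst (rep (fr x s))"
proof -
  have "(x, s) \<in> fr x s" using assms by (simp add: fr_def)
  then have "rep (fr x s) \<in> fr x s" unfolding rep_def by (rule someI)
  then show "fst (rep (fr x s)) \<in> carrier R" "snd (rep (fr x s)) \<in> S"
    "snd (rep (fr x s)) \<otimes> x = s \<otimes> fst (rep (fr x s))"
    by (auto simp: fr_def)
qed

lemma split_mult:
  "x \<in> carrier R \<Longrightarrow> y \<in> carrier R \<Longrightarrow> s \<in> S \<Longrightarrow> t \<in> S \<Longrightarrow>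
    (s \<otimes> t) \<otimes> (x \<otimes> y) = (s \<otimes> x) \<otimes> (t \<otimes> y)"
  by (simp add: m_assoc S_lcomm S_closed)

lemma mult_fr:
  assumes "x \<in> carrier R" "s \<in> S" "y \<in> carrier R" "t \<in> S"
  shows "fr x s \<otimes>\<^bsub>fractions\<^esub> fr y t = fr (x \<otimes> y) (s \<otimes> t)"
proof -
  note a = rep_fr [OF assms(1,2)] and b = rep_fr [OF assms(3,4)]
  have "s \<otimes> t \<otimes> (fst (rep (fr x s)) \<otimes> fst (rep (fr y t))) =
      snd (rep (fr x s)) \<otimes> snd (rep (fr y t)) \<otimes> (x \<otimes> y)"
    unfolding split_mult [OF a(1) b(1) assms(2,4)] split_mult [OF assms(1,3) a(2) b(2)] a(3) b(3) ..
  then show ?thesis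
    using a b assms unfolding fractions_def by (simp add: fr_eq_iff S_mult)
qed

lemma add_fr:
  assumes "x \<in> carrier R" "s \<in> S" "y \<in> carrier R" "t \<in> S"
  shows "fr x s \<oplus>\<^bsub>fractions\<^esub> fr y t = fr (t \<otimes> x \<oplus> s \<otimes> y) (s \<otimes> t)"
proof -
  define x' s' y' t' where d: "x' = fst (rep (fr x s))" "s' = snd (rep (fr x s))"
    "y' = fst (rep (fr y t))" "t' = snd (rep (fr y t))"
  have a: "x' \<in> carrier R" "s' \<in> S" "s' \<otimes> x = s \<otimes> x'" and b: "y' \<in> carrier R" "t' \<in> S" "t' \<otimes> y = t \<otimes> y'"
    using rep_fr [OF assms(1,2)] rep_fr [OF assms(3,4)] by (simp_all add: d)
  note S = assms(2,4) a(2) b(2)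
  note c = assms a b S [THEN S_closed]
  have "(s \<otimes> t) \<otimes> (t' \<otimes> x') = (t \<otimes> t') \<otimes> (s \<otimes> x')"
    using c by (simp add: m_assoc S_lcomm S_comm)
  also have "\<dots> = (s' \<otimes> t') \<otimes> (t \<otimes> x)"
    unfolding a(3) [symmetric] using c(1-6,8,9) S S [THEN S_closed] by (simp add: m_assoc S_lcomm S_comm)
  finally have 1: "(s \<otimes> t) \<otimes> (t' \<otimes> x') = (s' \<otimes> t') \<otimes> (t \<otimes> x)" .
  have "(s \<otimes> t) \<otimes> (s' \<otimes> y') = (s \<otimes> s') \<otimes> (t \<otimes> y')"
    using c by (simp add: m_assoc S_lcomm S_comm)
  also have "\<dots> = (s' \<otimes> t') \<otimes> (s \<otimes> y)"
    unfolding b(3) [symmetric] using c(1-6,8,9) S S [THEN S_closed] by (simp add: m_assoc S_lcomm S_comm)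
  finally have 2: "(s \<otimes> t) \<otimes> (s' \<otimes> y') = (s' \<otimes> t') \<otimes> (s \<otimes> y)" .
  have "(s \<otimes> t) \<otimes> (t' \<otimes> x' \<oplus> s' \<otimes> y') = (s' \<otimes> t') \<otimes> (t \<otimes> x \<oplus> s \<otimes> y)"
    using c 1 2 by (simp add: r_distr)
  then have "fr (t' \<otimes> x' \<oplus> s' \<otimes> y') (s' \<otimes> t') = fr (t \<otimes> x \<oplus> s \<otimes> y) (s \<otimes> t)"
    using c by (subst fr_eq_iff) (auto simp: S_mult)
  then show ?thesis unfolding fractions_def by (simp add: d)
qed

lemma carrier_fractions: "carrier fractions = {fr x s |x s. x \<in> carrier R \<and> s \<in> S}"
  and one_fractions: "\<one>\<^bsub>fractions\<^esub> = fr \<one> \<one>" and zero_fractions: "\<zero>\<^bsub>fractions\<^esub> = fr \<zero> \<one>"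
  by (simp_all add: fractions_def)

lemma fr_closed: "x \<in> carrier R \<Longrightarrow> s \<in> S \<Longrightarrow> fr x s \<in> carrier fractions"
  by (auto simp: carrier_fractions)

lemma fr_cancel: "x \<in> carrier R \<Longrightarrow> s \<in> S \<Longrightarrow> t \<in> S \<Longrightarrow> fr (t \<otimes> x) (t \<otimes> s) = fr x s"
  by (simp add: fr_eq_iff S_mult S_closed m_assoc S_lcomm S_comm)

lemma fr_zero: "s \<in> S \<Longrightarrow> fr \<zero> s = fr \<zero> \<one>"
  by (simp add: fr_eq_iff S_one S_closed)

lemma fractionsE:
  assumes "X \<in> carrier fractions"
  obtains x s where "x \<in> carrier R" "s \<in> S" "X = fr x s"
  using assms by (auto simp: carrier_fractions)

lemma fractions_is_ring: "ring fractions"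
proof (rule ringI)
  show "abelian_group fractions"
  proof (rule abelian_groupI)
    fix X Y assume "X \<in> carrier fractions" "Y \<in> carrier fractions"
    then obtain x s y t where xy: "x \<in> carrier R" "s \<in> S" "X = fr x s" "y \<in> carrier R" "t \<in> S" "Y = fr y t"
      by (meson fractionsE)
    then show "X \<oplus>\<^bsub>fractions\<^esub> Y \<in> carrier fractions"
      by (auto simp: add_fr S_mult S_closed intro!: fr_closed)
    show "X \<oplus>\<^bsub>fractions\<^esub> Y = Y \<oplus>\<^bsub>fractions\<^esub> X"
      using xy by (simp add: add_fr S_closed a_comm S_comm)
  next
    fix X Y Z assume "X \<in> carrier fractions" "Y \<in> carrier fractions" "Z \<in> carrier fractions"
    then obtain x s y t z u where xyz: "x \<in> carrier R" "s \<in> S" "X = fr x s" "y \<in> carrier R" "t \<in> S" "Y = fr y t"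
      "z \<in> carrier R" "u \<in> S" "Z = fr z u"
      by (meson fractionsE)
    then show "X \<oplus>\<^bsub>fractions\<^esub> Y \<oplus>\<^bsub>fractions\<^esub> Z = X \<oplus>\<^bsub>fractions\<^esub> (Y \<oplus>\<^bsub>fractions\<^esub> Z)"
      by (simp add: add_fr S_mult S_closed r_distr a_assoc m_assoc S_lcomm S_comm)
  next
    show "\<zero>\<^bsub>fractions\<^esub> \<in> carrier fractions" by (auto simp: zero_fractions S_one intro: fr_closed)
    fix X assume "X \<in> carrier fractions"
    then obtain x s where x: "x \<in> carrier R" "s \<in> S" "X = fr x s" by (rule fractionsE)
    then show "\<zero>\<^bsub>fractions\<^esub> \<oplus>\<^bsub>fractions\<^esub> X = X"
      by (simp add: zero_fractions add_fr S_one S_closed)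
    have "fr (\<ominus> x) s \<oplus>\<^bsub>fractions\<^esub> X = \<zero>\<^bsub>fractions\<^esub>"
      using x by (simp add: zero_fractions add_fr S_closed r_distr [symmetric] l_neg fr_zero S_mult)
    moreover have "fr (\<ominus> x) s \<in> carrier fractions" using x by (auto intro: fr_closed)
    ultimately show "\<exists>Y\<in>carrier fractions. Y \<oplus>\<^bsub>fractions\<^esub> X = \<zero>\<^bsub>fractions\<^esub>" by blast
  qed
next
  show "monoid fractions"
  proof (rule monoidI)
    fix X Y assume "X \<in> carrier fractions" "Y \<in> carrier fractions"
    then show "X \<otimes>\<^bsub>fractions\<^esub> Y \<in> carrier fractions"
      by (auto elim!: fractionsE simp: mult_fr S_mult intro!: fr_closed)
  next
    show "\<one>\<^bsub>fractions\<^esub> \<in> carrier fractions" by (auto simp: one_fractions S_one intro: fr_closed)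
  next
    fix X Y Z assume "X \<in> carrier fractions" "Y \<in> carrier fractions" "Z \<in> carrier fractions"
    then show "X \<otimes>\<^bsub>fractions\<^esub> Y \<otimes>\<^bsub>fractions\<^esub> Z = X \<otimes>\<^bsub>fractions\<^esub> (Y \<otimes>\<^bsub>fractions\<^esub> Z)"
      by (auto elim!: fractionsE simp: mult_fr S_mult m_assoc S_closed)
  next
    fix X assume "X \<in> carrier fractions"
    then show "\<one>\<^bsub>fractions\<^esub> \<otimes>\<^bsub>fractions\<^esub> X = X" "X \<otimes>\<^bsub>fractions\<^esub> \<one>\<^bsub>fractions\<^esub> = X"
      by (auto elim!: fractionsE simp: mult_fr one_fractions S_one S_closed)
  qed
next
  fix X Y Z assume "X \<in> carrier fractions" "Y \<in> carrier fractions" "Z \<in> carrier fractions"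
  then obtain x s y t z u where xyz: "x \<in> carrier R" "s \<in> S" "X = fr x s" "y \<in> carrier R" "t \<in> S" "Y = fr y t"
    "z \<in> carrier R" "u \<in> S" "Z = fr z u"
    by (meson fractionsE)
  note c = xyz(1,2,4,5,7,8) S_closed [OF xyz(2)] S_closed [OF xyz(5)] S_closed [OF xyz(8)]
  have "X \<otimes>\<^bsub>fractions\<^esub> Z \<oplus>\<^bsub>fractions\<^esub> Y \<otimes>\<^bsub>fractions\<^esub> Z =
      fr (u \<otimes> (t \<otimes> (x \<otimes> z) \<oplus> s \<otimes> (y \<otimes> z))) (u \<otimes> (s \<otimes> t \<otimes> u))"
    using c by (simp add: xyz mult_fr add_fr S_mult r_distr m_assoc S_lcomm S_comm)
  also have "\<dots> = (X \<oplus>\<^bsub>fractions\<^esub> Y) \<otimes>\<^bsub>fractions\<^esub> Z"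
    using c by (simp add: xyz fr_cancel mult_fr add_fr S_mult l_distr m_assoc)
  finally show "(X \<oplus>\<^bsub>fractions\<^esub> Y) \<otimes>\<^bsub>fractions\<^esub> Z = X \<otimes>\<^bsub>fractions\<^esub> Z \<oplus>\<^bsub>fractions\<^esub> Y \<otimes>\<^bsub>fractions\<^esub> Z" ..
  have "Z \<otimes>\<^bsub>fractions\<^esub> X \<oplus>\<^bsub>fractions\<^esub> Z \<otimes>\<^bsub>fractions\<^esub> Y =
      fr (u \<otimes> (z \<otimes> (t \<otimes> x \<oplus> s \<otimes> y))) (u \<otimes> (u \<otimes> (s \<otimes> t)))"
    using c by (simp add: xyz mult_fr add_fr S_mult r_distr m_assoc S_lcomm S_comm)
  also have "\<dots> = Z \<otimes>\<^bsub>fractions\<^esub> (X \<oplus>\<^bsub>fractions\<^esub> Y)"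
    using c by (simp add: xyz fr_cancel mult_fr add_fr S_mult)
  finally show "Z \<otimes>\<^bsub>fractions\<^esub> (X \<oplus>\<^bsub>fractions\<^esub> Y) = Z \<otimes>\<^bsub>fractions\<^esub> X \<oplus>\<^bsub>fractions\<^esub> Z \<otimes>\<^bsub>fractions\<^esub> Y" ..
qed

theorem central_fractions_exist:
  obtains Q :: "('a \<times> 'a) set ring" and \<iota> where
    "ring Q" "\<iota> \<in> ring_hom R Q" "inj_on \<iota> (carrier R)" "\<And>s. s \<in> S \<Longrightarrow> \<iota> s \<in> Units Q"
    "\<And>q. q \<in> carrier Q \<Longrightarrow> \<exists>x\<in>carrier R. \<exists>s\<in>S. \<iota> s \<otimes>\<^bsub>Q\<^esub> q = \<iota> x"
proof
  let ?i = "\<lambda>x. fr x \<one>"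
  show "ring fractions" by (rule fractions_is_ring)
  show "?i \<in> ring_hom R fractions"
    by (rule ring_hom_memI) (auto simp: mult_fr add_fr S_one one_fractions intro: fr_closed)
  show "inj_on ?i (carrier R)" by (auto simp: inj_on_def fr_eq_iff S_one)
  show "?i s \<in> Units fractions" if s: "s \<in> S" for s
  proof -
    have "fr s s = fr \<one> \<one>" using s by (simp add: fr_eq_iff S_one S_closed)
    then have "fr \<one> s \<otimes>\<^bsub>fractions\<^esub> ?i s = \<one>\<^bsub>fractions\<^esub>" "?i s \<otimes>\<^bsub>fractions\<^esub> fr \<one> s = \<one>\<^bsub>fractions\<^esub>"
      using s by (simp_all add: mult_fr S_one S_closed one_fractions)
    moreover have "?i s \<in> carrier fractions" "fr \<one> s \<in> carrier fractions"
      using s by (auto intro: fr_closed simp: S_one S_closed)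
    ultimately show ?thesis unfolding Units_def by blast
  qed
  show "\<exists>x\<in>carrier R. \<exists>s\<in>S. ?i s \<otimes>\<^bsub>fractions\<^esub> q = ?i x" if q: "q \<in> carrier fractions" for q
  proof -
    obtain x s where x: "x \<in> carrier R" "s \<in> S" "q = fr x s" using q by (rule fractionsE)
    then have "?i s \<otimes>\<^bsub>fractions\<^esub> q = ?i x"
      using fr_cancel [of x \<one> s] by (simp add: mult_fr S_one S_closed)
    then show ?thesis using x by blast
  qed
qed

end

section \<open>Transport of chain conditions and passage to central fractions\<close>

lemma acc_embed:
  assumes acc: "ascending_chain_condition \<J>" and f: "\<And>U. U \<in> \<I> \<Longrightarrow> f U \<in> \<J>"
    and mono: "\<And>U V. U \<in> \<I> \<Longrightarrow> V \<in> \<I> \<Longrightarrow> U \<subseteq> V \<Longrightarrow> f U \<subseteq> f V"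
    and inj: "\<And>U V. U \<in> \<I> \<Longrightarrow> V \<in> \<I> \<Longrightarrow> U \<subseteq> V \<Longrightarrow> f U = f V \<Longrightarrow> U = V"
  shows "ascending_chain_condition \<I>"
  unfolding ascending_chain_condition_def
proof (intro allI impI)
  fix U :: "nat \<Rightarrow> _" assume U: "\<forall>n. U n \<in> \<I> \<and> U n \<subseteq> U (Suc n)"
  then have "\<forall>n. f (U n) \<in> \<J> \<and> f (U n) \<subseteq> f (U (Suc n))" using f mono by blast
  then have "\<exists>m. \<forall>n\<ge>m. f (U n) = f (U m)"
    using acc [unfolded ascending_chain_condition_def, rule_format, of "\<lambda>n. f (U n)"] by blast
  then obtain m where m: "\<forall>n\<ge>m. f (U n) = f (U m)" by blast
  have le: "U m \<subseteq> U n" if "m \<le> n" for n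
    by (rule lift_Suc_mono_le [of U]) (use U that in blast)+
  have "U n = U m" if "m \<le> n" for n
    by (rule inj [symmetric]) (use U that m le in \<open>blast | metis\<close>)+
  then show "\<exists>m. \<forall>n\<ge>m. U n = U m" by blast
qed

lemma representable_embed:
  assumes "representable Q" "\<iota> \<in> ring_hom R Q" "inj_on \<iota> (carrier R)"
  shows "representable R"
proof -
  obtain K :: "'a list ring" and n \<phi> where K: "field K" "n \<ge> 1"
    "\<phi> \<in> ring_hom Q (matrix_ring K n)" "inj_on \<phi> (carrier Q)"
    using assms(1) unfolding representable_def by blast
  have "\<phi> \<circ> \<iota> \<in> ring_hom R (matrix_ring K n)"
    using ring_hom_trans [OF assms(2) K(3)] .
  moreover have "inj_on (\<phi> \<circ> \<iota>) (carrier R)"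
    using assms(2,3) K(4) ring_hom_closed [OF assms(2)]
    by (intro comp_inj_on) (auto intro: inj_on_subset)
  ultimately show ?thesis using representableI [OF K(1,2)] by blast
qed

lemma (in ring_hom_ring) hom_nat: "h ([(n::nat)] \<cdot>\<^bsub>R\<^esub> \<one>\<^bsub>R\<^esub>) = [n] \<cdot>\<^bsub>S\<^esub> \<one>\<^bsub>S\<^esub>"
  by (induction n) auto

text \<open>This is how the effect of a base field is handed on to quotients, fractions and
  endomorphism rings without keeping track of scalars.\<close>

lemma (in ring_hom_ring) nat_zero_or_unit_hom:
  assumes "[(n::nat)] \<cdot>\<^bsub>R\<^esub> \<one>\<^bsub>R\<^esub> = \<zero>\<^bsub>R\<^esub> \<or> [n] \<cdot>\<^bsub>R\<^esub> \<one>\<^bsub>R\<^esub> \<in> Units R"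
  shows "[n] \<cdot>\<^bsub>S\<^esub> \<one>\<^bsub>S\<^esub> = \<zero>\<^bsub>S\<^esub> \<or> [n] \<cdot>\<^bsub>S\<^esub> \<one>\<^bsub>S\<^esub> \<in> Units S"
proof -
  have "h u \<in> Units S" if u: "u \<in> Units R" for u
  proof -
    define v where "v = inv\<^bsub>R\<^esub> u"
    have v: "v \<in> carrier R" "u \<otimes>\<^bsub>R\<^esub> v = \<one>\<^bsub>R\<^esub>" "v \<otimes>\<^bsub>R\<^esub> u = \<one>\<^bsub>R\<^esub>" "u \<in> carrier R"
      using u by (simp_all add: v_def R.Units_closed)
    then have "h u \<otimes>\<^bsub>S\<^esub> h v = \<one>\<^bsub>S\<^esub>" "h v \<otimes>\<^bsub>S\<^esub> h u = \<one>\<^bsub>S\<^esub>"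
      by (metis hom_mult hom_one)+
    then show ?thesis using v unfolding Units_def by auto
  qed
  then show ?thesis using assms hom_nat [of n] by (metis hom_zero)
qed

text \<open>Inverting all regular elements of \<open>Z\<close> makes each element of
  \<open>Z\<close> nilpotent or a unit. This is the local situation already settled, and
  \<open>R\<close> embeds in the ring of fractions.\<close>

theorem (in ring) uniform_representable:
  assumes sZ: "subring Z R" and cent: "Z \<subseteq> ring_center R" and nz: "\<one> \<noteq> \<zero>"
    and dich: "\<And>z. z \<in> Z \<Longrightarrow> (\<exists>n::nat. z [^] n = \<zero>) \<or> (\<forall>x\<in>carrier R. z \<otimes> x = \<zero> \<longrightarrow> x = \<zero>)"
    and nat: "\<And>n::nat. [n] \<cdot> \<one> = \<zero> \<or> [n] \<cdot> \<one> \<in> Units R"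
    and c: "c \<in> Z" "\<And>x. x \<in> carrier R \<Longrightarrow> c \<otimes> x = \<zero> \<Longrightarrow> x = \<zero>"
    and acc: "ascending_chain_condition {U. saturated_submodule Z c R U}"
  shows "representable R"
proof -
  note ZR = subringE(1) [OF sZ]
  define S where "S = {z \<in> Z. \<forall>x\<in>carrier R. z \<otimes> x = \<zero> \<longrightarrow> x = \<zero>}"
  have SZ: "S \<subseteq> Z" unfolding S_def by blast
  have Sreg: "x = \<zero>" if "s \<in> S" "x \<in> carrier R" "s \<otimes> x = \<zero>" for s x
    using that unfolding S_def by blast
  interpret central_denominators R S
  proof
    show "S \<subseteq> ring_center R" using SZ cent by blast
    show "\<one> \<in> S" unfolding S_def using subringE(3) [OF sZ] by simp
    fix s t assume st: "s \<in> S" "t \<in> S"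
    have c: "s \<in> carrier R" "t \<in> carrier R" using st SZ ZR by blast+
    have "x = \<zero>" if x: "x \<in> carrier R" "s \<otimes> t \<otimes> x = \<zero>" for x
    proof -
      have "s \<otimes> (t \<otimes> x) = \<zero>" using x c by (simp add: m_assoc)
      then have "t \<otimes> x = \<zero>" by (rule Sreg [OF st(1), rotated]) (use x c in blast)
      then show ?thesis by (rule Sreg [OF st(2) x(1)])
    qed
    moreover have "s \<otimes> t \<in> Z" using st SZ subringE(6) [OF sZ] by blast
    ultimately show "s \<otimes> t \<in> S" unfolding S_def by blast
  next
    fix s x assume "s \<in> S" "x \<in> carrier R" "s \<otimes> x = \<zero>"
    then show "x = \<zero>" by (rule Sreg)
  qed
  obtain Q :: "('a \<times> 'a) set ring" and \<iota> where
    Q: "ring Q" "\<iota> \<in> ring_hom R Q" "inj_on \<iota> (carrier R)" and unit: "\<And>s. s \<in> S \<Longrightarrow> \<iota> s \<in> Units Q"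
    and frac: "\<And>q. q \<in> carrier Q \<Longrightarrow> \<exists>x\<in>carrier R. \<exists>s\<in>S. \<iota> s \<otimes>\<^bsub>Q\<^esub> q = \<iota> x"
    using central_fractions_exist by metis
  interpret Q: ring Q by fact
  interpret h: ring_hom_ring R Q \<iota> using Q by (intro ring_hom_ringI2) (auto intro: ring_axioms)
  note [simp] = S_closed
  have cancel: "q = q'" if "s \<in> S" "\<iota> s \<otimes>\<^bsub>Q\<^esub> q = \<iota> s \<otimes>\<^bsub>Q\<^esub> q'" "q \<in> carrier Q" "q' \<in> carrier Q" for s q q'
    using that unit Q.Units_l_cancel by blast
  have Zcent: "\<iota> z \<otimes>\<^bsub>Q\<^esub> y = y \<otimes>\<^bsub>Q\<^esub> \<iota> z" if z: "z \<in> Z" and y: "y \<in> carrier Q" for z y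
  proof -
    obtain x t where xt: "x \<in> carrier R" "t \<in> S" "\<iota> t \<otimes>\<^bsub>Q\<^esub> y = \<iota> x" using frac [OF y] by blast
    have zR: "z \<in> carrier R" "z \<otimes> x = x \<otimes> z" "t \<otimes> z = z \<otimes> t" "t \<in> carrier R"
      using z cent xt S_comm [of t z] by (auto simp: ring_center_def)
    have "\<iota> t \<otimes>\<^bsub>Q\<^esub> (\<iota> z \<otimes>\<^bsub>Q\<^esub> y) = \<iota> (t \<otimes> z) \<otimes>\<^bsub>Q\<^esub> y"
      using zR(1,4) y by (simp add: Q.m_assoc)
    also have "\<dots> = \<iota> z \<otimes>\<^bsub>Q\<^esub> \<iota> x"
      unfolding zR(3) xt(3) [symmetric] using zR(1,4) y by (simp add: Q.m_assoc)
    also have "\<dots> = \<iota> x \<otimes>\<^bsub>Q\<^esub> \<iota> z"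
      using zR(1,2) xt(1) h.hom_mult [of z x] h.hom_mult [of x z] by simp
    also have "\<dots> = \<iota> t \<otimes>\<^bsub>Q\<^esub> (y \<otimes>\<^bsub>Q\<^esub> \<iota> z)"
      unfolding xt(3) [symmetric] using zR(1,4) y by (simp add: Q.m_assoc)
    finally show ?thesis using cancel xt(2) zR(1) y by (meson Q.m_closed h.hom_closed)
  qed
  \<comment> \<open>The fractions with numerator in \<open>Z\<close>, characterized inside
    \<open>Q\<close> independently of how \<open>Q\<close> was built.\<close>
  define A where "A = {q \<in> carrier Q. \<exists>z\<in>Z. \<exists>s\<in>S. \<iota> s \<otimes>\<^bsub>Q\<^esub> q = \<iota> z}"
  have AI: "q \<in> A" if "q \<in> carrier Q" "z \<in> Z" "s \<in> S" "\<iota> s \<otimes>\<^bsub>Q\<^esub> q = \<iota> z" for q z s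
    using that by (auto simp: A_def)
  have AE: "\<exists>z s. z \<in> Z \<and> s \<in> S \<and> \<iota> s \<otimes>\<^bsub>Q\<^esub> q = \<iota> z \<and> q \<in> carrier Q" if "q \<in> A" for q
    using that by (auto simp: A_def)
  have AQ: "A \<subseteq> carrier Q" by (auto simp: A_def)
  have ZA: "\<iota> z \<in> A" if "z \<in> Z" for z
    by (rule AI [of _ z \<one>]) (use that ZR S_one in auto)
  have invA: "inv\<^bsub>Q\<^esub> (\<iota> s) \<in> A" if "s \<in> S" for s
    by (rule AI [of _ \<one> s]) (use that unit subringE(3) [OF sZ] in auto)
  have Acent: "A \<subseteq> ring_center Q"
  proof
    fix q assume "q \<in> A"
    then obtain z s where zs: "z \<in> Z" "s \<in> S" "\<iota> s \<otimes>\<^bsub>Q\<^esub> q = \<iota> z" "q \<in> carrier Q" using AE by blast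
    have sZ': "s \<in> Z" "s \<in> carrier R" using zs SZ ZR by auto
    have "q \<otimes>\<^bsub>Q\<^esub> y = y \<otimes>\<^bsub>Q\<^esub> q" if y: "y \<in> carrier Q" for y
    proof (rule cancel [OF zs(2)])
      have "\<iota> s \<otimes>\<^bsub>Q\<^esub> (q \<otimes>\<^bsub>Q\<^esub> y) = \<iota> z \<otimes>\<^bsub>Q\<^esub> y"
        unfolding zs(3) [symmetric] using zs(4) y sZ' by (simp add: Q.m_assoc)
      also have "\<dots> = y \<otimes>\<^bsub>Q\<^esub> \<iota> z" using Zcent zs y by blast
      also have "\<dots> = (y \<otimes>\<^bsub>Q\<^esub> \<iota> s) \<otimes>\<^bsub>Q\<^esub> q"
        unfolding zs(3) [symmetric] using zs(4) y sZ' by (simp add: Q.m_assoc)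
      also have "\<dots> = (\<iota> s \<otimes>\<^bsub>Q\<^esub> y) \<otimes>\<^bsub>Q\<^esub> q" using Zcent [OF sZ'(1) y] by simp
      also have "\<dots> = \<iota> s \<otimes>\<^bsub>Q\<^esub> (y \<otimes>\<^bsub>Q\<^esub> q)" using zs(4) y sZ' by (simp add: Q.m_assoc)
      finally show "\<iota> s \<otimes>\<^bsub>Q\<^esub> (q \<otimes>\<^bsub>Q\<^esub> y) = \<iota> s \<otimes>\<^bsub>Q\<^esub> (y \<otimes>\<^bsub>Q\<^esub> q)" .
    qed (use zs y in auto)
    then show "q \<in> ring_center Q" using zs by (simp add: ring_center_def)
  qed
  have sA: "subring A Q"
  proof (rule Q.subringI)
    show "A \<subseteq> carrier Q" by (rule AQ)
    show "\<one>\<^bsub>Q\<^esub> \<in> A" using ZA [OF subringE(3) [OF sZ]] by simp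
    fix p q assume p: "p \<in> A" and q: "q \<in> A"
    obtain z s w t where zs: "z \<in> Z" "s \<in> S" "\<iota> s \<otimes>\<^bsub>Q\<^esub> p = \<iota> z" "p \<in> carrier Q"
      and wt: "w \<in> Z" "t \<in> S" "\<iota> t \<otimes>\<^bsub>Q\<^esub> q = \<iota> w" "q \<in> carrier Q"
      using AE [OF p] AE [OF q] by blast
    have stZ: "s \<in> Z" "t \<in> Z" "s \<in> carrier R" "t \<in> carrier R" "z \<in> carrier R" "w \<in> carrier R"
      using zs wt SZ ZR by auto
    have 1: "\<iota> (s \<otimes> t) \<otimes>\<^bsub>Q\<^esub> p = \<iota> t \<otimes>\<^bsub>Q\<^esub> \<iota> z"
      unfolding zs(3) [symmetric] S_comm [OF zs(2) stZ(4), symmetric] using zs(4) stZ by (simp add: Q.m_assoc)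
    have 2: "\<iota> (s \<otimes> t) \<otimes>\<^bsub>Q\<^esub> q = \<iota> s \<otimes>\<^bsub>Q\<^esub> \<iota> w"
      unfolding wt(3) [symmetric] using wt(4) stZ by (simp add: Q.m_assoc)
    have "\<iota> (s \<otimes> t) \<otimes>\<^bsub>Q\<^esub> (p \<oplus>\<^bsub>Q\<^esub> q) = \<iota> (s \<otimes> t) \<otimes>\<^bsub>Q\<^esub> p \<oplus>\<^bsub>Q\<^esub> \<iota> (s \<otimes> t) \<otimes>\<^bsub>Q\<^esub> q"
      using zs(4) wt(4) stZ by (intro Q.r_distr) auto
    also have "\<dots> = \<iota> (t \<otimes> z \<oplus> s \<otimes> w)" unfolding 1 2 using stZ by simp
    finally show "p \<oplus>\<^bsub>Q\<^esub> q \<in> A"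
      using zs wt stZ S_mult subringE(6,7) [OF sZ] by (intro AI [of _ "t \<otimes> z \<oplus> s \<otimes> w" "s \<otimes> t"]) auto
    have "\<iota> (s \<otimes> t) \<otimes>\<^bsub>Q\<^esub> (p \<otimes>\<^bsub>Q\<^esub> q) = \<iota> s \<otimes>\<^bsub>Q\<^esub> (\<iota> t \<otimes>\<^bsub>Q\<^esub> p) \<otimes>\<^bsub>Q\<^esub> q"
      using zs(4) wt(4) stZ by (simp add: Q.m_assoc)
    also have "\<dots> = (\<iota> s \<otimes>\<^bsub>Q\<^esub> p) \<otimes>\<^bsub>Q\<^esub> (\<iota> t \<otimes>\<^bsub>Q\<^esub> q)"
      unfolding Zcent [OF stZ(2) zs(4)] using zs(4) wt(4) stZ by (simp add: Q.m_assoc)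
    also have "\<dots> = \<iota> (z \<otimes> w)" unfolding zs(3) wt(3) using stZ by simp
    finally show "p \<otimes>\<^bsub>Q\<^esub> q \<in> A"
      using zs wt stZ S_mult subringE(6) [OF sZ] by (intro AI [of _ "z \<otimes> w" "s \<otimes> t"]) auto
  next
    fix p assume p: "p \<in> A"
    obtain z s where zs: "z \<in> Z" "s \<in> S" "\<iota> s \<otimes>\<^bsub>Q\<^esub> p = \<iota> z" "p \<in> carrier Q"
      using AE [OF p] by blast
    then show "\<ominus>\<^bsub>Q\<^esub> p \<in> A"
      using ZR subringE(5) [OF sZ] by (intro AI [of _ "\<ominus> z" s]) (auto simp: Q.r_minus)
  qed
  have Qnz: "\<one>\<^bsub>Q\<^esub> \<noteq> \<zero>\<^bsub>Q\<^esub>"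
    using nz Q(3) h.hom_one h.hom_zero unfolding inj_on_def by (metis one_closed zero_closed)
  \<comment> \<open>If the numerator z is regular, then s/z is an inverse of q. Otherwise z is
    nilpotent, and q is too, because the central unit s can be cancelled from the power.\<close>
  have Adich: "(\<exists>n::nat. q [^]\<^bsub>Q\<^esub> n = \<zero>\<^bsub>Q\<^esub>) \<or> (\<exists>b\<in>A. q \<otimes>\<^bsub>Q\<^esub> b = \<one>\<^bsub>Q\<^esub>)" if q: "q \<in> A" for q
  proof -
    obtain z s where zs: "z \<in> Z" "s \<in> S" "\<iota> s \<otimes>\<^bsub>Q\<^esub> q = \<iota> z" "q \<in> carrier Q"
      using AE [OF q] by blast
    have sR: "s \<in> Z" "s \<in> carrier R" "z \<in> carrier R" using zs SZ ZR by auto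
    show ?thesis
    proof (cases "z \<in> S")
      case True
      have "q \<otimes>\<^bsub>Q\<^esub> (\<iota> s \<otimes>\<^bsub>Q\<^esub> inv\<^bsub>Q\<^esub> (\<iota> z)) = (q \<otimes>\<^bsub>Q\<^esub> \<iota> s) \<otimes>\<^bsub>Q\<^esub> inv\<^bsub>Q\<^esub> (\<iota> z)"
        using unit [OF True] zs(4) sR by (simp add: Q.m_assoc)
      also have "\<dots> = \<one>\<^bsub>Q\<^esub>"
        unfolding Zcent [OF sR(1) zs(4), symmetric] zs(3) using unit [OF True] by simp
      finally show ?thesis
        using invA [OF True] ZA [OF sR(1)] subringE(6) [OF sA] by blast
    next
      case False
      then obtain n :: nat where n: "z [^] n = \<zero>" using dich [OF zs(1)] zs(1) unfolding S_def by blast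
      have "(\<iota> s \<otimes>\<^bsub>Q\<^esub> q) [^]\<^bsub>Q\<^esub> n = \<zero>\<^bsub>Q\<^esub>"
        unfolding zs(3) using n h.hom_nat_pow [OF sR(3), of n] by simp
      moreover have "(\<iota> s \<otimes>\<^bsub>Q\<^esub> q) [^]\<^bsub>Q\<^esub> n = \<iota> s [^]\<^bsub>Q\<^esub> n \<otimes>\<^bsub>Q\<^esub> q [^]\<^bsub>Q\<^esub> n"
        using Zcent [OF sR(1) zs(4)] zs(4) sR by (intro Q.pow_mult_distrib) auto
      moreover have "\<iota> s [^]\<^bsub>Q\<^esub> n \<in> Units Q" using Q.Units_pow_closed [OF unit [OF zs(2)]] .
      ultimately have "q [^]\<^bsub>Q\<^esub> n = \<zero>\<^bsub>Q\<^esub>"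
        using Q.Units_l_cancel [of "\<iota> s [^]\<^bsub>Q\<^esub> n" "q [^]\<^bsub>Q\<^esub> n" "\<zero>\<^bsub>Q\<^esub>"] zs(4) Q.Units_closed [of "\<iota> s [^]\<^bsub>Q\<^esub> n"] by simp
      then show ?thesis by blast
    qed
  qed
  \<comment> \<open>Contraction to \<open>R\<close> yields \<open>c\<close>-saturated submodules
    because \<open>c\<close> becomes invertible with inverse in \<open>A\<close>. It loses nothing,
    because every q becomes an element of \<open>R\<close> after multiplication by some s whose
    inverse is in \<open>A\<close>.\<close>
  have Aacc: "ascending_chain_condition {U. saturated_submodule A \<one>\<^bsub>Q\<^esub> Q U}"
  proof (rule acc_embed [OF acc, where f = "\<lambda>U. {x \<in> carrier R. \<iota> x \<in> U}"])
    fix U assume "U \<in> {U. saturated_submodule A \<one>\<^bsub>Q\<^esub> Q U}"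
    then have U: "saturated_submodule A \<one>\<^bsub>Q\<^esub> Q U" by simp
    note D = saturated_submoduleD(1-4) [OF U]
    have "saturated_submodule Z c R {x \<in> carrier R. \<iota> x \<in> U}"
    proof (rule saturated_submoduleI)
      fix x assume x: "x \<in> carrier R" "c \<otimes> x \<in> {x \<in> carrier R. \<iota> x \<in> U}"
      have cS: "c \<in> S" using c unfolding S_def by blast
      have "\<iota> c \<otimes>\<^bsub>Q\<^esub> \<iota> x \<in> U" using x cS by simp
      then have "inv\<^bsub>Q\<^esub> (\<iota> c) \<otimes>\<^bsub>Q\<^esub> (\<iota> c \<otimes>\<^bsub>Q\<^esub> \<iota> x) \<in> U" using D(4) invA [OF cS] by blast
      moreover have "inv\<^bsub>Q\<^esub> (\<iota> c) \<otimes>\<^bsub>Q\<^esub> (\<iota> c \<otimes>\<^bsub>Q\<^esub> \<iota> x) = \<iota> x"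
        using unit [OF cS] x cS by (simp add: Q.m_assoc [symmetric])
      ultimately show "x \<in> {x \<in> carrier R. \<iota> x \<in> U}" using x by simp
    qed (use D ZR ZA in auto)
    then show "{x \<in> carrier R. \<iota> x \<in> U} \<in> {U. saturated_submodule Z c R U}" by simp
    fix V assume "V \<in> {U. saturated_submodule A \<one>\<^bsub>Q\<^esub> Q U}" "U \<subseteq> V"
      and eq: "{x \<in> carrier R. \<iota> x \<in> U} = {x \<in> carrier R. \<iota> x \<in> V}"
    then have V: "saturated_submodule A \<one>\<^bsub>Q\<^esub> Q V" by simp
    note E = saturated_submoduleD(1-4) [OF V]
    have "q \<in> U" if q: "q \<in> V" for q
    proof -
      have qQ: "q \<in> carrier Q" using q E by blast
      obtain x s where xs: "x \<in> carrier R" "s \<in> S" "\<iota> s \<otimes>\<^bsub>Q\<^esub> q = \<iota> x" using frac qQ by blast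
      have "\<iota> s \<in> A" using ZA xs SZ by blast
      then have "\<iota> x \<in> V" using E(4) q xs(3) by metis
      then have "\<iota> x \<in> U" using eq xs by blast
      then have "inv\<^bsub>Q\<^esub> (\<iota> s) \<otimes>\<^bsub>Q\<^esub> \<iota> x \<in> U" using D(4) invA [OF xs(2)] by blast
      moreover have "inv\<^bsub>Q\<^esub> (\<iota> s) \<otimes>\<^bsub>Q\<^esub> \<iota> x = q"
        unfolding xs(3) [symmetric] using unit [OF xs(2)] qQ xs(2) by (simp add: Q.m_assoc [symmetric])
      ultimately show ?thesis by simp
    qed
    then show "U = V" using \<open>U \<subseteq> V\<close> by blast
  qed auto
  have "representable Q"
    using Q.central_local_representable [OF sA Acent Qnz Adich _ Aacc] h.nat_zero_or_unit_hom nat by blast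
  then show ?thesis using representable_embed Q by blast
qed

section \<open>Rings of additive maps and the compositum of two fields\<close>

text \<open>The pairs in \<open>P\<close> are operators to be intertwined. Multiplication and unit
  are parameters, so that one proof of the group laws covers both the group of additive maps between
  two fields and the commutant of a set of operators.\<close>

definition lin_maps ::
    "('a, 'm) ring_scheme \<Rightarrow> ('b, 'n) ring_scheme \<Rightarrow> (('a \<Rightarrow> 'a) \<times> ('b \<Rightarrow> 'b)) set \<Rightarrow>
      (('a \<Rightarrow> 'b) \<Rightarrow> ('a \<Rightarrow> 'b) \<Rightarrow> ('a \<Rightarrow> 'b)) \<Rightarrow> ('a \<Rightarrow> 'b) \<Rightarrow> ('a \<Rightarrow> 'b) ring"
  where "lin_maps G H P m e = \<lparr>
    carrier = {f \<in> carrier G \<rightarrow>\<^sub>E carrier H.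
      (\<forall>x\<in>carrier G. \<forall>y\<in>carrier G. f (x \<oplus>\<^bsub>G\<^esub> y) = f x \<oplus>\<^bsub>H\<^esub> f y) \<and>
      (\<forall>(\<phi>, \<psi>)\<in>P. \<forall>x\<in>carrier G. f (\<phi> x) = \<psi> (f x))},
    monoid.mult = m, one = e, zero = (\<lambda>x\<in>carrier G. \<zero>\<^bsub>H\<^esub>),
    add = (\<lambda>f g. \<lambda>x\<in>carrier G. f x \<oplus>\<^bsub>H\<^esub> g x) \<rparr>"

definition additive_endo :: "('a, 'm) ring_scheme \<Rightarrow> ('a \<Rightarrow> 'a) \<Rightarrow> bool"
  where "additive_endo G \<phi> \<longleftrightarrow> \<phi> \<in> carrier G \<rightarrow> carrier G \<and>
    (\<forall>x\<in>carrier G. \<forall>y\<in>carrier G. \<phi> (x \<oplus>\<^bsub>G\<^esub> y) = \<phi> x \<oplus>\<^bsub>G\<^esub> \<phi> y)"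

lemma lin_maps_abelian_group:
  assumes "abelian_group G" "abelian_group H"
    and P: "\<And>\<phi> \<psi>. (\<phi>, \<psi>) \<in> P \<Longrightarrow> \<phi> \<in> carrier G \<rightarrow> carrier G \<and> additive_endo H \<psi>"
  shows "abelian_group (lin_maps G H P m e)" (is "abelian_group ?L")
proof -
  interpret G: abelian_group G by fact
  interpret H: abelian_group H by fact
  have P0: "\<psi> \<zero>\<^bsub>H\<^esub> = \<zero>\<^bsub>H\<^esub>" and Pneg: "\<And>x. x \<in> carrier H \<Longrightarrow> \<psi> (\<ominus>\<^bsub>H\<^esub> x) = \<ominus>\<^bsub>H\<^esub> \<psi> x"
    and Pcl: "\<And>x. x \<in> carrier H \<Longrightarrow> \<psi> x \<in> carrier H"
    and Padd: "\<And>x y. x \<in> carrier H \<Longrightarrow> y \<in> carrier H \<Longrightarrow> \<psi> (x \<oplus>\<^bsub>H\<^esub> y) = \<psi> x \<oplus>\<^bsub>H\<^esub> \<psi> y"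
    and Gcl: "\<And>x. x \<in> carrier G \<Longrightarrow> \<phi> x \<in> carrier G"
    if "(\<phi>, \<psi>) \<in> P" for \<phi> \<psi>
  proof -
    have e: "additive_endo H \<psi>" and g: "\<phi> \<in> carrier G \<rightarrow> carrier G" using P that by auto
    show cl: "\<And>x. x \<in> carrier H \<Longrightarrow> \<psi> x \<in> carrier H"
      and add: "\<And>x y. x \<in> carrier H \<Longrightarrow> y \<in> carrier H \<Longrightarrow> \<psi> (x \<oplus>\<^bsub>H\<^esub> y) = \<psi> x \<oplus>\<^bsub>H\<^esub> \<psi> y"
      using e by (auto simp: additive_endo_def)
    have "\<psi> \<zero>\<^bsub>H\<^esub> \<oplus>\<^bsub>H\<^esub> \<psi> \<zero>\<^bsub>H\<^esub> = \<psi> \<zero>\<^bsub>H\<^esub>" using add [of "\<zero>\<^bsub>H\<^esub>" "\<zero>\<^bsub>H\<^esub>"] by simp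
    then show z: "\<psi> \<zero>\<^bsub>H\<^esub> = \<zero>\<^bsub>H\<^esub>" using cl [of "\<zero>\<^bsub>H\<^esub>"] by (simp add: H.add.l_cancel_one)
    show "\<psi> (\<ominus>\<^bsub>H\<^esub> x) = \<ominus>\<^bsub>H\<^esub> \<psi> x" if "x \<in> carrier H" for x
    proof -
      have "\<psi> (\<ominus>\<^bsub>H\<^esub> x) \<oplus>\<^bsub>H\<^esub> \<psi> x = \<zero>\<^bsub>H\<^esub>" using add [of "\<ominus>\<^bsub>H\<^esub> x" x] that z by (simp add: H.l_neg)
      then show ?thesis using that cl by (metis H.a_inv_closed H.minus_equality)
    qed
    show "\<And>x. x \<in> carrier G \<Longrightarrow> \<phi> x \<in> carrier G" using g by auto
  qed
  have mem: "f \<in> carrier ?L \<longleftrightarrow> f \<in> carrier G \<rightarrow>\<^sub>E carrier H \<and>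
      (\<forall>x\<in>carrier G. \<forall>y\<in>carrier G. f (x \<oplus>\<^bsub>G\<^esub> y) = f x \<oplus>\<^bsub>H\<^esub> f y) \<and>
      (\<forall>\<phi> \<psi>. (\<phi>, \<psi>) \<in> P \<longrightarrow> (\<forall>x\<in>carrier G. f (\<phi> x) = \<psi> (f x)))" for f
    by (auto simp: lin_maps_def)
  have app: "f x \<in> carrier H" if "f \<in> carrier ?L" "x \<in> carrier G" for f x
    using that by (auto simp: mem)
  have eqI: "f = g" if "f \<in> carrier ?L" "g \<in> carrier ?L" "\<And>x. x \<in> carrier G \<Longrightarrow> f x = g x" for f g
    using that by (intro PiE_ext [of f "carrier G" _ g]) (auto simp: mem)
  have add: "(f \<oplus>\<^bsub>?L\<^esub> g) x = f x \<oplus>\<^bsub>H\<^esub> g x" if "x \<in> carrier G" for f g x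
    using that by (simp add: lin_maps_def)
  have zero: "\<zero>\<^bsub>?L\<^esub> x = \<zero>\<^bsub>H\<^esub>" if "x \<in> carrier G" for x
    using that by (simp add: lin_maps_def)
  have ext: "f \<oplus>\<^bsub>?L\<^esub> g \<in> extensional (carrier G)" "\<zero>\<^bsub>?L\<^esub> \<in> extensional (carrier G)" for f g
    by (simp_all add: lin_maps_def)
  have addL: "f \<oplus>\<^bsub>?L\<^esub> g \<in> carrier ?L" if "f \<in> carrier ?L" "g \<in> carrier ?L" for f g
    unfolding mem
  proof (intro conjI ballI allI impI)
    show "f \<oplus>\<^bsub>?L\<^esub> g \<in> carrier G \<rightarrow>\<^sub>E carrier H" using app that ext by (auto simp: PiE_def add)
    fix x y assume "x \<in> carrier G" "y \<in> carrier G"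
    then show "(f \<oplus>\<^bsub>?L\<^esub> g) (x \<oplus>\<^bsub>G\<^esub> y) = (f \<oplus>\<^bsub>?L\<^esub> g) x \<oplus>\<^bsub>H\<^esub> (f \<oplus>\<^bsub>?L\<^esub> g) y"
      using app [OF that(1)] app [OF that(2)] that by (simp add: add mem H.a_ac)
  next
    fix \<phi> \<psi> x assume p: "(\<phi>, \<psi>) \<in> P" "x \<in> carrier G"
    then show "(f \<oplus>\<^bsub>?L\<^esub> g) (\<phi> x) = \<psi> ((f \<oplus>\<^bsub>?L\<^esub> g) x)"
      using Gcl [OF p] Padd [OF p(1) app [OF that(1) p(2)] app [OF that(2) p(2)]] that
      by (simp add: add mem)
  qed
  have zeroL: "\<zero>\<^bsub>?L\<^esub> \<in> carrier ?L"
    unfolding mem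
  proof (intro conjI ballI allI impI)
    show "\<zero>\<^bsub>?L\<^esub> \<in> carrier G \<rightarrow>\<^sub>E carrier H" using ext by (auto simp: PiE_def zero)
    fix \<phi> \<psi> x assume p: "(\<phi>, \<psi>) \<in> P" "x \<in> carrier G"
    then show "\<zero>\<^bsub>?L\<^esub> (\<phi> x) = \<psi> (\<zero>\<^bsub>?L\<^esub> x)"
      using Gcl [OF p] P0 [OF p(1)] by (simp add: zero)
  qed (simp add: zero)
  show ?thesis
  proof (rule abelian_groupI)
    fix f assume f: "f \<in> carrier ?L"
    define g where "g = (\<lambda>x\<in>carrier G. \<ominus>\<^bsub>H\<^esub> f x)"
    have "g \<in> carrier ?L"
      unfolding mem
    proof (intro conjI ballI allI impI)
      show "g \<in> carrier G \<rightarrow>\<^sub>E carrier H" using app f by (auto simp: g_def)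
      fix x y assume "x \<in> carrier G" "y \<in> carrier G"
      then show "g (x \<oplus>\<^bsub>G\<^esub> y) = g x \<oplus>\<^bsub>H\<^esub> g y"
        using app [OF f] f by (simp add: g_def mem H.minus_add)
    next
      fix \<phi> \<psi> x assume p: "(\<phi>, \<psi>) \<in> P" "x \<in> carrier G"
      then show "g (\<phi> x) = \<psi> (g x)"
        using Gcl [OF p] Pneg [OF p(1) app [OF f p(2)]] f by (simp add: g_def mem)
    qed
    moreover have "g \<oplus>\<^bsub>?L\<^esub> f = \<zero>\<^bsub>?L\<^esub>"
      using f \<open>g \<in> carrier ?L\<close> app [OF f] by (intro eqI addL zeroL) (auto simp: add zero g_def H.l_neg)
    ultimately show "\<exists>g\<in>carrier ?L. g \<oplus>\<^bsub>?L\<^esub> f = \<zero>\<^bsub>?L\<^esub>" by blast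
  next
    fix f g assume fg: "f \<in> carrier ?L" "g \<in> carrier ?L"
    then show "f \<oplus>\<^bsub>?L\<^esub> g = g \<oplus>\<^bsub>?L\<^esub> f"
      by (intro eqI addL) (auto simp: add app H.a_comm)
    fix h assume "h \<in> carrier ?L"
    then show "f \<oplus>\<^bsub>?L\<^esub> g \<oplus>\<^bsub>?L\<^esub> h = f \<oplus>\<^bsub>?L\<^esub> (g \<oplus>\<^bsub>?L\<^esub> h)"
      using fg by (intro eqI addL) (auto simp: add app H.a_assoc)
  next
    fix f assume "f \<in> carrier ?L"
    then show "\<zero>\<^bsub>?L\<^esub> \<oplus>\<^bsub>?L\<^esub> f = f"
      by (intro eqI addL zeroL) (auto simp: add zero app)
  qed (use addL zeroL in auto)
qed

text \<open>Multiplication is composition in the opposite order, so that right multiplications form a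
  homomorphic image of a ring.\<close>

definition commutant_ring :: "('a, 'm) ring_scheme \<Rightarrow> ('a \<Rightarrow> 'a) set \<Rightarrow> ('a \<Rightarrow> 'a) ring"
  where "commutant_ring G \<Phi> = lin_maps G G ((\<lambda>\<phi>. (\<phi>, \<phi>)) ` \<Phi>)
    (\<lambda>f g. \<lambda>x\<in>carrier G. g (f x)) (\<lambda>x\<in>carrier G. x)"

lemma commutant_ring_mem:
  "f \<in> carrier (commutant_ring G \<Phi>) \<longleftrightarrow> f \<in> extensional (carrier G) \<and> additive_endo G f \<and>
    (\<forall>\<phi>\<in>\<Phi>. \<forall>x\<in>carrier G. f (\<phi> x) = \<phi> (f x))"
  by (auto simp: commutant_ring_def lin_maps_def additive_endo_def PiE_def)

lemma commutant_ring_simps: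
  assumes "x \<in> carrier G"
  shows "(f \<otimes>\<^bsub>commutant_ring G \<Phi>\<^esub> g) x = g (f x)" "(f \<oplus>\<^bsub>commutant_ring G \<Phi>\<^esub> g) x = f x \<oplus>\<^bsub>G\<^esub> g x"
    "\<one>\<^bsub>commutant_ring G \<Phi>\<^esub> x = x" "\<zero>\<^bsub>commutant_ring G \<Phi>\<^esub> x = \<zero>\<^bsub>G\<^esub>"
  using assms by (simp_all add: commutant_ring_def lin_maps_def)

lemma commutant_ring_app:
  "f \<in> carrier (commutant_ring G \<Phi>) \<Longrightarrow> x \<in> carrier G \<Longrightarrow> f x \<in> carrier G"
  "f \<in> carrier (commutant_ring G \<Phi>) \<Longrightarrow> x \<in> carrier G \<Longrightarrow> y \<in> carrier G \<Longrightarrow>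
    f (x \<oplus>\<^bsub>G\<^esub> y) = f x \<oplus>\<^bsub>G\<^esub> f y"
  by (auto simp: commutant_ring_mem additive_endo_def)

lemma commutant_ring_eqI:
  assumes "f \<in> carrier (commutant_ring G \<Phi>)" "g \<in> carrier (commutant_ring G \<Phi>)"
    "\<And>x. x \<in> carrier G \<Longrightarrow> f x = g x"
  shows "f = g"
  using assms by (intro extensionalityI [of f "carrier G" g]) (auto simp: commutant_ring_mem)

lemma commutant_ring_is_ring:
  assumes "abelian_group G" and \<Phi>: "\<And>\<phi>. \<phi> \<in> \<Phi> \<Longrightarrow> additive_endo G \<phi>"
  shows "ring (commutant_ring G \<Phi>)" (is "ring ?C")
proof (rule ringI)
  interpret G: abelian_group G by fact
  show ab: "abelian_group ?C"
    unfolding commutant_ring_def using assms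
    by (intro lin_maps_abelian_group) (auto simp: additive_endo_def)
  interpret C: abelian_group ?C by (rule ab)
  have \<Phi>c: "\<phi> x \<in> carrier G" if "\<phi> \<in> \<Phi>" "x \<in> carrier G" for \<phi> x
    using \<Phi> that by (auto simp: additive_endo_def)
  have cl: "f \<otimes>\<^bsub>?C\<^esub> g \<in> carrier ?C" if "f \<in> carrier ?C" "g \<in> carrier ?C" for f g
  proof -
    have "f \<otimes>\<^bsub>?C\<^esub> g \<in> extensional (carrier G)" by (simp add: commutant_ring_def lin_maps_def)
    moreover have "additive_endo G (f \<otimes>\<^bsub>?C\<^esub> g)"
      using commutant_ring_app [OF that(1)] commutant_ring_app [OF that(2)]
      by (auto simp: additive_endo_def commutant_ring_simps)
    moreover have "(f \<otimes>\<^bsub>?C\<^esub> g) (\<phi> x) = \<phi> ((f \<otimes>\<^bsub>?C\<^esub> g) x)" if "\<phi> \<in> \<Phi>" "x \<in> carrier G" for \<phi> x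
      using \<Phi>c [OF that] that commutant_ring_app(1) [OF \<open>f \<in> carrier ?C\<close>] \<open>f \<in> _\<close> \<open>g \<in> _\<close>
      by (simp add: commutant_ring_simps commutant_ring_mem)
    ultimately show ?thesis by (simp add: commutant_ring_mem)
  qed
  have one: "\<one>\<^bsub>?C\<^esub> \<in> carrier ?C"
  proof -
    have "\<one>\<^bsub>?C\<^esub> \<in> extensional (carrier G)" by (simp add: commutant_ring_def lin_maps_def)
    then show ?thesis
      using \<Phi>c by (simp add: commutant_ring_mem additive_endo_def commutant_ring_simps)
  qed
  note app = commutant_ring_app
  show "monoid ?C"
  proof (rule monoidI)
    fix f g h assume fgh: "f \<in> carrier ?C" "g \<in> carrier ?C" "h \<in> carrier ?C"
    show "f \<otimes>\<^bsub>?C\<^esub> g \<otimes>\<^bsub>?C\<^esub> h = f \<otimes>\<^bsub>?C\<^esub> (g \<otimes>\<^bsub>?C\<^esub> h)"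
      using fgh by (intro commutant_ring_eqI [of _ G \<Phi>] cl) (auto simp: commutant_ring_simps app)
  next
    fix f assume f: "f \<in> carrier ?C"
    show "\<one>\<^bsub>?C\<^esub> \<otimes>\<^bsub>?C\<^esub> f = f" "f \<otimes>\<^bsub>?C\<^esub> \<one>\<^bsub>?C\<^esub> = f"
      using f one by (auto intro!: commutant_ring_eqI [of _ G \<Phi>] cl simp: commutant_ring_simps app)
  qed (use cl one in auto)
  fix f g h assume fgh: "f \<in> carrier ?C" "g \<in> carrier ?C" "h \<in> carrier ?C"
  show "(f \<oplus>\<^bsub>?C\<^esub> g) \<otimes>\<^bsub>?C\<^esub> h = f \<otimes>\<^bsub>?C\<^esub> h \<oplus>\<^bsub>?C\<^esub> g \<otimes>\<^bsub>?C\<^esub> h"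
    using fgh by (intro commutant_ring_eqI [of _ G \<Phi>] cl C.a_closed) (auto simp: commutant_ring_simps app)
  show "h \<otimes>\<^bsub>?C\<^esub> (f \<oplus>\<^bsub>?C\<^esub> g) = h \<otimes>\<^bsub>?C\<^esub> f \<oplus>\<^bsub>?C\<^esub> h \<otimes>\<^bsub>?C\<^esub> g"
    using fgh by (intro commutant_ring_eqI [of _ G \<Phi>] cl C.a_closed) (auto simp: commutant_ring_simps app)
qed

section \<open>Maximal ideals, an additive functional between fields, and the compositum\<close>

lemma (in cring) exists_maximal_ideal:
  assumes "\<one> \<noteq> \<zero>"
  shows "\<exists>M. maximalideal M R"
proof -
  let ?F = "{I. ideal I R \<and> \<one> \<notin> I}"
  have "\<exists>M\<in>?F. \<forall>X\<in>?F. M \<subseteq> X \<longrightarrow> X = M"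
  proof (rule subset_Zorn_nonempty)
    show "?F \<noteq> {}" using zeroideal assms by blast
    fix \<C> assume C: "\<C> \<noteq> {}" "subset.chain ?F \<C>"
    then have id: "ideal I R" "\<one> \<notin> I" if "I \<in> \<C>" for I using that by (auto simp: subset_chain_def)
    have idI: "additive_subgroup I R" if "I \<in> \<C>" for I using id(1) [OF that] by (rule ideal.axioms(1))
    have common: "\<exists>I\<in>\<C>. x \<in> I \<and> y \<in> I" if "x \<in> \<Union>\<C>" "y \<in> \<Union>\<C>" for x y
      using that C(2) unfolding subset_chain_def by (metis Union_iff subsetD)
    have "ideal (\<Union>\<C>) R"
    proof (rule idealI)
      show "subgroup (\<Union>\<C>) (add_monoid R)"
      proof
        show "\<Union>\<C> \<subseteq> carrier (add_monoid R)"
          using ideal.Icarr [OF id(1)] by auto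
        show "\<one>\<^bsub>add_monoid R\<^esub> \<in> \<Union>\<C>"
          using C(1) additive_subgroup.zero_closed [OF idI] by auto
        fix x y assume "x \<in> \<Union>\<C>" "y \<in> \<Union>\<C>"
        then obtain I where "I \<in> \<C>" "x \<in> I" "y \<in> I" using common by blast
        then show "x \<otimes>\<^bsub>add_monoid R\<^esub> y \<in> \<Union>\<C>"
          using additive_subgroup.a_closed [OF idI] by auto
      next
        fix x assume "x \<in> \<Union>\<C>"
        then obtain I where I: "I \<in> \<C>" "x \<in> I" by blast
        then have "\<ominus> x \<in> I" using additive_subgroup.a_inv_closed [OF idI] by blast
        then show "inv\<^bsub>add_monoid R\<^esub> x \<in> \<Union>\<C>" using I by (auto simp: a_inv_def)
      qed
    next
      show "ring R" by (rule ring_axioms)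
      fix a x assume "a \<in> \<Union>\<C>" "x \<in> carrier R"
      then show "x \<otimes> a \<in> \<Union>\<C>" "a \<otimes> x \<in> \<Union>\<C>"
        using ideal.I_l_closed [OF id(1)] ideal.I_r_closed [OF id(1)] by blast+
    qed
    then show "\<Union>\<C> \<in> ?F" using id by blast
  qed
  then obtain M where M: "ideal M R" "\<one> \<notin> M" and max: "\<And>X. ideal X R \<Longrightarrow> \<one> \<notin> X \<Longrightarrow> M \<subseteq> X \<Longrightarrow> X = M"
    by blast
  have "maximalideal M R"
  proof (rule maximalidealI [OF M(1)])
    show "carrier R \<noteq> M" using M by auto
    fix J assume J: "ideal J R" "M \<subseteq> J" "J \<subseteq> carrier R"
    show "J = M \<or> J = carrier R"
      using max [OF J(1) _ J(2)] ideal.one_imp_carrier [OF J(1)] by blast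
  qed
  then show ?thesis by blast
qed

text \<open>An additive map that sends 1 to 1 exists because the prime fields agree: take a maximal
  subspace \<open>H\<close> over the prime field that avoids 1, and project along it.\<close>

lemma (in field) prime_complement:
  defines "e \<equiv> \<lambda>n::int. [n] \<cdot> \<one>"
  shows "\<exists>H. H \<subseteq> carrier R \<and> \<zero> \<in> H \<and> (\<forall>x\<in>H. \<forall>y\<in>H. x \<oplus> y \<in> H) \<and> (\<forall>n. \<forall>x\<in>H. e n \<otimes> x \<in> H) \<and>
    (\<forall>n. e n \<in> H \<longrightarrow> e n = \<zero>) \<and> (\<forall>x\<in>carrier R. \<exists>n m. \<exists>h\<in>H. e n \<noteq> \<zero> \<and> e n \<otimes> x = e m \<oplus> h)"
proof -
  have ec [simp]: "e n \<in> carrier R" for n by (simp add: e_def)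
  have eadd: "e (n + m) = e n \<oplus> e m" for n m by (simp add: e_def add.int_pow_mult)
  have emult: "e (n * m) = e n \<otimes> e m" for n m
    by (simp add: e_def add_pow_ldistr_int add.int_pow_pow mult.commute)
  have eneg: "e (- n) = \<ominus> e n" for n by (simp add: e_def add.int_pow_neg)
  have e1: "e 1 = \<one>" and e0: "e 0 = \<zero>" by (simp_all add: e_def add_pow_int_ge)
  have enz: "e n \<otimes> e m \<noteq> \<zero>" if "e n \<noteq> \<zero>" "e m \<noteq> \<zero>" for n m
    using that integral [of "e n" "e m"] by auto
  \<comment> \<open>Closure under division by nonzero integers makes these groups the subspaces over
    the prime field, without that field being constructed.\<close>
  define P where "P H \<longleftrightarrow> H \<subseteq> carrier R \<and> \<zero> \<in> H \<and> (\<forall>x\<in>H. \<forall>y\<in>H. x \<oplus> y \<in> H) \<and>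
    (\<forall>n. \<forall>x\<in>H. e n \<otimes> x \<in> H) \<and> (\<forall>n. \<forall>x\<in>carrier R. e n \<noteq> \<zero> \<longrightarrow> e n \<otimes> x \<in> H \<longrightarrow> x \<in> H)" for H
  let ?F = "{H. P H \<and> \<one> \<notin> H}"
  have "\<exists>M\<in>?F. \<forall>X\<in>?F. M \<subseteq> X \<longrightarrow> X = M"
  proof (rule subset_Zorn_nonempty)
    have z: "x = \<zero>" if "x \<in> carrier R" "e n \<noteq> \<zero>" "e n \<otimes> x = \<zero>" for n x
      using that integral [of "e n" x] by auto
    have "P {\<zero>}"
      unfolding P_def
    proof (intro conjI ballI allI impI)
      fix n x assume "x \<in> carrier R" "e n \<noteq> \<zero>" "e n \<otimes> x \<in> {\<zero>}"
      then show "x \<in> {\<zero>}" using z by blast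
    qed simp_all
    then show "?F \<noteq> {}" by auto
    fix \<C> assume C: "\<C> \<noteq> {}" "subset.chain ?F \<C>"
    then have id: "P I" "\<one> \<notin> I" if "I \<in> \<C>" for I using that by (auto simp: subset_chain_def)
    have common: "\<exists>I\<in>\<C>. x \<in> I \<and> y \<in> I" if "x \<in> \<Union>\<C>" "y \<in> \<Union>\<C>" for x y
      using that C(2) unfolding subset_chain_def by (metis Union_iff subsetD)
    have "x \<oplus> y \<in> \<Union>\<C>" if "x \<in> \<Union>\<C>" "y \<in> \<Union>\<C>" for x y
      using common [OF that] id(1) unfolding P_def by (meson UnionI)
    moreover have "\<Union>\<C> \<subseteq> carrier R" "\<zero> \<in> \<Union>\<C>" using id(1) C(1) unfolding P_def by blast+
    moreover have "e n \<otimes> x \<in> \<Union>\<C>" if "x \<in> \<Union>\<C>" for n x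
      using that id(1) unfolding P_def by (meson UnionE UnionI)
    moreover have "x \<in> \<Union>\<C>" if "x \<in> carrier R" "e n \<noteq> \<zero>" "e n \<otimes> x \<in> \<Union>\<C>" for n x
      using that id(1) unfolding P_def by (meson UnionE UnionI)
    ultimately have "P (\<Union>\<C>)" unfolding P_def by blast
    then show "\<Union>\<C> \<in> ?F" using id(2) by blast
  qed
  then obtain H where H: "P H" "\<one> \<notin> H" and max: "\<And>X. P X \<Longrightarrow> \<one> \<notin> X \<Longrightarrow> H \<subseteq> X \<Longrightarrow> X = H" by blast
  have HR: "H \<subseteq> carrier R" and H0: "\<zero> \<in> H" and Ha: "\<And>x y. x \<in> H \<Longrightarrow> y \<in> H \<Longrightarrow> x \<oplus> y \<in> H"
    and He: "\<And>n x. x \<in> H \<Longrightarrow> e n \<otimes> x \<in> H"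
    and Hp: "\<And>n x. x \<in> carrier R \<Longrightarrow> e n \<noteq> \<zero> \<Longrightarrow> e n \<otimes> x \<in> H \<Longrightarrow> x \<in> H"
    using H(1) unfolding P_def by blast+
  have H1: "e n = \<zero>" if "e n \<in> H" for n
    using Hp [of \<one> n] that H(2) by auto
  have "\<exists>n m. \<exists>h\<in>H. e n \<noteq> \<zero> \<and> e n \<otimes> x = e m \<oplus> h" if x: "x \<in> carrier R" for x
  proof (cases "x \<in> H")
    case True
    then have "e 1 \<noteq> \<zero> \<and> e 1 \<otimes> x = e 0 \<oplus> x" using x by (simp add: e0 e1)
    then show ?thesis using True by blast
  next
    case False
    \<comment> \<open>The span of \<open>H\<close> and \<open>x\<close> over the prime field, with
      denominators cleared on the left.\<close>
    define X where "X = {y \<in> carrier R. \<exists>k j. \<exists>h\<in>H. e k \<noteq> \<zero> \<and> e k \<otimes> y = e j \<otimes> x \<oplus> h}"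
    have XI: "y \<in> X" if "y \<in> carrier R" "e k \<noteq> \<zero>" "e k \<otimes> y = e j \<otimes> x \<oplus> h" "h \<in> H" for y k j h
      using that by (auto simp: X_def)
    have "P X"
      unfolding P_def
    proof (intro conjI ballI allI impI)
      show "X \<subseteq> carrier R" by (auto simp: X_def)
      show "\<zero> \<in> X" using XI [of \<zero> 1 0 \<zero>] H0 x by (simp add: e0 e1)
      fix y z assume "y \<in> X" "z \<in> X"
      then obtain k j h l i g where a: "h \<in> H" "e k \<noteq> \<zero>" "e k \<otimes> y = e j \<otimes> x \<oplus> h" "y \<in> carrier R"
        and b: "g \<in> H" "e l \<noteq> \<zero>" "e l \<otimes> z = e i \<otimes> x \<oplus> g" "z \<in> carrier R" unfolding X_def by blast
      have c: "h \<in> carrier R" "g \<in> carrier R" using a b HR by auto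
      have "e (k * l) \<otimes> (y \<oplus> z) = e l \<otimes> (e k \<otimes> y) \<oplus> e k \<otimes> (e l \<otimes> z)"
        unfolding emult using a(4) b(4) ec [of k] ec [of l] by algebra
      also have "\<dots> = (e l \<otimes> e j \<oplus> e k \<otimes> e i) \<otimes> x \<oplus> (e l \<otimes> h \<oplus> e k \<otimes> g)"
        unfolding a(3) b(3) using c x ec [of k] ec [of l] ec [of i] ec [of j] by algebra
      finally have "e (k * l) \<otimes> (y \<oplus> z) = e (l * j + k * i) \<otimes> x \<oplus> (e l \<otimes> h \<oplus> e k \<otimes> g)"
        by (simp only: eadd emult)
      then show "y \<oplus> z \<in> X"
        by (rule XI [rotated 2]) (use a b He Ha enz in \<open>auto simp: emult\<close>)
    next
      fix n y assume "y \<in> X"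
      then obtain k j h where a: "h \<in> H" "e k \<noteq> \<zero>" "e k \<otimes> y = e j \<otimes> x \<oplus> h" "y \<in> carrier R"
        unfolding X_def by blast
      have c: "h \<in> carrier R" using a HR by auto
      have "e k \<otimes> (e n \<otimes> y) = e n \<otimes> (e k \<otimes> y)" using a(4) ec [of k] ec [of n] by algebra
      also have "\<dots> = e (n * j) \<otimes> x \<oplus> e n \<otimes> h"
        unfolding a(3) emult using c x ec [of n] ec [of j] by algebra
      finally show "e n \<otimes> y \<in> X"
        by (rule XI [rotated 2]) (use a He in auto)
    next
      fix n y assume y: "y \<in> carrier R" "e n \<noteq> \<zero>" "e n \<otimes> y \<in> X"
      then obtain k j h where a: "h \<in> H" "e k \<noteq> \<zero>" "e k \<otimes> (e n \<otimes> y) = e j \<otimes> x \<oplus> h"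
        unfolding X_def by blast
      then have "e (k * n) \<otimes> y = e j \<otimes> x \<oplus> h" using y(1) by (simp add: emult m_assoc)
      then show "y \<in> X"
        by (rule XI [rotated 2]) (use a y enz in \<open>auto simp: emult\<close>)
    qed
    moreover have "H \<subseteq> X"
    proof
      fix h assume "h \<in> H"
      then show "h \<in> X" using XI [of h 1 0 h] HR x by (auto simp: e0 e1)
    qed
    moreover have "x \<in> X" using XI [of x 1 1 \<zero>] H0 x by (simp add: e1)
    \<comment> \<open>Since \<open>x\<close> is outside \<open>H\<close>, maximality forces 1 into
      the span. The coefficient of \<open>x\<close> in the resulting relation is nonzero because
      \<open>H\<close> meets the prime field only in zero, so the relation can be solved for
      \<open>x\<close>.\<close>
    ultimately have "\<one> \<in> X" using max False by blast
    then obtain k j h where a: "h \<in> H" "e k \<noteq> \<zero>" "e k \<otimes> \<one> = e j \<otimes> x \<oplus> h" unfolding X_def by blast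
    have c: "h \<in> carrier R" using a HR by auto
    have "e j \<noteq> \<zero>"
    proof
      assume "e j = \<zero>"
      then have "e k = h" using a c x by simp
      then show False using H1 a by auto
    qed
    moreover have "e j \<otimes> x = e k \<oplus> e (- 1) \<otimes> h"
    proof -
      have "e k \<oplus> e (- 1) \<otimes> h = e k \<otimes> \<one> \<ominus> h"
        using c ec [of k] by (simp add: eneg e1 l_minus minus_eq)
      also have "\<dots> = e j \<otimes> x" unfolding a(3) using c x ec [of j] by algebra
      finally show ?thesis ..
    qed
    ultimately show ?thesis using He [OF a(1)] by blast
  qed
  then show ?thesis
    using HR H0 Ha He H1 by (intro exI [of _ H]) simp
qed

lemma additive_functional:
  fixes K :: "('k, 'm) ring_scheme" and L :: "('l, 'n) ring_scheme"
  assumes "field K" "field L"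
    and char: "\<And>n::nat. [n] \<cdot>\<^bsub>K\<^esub> \<one>\<^bsub>K\<^esub> = \<zero>\<^bsub>K\<^esub> \<longleftrightarrow> [n] \<cdot>\<^bsub>L\<^esub> \<one>\<^bsub>L\<^esub> = \<zero>\<^bsub>L\<^esub>"
  shows "\<exists>f\<in>carrier K \<rightarrow> carrier L. f \<one>\<^bsub>K\<^esub> = \<one>\<^bsub>L\<^esub> \<and>
    (\<forall>x\<in>carrier K. \<forall>y\<in>carrier K. f (x \<oplus>\<^bsub>K\<^esub> y) = f x \<oplus>\<^bsub>L\<^esub> f y)"
proof -
  interpret K: field K by fact
  interpret L: field L by fact
  define e where "e n = [(n::int)] \<cdot>\<^bsub>K\<^esub> \<one>\<^bsub>K\<^esub>" for n
  define d where "d n = [(n::int)] \<cdot>\<^bsub>L\<^esub> \<one>\<^bsub>L\<^esub>" for n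
  have ec [simp]: "e n \<in> carrier K" "d n \<in> carrier L" for n by (simp_all add: e_def d_def)
  have eadd: "e (n + m) = e n \<oplus>\<^bsub>K\<^esub> e m" "d (n + m) = d n \<oplus>\<^bsub>L\<^esub> d m" for n m
    by (simp_all add: e_def d_def K.add.int_pow_mult L.add.int_pow_mult)
  have emult: "e (n * m) = e n \<otimes>\<^bsub>K\<^esub> e m" "d (n * m) = d n \<otimes>\<^bsub>L\<^esub> d m" for n m
    by (simp_all add: e_def d_def K.add_pow_ldistr_int K.add.int_pow_pow L.add_pow_ldistr_int L.add.int_pow_pow mult.commute)
  have eneg: "e (- n) = \<ominus>\<^bsub>K\<^esub> e n" "d (- n) = \<ominus>\<^bsub>L\<^esub> d n" for n
    by (simp_all add: e_def d_def K.add.int_pow_neg L.add.int_pow_neg)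
  have e1: "e 1 = \<one>\<^bsub>K\<^esub>" "d 1 = \<one>\<^bsub>L\<^esub>" and e0: "e 0 = \<zero>\<^bsub>K\<^esub>" "d 0 = \<zero>\<^bsub>L\<^esub>"
    by (simp_all add: e_def d_def add_pow_int_ge)
  have ed: "e n = \<zero>\<^bsub>K\<^esub> \<longleftrightarrow> d n = \<zero>\<^bsub>L\<^esub>" for n
  proof (cases "n \<ge> 0")
    case True
    then show ?thesis using char [of "nat n"] by (simp add: e_def d_def add_pow_int_ge)
  next
    case False
    then have "e (- n) = \<zero>\<^bsub>K\<^esub> \<longleftrightarrow> d (- n) = \<zero>\<^bsub>L\<^esub>"
      using char [of "nat (- n)"] by (simp add: e_def d_def add_pow_int_ge)
    then show ?thesis
      unfolding eneg by (metis K.minus_zero L.minus_zero K.minus_minus L.minus_minus ec)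
  qed
  obtain H where HR: "H \<subseteq> carrier K" and H0: "\<zero>\<^bsub>K\<^esub> \<in> H" and Ha: "\<And>x y. x \<in> H \<Longrightarrow> y \<in> H \<Longrightarrow> x \<oplus>\<^bsub>K\<^esub> y \<in> H"
    and He: "\<And>n x. x \<in> H \<Longrightarrow> e n \<otimes>\<^bsub>K\<^esub> x \<in> H" and H1: "\<And>n. e n \<in> H \<Longrightarrow> e n = \<zero>\<^bsub>K\<^esub>"
    and Hx: "\<And>x. x \<in> carrier K \<Longrightarrow> \<exists>n m. \<exists>h\<in>H. e n \<noteq> \<zero>\<^bsub>K\<^esub> \<and> e n \<otimes>\<^bsub>K\<^esub> x = e m \<oplus>\<^bsub>K\<^esub> h"
    using K.prime_complement [folded e_def] by metis
  \<comment> \<open>If x = m/n + h with h in \<open>H\<close>, the value is to be m/n computed in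
    \<open>L\<close>. Both conditions are written with denominators cleared.\<close>
  define rel where "rel x q \<longleftrightarrow> q \<in> carrier L \<and> (\<exists>n m. \<exists>h\<in>H. e n \<noteq> \<zero>\<^bsub>K\<^esub> \<and> e n \<otimes>\<^bsub>K\<^esub> x = e m \<oplus>\<^bsub>K\<^esub> h \<and>
    d n \<otimes>\<^bsub>L\<^esub> q = d m)" for x q
  have relI: "rel x q" if "q \<in> carrier L" "e n \<noteq> \<zero>\<^bsub>K\<^esub>" "e n \<otimes>\<^bsub>K\<^esub> x = e m \<oplus>\<^bsub>K\<^esub> h" "h \<in> H" "d n \<otimes>\<^bsub>L\<^esub> q = d m" for x q n m h
    using that unfolding rel_def by blast
  have ex: "\<exists>q. rel x q" if x: "x \<in> carrier K" for x
  proof -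
    obtain n m h where a: "h \<in> H" "e n \<noteq> \<zero>\<^bsub>K\<^esub>" "e n \<otimes>\<^bsub>K\<^esub> x = e m \<oplus>\<^bsub>K\<^esub> h" using Hx [OF x] by blast
    then have u: "d n \<in> Units L" using ed [of n] by (simp add: L.field_Units)
    have "rel x (inv\<^bsub>L\<^esub> (d n) \<otimes>\<^bsub>L\<^esub> d m)"
      by (rule relI [OF _ a(2,3,1)]) (use u in \<open>auto simp: L.m_assoc [symmetric]\<close>)
    then show ?thesis by blast
  qed
  have uniq: "q = r" if rq: "rel x q" and rr: "rel x r" and rx: "x \<in> carrier K" for x q r
  proof -
    obtain n m h where a: "h \<in> H" "e n \<noteq> \<zero>\<^bsub>K\<^esub>" "e n \<otimes>\<^bsub>K\<^esub> x = e m \<oplus>\<^bsub>K\<^esub> h" "d n \<otimes>\<^bsub>L\<^esub> q = d m" "q \<in> carrier L"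
      using rq unfolding rel_def by blast
    obtain n' m' h' where b: "h' \<in> H" "e n' \<noteq> \<zero>\<^bsub>K\<^esub>" "e n' \<otimes>\<^bsub>K\<^esub> x = e m' \<oplus>\<^bsub>K\<^esub> h'" "d n' \<otimes>\<^bsub>L\<^esub> r = d m'" "r \<in> carrier L"
      using rr unfolding rel_def by blast
    have c: "h \<in> carrier K" "h' \<in> carrier K" using a b HR by auto
    \<comment> \<open>Eliminating x from the two expressions shows that this integer multiple of 1
      lies in \<open>H\<close>. Hence it vanishes in \<open>K\<close> and, the characteristics being
      equal, its counterpart vanishes in \<open>L\<close>.\<close>
    have "e (n' * m - n * m') = e n' \<otimes>\<^bsub>K\<^esub> e m \<ominus>\<^bsub>K\<^esub> e n \<otimes>\<^bsub>K\<^esub> e m'"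
      unfolding diff_conv_add_uminus eadd eneg emult by (simp add: K.minus_eq)
    also have "\<dots> = (e n \<otimes>\<^bsub>K\<^esub> (e m' \<oplus>\<^bsub>K\<^esub> h') \<ominus>\<^bsub>K\<^esub> e n' \<otimes>\<^bsub>K\<^esub> (e m \<oplus>\<^bsub>K\<^esub> h)) \<oplus>\<^bsub>K\<^esub>
        (e n' \<otimes>\<^bsub>K\<^esub> e m \<ominus>\<^bsub>K\<^esub> e n \<otimes>\<^bsub>K\<^esub> e m')"
      unfolding a(3) [symmetric] b(3) [symmetric]
      using rx ec(1) [of n] ec(1) [of n'] ec(1) [of m] ec(1) [of m'] by algebra
    also have "\<dots> = e n \<otimes>\<^bsub>K\<^esub> h' \<oplus>\<^bsub>K\<^esub> \<ominus>\<^bsub>K\<^esub> \<one>\<^bsub>K\<^esub> \<otimes>\<^bsub>K\<^esub> (e n' \<otimes>\<^bsub>K\<^esub> h)"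
      using c ec(1) [of n] ec(1) [of n'] ec(1) [of m] ec(1) [of m'] by algebra
    also have "\<dots> = e n \<otimes>\<^bsub>K\<^esub> h' \<oplus>\<^bsub>K\<^esub> e (- 1) \<otimes>\<^bsub>K\<^esub> (e n' \<otimes>\<^bsub>K\<^esub> h)" by (simp add: eneg e1)
    finally have "e (n' * m - n * m') \<in> H" using a b Ha He by simp
    then have "d (n' * m + - (n * m')) = \<zero>\<^bsub>L\<^esub>" using H1 ed by (metis diff_conv_add_uminus)
    then have z: "d n' \<otimes>\<^bsub>L\<^esub> d m \<ominus>\<^bsub>L\<^esub> d n \<otimes>\<^bsub>L\<^esub> d m' = \<zero>\<^bsub>L\<^esub>"
      unfolding eadd eneg emult by (simp add: L.minus_eq)
    have "d n \<otimes>\<^bsub>L\<^esub> (d n' \<otimes>\<^bsub>L\<^esub> (q \<ominus>\<^bsub>L\<^esub> r)) = d n' \<otimes>\<^bsub>L\<^esub> (d n \<otimes>\<^bsub>L\<^esub> q) \<ominus>\<^bsub>L\<^esub> d n \<otimes>\<^bsub>L\<^esub> (d n' \<otimes>\<^bsub>L\<^esub> r)"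
      using a(5) b(5) ec(2) [of n] ec(2) [of n'] by algebra
    also have "\<dots> = \<zero>\<^bsub>L\<^esub>" unfolding a(4) b(4) by (rule z)
    finally have "q \<ominus>\<^bsub>L\<^esub> r = \<zero>\<^bsub>L\<^esub>"
      using a b ed [of n] ed [of n'] L.integral [of "d n" "d n' \<otimes>\<^bsub>L\<^esub> (q \<ominus>\<^bsub>L\<^esub> r)"] L.integral [of "d n'" "q \<ominus>\<^bsub>L\<^esub> r"] by auto
    then show ?thesis using a b by simp
  qed
  define f where "f x = (SOME q. rel x q)" for x
  have f: "rel x (f x)" if "x \<in> carrier K" for x unfolding f_def using someI_ex [OF ex [OF that]] .
  have fL: "f x \<in> carrier L" if "x \<in> carrier K" for x using f [OF that] by (simp add: rel_def)
  have "f \<one>\<^bsub>K\<^esub> = \<one>\<^bsub>L\<^esub>"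
    by (rule uniq [OF f _ K.one_closed]) (use relI [of "\<one>\<^bsub>L\<^esub>" 1 "\<one>\<^bsub>K\<^esub>" 1 "\<zero>\<^bsub>K\<^esub>"] H0 in \<open>auto simp: e1\<close>)
  moreover have "f (x \<oplus>\<^bsub>K\<^esub> y) = f x \<oplus>\<^bsub>L\<^esub> f y" if xy: "x \<in> carrier K" "y \<in> carrier K" for x y
  proof (rule uniq [OF f])
    obtain n m h where a: "h \<in> H" "e n \<noteq> \<zero>\<^bsub>K\<^esub>" "e n \<otimes>\<^bsub>K\<^esub> x = e m \<oplus>\<^bsub>K\<^esub> h" "d n \<otimes>\<^bsub>L\<^esub> f x = d m"
      using f [OF xy(1)] unfolding rel_def by blast
    obtain n' m' h' where b: "h' \<in> H" "e n' \<noteq> \<zero>\<^bsub>K\<^esub>" "e n' \<otimes>\<^bsub>K\<^esub> y = e m' \<oplus>\<^bsub>K\<^esub> h'" "d n' \<otimes>\<^bsub>L\<^esub> f y = d m'"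
      using f [OF xy(2)] unfolding rel_def by blast
    have c: "h \<in> carrier K" "h' \<in> carrier K" using a b HR by auto
    show "rel (x \<oplus>\<^bsub>K\<^esub> y) (f x \<oplus>\<^bsub>L\<^esub> f y)"
    proof (rule relI)
      show "f x \<oplus>\<^bsub>L\<^esub> f y \<in> carrier L" using fL xy by simp
      show "e (n * n') \<noteq> \<zero>\<^bsub>K\<^esub>" using a b K.integral [of "e n" "e n'"] by (auto simp: emult)
      show "e n' \<otimes>\<^bsub>K\<^esub> h \<oplus>\<^bsub>K\<^esub> e n \<otimes>\<^bsub>K\<^esub> h' \<in> H" using a b Ha He by simp
      have "e (n * n') \<otimes>\<^bsub>K\<^esub> (x \<oplus>\<^bsub>K\<^esub> y) = e n' \<otimes>\<^bsub>K\<^esub> (e n \<otimes>\<^bsub>K\<^esub> x) \<oplus>\<^bsub>K\<^esub> e n \<otimes>\<^bsub>K\<^esub> (e n' \<otimes>\<^bsub>K\<^esub> y)"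
        unfolding emult using xy ec(1) [of n] ec(1) [of n'] by algebra
      then show "e (n * n') \<otimes>\<^bsub>K\<^esub> (x \<oplus>\<^bsub>K\<^esub> y) =
          e (n' * m + n * m') \<oplus>\<^bsub>K\<^esub> (e n' \<otimes>\<^bsub>K\<^esub> h \<oplus>\<^bsub>K\<^esub> e n \<otimes>\<^bsub>K\<^esub> h')"
        unfolding a(3) b(3) emult eadd
        using c ec(1) [of n] ec(1) [of n'] ec(1) [of m] ec(1) [of m'] by (simp add: K.r_distr K.a_ac)
      have "d (n * n') \<otimes>\<^bsub>L\<^esub> (f x \<oplus>\<^bsub>L\<^esub> f y) = d n' \<otimes>\<^bsub>L\<^esub> (d n \<otimes>\<^bsub>L\<^esub> f x) \<oplus>\<^bsub>L\<^esub> d n \<otimes>\<^bsub>L\<^esub> (d n' \<otimes>\<^bsub>L\<^esub> f y)"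
        unfolding emult using fL [OF xy(1)] fL [OF xy(2)] ec(2) [of n] ec(2) [of n'] by algebra
      then show "d (n * n') \<otimes>\<^bsub>L\<^esub> (f x \<oplus>\<^bsub>L\<^esub> f y) = d (n' * m + n * m')"
        unfolding a(4) b(4) by (simp add: emult eadd)
    qed
  qed (use xy in auto)
  ultimately show ?thesis using fL by (intro bexI [of _ f]) auto
qed

text \<open>The two fields act by commuting operators on the nonzero group of additive maps from one
  to the other; the compositum is a residue field of a commutative ring containing both actions.\<close>

theorem compositum_exists:
  fixes K :: "('k, 'm) ring_scheme" and L :: "('l, 'n) ring_scheme"
  assumes "field K" "field L"
    and char: "\<And>n::nat. [n] \<cdot>\<^bsub>K\<^esub> \<one>\<^bsub>K\<^esub> = \<zero>\<^bsub>K\<^esub> \<longleftrightarrow> [n] \<cdot>\<^bsub>L\<^esub> \<one>\<^bsub>L\<^esub> = \<zero>\<^bsub>L\<^esub>"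
  obtains \<Omega> :: "(('k \<Rightarrow> 'l) \<Rightarrow> ('k \<Rightarrow> 'l)) set ring" and g h
    where "field \<Omega>" "g \<in> ring_hom K \<Omega>" "h \<in> ring_hom L \<Omega>"
proof -
  interpret K: field K by fact
  interpret L: field L by fact
  define V where "V = lin_maps K L {} undefined undefined"
  have "abelian_group V"
    unfolding V_def by (intro lin_maps_abelian_group) (auto intro: K.is_abelian_group L.is_abelian_group)
  then interpret V: abelian_group V .
  have Vmem: "f \<in> carrier V \<longleftrightarrow> f \<in> carrier K \<rightarrow>\<^sub>E carrier L \<and>
      (\<forall>x\<in>carrier K. \<forall>y\<in>carrier K. f (x \<oplus>\<^bsub>K\<^esub> y) = f x \<oplus>\<^bsub>L\<^esub> f y)" for f
    by (auto simp: V_def lin_maps_def)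
  have Vadd: "f \<oplus>\<^bsub>V\<^esub> g = (\<lambda>x\<in>carrier K. f x \<oplus>\<^bsub>L\<^esub> g x)" for f g by (simp add: V_def lin_maps_def)
  have Vapp: "f x \<in> carrier L" if "f \<in> carrier V" "x \<in> carrier K" for f x using that by (auto simp: Vmem)
  have Vapp2: "f (x \<oplus>\<^bsub>K\<^esub> y) = f x \<oplus>\<^bsub>L\<^esub> f y" if "f \<in> carrier V" "x \<in> carrier K" "y \<in> carrier K" for f x y
    using that by (simp add: Vmem)
  have Vext: "f = g" if "f \<in> carrier V" "g \<in> carrier V" "\<And>x. x \<in> carrier K \<Longrightarrow> f x = g x" for f g
    using that by (intro PiE_ext [of f "carrier K" _ g]) (auto simp: Vmem)
  \<comment> \<open>\<open>K\<close> acts by composition with multiplications on the source and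
    \<open>L\<close> by multiplications on the target, so the two actions commute.\<close>
  define a where "a x = (\<lambda>f\<in>carrier V. \<lambda>z\<in>carrier K. f (x \<otimes>\<^bsub>K\<^esub> z))" for x
  define b where "b y = (\<lambda>f\<in>carrier V. \<lambda>z\<in>carrier K. y \<otimes>\<^bsub>L\<^esub> f z)" for y
  have aV: "a x f \<in> carrier V" if "x \<in> carrier K" "f \<in> carrier V" for x f
    unfolding Vmem [of "a x f"] using that Vapp [OF that(2)] Vapp2 [OF that(2)] by (auto simp: a_def K.r_distr)
  have bV: "b y f \<in> carrier V" if "y \<in> carrier L" "f \<in> carrier V" for y f
    unfolding Vmem [of "b y f"] using that Vapp [OF that(2)] Vapp2 [OF that(2)] by (auto simp: b_def L.r_distr)
  have aa: "a x f z = f (x \<otimes>\<^bsub>K\<^esub> z)" if "f \<in> carrier V" "z \<in> carrier K" for x f z using that by (simp add: a_def)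
  have ba: "b y f z = y \<otimes>\<^bsub>L\<^esub> f z" if "f \<in> carrier V" "z \<in> carrier K" for y f z using that by (simp add: b_def)
  have Va: "(f \<oplus>\<^bsub>V\<^esub> g) z = f z \<oplus>\<^bsub>L\<^esub> g z" if "z \<in> carrier K" for f g z using that by (simp add: Vadd)
  define \<Phi> where "\<Phi> = a ` carrier K \<union> b ` carrier L"
  have \<Phi>e: "additive_endo V \<phi>" if "\<phi> \<in> \<Phi>" for \<phi>
  proof -
    have "additive_endo V (a x)" if "x \<in> carrier K" for x
      unfolding additive_endo_def using that aV by (auto intro!: Vext simp: aa Va)
    moreover have "additive_endo V (b y)" if "y \<in> carrier L" for y
      unfolding additive_endo_def using that bV Vapp by (auto intro!: Vext simp: ba Va L.r_distr)
    ultimately show ?thesis using that by (auto simp: \<Phi>_def)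
  qed
  have comm: "\<phi> (\<psi> f) = \<psi> (\<phi> f)" if "\<phi> \<in> \<Phi>" "\<psi> \<in> \<Phi>" "f \<in> carrier V" for \<phi> \<psi> f
  proof -
    have "a x (a y f) = a y (a x f)" if "x \<in> carrier K" "y \<in> carrier K" for x y
      using that aV \<open>f \<in> carrier V\<close> by (intro Vext) (auto simp: aa K.m_lcomm)
    moreover have "b x (b y f) = b y (b x f)" if "x \<in> carrier L" "y \<in> carrier L" for x y
      using that bV Vapp \<open>f \<in> carrier V\<close> by (intro Vext) (auto simp: ba L.m_lcomm)
    moreover have "a x (b y f) = b y (a x f)" if "x \<in> carrier K" "y \<in> carrier L" for x y
      using that aV bV \<open>f \<in> carrier V\<close> by (intro Vext) (auto simp: aa ba)
    ultimately show ?thesis using that(1,2) unfolding \<Phi>_def by force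
  qed
  define T1 where "T1 = carrier (commutant_ring V \<Phi>)"
  \<comment> \<open>The bicommutant of the operators. They commute with each other, so they lie in
    their commutant \<open>T1\<close>. Whatever commutes with \<open>T1\<close> then commutes with
    them and lies in \<open>T1\<close> too. So the elements of \<open>T\<close> commute with
    \<open>T1\<close>, and thus with each other.\<close>
  define T where "T = commutant_ring V T1"
  have T1e: "additive_endo V \<phi>" if "\<phi> \<in> T1" for \<phi> using that by (simp add: T1_def commutant_ring_mem)
  interpret T: ring T unfolding T_def using V.abelian_group_axioms T1e by (rule commutant_ring_is_ring)
  have Tmem: "f \<in> carrier T \<longleftrightarrow> f \<in> extensional (carrier V) \<and> additive_endo V f \<and>
    (\<forall>\<phi>\<in>T1. \<forall>x\<in>carrier V. f (\<phi> x) = \<phi> (f x))" for f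
    unfolding T_def by (rule commutant_ring_mem)
  have ext\<Phi>: "\<phi> \<in> extensional (carrier V)" if "\<phi> \<in> \<Phi>" for \<phi> using that by (auto simp: \<Phi>_def a_def b_def)
  have \<Phi>T: "\<phi> \<in> carrier T" if "\<phi> \<in> \<Phi>" for \<phi>
    using that ext\<Phi> \<Phi>e unfolding Tmem T1_def by (auto simp: commutant_ring_mem)
  have \<Phi>T1: "\<Phi> \<subseteq> T1"
  proof
    fix \<phi> assume p: "\<phi> \<in> \<Phi>"
    show "\<phi> \<in> T1"
      unfolding T1_def commutant_ring_mem using ext\<Phi> [OF p] \<Phi>e [OF p] comm [OF p] by simp
  qed
  have TT1: "carrier T \<subseteq> T1"
  proof
    fix f assume "f \<in> carrier T"
    then have f: "f \<in> extensional (carrier V)" "additive_endo V f"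
      "\<And>\<phi> x. \<phi> \<in> T1 \<Longrightarrow> x \<in> carrier V \<Longrightarrow> f (\<phi> x) = \<phi> (f x)"
      unfolding Tmem by simp_all
    show "f \<in> T1"
      unfolding T1_def commutant_ring_mem using f(1,2) f(3) [OF subsetD [OF \<Phi>T1]] by simp
  qed
  note Tsimps = commutant_ring_simps [where G = V and \<Phi> = T1, folded T_def]
  note Teq = commutant_ring_eqI [where G = V and \<Phi> = T1, folded T_def]
  have Tcomm: "f \<otimes>\<^bsub>T\<^esub> g = g \<otimes>\<^bsub>T\<^esub> f" if f: "f \<in> carrier T" and g: "g \<in> carrier T" for f g
  proof (rule Teq [OF T.m_closed [OF f g] T.m_closed [OF g f]])
    fix x assume "x \<in> carrier V"
    then show "(f \<otimes>\<^bsub>T\<^esub> g) x = (g \<otimes>\<^bsub>T\<^esub> f) x"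
      using f subsetD [OF TT1 g] by (simp add: Tsimps Tmem)
  qed
  have "cring T"
    by (intro cring.intro T.ring_axioms comm_monoid.intro T.monoid_axioms comm_monoid_axioms.intro Tcomm)
  then interpret T: cring T .
  \<comment> \<open>The functional is a nonzero element of \<open>V\<close>. This makes
    \<open>T\<close> a nonzero ring and so provides a maximal ideal.\<close>
  obtain l where l: "l \<in> carrier K \<rightarrow> carrier L" "l \<one>\<^bsub>K\<^esub> = \<one>\<^bsub>L\<^esub>"
    "\<forall>x\<in>carrier K. \<forall>y\<in>carrier K. l (x \<oplus>\<^bsub>K\<^esub> y) = l x \<oplus>\<^bsub>L\<^esub> l y"
    using additive_functional [OF assms] by blast
  have lV: "restrict l (carrier K) \<in> carrier V" unfolding Vmem using l by auto
  have "\<one>\<^bsub>T\<^esub> \<noteq> \<zero>\<^bsub>T\<^esub>"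
  proof
    assume "\<one>\<^bsub>T\<^esub> = \<zero>\<^bsub>T\<^esub>"
    then have "restrict l (carrier K) = \<zero>\<^bsub>V\<^esub>"
      using Tsimps(3,4) [OF lV] by metis
    then have "restrict l (carrier K) \<one>\<^bsub>K\<^esub> = \<zero>\<^bsub>L\<^esub>" by (simp add: V_def lin_maps_def)
    then show False using l(2) by simp
  qed
  then obtain M where "maximalideal M T" using T.exists_maximal_ideal by blast
  then interpret M: maximalideal M T .
  have aT: "a x \<in> carrier T" if "x \<in> carrier K" for x using that \<Phi>T by (simp add: \<Phi>_def)
  have ahom: "a \<in> ring_hom K T"
  proof (rule ring_hom_memI)
    fix x y assume xy: "x \<in> carrier K" "y \<in> carrier K"
    note t = aT [OF xy(1)] aT [OF xy(2)]
    show "a (x \<otimes>\<^bsub>K\<^esub> y) = a x \<otimes>\<^bsub>T\<^esub> a y"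
    proof (rule Teq [OF aT [OF K.m_closed [OF xy]] T.m_closed [OF t]])
      fix f assume f: "f \<in> carrier V"
      show "a (x \<otimes>\<^bsub>K\<^esub> y) f = (a x \<otimes>\<^bsub>T\<^esub> a y) f"
        unfolding Tsimps(1) [OF f]
        by (rule Vext) (use f xy aV in \<open>auto simp: aa K.m_assoc\<close>)
    qed
    show "a (x \<oplus>\<^bsub>K\<^esub> y) = a x \<oplus>\<^bsub>T\<^esub> a y"
    proof (rule Teq [OF aT [OF K.a_closed [OF xy]] T.a_closed [OF t]])
      fix f assume f: "f \<in> carrier V"
      show "a (x \<oplus>\<^bsub>K\<^esub> y) f = (a x \<oplus>\<^bsub>T\<^esub> a y) f"
        unfolding Tsimps(2) [OF f]
        by (rule Vext) (use f xy aV in \<open>auto simp: aa Va Vapp2 K.l_distr\<close>)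
    qed
  next
    show "a \<one>\<^bsub>K\<^esub> = \<one>\<^bsub>T\<^esub>"
    proof (rule Teq [OF aT [OF K.one_closed] T.one_closed])
      fix f assume f: "f \<in> carrier V"
      show "a \<one>\<^bsub>K\<^esub> f = \<one>\<^bsub>T\<^esub> f"
        unfolding Tsimps(3) [OF f] by (rule Vext) (use f aV in \<open>auto simp: aa\<close>)
    qed
  qed (rule aT)
  have bT: "b x \<in> carrier T" if "x \<in> carrier L" for x using that \<Phi>T by (simp add: \<Phi>_def)
  have bhom: "b \<in> ring_hom L T"
  proof (rule ring_hom_memI)
    fix x y assume xy: "x \<in> carrier L" "y \<in> carrier L"
    note t = bT [OF xy(1)] bT [OF xy(2)]
    show "b (x \<otimes>\<^bsub>L\<^esub> y) = b x \<otimes>\<^bsub>T\<^esub> b y"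
    proof (rule Teq [OF bT [OF L.m_closed [OF xy]] T.m_closed [OF t]])
      fix f assume f: "f \<in> carrier V"
      show "b (x \<otimes>\<^bsub>L\<^esub> y) f = (b x \<otimes>\<^bsub>T\<^esub> b y) f"
        unfolding Tsimps(1) [OF f]
        by (rule Vext) (use f xy bV Vapp in \<open>auto simp: ba L.m_ac\<close>)
    qed
    show "b (x \<oplus>\<^bsub>L\<^esub> y) = b x \<oplus>\<^bsub>T\<^esub> b y"
    proof (rule Teq [OF bT [OF L.a_closed [OF xy]] T.a_closed [OF t]])
      fix f assume f: "f \<in> carrier V"
      show "b (x \<oplus>\<^bsub>L\<^esub> y) f = (b x \<oplus>\<^bsub>T\<^esub> b y) f"
        unfolding Tsimps(2) [OF f]
        by (rule Vext) (use f xy bV Vapp in \<open>auto simp: ba Va L.l_distr\<close>)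
    qed
  next
    show "b \<one>\<^bsub>L\<^esub> = \<one>\<^bsub>T\<^esub>"
    proof (rule Teq [OF bT [OF L.one_closed] T.one_closed])
      fix f assume f: "f \<in> carrier V"
      show "b \<one>\<^bsub>L\<^esub> f = \<one>\<^bsub>T\<^esub> f"
        unfolding Tsimps(3) [OF f] by (rule Vext) (use f bV Vapp in \<open>auto simp: ba\<close>)
    qed
  qed (rule bT)
  show thesis
  proof (rule that)
    show "field (T Quot M)" using M.quotient_is_field T.is_cring by blast
    show "(+>\<^bsub>T\<^esub>) M \<circ> a \<in> ring_hom K (T Quot M)" "(+>\<^bsub>T\<^esub>) M \<circ> b \<in> ring_hom L (T Quot M)"
      using ring_hom_trans [OF ahom M.rcos_ring_hom] ring_hom_trans [OF bhom M.rcos_ring_hom] by simp_all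
  qed
qed

section \<open>Block-diagonal sums of representations over different fields\<close>

text \<open>Integer multiples of the unit matrix are scalar, and matrices of positive size form a
  nonzero ring, so no unit is sent to zero. Consequently all fields over which \<open>S\<close> has
  a representation share one characteristic, as a compositum demands.\<close>

lemma (in field) hom_nat_zero_iff:
  assumes "ring S" "\<phi> \<in> ring_hom S (matrix_ring R n)" "n \<ge> 1"
    and nat: "\<And>m::nat. [m] \<cdot>\<^bsub>S\<^esub> \<one>\<^bsub>S\<^esub> = \<zero>\<^bsub>S\<^esub> \<or> [m] \<cdot>\<^bsub>S\<^esub> \<one>\<^bsub>S\<^esub> \<in> Units S"
  shows "[(m::nat)] \<cdot> \<one> = \<zero> \<longleftrightarrow> [m] \<cdot>\<^bsub>S\<^esub> \<one>\<^bsub>S\<^esub> = \<zero>\<^bsub>S\<^esub>"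
proof -
  let ?M = "matrix_ring R n"
  interpret S: ring S by fact
  interpret M: ring ?M by (rule matrix_ring_is_ring)
  interpret h: ring_hom_ring S ?M \<phi> using assms S.ring_axioms M.ring_axioms by (intro ring_hom_ringI2)
  have hnat: "\<phi> ([m] \<cdot>\<^bsub>S\<^esub> \<one>\<^bsub>S\<^esub>) = [m] \<cdot>\<^bsub>?M\<^esub> \<one>\<^bsub>?M\<^esub>" for m :: nat
    by (induction m) auto
  have scalar: "([m] \<cdot>\<^bsub>?M\<^esub> \<one>\<^bsub>?M\<^esub>) (i, j) = (if i = j then [m] \<cdot> \<one> else \<zero>)" if "i < n" "j < n" for i j and m :: nat
    using that
  proof (induction m)
    case (Suc m)
    have "([Suc m] \<cdot>\<^bsub>?M\<^esub> \<one>\<^bsub>?M\<^esub>) (i, j) = ([m] \<cdot>\<^bsub>?M\<^esub> \<one>\<^bsub>?M\<^esub> \<oplus>\<^bsub>?M\<^esub> \<one>\<^bsub>?M\<^esub>) (i, j)" by simp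
    also have "\<dots> = ([m] \<cdot>\<^bsub>?M\<^esub> \<one>\<^bsub>?M\<^esub>) (i, j) \<oplus> \<one>\<^bsub>?M\<^esub> (i, j)"
      using that by (simp add: matrix_ring_def)
    also have "\<one>\<^bsub>?M\<^esub> (i, j) = (if i = j then \<one> else \<zero>)" using that by (simp add: matrix_ring_def)
    finally show ?case using Suc by simp
  next
    case 0
    have "([(0::nat)] \<cdot>\<^bsub>?M\<^esub> \<one>\<^bsub>?M\<^esub>) (i, j) = \<zero>\<^bsub>?M\<^esub> (i, j)" by simp
    also have "\<dots> = \<zero>" using that by (simp add: matrix_ring_def)
    finally show ?case by simp
  qed
  have n0: "0 < n" using assms(3) by simp
  have nz: "\<one>\<^bsub>?M\<^esub> \<noteq> \<zero>\<^bsub>?M\<^esub>"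
  proof
    assume "\<one>\<^bsub>?M\<^esub> = \<zero>\<^bsub>?M\<^esub>"
    from fun_cong [OF this, of "(0, 0)"] show False using n0 by (simp add: matrix_ring_def)
  qed
  show ?thesis
  proof
    assume "[m] \<cdot>\<^bsub>S\<^esub> \<one>\<^bsub>S\<^esub> = \<zero>\<^bsub>S\<^esub>"
    then have "[m] \<cdot>\<^bsub>?M\<^esub> \<one>\<^bsub>?M\<^esub> = \<zero>\<^bsub>?M\<^esub>" using hnat [of m] by simp
    then show "[m] \<cdot> \<one> = \<zero>" using scalar [of 0 0 m] n0 by (simp add: matrix_ring_def)
  next
    assume z: "[m] \<cdot> \<one> = \<zero>"
    show "[m] \<cdot>\<^bsub>S\<^esub> \<one>\<^bsub>S\<^esub> = \<zero>\<^bsub>S\<^esub>"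
    proof (rule ccontr)
      assume "[m] \<cdot>\<^bsub>S\<^esub> \<one>\<^bsub>S\<^esub> \<noteq> \<zero>\<^bsub>S\<^esub>"
      then have u: "[m] \<cdot>\<^bsub>S\<^esub> \<one>\<^bsub>S\<^esub> \<in> Units S" using nat by blast
      define u v where "u = [m] \<cdot>\<^bsub>S\<^esub> \<one>\<^bsub>S\<^esub>" and "v = inv\<^bsub>S\<^esub> u"
      have uv: "u \<in> carrier S" "v \<in> carrier S" "u \<otimes>\<^bsub>S\<^esub> v = \<one>\<^bsub>S\<^esub>" using u by (simp_all add: u_def v_def)
      have "\<phi> u = \<zero>\<^bsub>?M\<^esub>"
      proof -
        have "\<phi> u \<in> {..<n} \<times> {..<n} \<rightarrow>\<^sub>E carrier R" "\<zero>\<^bsub>?M\<^esub> \<in> {..<n} \<times> {..<n} \<rightarrow>\<^sub>E carrier R"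
          using h.hom_closed [OF uv(1)] M.zero_closed by (simp_all add: matrix_ring_def)
        then show ?thesis
          by (rule PiE_ext) (use scalar [of _ _ m] z hnat [of m] in \<open>auto simp: u_def matrix_ring_def\<close>)
      qed
      then have "\<phi> (u \<otimes>\<^bsub>S\<^esub> v) = \<zero>\<^bsub>?M\<^esub>" using uv(1,2) by simp
      then show False using nz uv(3) by simp
    qed
  qed
qed

lemma matrix_ring_eq_zero_iff:
  assumes "A \<in> carrier (matrix_ring F k)"
  shows "A = \<zero>\<^bsub>matrix_ring F k\<^esub> \<longleftrightarrow> (\<forall>i<k. \<forall>j<k. A (i, j) = \<zero>\<^bsub>F\<^esub>)"
proof
  assume "\<forall>i<k. \<forall>j<k. A (i, j) = \<zero>\<^bsub>F\<^esub>"
  then show "A = \<zero>\<^bsub>matrix_ring F k\<^esub>"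
    using assms by (auto simp: matrix_ring_def PiE_def extensional_def fun_eq_iff)
qed (simp add: matrix_ring_def)

text \<open>A block-diagonal sum over a compositum. Kernels are tracked instead of injectivity, so
  that embeddings of different quotients of \<open>R\<close> can be combined as representations of
  \<open>R\<close> itself.\<close>

lemma product_representation:
  fixes K :: "('k, 'x) ring_scheme" and L :: "('l, 'y) ring_scheme"
  assumes R: "ring R" and K: "field K" and L: "field L" and n: "n \<ge> 1" and m: "m \<ge> 1"
    and \<phi>: "\<phi> \<in> ring_hom R (matrix_ring K n)" and \<psi>: "\<psi> \<in> ring_hom R (matrix_ring L m)"
    and nat: "\<And>m::nat. [m] \<cdot>\<^bsub>R\<^esub> \<one>\<^bsub>R\<^esub> = \<zero>\<^bsub>R\<^esub> \<or> [m] \<cdot>\<^bsub>R\<^esub> \<one>\<^bsub>R\<^esub> \<in> Units R"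
  obtains \<Omega> :: "(('k \<Rightarrow> 'l) \<Rightarrow> ('k \<Rightarrow> 'l)) set ring" and \<chi> where "field \<Omega>"
    "\<chi> \<in> ring_hom R (matrix_ring \<Omega> (n + m))"
    "\<And>r. r \<in> carrier R \<Longrightarrow> \<chi> r = \<zero>\<^bsub>matrix_ring \<Omega> (n + m)\<^esub> \<longleftrightarrow>
      \<phi> r = \<zero>\<^bsub>matrix_ring K n\<^esub> \<and> \<psi> r = \<zero>\<^bsub>matrix_ring L m\<^esub>"
proof -
  interpret R: ring R by fact
  interpret K: field K by fact
  interpret L: field L by fact
  obtain \<Omega> :: "(('k \<Rightarrow> 'l) \<Rightarrow> ('k \<Rightarrow> 'l)) set ring" and g h
    where \<Omega>: "field \<Omega>" and g: "g \<in> ring_hom K \<Omega>" and h: "h \<in> ring_hom L \<Omega>"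
    using compositum_exists [OF K L] K.hom_nat_zero_iff [OF R \<phi> n nat] L.hom_nat_zero_iff [OF R \<psi> m nat]
    by metis
  interpret \<Omega>: field \<Omega> by fact
  interpret g: ring_hom_cring K \<Omega> g
    using g by (intro ring_hom_cring.intro ring_hom_cring_axioms.intro K.is_cring \<Omega>.is_cring)
  interpret h: ring_hom_cring L \<Omega> h
    using h by (intro ring_hom_cring.intro ring_hom_cring_axioms.intro L.is_cring \<Omega>.is_cring)
  have inj: "inj_on g (carrier K)" "inj_on h (carrier L)"
    using non_trivial_field_hom_is_inj g h K L \<Omega> by blast+
  have g0: "g x = \<zero>\<^bsub>\<Omega>\<^esub> \<longleftrightarrow> x = \<zero>\<^bsub>K\<^esub>" if "x \<in> carrier K" for x
    using inj(1) that g.hom_zero K.zero_closed unfolding inj_on_def by metis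
  have h0: "h x = \<zero>\<^bsub>\<Omega>\<^esub> \<longleftrightarrow> x = \<zero>\<^bsub>L\<^esub>" if "x \<in> carrier L" for x
    using inj(2) that h.hom_zero L.zero_closed unfolding inj_on_def by metis
  have \<phi>c: "\<phi> r (i, j) \<in> carrier K" if "r \<in> carrier R" "i < n" "j < n" for r i j
    using ring_hom_closed [OF \<phi> that(1)] that by (auto simp: matrix_ring_def)
  have \<psi>c: "\<psi> r (i, j) \<in> carrier L" if "r \<in> carrier R" "i < m" "j < m" for r i j
    using ring_hom_closed [OF \<psi> that(1)] that by (auto simp: matrix_ring_def)
  define E where "E r i j = (if i < n \<and> j < n then g (\<phi> r (i, j))
    else if n \<le> i \<and> n \<le> j then h (\<psi> r (i - n, j - n)) else \<zero>\<^bsub>\<Omega>\<^esub>)" for r i j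
  define \<chi> where "\<chi> r = (\<lambda>(i, j)\<in>{..<n + m} \<times> {..<n + m}. E r i j)" for r
  have Ec: "E r i j \<in> carrier \<Omega>" if "r \<in> carrier R" "i < n + m" "j < n + m" for r i j
    using that \<phi>c \<psi>c by (auto simp: E_def)
  have mult: "(\<Oplus>\<^bsub>\<Omega>\<^esub>k\<in>{..<n + m}. E r i k \<otimes>\<^bsub>\<Omega>\<^esub> E s k j) = E (r \<otimes>\<^bsub>R\<^esub> s) i j"
    if rs: "r \<in> carrier R" "s \<in> carrier R" and ij: "i < n + m" "j < n + m" for r s i j
  proof -
    let ?f = "\<lambda>k. E r i k \<otimes>\<^bsub>\<Omega>\<^esub> E s k j"
    have fc: "?f k \<in> carrier \<Omega>" if "k < n + m" for k using that rs ij Ec by auto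
    have un: "{..<n + m} = {..<n} \<union> (\<lambda>k. n + k) ` {..<m}"
    proof (intro equalityI subsetI)
      fix x assume x: "x \<in> {..<n + m}"
      show "x \<in> {..<n} \<union> (\<lambda>k. n + k) ` {..<m}"
      proof (cases "x < n")
        case False
        then show ?thesis using x by (intro UnI2 image_eqI [of _ _ "x - n"]) auto
      qed simp
    qed auto
    have "(\<Oplus>\<^bsub>\<Omega>\<^esub>k\<in>{..<n + m}. ?f k) =
        (\<Oplus>\<^bsub>\<Omega>\<^esub>k\<in>{..<n}. ?f k) \<oplus>\<^bsub>\<Omega>\<^esub> (\<Oplus>\<^bsub>\<Omega>\<^esub>k\<in>(\<lambda>k. n + k) ` {..<m}. ?f k)"
      unfolding un using fc by (intro \<Omega>.finsum_Un_disjoint) auto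
    also have "(\<Oplus>\<^bsub>\<Omega>\<^esub>k\<in>(\<lambda>k. n + k) ` {..<m}. ?f k) = (\<Oplus>\<^bsub>\<Omega>\<^esub>k\<in>{..<m}. ?f (n + k))"
      using fc by (intro \<Omega>.finsum_reindex) auto
    finally have split: "(\<Oplus>\<^bsub>\<Omega>\<^esub>k\<in>{..<n + m}. ?f k) =
        (\<Oplus>\<^bsub>\<Omega>\<^esub>k\<in>{..<n}. ?f k) \<oplus>\<^bsub>\<Omega>\<^esub> (\<Oplus>\<^bsub>\<Omega>\<^esub>k\<in>{..<m}. ?f (n + k))" .
    have z1: "(\<Oplus>\<^bsub>\<Omega>\<^esub>k\<in>{..<n}. ?f k) = \<zero>\<^bsub>\<Omega>\<^esub>" if "\<not> (i < n \<and> j < n)"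
    proof -
      have "?f k = \<zero>\<^bsub>\<Omega>\<^esub>" if "k < n" for k
      proof (cases "i < n")
        case True
        then have "E s k j = \<zero>\<^bsub>\<Omega>\<^esub>" using that \<open>\<not> _\<close> by (simp add: E_def)
        moreover have "E r i k \<in> carrier \<Omega>" using that rs ij Ec by simp
        ultimately show ?thesis by simp
      next
        case False
        then have "E r i k = \<zero>\<^bsub>\<Omega>\<^esub>" using that by (simp add: E_def)
        moreover have "E s k j \<in> carrier \<Omega>" using that rs ij Ec by simp
        ultimately show ?thesis by simp
      qed
      then have "(\<Oplus>\<^bsub>\<Omega>\<^esub>k\<in>{..<n}. ?f k) = (\<Oplus>\<^bsub>\<Omega>\<^esub>k\<in>{..<n}. \<zero>\<^bsub>\<Omega>\<^esub>)"
        by (intro \<Omega>.finsum_cong') auto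
      then show ?thesis by simp
    qed
    have z2: "(\<Oplus>\<^bsub>\<Omega>\<^esub>k\<in>{..<m}. ?f (n + k)) = \<zero>\<^bsub>\<Omega>\<^esub>" if "\<not> (n \<le> i \<and> n \<le> j)"
    proof -
      have "?f (n + k) = \<zero>\<^bsub>\<Omega>\<^esub>" if "k < m" for k
      proof (cases "n \<le> i")
        case True
        then have "E s (n + k) j = \<zero>\<^bsub>\<Omega>\<^esub>" using that \<open>\<not> _\<close> by (simp add: E_def)
        moreover have "E r i (n + k) \<in> carrier \<Omega>" using that rs ij Ec by simp
        ultimately show ?thesis by simp
      next
        case False
        then have "E r i (n + k) = \<zero>\<^bsub>\<Omega>\<^esub>" using that by (simp add: E_def)
        moreover have "E s (n + k) j \<in> carrier \<Omega>" using that rs ij Ec by simp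
        ultimately show ?thesis by simp
      qed
      then have "(\<Oplus>\<^bsub>\<Omega>\<^esub>k\<in>{..<m}. ?f (n + k)) = (\<Oplus>\<^bsub>\<Omega>\<^esub>k\<in>{..<m}. \<zero>\<^bsub>\<Omega>\<^esub>)"
        by (intro \<Omega>.finsum_cong') auto
      then show ?thesis by simp
    qed
    have gsum: "g (\<Oplus>\<^bsub>K\<^esub>k\<in>{..<n}. \<phi> r (i, k) \<otimes>\<^bsub>K\<^esub> \<phi> s (k, j)) = (\<Oplus>\<^bsub>\<Omega>\<^esub>k\<in>{..<n}. ?f k)"
      if "i < n" "j < n"
    proof -
      have "g (\<Oplus>\<^bsub>K\<^esub>k\<in>{..<n}. \<phi> r (i, k) \<otimes>\<^bsub>K\<^esub> \<phi> s (k, j)) =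
          (\<Oplus>\<^bsub>\<Omega>\<^esub>k\<in>{..<n}. (g \<circ> (\<lambda>k. \<phi> r (i, k) \<otimes>\<^bsub>K\<^esub> \<phi> s (k, j))) k)"
        using that rs \<phi>c by (subst g.hom_finsum) auto
      also have "\<dots> = (\<Oplus>\<^bsub>\<Omega>\<^esub>k\<in>{..<n}. ?f k)"
        using that rs \<phi>c fc by (intro \<Omega>.finsum_cong') (auto simp: E_def)
      finally show ?thesis .
    qed
    have hsum: "h (\<Oplus>\<^bsub>L\<^esub>k\<in>{..<m}. \<psi> r (i - n, k) \<otimes>\<^bsub>L\<^esub> \<psi> s (k, j - n)) = (\<Oplus>\<^bsub>\<Omega>\<^esub>k\<in>{..<m}. ?f (n + k))"
      if "n \<le> i" "n \<le> j"
    proof -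
      have lt: "i - n < m" "j - n < m" using that ij by auto
      have "h (\<Oplus>\<^bsub>L\<^esub>k\<in>{..<m}. \<psi> r (i - n, k) \<otimes>\<^bsub>L\<^esub> \<psi> s (k, j - n)) =
          (\<Oplus>\<^bsub>\<Omega>\<^esub>k\<in>{..<m}. (h \<circ> (\<lambda>k. \<psi> r (i - n, k) \<otimes>\<^bsub>L\<^esub> \<psi> s (k, j - n))) k)"
        using lt rs \<psi>c by (subst h.hom_finsum) auto
      also have "\<dots> = (\<Oplus>\<^bsub>\<Omega>\<^esub>k\<in>{..<m}. ?f (n + k))"
        using that lt rs \<psi>c fc by (intro \<Omega>.finsum_cong') (auto simp: E_def)
      finally show ?thesis .
    qed
    consider "i < n" "j < n" | "n \<le> i" "n \<le> j" | "\<not> (i < n \<and> j < n)" "\<not> (n \<le> i \<and> n \<le> j)" by linarith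
    then show ?thesis
    proof cases
      case 1
      have "\<phi> (r \<otimes>\<^bsub>R\<^esub> s) (i, j) = (\<Oplus>\<^bsub>K\<^esub>k\<in>{..<n}. \<phi> r (i, k) \<otimes>\<^bsub>K\<^esub> \<phi> s (k, j))"
        using ring_hom_mult [OF \<phi> rs] 1 by (simp add: matrix_ring_def)
      then have "E (r \<otimes>\<^bsub>R\<^esub> s) i j = (\<Oplus>\<^bsub>\<Omega>\<^esub>k\<in>{..<n}. ?f k)" using gsum [OF 1] 1 by (simp add: E_def)
      then show ?thesis using 1 split z2 fc by simp
    next
      case 2
      have lt: "i - n < m" "j - n < m" using 2 ij by auto
      have "\<psi> (r \<otimes>\<^bsub>R\<^esub> s) (i - n, j - n) = (\<Oplus>\<^bsub>L\<^esub>k\<in>{..<m}. \<psi> r (i - n, k) \<otimes>\<^bsub>L\<^esub> \<psi> s (k, j - n))"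
        using ring_hom_mult [OF \<psi> rs] lt by (simp add: matrix_ring_def)
      then have "E (r \<otimes>\<^bsub>R\<^esub> s) i j = (\<Oplus>\<^bsub>\<Omega>\<^esub>k\<in>{..<m}. ?f (n + k))" using hsum [OF 2] 2 by (simp add: E_def)
      moreover have "(\<Oplus>\<^bsub>\<Omega>\<^esub>k\<in>{..<m}. ?f (n + k)) \<in> carrier \<Omega>" using fc by (intro \<Omega>.finsum_closed) auto
      ultimately show ?thesis using 2 split z1 by simp
    next
      case 3
      then show ?thesis using split z1 z2 by (auto simp: E_def)
    qed
  qed
  have add: "E (r \<oplus>\<^bsub>R\<^esub> s) i j = E r i j \<oplus>\<^bsub>\<Omega>\<^esub> E s i j"
    if rs: "r \<in> carrier R" "s \<in> carrier R" and ij: "i < n + m" "j < n + m" for r s i j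
  proof -
    have "\<phi> (r \<oplus>\<^bsub>R\<^esub> s) (i, j) = \<phi> r (i, j) \<oplus>\<^bsub>K\<^esub> \<phi> s (i, j)" if "i < n" "j < n"
      using ring_hom_add [OF \<phi> rs] that by (simp add: matrix_ring_def)
    moreover have "\<psi> (r \<oplus>\<^bsub>R\<^esub> s) (i, j) = \<psi> r (i, j) \<oplus>\<^bsub>L\<^esub> \<psi> s (i, j)" if "i < m" "j < m" for i j
      using ring_hom_add [OF \<psi> rs] that by (simp add: matrix_ring_def)
    ultimately show ?thesis using rs ij \<phi>c \<psi>c by (auto simp: E_def)
  qed
  have one: "E \<one>\<^bsub>R\<^esub> i j = (if i = j then \<one>\<^bsub>\<Omega>\<^esub> else \<zero>\<^bsub>\<Omega>\<^esub>)" if ij: "i < n + m" "j < n + m" for i j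
  proof -
    have "\<phi> \<one>\<^bsub>R\<^esub> (i, j) = (if i = j then \<one>\<^bsub>K\<^esub> else \<zero>\<^bsub>K\<^esub>)" if "i < n" "j < n"
      using ring_hom_one [OF \<phi>] that by (simp add: matrix_ring_def)
    moreover have "\<psi> \<one>\<^bsub>R\<^esub> (i, j) = (if i = j then \<one>\<^bsub>L\<^esub> else \<zero>\<^bsub>L\<^esub>)" if "i < m" "j < m" for i j
      using ring_hom_one [OF \<psi>] that by (simp add: matrix_ring_def)
    ultimately show ?thesis using ij by (auto simp: E_def)
  qed
  have hom: "\<chi> \<in> ring_hom R (matrix_ring \<Omega> (n + m))"
  proof (rule ring_hom_memI)
    fix r assume "r \<in> carrier R"
    then show "\<chi> r \<in> carrier (matrix_ring \<Omega> (n + m))" using Ec by (auto simp: \<chi>_def matrix_ring_def)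
  next
    fix r s assume rs: "r \<in> carrier R" "s \<in> carrier R"
    have "(\<Oplus>\<^bsub>\<Omega>\<^esub>k\<in>{..<n + m}. \<chi> r (i, k) \<otimes>\<^bsub>\<Omega>\<^esub> \<chi> s (k, j)) = E (r \<otimes>\<^bsub>R\<^esub> s) i j" if "i < n + m" "j < n + m" for i j
      unfolding mult [OF rs that, symmetric] using that rs Ec
      by (intro \<Omega>.finsum_cong') (auto simp: \<chi>_def)
    then show "\<chi> (r \<otimes>\<^bsub>R\<^esub> s) = \<chi> r \<otimes>\<^bsub>matrix_ring \<Omega> (n + m)\<^esub> \<chi> s"
      unfolding \<chi>_def [of "r \<otimes>\<^bsub>R\<^esub> s"] by (auto simp: matrix_ring_def intro!: restrict_ext)
    show "\<chi> (r \<oplus>\<^bsub>R\<^esub> s) = \<chi> r \<oplus>\<^bsub>matrix_ring \<Omega> (n + m)\<^esub> \<chi> s"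
      using add [OF rs] by (auto simp: \<chi>_def matrix_ring_def intro!: restrict_ext)
  next
    show "\<chi> \<one>\<^bsub>R\<^esub> = \<one>\<^bsub>matrix_ring \<Omega> (n + m)\<^esub>" using one by (auto simp: \<chi>_def matrix_ring_def intro!: restrict_ext)
  qed
  show thesis
  proof (rule that [OF \<Omega> hom])
    fix r assume r: "r \<in> carrier R"
    have "\<chi> r = \<zero>\<^bsub>matrix_ring \<Omega> (n + m)\<^esub> \<longleftrightarrow> (\<forall>i<n + m. \<forall>j<n + m. E r i j = \<zero>\<^bsub>\<Omega>\<^esub>)"
      unfolding matrix_ring_eq_zero_iff [OF ring_hom_closed [OF hom r]] by (simp add: \<chi>_def)
    also have "\<dots> \<longleftrightarrow> (\<forall>i<n. \<forall>j<n. \<phi> r (i, j) = \<zero>\<^bsub>K\<^esub>) \<and> (\<forall>i<m. \<forall>j<m. \<psi> r (i, j) = \<zero>\<^bsub>L\<^esub>)"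
    proof (intro iffI conjI allI impI)
      fix i j assume a: "\<forall>i<n + m. \<forall>j<n + m. E r i j = \<zero>\<^bsub>\<Omega>\<^esub>"
      show "\<phi> r (i, j) = \<zero>\<^bsub>K\<^esub>" if "i < n" "j < n"
        using a [rule_format, of i j] that g0 [OF \<phi>c [OF r that]] by (simp add: E_def)
      show "\<psi> r (i, j) = \<zero>\<^bsub>L\<^esub>" if "i < m" "j < m"
        using a [rule_format, of "n + i" "n + j"] that h0 [OF \<psi>c [OF r that]] by (simp add: E_def)
    qed (auto simp: E_def)
    also have "\<dots> \<longleftrightarrow> \<phi> r = \<zero>\<^bsub>matrix_ring K n\<^esub> \<and> \<psi> r = \<zero>\<^bsub>matrix_ring L m\<^esub>"
      unfolding matrix_ring_eq_zero_iff [OF ring_hom_closed [OF \<phi> r]]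
        matrix_ring_eq_zero_iff [OF ring_hom_closed [OF \<psi> r]] ..
    finally show "\<chi> r = \<zero>\<^bsub>matrix_ring \<Omega> (n + m)\<^esub> \<longleftrightarrow>
      \<phi> r = \<zero>\<^bsub>matrix_ring K n\<^esub> \<and> \<psi> r = \<zero>\<^bsub>matrix_ring L m\<^esub>" .
  qed
qed

section \<open>Subdirect decomposition into irreducible quotients\<close>

context ring
begin

lemma quot_carrierE:
  assumes "X \<in> carrier (R Quot I)"
  obtains r where "r \<in> carrier R" "X = I +> r"
  using assms unfolding FactRing_def A_RCOSETS_def' by auto

lemma quot_eq_zero_iff:
  assumes "ideal I R" "r \<in> carrier R"
  shows "I +> r = \<zero>\<^bsub>R Quot I\<^esub> \<longleftrightarrow> r \<in> I"
  using ideal.rcos_const_imp_mem [OF assms] a_rcos_zero [OF assms(1)] by (auto simp: FactRing_def)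

lemma quot_representableI:
  assumes I: "ideal I R" and F: "field \<Omega>" "n \<ge> 1" and \<chi>: "\<chi> \<in> ring_hom R (matrix_ring \<Omega> n)"
    and ker: "\<And>r. r \<in> carrier R \<Longrightarrow> \<chi> r = \<zero>\<^bsub>matrix_ring \<Omega> n\<^esub> \<longleftrightarrow> r \<in> I"
  shows "representable (R Quot I)"
proof -
  interpret \<Omega>: field \<Omega> by fact
  interpret h: ring_hom_ring R "matrix_ring \<Omega> n" \<chi>
    by (rule ring_hom_ringI2 [OF ring_axioms \<Omega>.matrix_ring_is_ring \<chi>])
  have k: "a_kernel R (matrix_ring \<Omega> n) \<chi> = I"
    unfolding a_kernel_def' using ker ideal.Icarr [OF I] by blast
  show ?thesis
  proof (rule representableI [OF F])
    show "(\<lambda>X. the_elem (\<chi> ` X)) \<in> ring_hom (R Quot I) (matrix_ring \<Omega> n)"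
      using h.the_elem_hom unfolding k .
    show "inj_on (\<lambda>X. the_elem (\<chi> ` X)) (carrier (R Quot I))"
      using h.the_elem_inj unfolding k inj_on_def by blast
  qed
qed

lemma quot_representation:
  assumes I: "ideal I R" and rep: "representable (R Quot I)"
  obtains K :: "'a set list ring" and n \<phi> where "field K" "n \<ge> 1" "\<phi> \<in> ring_hom R (matrix_ring K n)"
    "\<And>r. r \<in> carrier R \<Longrightarrow> \<phi> r = \<zero>\<^bsub>matrix_ring K n\<^esub> \<longleftrightarrow> r \<in> I"
proof -
  interpret I: ideal I R by fact
  obtain K :: "'a set list ring" and n \<phi> where K: "field K" "n \<ge> 1"
    "\<phi> \<in> ring_hom (R Quot I) (matrix_ring K n)" "inj_on \<phi> (carrier (R Quot I))"
    using rep unfolding representable_def by blast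
  interpret K: field K by fact
  interpret Q: ring "R Quot I" by (rule I.quotient_is_ring)
  interpret h: ring_hom_ring "R Quot I" "matrix_ring K n" \<phi>
    by (rule ring_hom_ringI2 [OF Q.ring_axioms K.matrix_ring_is_ring K(3)])
  show thesis
  proof (rule that [OF K(1,2)])
    show "\<phi> \<circ> (+>) I \<in> ring_hom R (matrix_ring K n)"
      using ring_hom_trans [OF I.rcos_ring_hom K(3)] .
    fix r assume r: "r \<in> carrier R"
    then have X: "I +> r \<in> carrier (R Quot I)" using ring_hom_closed [OF I.rcos_ring_hom] by simp
    have "\<phi> (I +> r) = \<zero>\<^bsub>matrix_ring K n\<^esub> \<longleftrightarrow> I +> r = \<zero>\<^bsub>R Quot I\<^esub>"
      using inj_onD [OF K(4) _ X Q.zero_closed] h.hom_zero by auto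
    then show "(\<phi> \<circ> (+>) I) r = \<zero>\<^bsub>matrix_ring K n\<^esub> \<longleftrightarrow> r \<in> I"
      using quot_eq_zero_iff [OF I r] by simp
  qed
qed

text \<open>The quotient by the intersection embeds in the product of the two quotients. In place of
  the product stands a block-diagonal representation of \<open>R\<close> whose kernel is the
  intersection.\<close>

lemma quot_Int_representable:
  assumes I: "ideal I R" and J: "ideal J R"
    and rep: "representable (R Quot I)" "representable (R Quot J)"
    and nat: "\<And>m::nat. [m] \<cdot> \<one> = \<zero> \<or> [m] \<cdot> \<one> \<in> Units R"
  shows "representable (R Quot (I \<inter> J))"
proof -
  obtain K :: "'a set list ring" and n \<phi> where K: "field K" "n \<ge> 1" "\<phi> \<in> ring_hom R (matrix_ring K n)"
    "\<And>r. r \<in> carrier R \<Longrightarrow> \<phi> r = \<zero>\<^bsub>matrix_ring K n\<^esub> \<longleftrightarrow> r \<in> I"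
    using quot_representation [OF I rep(1)] by blast
  obtain L :: "'a set list ring" and m \<psi> where L: "field L" "m \<ge> 1" "\<psi> \<in> ring_hom R (matrix_ring L m)"
    "\<And>r. r \<in> carrier R \<Longrightarrow> \<psi> r = \<zero>\<^bsub>matrix_ring L m\<^esub> \<longleftrightarrow> r \<in> J"
    using quot_representation [OF J rep(2)] by blast
  obtain \<Omega> :: "(('a set list \<Rightarrow> 'a set list) \<Rightarrow> ('a set list \<Rightarrow> 'a set list)) set ring" and \<chi>
    where \<Omega>: "field \<Omega>" "\<chi> \<in> ring_hom R (matrix_ring \<Omega> (n + m))"
    "\<And>r. r \<in> carrier R \<Longrightarrow> \<chi> r = \<zero>\<^bsub>matrix_ring \<Omega> (n + m)\<^esub> \<longleftrightarrow>
      \<phi> r = \<zero>\<^bsub>matrix_ring K n\<^esub> \<and> \<psi> r = \<zero>\<^bsub>matrix_ring L m\<^esub>"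
    using product_representation [OF ring_axioms K(1) L(1) K(2) L(2) K(3) L(3) nat] by metis
  show ?thesis
    by (rule quot_representableI [OF i_intersect [OF I J] \<Omega>(1) _ \<Omega>(2)])
      (use K(2,4) L(4) \<Omega>(3) in auto)
qed

lemma saturated_idealI:
  assumes "saturated_submodule Z c R I" "subring Z R"
    and "\<And>a x. a \<in> I \<Longrightarrow> x \<in> carrier R \<Longrightarrow> x \<otimes> a \<in> I \<and> a \<otimes> x \<in> I"
  shows "ideal I R"
proof (rule idealI [OF ring_axioms])
  show "subgroup I (add_monoid R)"
    using saturated_submoduleD(1-3) [OF assms(1)] saturated_submodule_uminus [OF assms(1,2)]
    by (intro add.subgroupI) (auto simp: a_inv_def)
qed (use assms(3) in auto)

text \<open>Fitting's argument: modulo \<open>I\<close>, the kernel and the image of multiplication by a large power of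
  \<open>z\<close> meet trivially.\<close>

lemma irreducible_quotient_dichotomy:
  assumes sZ: "subring Z R" and cent: "Z \<subseteq> ring_center R"
    and c: "c \<in> Z"
    and acc: "ascending_chain_condition {U. saturated_submodule Z c R U}"
    and I: "ideal I R" "saturated_submodule Z c R I"
    and irr: "\<And>J J'. ideal J R \<Longrightarrow> saturated_submodule Z c R J \<Longrightarrow> ideal J' R \<Longrightarrow>
      saturated_submodule Z c R J' \<Longrightarrow> I \<subseteq> J \<Longrightarrow> I \<subseteq> J' \<Longrightarrow> J \<inter> J' \<subseteq> I \<Longrightarrow> J = I \<or> J' = I"
    and z: "z \<in> Z"
  shows "(\<exists>n::nat. z [^] n \<in> I) \<or> (\<forall>x\<in>carrier R. z \<otimes> x \<in> I \<longrightarrow> x \<in> I)"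
proof -
  note ZR = subringE(1) [OF sZ]
  have zR: "z \<in> carrier R" and cR: "c \<in> carrier R" using z c ZR by auto
  have comm: "a \<otimes> x = x \<otimes> a" if "a \<in> Z" "x \<in> carrier R" for a x
    using cent that by (auto simp: ring_center_def)
  have powZ: "a [^] (n::nat) \<in> Z" if "a \<in> Z" for a n
    using that subringE(3,6) [OF sZ] by (induction n) auto
  have lcomm: "x \<otimes> (a \<otimes> y) = a \<otimes> (x \<otimes> y)" if "a \<in> Z" "x \<in> carrier R" "y \<in> carrier R" for a x y
    using that comm [of a x] ZR by (simp add: m_assoc [symmetric] subset_iff)
  note ID = saturated_submoduleD(1-4) [OF I(2)]
  have IZ: "a \<otimes> x \<in> I" "x \<otimes> a \<in> I" if "x \<in> I" "a \<in> carrier R" for a x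
    using ideal.I_l_closed [OF I(1)] ideal.I_r_closed [OF I(1)] that by auto
  have Isat: "x \<in> I" if "c [^] (n::nat) \<otimes> x \<in> I" "x \<in> carrier R" for n x
    using saturated_submodule_pow [OF I(2) cR that(2,1)] .
  define ann where "ann k = {x \<in> carrier R. z [^] (k::nat) \<otimes> x \<in> I}" for k
  have annsat: "saturated_submodule Z c R (ann k)" for k
  proof (rule saturated_submoduleI)
    show "\<zero> \<in> ann k" using zR ID by (simp add: ann_def)
    show "x \<oplus> y \<in> ann k" if "x \<in> ann k" "y \<in> ann k" for x y
      using that zR ID by (auto simp: ann_def r_distr)
    show "a \<otimes> x \<in> ann k" if "a \<in> Z" "x \<in> ann k" for a x
      using that zR ZR IZ(1) [of "z [^] k \<otimes> x" a] by (auto simp: ann_def lcomm)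
    show "x \<in> ann k" if x: "x \<in> carrier R" "c \<otimes> x \<in> ann k" for x
    proof -
      have "c \<otimes> (z [^] k \<otimes> x) \<in> I" using x zR cR lcomm [OF c, of "z [^] k" x] by (simp add: ann_def)
      then have "z [^] k \<otimes> x \<in> I" by (rule saturated_submoduleD(5) [OF I(2), rotated]) (use x zR in simp)
      then show ?thesis using x by (simp add: ann_def)
    qed
  qed (auto simp: ann_def)
  have annideal: "ideal (ann k) R" for k
  proof (rule saturated_idealI [OF annsat sZ])
    fix a x assume ax: "a \<in> ann k" "x \<in> carrier R"
    then have a: "a \<in> carrier R" "z [^] k \<otimes> a \<in> I" by (auto simp: ann_def)
    have "z [^] k \<otimes> (x \<otimes> a) = x \<otimes> (z [^] k \<otimes> a)" using lcomm [OF powZ [OF z]] ax a by simp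
    moreover have "z [^] k \<otimes> (a \<otimes> x) = (z [^] k \<otimes> a) \<otimes> x" using ax a zR by (simp add: m_assoc)
    ultimately show "x \<otimes> a \<in> ann k \<and> a \<otimes> x \<in> ann k" using ax a IZ by (simp add: ann_def)
  qed
  have annmono: "ann k \<subseteq> ann (Suc k)" for k
  proof
    fix x assume x: "x \<in> ann k"
    then have "z [^] Suc k \<otimes> x = z \<otimes> (z [^] k \<otimes> x)"
      unfolding nat_pow_Suc2 [OF zR] using zR by (simp add: ann_def m_assoc)
    then show "x \<in> ann (Suc k)" using x IZ zR by (simp add: ann_def)
  qed
  obtain m0 where m0: "\<forall>n\<ge>m0. ann n = ann m0"
    using acc annsat annmono unfolding ascending_chain_condition_def by blast
  \<comment> \<open>One more than the stable index: the exponent must be positive so that z^m x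
    contains the factor z x in the last step.\<close>
  define m where "m = Suc m0"
  have "m0 \<le> m" "m0 \<le> m + m" by (simp_all add: m_def)
  then have m: "ann (m + m) = ann m" using m0 by blast
  have zm: "z [^] m \<in> Z" "z [^] m \<in> carrier R" using powZ z zR by auto
  \<comment> \<open>The saturation of z^m R + I, which is two-sided because \<open>z\<close> and
    \<open>c\<close> are central.\<close>
  define J where "J = {x \<in> carrier R. \<exists>n::nat. \<exists>y\<in>carrier R. \<exists>i\<in>I. c [^] n \<otimes> x = z [^] m \<otimes> y \<oplus> i}"
  have JI: "x \<in> J" if "x \<in> carrier R" "y \<in> carrier R" "i \<in> I" "c [^] n \<otimes> x = z [^] m \<otimes> y \<oplus> i" for x y i and n :: nat
    using that unfolding J_def by blast
  have JE: "\<exists>n y i. x \<in> carrier R \<and> y \<in> carrier R \<and> i \<in> I \<and> c [^] (n::nat) \<otimes> x = z [^] m \<otimes> y \<oplus> i" if "x \<in> J" for x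
    using that unfolding J_def by blast
  have cp: "c [^] (n::nat) \<in> Z" "c [^] n \<in> carrier R" for n using powZ c cR by auto
  have IJ: "I \<subseteq> J"
  proof
    fix i assume "i \<in> I"
    then show "i \<in> J" using ID zm by (intro JI [of i \<zero> i 0]) auto
  qed
  have Jl: "r \<otimes> x \<in> J" and Jr: "x \<otimes> r \<in> J" if x: "x \<in> J" and r: "r \<in> carrier R" for x r
  proof -
    obtain n y i where a: "x \<in> carrier R" "y \<in> carrier R" "i \<in> I" "c [^] (n::nat) \<otimes> x = z [^] m \<otimes> y \<oplus> i"
      using JE [OF x] by blast
    have iR: "i \<in> carrier R" using a ID by blast
    have "c [^] n \<otimes> (r \<otimes> x) = r \<otimes> (c [^] n \<otimes> x)" using lcomm [OF cp(1) r a(1)] by simp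
    also have "\<dots> = z [^] m \<otimes> (r \<otimes> y) \<oplus> r \<otimes> i"
      unfolding a(4) using a(2) r iR zm lcomm [OF zm(1) r a(2)] by (simp add: r_distr)
    finally show "r \<otimes> x \<in> J" using a r IZ by (intro JI [of _ "r \<otimes> y" "r \<otimes> i" n]) auto
    have "c [^] n \<otimes> (x \<otimes> r) = (c [^] n \<otimes> x) \<otimes> r" using a(1) r cp by (simp add: m_assoc)
    also have "\<dots> = z [^] m \<otimes> (y \<otimes> r) \<oplus> i \<otimes> r"
      unfolding a(4) using a(2) r iR zm by (simp add: l_distr m_assoc)
    finally show "x \<otimes> r \<in> J" using a r IZ by (intro JI [of _ "y \<otimes> r" "i \<otimes> r" n]) auto
  qed
  have Jsat: "saturated_submodule Z c R J"
  proof (rule saturated_submoduleI)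
    show "J \<subseteq> carrier R" by (auto simp: J_def)
    show "\<zero> \<in> J" using IJ ID by blast
    fix x x' assume "x \<in> J" "x' \<in> J"
    then obtain n y i n' y' i' where a: "x \<in> carrier R" "y \<in> carrier R" "i \<in> I" "c [^] (n::nat) \<otimes> x = z [^] m \<otimes> y \<oplus> i"
      and b: "x' \<in> carrier R" "y' \<in> carrier R" "i' \<in> I" "c [^] (n'::nat) \<otimes> x' = z [^] m \<otimes> y' \<oplus> i'"
      using JE by meson
    have iR: "i \<in> carrier R" "i' \<in> carrier R" using a b ID by blast+
    have "c [^] (n' + n) \<otimes> x = c [^] n' \<otimes> (c [^] n \<otimes> x)"
      using a(1) cp by (simp add: m_assoc [symmetric] nat_pow_mult cR)
    then have 1: "c [^] (n' + n) \<otimes> x = z [^] m \<otimes> (c [^] n' \<otimes> y) \<oplus> c [^] n' \<otimes> i"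
      unfolding a(4) using a(2) iR zm cp lcomm [OF zm(1) cp(2) a(2)] by (simp add: r_distr)
    have "c [^] (n + n') \<otimes> x' = c [^] n \<otimes> (c [^] n' \<otimes> x')"
      using b(1) cp by (simp add: m_assoc [symmetric] nat_pow_mult cR)
    then have 2: "c [^] (n' + n) \<otimes> x' = z [^] m \<otimes> (c [^] n \<otimes> y') \<oplus> c [^] n \<otimes> i'"
      unfolding b(4) using b(2) iR zm cp lcomm [OF zm(1) cp(2) b(2)] by (simp add: r_distr add.commute)
    have "c [^] (n' + n) \<otimes> (x \<oplus> x') = z [^] m \<otimes> (c [^] n' \<otimes> y \<oplus> c [^] n \<otimes> y') \<oplus> (c [^] n' \<otimes> i \<oplus> c [^] n \<otimes> i')"
      using a(1,2) b(1,2) 1 2 iR zm cp by (simp add: r_distr a_ac)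
    then show "x \<oplus> x' \<in> J"
      using a b cp IZ ID by (intro JI [of _ "c [^] n' \<otimes> y \<oplus> c [^] n \<otimes> y'" "c [^] n' \<otimes> i \<oplus> c [^] n \<otimes> i'" "n' + n"]) auto
  next
    fix x assume x: "x \<in> carrier R" "c \<otimes> x \<in> J"
    then obtain n y i where a: "y \<in> carrier R" "i \<in> I" "c [^] (n::nat) \<otimes> (c \<otimes> x) = z [^] m \<otimes> y \<oplus> i"
      using JE by blast
    then have "c [^] Suc n \<otimes> x = z [^] m \<otimes> y \<oplus> i" using x cR by (simp add: m_assoc)
    then show "x \<in> J" using a x by (intro JI [of x y i "Suc n"]) auto
  qed (use Jl ZR in auto)
  have Jideal: "ideal J R" using saturated_idealI [OF Jsat sZ] Jl Jr by blast
  have "ann m \<inter> J \<subseteq> I"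
  proof
    fix x assume x: "x \<in> ann m \<inter> J"
    then obtain n y i where a: "x \<in> carrier R" "y \<in> carrier R" "i \<in> I" "c [^] (n::nat) \<otimes> x = z [^] m \<otimes> y \<oplus> i"
      using JE by blast
    have iR: "i \<in> carrier R" using a ID by blast
    have zx: "z [^] m \<otimes> x \<in> I" using x by (simp add: ann_def)
    have Isub: "u \<ominus> v \<in> I" if "u \<in> I" "v \<in> I" for u v
      using saturated_submodule_minus [OF I(2) sZ that] .
    \<comment> \<open>Multiplying the equation for c^n x by z^m shows that z^(2m) y lies in
      \<open>I\<close>. Stability of the annihilators gives z^m y in \<open>I\<close>, hence c^n x
      in \<open>I\<close>, and saturation gives x in \<open>I\<close>.\<close>
    have "z [^] m \<otimes> (z [^] m \<otimes> y) = z [^] m \<otimes> (c [^] n \<otimes> x) \<ominus> z [^] m \<otimes> i"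
      unfolding a(4) using zm a(2) iR by (simp add: r_distr minus_eq a_assoc r_neg)
    also have "z [^] m \<otimes> (c [^] n \<otimes> x) = c [^] n \<otimes> (z [^] m \<otimes> x)" using lcomm [OF cp(1) zm(2) a(1)] .
    finally have "z [^] m \<otimes> (z [^] m \<otimes> y) \<in> I" using Isub IZ zx a(3) zm cp by simp
    moreover have "z [^] m \<otimes> (z [^] m \<otimes> y) = z [^] (m + m) \<otimes> y"
      using zR a(2) zm by (simp add: m_assoc [symmetric] nat_pow_mult)
    ultimately have "y \<in> ann (m + m)" using a(2) by (simp add: ann_def)
    then have "z [^] m \<otimes> y \<in> I" unfolding m by (simp add: ann_def)
    then have "c [^] n \<otimes> x \<in> I" using a ID by simp
    then show "x \<in> I" using Isat a by blast
  qed
  moreover have "I \<subseteq> ann m" using IZ zm ID by (auto simp: ann_def)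
  ultimately have "ann m = I \<or> J = I" using irr annideal annsat Jideal Jsat IJ by blast
  then show ?thesis
  proof
    assume "J = I"
    moreover have "z [^] m \<in> J" using zm ID by (intro JI [of _ \<one> \<zero> 0]) auto
    ultimately show ?thesis by blast
  next
    assume A: "ann m = I"
    have "x \<in> I" if x: "x \<in> carrier R" "z \<otimes> x \<in> I" for x
    proof -
      have "z [^] m \<otimes> x = z [^] m0 \<otimes> (z \<otimes> x)" unfolding m_def using x zR by (simp add: m_assoc)
      then have "x \<in> ann m" using x IZ zR by (simp add: ann_def)
      then show ?thesis using A by simp
    qed
    then show ?thesis by blast
  qed
qed


text \<open>Noetherian induction in place of an explicit decomposition. A maximal \<open>I\<close>
  with non-representable quotient is irreducible, since an intersection of two larger ideals has a
  representable quotient. But then each element of \<open>Z\<close> is nilpotent or regular modulo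
  \<open>I\<close>, and the quotient is representable after all.\<close>

theorem central_saturated_representable:
  assumes sZ: "subring Z R" and cent: "Z \<subseteq> ring_center R" and nz: "\<one> \<noteq> \<zero>"
    and nat: "\<And>n::nat. [n] \<cdot> \<one> = \<zero> \<or> [n] \<cdot> \<one> \<in> Units R"
    and c: "c \<in> Z" "\<And>x. x \<in> carrier R \<Longrightarrow> c \<otimes> x = \<zero> \<Longrightarrow> x = \<zero>"
    and acc: "ascending_chain_condition {U. saturated_submodule Z c R U}"
  shows "representable R"
proof (rule ccontr)
  assume nrep: "\<not> representable R"
  note ZR = subringE(1) [OF sZ]
  \<comment> \<open>Only proper ideals are considered, because the zero ring is not representable:
    its 1 would have to go to the zero matrix and to the unit matrix.\<close>
  define Bad where "Bad = {I. ideal I R \<and> saturated_submodule Z c R I \<and> I \<noteq> carrier R \<and> \<not> representable (R Quot I)}"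
  have z0: "ideal {\<zero>} R" by (rule zeroideal)
  interpret z: ideal "{\<zero>}" R by (rule z0)
  interpret zq: ring_hom_ring R "R Quot {\<zero>}" "(+>) {\<zero>}" by (rule z.rcos_ring_hom_ring)
  have "a_kernel R (R Quot {\<zero>}) ((+>) {\<zero>}) = {\<zero>}"
    unfolding a_kernel_def' using quot_eq_zero_iff [OF z0] by blast
  then have "inj_on ((+>) {\<zero>}) (carrier R)" by (rule zq.trivial_ker_imp_inj)
  then have "\<not> representable (R Quot {\<zero>})"
    using nrep representable_embed [OF _ z.rcos_ring_hom] by blast
  moreover have "saturated_submodule Z c R {\<zero>}"
  proof (rule saturated_submoduleI)
    fix x assume x: "x \<in> carrier R" "c \<otimes> x \<in> {\<zero>}"
    then show "x \<in> {\<zero>}" using c(2) [OF x(1)] by blast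
  qed (use ZR in auto)
  ultimately have "{\<zero>} \<in> Bad" using z0 nz unfolding Bad_def by auto
  then have "\<exists>I\<in>Bad. \<forall>J\<in>Bad. I \<subseteq> J \<longrightarrow> J = I"
    by (intro acc_maximal [OF acc]) (auto simp: Bad_def)
  then obtain I where IB: "I \<in> Bad" and max: "\<And>J. J \<in> Bad \<Longrightarrow> I \<subseteq> J \<Longrightarrow> J = I" by blast
  have I: "ideal I R" and sI: "saturated_submodule Z c R I" and Ic: "I \<noteq> carrier R"
    and Irep: "\<not> representable (R Quot I)"
    using IB unfolding Bad_def by blast+
  note ID = saturated_submoduleD(1-4) [OF sI]
  have irr: "J = I \<or> J' = I"
    if J: "ideal J R" "saturated_submodule Z c R J" and J': "ideal J' R" "saturated_submodule Z c R J'"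
      and sub: "I \<subseteq> J" "I \<subseteq> J'" "J \<inter> J' \<subseteq> I" for J J'
  proof (rule ccontr)
    assume ne: "\<not> (J = I \<or> J' = I)"
    have JR: "J \<subseteq> carrier R" "J' \<subseteq> carrier R"
      by (rule saturated_submoduleD(1) [OF J(2)], rule saturated_submoduleD(1) [OF J'(2)])
    have "representable (R Quot J)"
    proof (rule ccontr)
      assume r: "\<not> representable (R Quot J)"
      \<comment> \<open>If J were everything, the inclusion of the intersection in \<open>I\<close>
        would give J' = I.\<close>
      have "J \<noteq> carrier R" using ne sub JR by auto
      then have "J \<in> Bad" using J r by (simp add: Bad_def)
      then show False using max sub(1) ne by blast
    qed
    moreover have "representable (R Quot J')"
    proof (rule ccontr)
      assume r: "\<not> representable (R Quot J')"
      have "J' \<noteq> carrier R" using ne sub JR by auto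
      then have "J' \<in> Bad" using J' r by (simp add: Bad_def)
      then show False using max sub(2) ne by blast
    qed
    ultimately have "representable (R Quot (J \<inter> J'))"
      using quot_Int_representable [OF J(1) J'(1) _ _ nat] by blast
    moreover have "J \<inter> J' = I" using sub by blast
    ultimately show False using Irep by simp
  qed
  interpret I: ideal I R by (rule I)
  interpret Q: ring "R Quot I" by (rule I.quotient_is_ring)
  interpret q: ring_hom_ring R "R Quot I" "(+>) I" by (rule I.rcos_ring_hom_ring)
  note qz = quot_eq_zero_iff [OF I]
  have Icarrier: "x \<in> I \<Longrightarrow> x \<in> carrier R" for x using ID by blast
  let ?Z = "(+>) I ` Z"
  have sZ': "subring ?Z (R Quot I)"
  proof (rule Q.subringI)
    show "?Z \<subseteq> carrier (R Quot I)" using ZR by auto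
    show "\<one>\<^bsub>R Quot I\<^esub> \<in> ?Z" using subringE(3) [OF sZ] q.hom_one by (metis imageI)
    fix X Y assume "X \<in> ?Z" "Y \<in> ?Z"
    then obtain x y where xy: "x \<in> Z" "X = I +> x" "y \<in> Z" "Y = I +> y" by blast
    then have c: "x \<in> carrier R" "y \<in> carrier R" using ZR by auto
    show "X \<oplus>\<^bsub>R Quot I\<^esub> Y \<in> ?Z" "X \<otimes>\<^bsub>R Quot I\<^esub> Y \<in> ?Z"
      unfolding xy(2,4) q.hom_add [OF c, symmetric] q.hom_mult [OF c, symmetric]
      using xy subringE(6,7) [OF sZ] by blast+
  next
    fix X assume "X \<in> ?Z"
    then obtain x where x: "x \<in> Z" "X = I +> x" by blast
    then have c: "x \<in> carrier R" using ZR by auto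
    show "\<ominus>\<^bsub>R Quot I\<^esub> X \<in> ?Z"
      unfolding x(2) q.hom_a_inv [OF c, symmetric] using x subringE(5) [OF sZ] by blast
  qed
  have cent': "?Z \<subseteq> ring_center (R Quot I)"
  proof clarify
    fix z assume z: "z \<in> Z"
    then have zR: "z \<in> carrier R" using ZR by auto
    have "(I +> z) \<otimes>\<^bsub>R Quot I\<^esub> X = X \<otimes>\<^bsub>R Quot I\<^esub> (I +> z)" if X: "X \<in> carrier (R Quot I)" for X
    proof -
      obtain x where x: "x \<in> carrier R" "X = I +> x" using X by (rule quot_carrierE)
      have "z \<otimes> x = x \<otimes> z" using cent z x by (auto simp: ring_center_def)
      then show ?thesis
        unfolding x(2) q.hom_mult [OF zR x(1), symmetric] q.hom_mult [OF x(1) zR, symmetric] by simp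
    qed
    then show "I +> z \<in> ring_center (R Quot I)" using zR by (simp add: ring_center_def)
  qed
  have nz': "\<one>\<^bsub>R Quot I\<^esub> \<noteq> \<zero>\<^bsub>R Quot I\<^esub>"
    using qz [OF one_closed] I.one_imp_carrier Ic q.hom_one by auto
  have reg: "X = \<zero>\<^bsub>R Quot I\<^esub>"
    if zx: "\<And>x. x \<in> carrier R \<Longrightarrow> z \<otimes> x \<in> I \<Longrightarrow> x \<in> I" and z: "z \<in> Z"
      and X: "X \<in> carrier (R Quot I)" "(I +> z) \<otimes>\<^bsub>R Quot I\<^esub> X = \<zero>\<^bsub>R Quot I\<^esub>" for z X
  proof -
    obtain x where x: "x \<in> carrier R" "X = I +> x" using X(1) by (rule quot_carrierE)
    have zR: "z \<in> carrier R" using z ZR by auto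
    have "I +> (z \<otimes> x) = \<zero>\<^bsub>R Quot I\<^esub>" using X(2) x zR by simp
    then have "z \<otimes> x \<in> I" using qz [of "z \<otimes> x"] x(1) zR by simp
    then have "x \<in> I" by (rule zx [OF x(1)])
    then show ?thesis using qz [OF x(1)] x(2) by simp
  qed
  have dich': "(\<exists>n::nat. z [^]\<^bsub>R Quot I\<^esub> n = \<zero>\<^bsub>R Quot I\<^esub>) \<or>
      (\<forall>x\<in>carrier (R Quot I). z \<otimes>\<^bsub>R Quot I\<^esub> x = \<zero>\<^bsub>R Quot I\<^esub> \<longrightarrow> x = \<zero>\<^bsub>R Quot I\<^esub>)"
    if "z \<in> ?Z" for z
  proof -
    obtain a where a: "a \<in> Z" "z = I +> a" using \<open>z \<in> ?Z\<close> by blast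
    have aR: "a \<in> carrier R" using a ZR by auto
    consider n :: nat where "a [^] n \<in> I" | "\<And>x. x \<in> carrier R \<Longrightarrow> a \<otimes> x \<in> I \<Longrightarrow> x \<in> I"
      using irreducible_quotient_dichotomy [OF sZ cent c(1) acc I sI irr a(1)] by blast
    then show ?thesis
    proof cases
      case 1
      then have "I +> (a [^] n) = \<zero>\<^bsub>R Quot I\<^esub>" using qz [of "a [^] n"] aR by simp
      then have "z [^]\<^bsub>R Quot I\<^esub> n = \<zero>\<^bsub>R Quot I\<^esub>"
        unfolding a(2) using q.hom_nat_pow [OF aR, of n] by simp
      then show ?thesis by blast
    next
      case 2
      then show ?thesis using reg [OF 2 a(1)] unfolding a(2) by blast
    qed
  qed
  have creg: "X = \<zero>\<^bsub>R Quot I\<^esub>"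
    if "X \<in> carrier (R Quot I)" "(I +> c) \<otimes>\<^bsub>R Quot I\<^esub> X = \<zero>\<^bsub>R Quot I\<^esub>" for X
    by (rule reg [OF _ c(1) that]) (rule saturated_submoduleD(5) [OF sI])
  have acc': "ascending_chain_condition {U. saturated_submodule ?Z (I +> c) (R Quot I) U}"
  proof (rule acc_embed [OF acc, where f = "\<lambda>U. {x \<in> carrier R. I +> x \<in> U}"])
    fix U assume "U \<in> {U. saturated_submodule ?Z (I +> c) (R Quot I) U}"
    then have U: "saturated_submodule ?Z (I +> c) (R Quot I) U" by simp
    note D = saturated_submoduleD(1-4) [OF U]
    have cR: "c \<in> carrier R" using c ZR by auto
    have "saturated_submodule Z c R {x \<in> carrier R. I +> x \<in> U}"
    proof (rule saturated_submoduleI)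
      show "\<zero> \<in> {x \<in> carrier R. I +> x \<in> U}" using D(2) q.hom_zero by simp
      fix x assume x: "x \<in> carrier R" "c \<otimes> x \<in> {x \<in> carrier R. I +> x \<in> U}"
      then have "(I +> c) \<otimes>\<^bsub>R Quot I\<^esub> (I +> x) \<in> U" using q.hom_mult [OF cR x(1)] by simp
      then have "I +> x \<in> U"
        by (rule saturated_submoduleD(5) [OF U, rotated]) (use x in simp)
      then show "x \<in> {x \<in> carrier R. I +> x \<in> U}" using x by simp
    next
      fix x y assume "x \<in> {x \<in> carrier R. I +> x \<in> U}" "y \<in> {x \<in> carrier R. I +> x \<in> U}"
      then show "x \<oplus> y \<in> {x \<in> carrier R. I +> x \<in> U}" using D(3) by simp
    next
      fix z x assume "z \<in> Z" "x \<in> {x \<in> carrier R. I +> x \<in> U}"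
      then show "z \<otimes> x \<in> {x \<in> carrier R. I +> x \<in> U}" using D(4) ZR by auto
    qed auto
    then show "{x \<in> carrier R. I +> x \<in> U} \<in> {U. saturated_submodule Z c R U}" by simp
    fix V assume "V \<in> {U. saturated_submodule ?Z (I +> c) (R Quot I) U}" "U \<subseteq> V"
      and eq: "{x \<in> carrier R. I +> x \<in> U} = {x \<in> carrier R. I +> x \<in> V}"
    then have "saturated_submodule ?Z (I +> c) (R Quot I) V" by simp
    then have V: "V \<subseteq> carrier (R Quot I)" by (rule saturated_submoduleD(1))
    have "X \<in> U" if X: "X \<in> V" for X
    proof -
      obtain x where x: "x \<in> carrier R" "X = I +> x" using V X by (meson quot_carrierE subsetD)
      then show ?thesis using eq X by blast
    qed
    then show "U = V" using \<open>U \<subseteq> V\<close> by blast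
  qed auto
  have "representable (R Quot I)"
  proof (rule Q.uniform_representable [OF sZ' cent' nz' dich' _ _ creg acc'])
    show "[n] \<cdot>\<^bsub>R Quot I\<^esub> \<one>\<^bsub>R Quot I\<^esub> = \<zero>\<^bsub>R Quot I\<^esub> \<or> [n] \<cdot>\<^bsub>R Quot I\<^esub> \<one>\<^bsub>R Quot I\<^esub> \<in> Units (R Quot I)" for n :: nat
      by (rule q.nat_zero_or_unit_hom [OF nat])
    show "I +> c \<in> ?Z" using c by blast
  qed
  then show False using Irep by blast
qed

end

section \<open>Chain conditions for saturated submodules\<close>

text \<open>Expresses that R/N is Noetherian with respect to saturated submodules, without forming
  the quotient.\<close>

definition acc_above :: "'a set \<Rightarrow> 'a \<Rightarrow> ('a, 'm) ring_scheme \<Rightarrow> 'a set \<Rightarrow> bool"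
  where "acc_above Z c R N \<longleftrightarrow> ascending_chain_condition {U. saturated_submodule Z c R U \<and> N \<subseteq> U}"

lemma acc_stable:
  assumes "ascending_chain_condition \<J>" "\<And>n. X n \<in> \<J>" "\<And>n. X n \<subseteq> X (Suc n)"
  obtains m where "\<And>n. m \<le> n \<Longrightarrow> X n = X (m::nat)"
  using assms unfolding ascending_chain_condition_def by meson

text \<open>A chain is stationary once two monotone invariants are, provided they jointly separate
  nested members. The classical instance is the pair U + N, U \<inter> N with the modular
  law.\<close>

lemma acc_pair:
  assumes acc: "ascending_chain_condition \<J>" "ascending_chain_condition \<K>"
    and f: "\<And>U. U \<in> \<I> \<Longrightarrow> f U \<in> \<J>" and g: "\<And>U. U \<in> \<I> \<Longrightarrow> g U \<in> \<K>"
    and mono: "\<And>U V. U \<subseteq> V \<Longrightarrow> f U \<subseteq> f V" "\<And>U V. U \<subseteq> V \<Longrightarrow> g U \<subseteq> g V"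
    and inj: "\<And>U V. U \<in> \<I> \<Longrightarrow> V \<in> \<I> \<Longrightarrow> U \<subseteq> V \<Longrightarrow> f U = f V \<Longrightarrow> g U = g V \<Longrightarrow> V \<subseteq> U"
  shows "ascending_chain_condition \<I>"
  unfolding ascending_chain_condition_def
proof (intro allI impI)
  fix U :: "nat \<Rightarrow> _" assume U: "\<forall>n. U n \<in> \<I> \<and> U n \<subseteq> U (Suc n)"
  then have UI: "U n \<in> \<I>" and US: "U n \<subseteq> U (Suc n)" for n by auto
  obtain k where k: "\<And>n. k \<le> n \<Longrightarrow> f (U n) = f (U k)"
    by (rule acc_stable [OF acc(1), of "\<lambda>n. f (U n)"]) (use f [OF UI] mono(1) [OF US] in auto)
  obtain l where l: "\<And>n. l \<le> n \<Longrightarrow> g (U n) = g (U l)"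
    by (rule acc_stable [OF acc(2), of "\<lambda>n. g (U n)"]) (use g [OF UI] mono(2) [OF US] in auto)
  let ?m = "max k l"
  have "U n = U ?m" if n: "?m \<le> n" for n
  proof
    show le: "U ?m \<subseteq> U n"
      by (rule lift_Suc_mono_le [of U, OF US n])
    have "k \<le> ?m" "l \<le> ?m" "k \<le> n" "l \<le> n" using n by auto
    then have "f (U ?m) = f (U n)" "g (U ?m) = g (U n)"
      using k [of ?m] k [of n] l [of ?m] l [of n] by metis+
    then show "U n \<subseteq> U ?m" by (rule inj [OF UI UI le])
  qed
  then show "\<exists>m. \<forall>n\<ge>m. U n = U m" by blast
qed

lemma acc_above_mono:
  assumes "acc_above Z c R N" "N \<subseteq> N'"
  shows "acc_above Z c R N'"
  unfolding acc_above_def ascending_chain_condition_def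
proof (intro allI impI)
  fix U :: "nat \<Rightarrow> _"
  assume "\<forall>n. U n \<in> {U. saturated_submodule Z c R U \<and> N' \<subseteq> U} \<and> U n \<subseteq> U (Suc n)"
  then have "\<forall>n. U n \<in> {U. saturated_submodule Z c R U \<and> N \<subseteq> U} \<and> U n \<subseteq> U (Suc n)"
    using assms(2) by blast
  then show "\<exists>m. \<forall>n\<ge>m. U n = U m"
    using assms(1) unfolding acc_above_def ascending_chain_condition_def by blast
qed

text \<open>A chain either stays at \<open>N\<close> forever or from some index on lies above a
  strictly larger member.\<close>

lemma acc_above_strict:
  assumes "\<And>U. saturated_submodule Z c R U \<Longrightarrow> N \<subseteq> U \<Longrightarrow> U \<noteq> N \<Longrightarrow> acc_above Z c R U"
  shows "acc_above Z c R N"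
  unfolding acc_above_def ascending_chain_condition_def
proof (intro allI impI)
  fix U :: "nat \<Rightarrow> _"
  assume U: "\<forall>n. U n \<in> {U. saturated_submodule Z c R U \<and> N \<subseteq> U} \<and> U n \<subseteq> U (Suc n)"
  show "\<exists>m. \<forall>n\<ge>m. U n = U m"
  proof (cases "\<forall>n. U n = N")
    case False
    then obtain k where k: "U k \<noteq> N" by blast
    then have acc: "acc_above Z c R (U k)" using assms U by blast
    have "U k \<subseteq> U (n + k)" for n
      by (rule lift_Suc_mono_le [of U]) (use U in \<open>blast, simp\<close>)
    then have "\<forall>n. U (n + k) \<in> {V. saturated_submodule Z c R V \<and> U k \<subseteq> V} \<and> U (n + k) \<subseteq> U (Suc n + k)"
      using U by simp
    then have c: "U (n + k) \<in> {V. saturated_submodule Z c R V \<and> U k \<subseteq> V}" "U (n + k) \<subseteq> U (Suc n + k)" for n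
      by simp_all
    obtain m where m: "\<And>n. m \<le> n \<Longrightarrow> U (n + k) = U (m + k)"
      by (rule acc_stable [OF acc [unfolded acc_above_def], of "\<lambda>n. U (n + k)"]) (use c in auto)
    have "U n = U (m + k)" if "m + k \<le> n" for n
      using m [of "n - k"] that by simp
    then show ?thesis by blast
  qed auto
qed

lemma acc_above_carrier: "acc_above Z c R (carrier R)"
proof (rule acc_above_strict)
  fix U assume U: "saturated_submodule Z c R U" "carrier R \<subseteq> U" "U \<noteq> carrier R"
  then show "acc_above Z c R U" using saturated_submoduleD(1) [OF U(1)] by blast
qed

lemma saturated_submodule_Int:
  assumes U: "saturated_submodule Z c R U" and V: "saturated_submodule Z c R V"
  shows "saturated_submodule Z c R (U \<inter> V)"
proof (rule saturated_submoduleI)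
  note D = saturated_submoduleD [OF U] and E = saturated_submoduleD [OF V]
  show "U \<inter> V \<subseteq> carrier R" "\<zero>\<^bsub>R\<^esub> \<in> U \<inter> V" using D(1,2) E(2) by blast+
  show "x \<oplus>\<^bsub>R\<^esub> y \<in> U \<inter> V" if "x \<in> U \<inter> V" "y \<in> U \<inter> V" for x y
    using that D(3) E(3) by blast
  show "z \<otimes>\<^bsub>R\<^esub> x \<in> U \<inter> V" if "z \<in> Z" "x \<in> U \<inter> V" for z x
    using that D(4) E(4) by blast
  show "x \<in> U \<inter> V" if "x \<in> carrier R" "c \<otimes>\<^bsub>R\<^esub> x \<in> U \<inter> V" for x
    using D(5) [OF that(1)] E(5) [OF that(1)] that(2) by simp
qed

lemma (in ring) add_minus_cancel:
  assumes "u \<in> carrier R" "w \<in> carrier R"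
  shows "(u \<oplus> w) \<ominus> u = w"
proof -
  have "(u \<oplus> w) \<ominus> u = w \<oplus> (u \<oplus> \<ominus> u)"
    using assms by (simp add: minus_eq a_comm [of u w] a_assoc)
  then show ?thesis using assms by (simp add: r_neg)
qed

text \<open>The elements of \<open>Z\<close> commute with each other but not necessarily with
  \<open>R\<close>, so \<open>R\<close> is regarded as a left \<open>Z\<close>-module. This is the
  position of the center of \<open>W\<close> inside \<open>R\<close>.\<close>

locale scalars = ring R for R (structure) and Z and c +
  assumes sZ: "subring Z R" and Z_comm: "a \<in> Z \<Longrightarrow> b \<in> Z \<Longrightarrow> a \<otimes> b = b \<otimes> a" and cZ: "c \<in> Z"
begin

lemma Z_carrier: "z \<in> Z \<Longrightarrow> z \<in> carrier R"
  using subringE(1) [OF sZ] by blast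

lemma c_carrier: "c \<in> carrier R" using cZ Z_carrier by blast

lemma cpow: "c [^] (n::nat) \<in> Z" "c [^] n \<in> carrier R"
proof -
  show "c [^] n \<in> Z" using cZ subringE(3,6) [OF sZ] by (induction n) auto
  then show "c [^] n \<in> carrier R" by (rule Z_carrier)
qed

lemma cpow_lcomm:
  assumes "z \<in> Z" "x \<in> carrier R"
  shows "c [^] (n::nat) \<otimes> (z \<otimes> x) = z \<otimes> (c [^] n \<otimes> x)"
  using assms cpow [of n] Z_comm [of z "c [^] n"] by (simp add: m_assoc [symmetric] Z_carrier)

lemma cpow_add:
  assumes "x \<in> carrier R"
  shows "c [^] (n + m :: nat) \<otimes> x = c [^] n \<otimes> (c [^] m \<otimes> x)"
  using assms cpow by (simp add: m_assoc [symmetric] nat_pow_mult c_carrier)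

definition saturation :: "'a set \<Rightarrow> 'a set"
  where "saturation N = {x \<in> carrier R. \<exists>n::nat. c [^] n \<otimes> x \<in> N}"

lemma saturation_mono: "N \<subseteq> N' \<Longrightarrow> saturation N \<subseteq> saturation N'"
  by (auto simp: saturation_def)

lemma saturation_incl: "N \<subseteq> carrier R \<Longrightarrow> N \<subseteq> saturation N"
  by (auto simp: saturation_def intro!: exI [of _ 0])

lemma saturation_saturated:
  assumes N: "N \<subseteq> carrier R" "\<zero> \<in> N" "\<And>x y. x \<in> N \<Longrightarrow> y \<in> N \<Longrightarrow> x \<oplus> y \<in> N"
    "\<And>z x. z \<in> Z \<Longrightarrow> x \<in> N \<Longrightarrow> z \<otimes> x \<in> N"
  shows "saturated_submodule Z c R (saturation N)"
proof (rule saturated_submoduleI)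
  show "saturation N \<subseteq> carrier R" by (auto simp: saturation_def)
  show "\<zero> \<in> saturation N" using N(2) saturation_incl [OF N(1)] by blast
  fix x y assume "x \<in> saturation N" "y \<in> saturation N"
  then obtain n m :: nat where a: "x \<in> carrier R" "c [^] n \<otimes> x \<in> N" "y \<in> carrier R" "c [^] m \<otimes> y \<in> N"
    by (auto simp: saturation_def)
  have "c [^] (m + n) \<otimes> (x \<oplus> y) = c [^] (m + n) \<otimes> x \<oplus> c [^] (n + m) \<otimes> y"
    using a cpow by (simp add: r_distr add.commute)
  also have "\<dots> = c [^] m \<otimes> (c [^] n \<otimes> x) \<oplus> c [^] n \<otimes> (c [^] m \<otimes> y)"
    using a by (simp add: cpow_add)
  also have "\<dots> \<in> N" using a cpow(1) N(3,4) by blast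
  finally show "x \<oplus> y \<in> saturation N" using a by (auto simp: saturation_def)
next
  fix z x assume z: "z \<in> Z" and "x \<in> saturation N"
  then obtain n :: nat where x: "x \<in> carrier R" "c [^] n \<otimes> x \<in> N" by (auto simp: saturation_def)
  have "c [^] n \<otimes> (z \<otimes> x) \<in> N" unfolding cpow_lcomm [OF z x(1)] using N(4) z x(2) by blast
  then show "z \<otimes> x \<in> saturation N" using z x Z_carrier by (auto simp: saturation_def)
next
  fix x assume x: "x \<in> carrier R" "c \<otimes> x \<in> saturation N"
  then obtain n :: nat where "c [^] n \<otimes> (c \<otimes> x) \<in> N" by (auto simp: saturation_def)
  then have "c [^] Suc n \<otimes> x \<in> N" using x c_carrier by (simp add: m_assoc)
  then show "x \<in> saturation N" using x unfolding saturation_def by blast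
qed

lemma saturated_pow:
  "saturated_submodule Z c R U \<Longrightarrow> x \<in> carrier R \<Longrightarrow> c [^] (n::nat) \<otimes> x \<in> U \<Longrightarrow> x \<in> U"
  by (rule saturated_submodule_pow [OF _ c_carrier])

lemma sum_submodule_saturated:
  assumes U: "U \<subseteq> carrier R" "\<zero> \<in> U" "\<And>x y. x \<in> U \<Longrightarrow> y \<in> U \<Longrightarrow> x \<oplus> y \<in> U"
      "\<And>z x. z \<in> Z \<Longrightarrow> x \<in> U \<Longrightarrow> z \<otimes> x \<in> U"
    and V: "V \<subseteq> carrier R" "\<zero> \<in> V" "\<And>x y. x \<in> V \<Longrightarrow> y \<in> V \<Longrightarrow> x \<oplus> y \<in> V"
      "\<And>z x. z \<in> Z \<Longrightarrow> x \<in> V \<Longrightarrow> z \<otimes> x \<in> V"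
  shows "saturated_submodule Z c R (saturation {u \<oplus> v |u v. u \<in> U \<and> v \<in> V})"
    "U \<subseteq> saturation {u \<oplus> v |u v. u \<in> U \<and> v \<in> V}" "V \<subseteq> saturation {u \<oplus> v |u v. u \<in> U \<and> v \<in> V}"
proof -
  let ?S = "{u \<oplus> v |u v. u \<in> U \<and> v \<in> V}"
  have S: "?S \<subseteq> carrier R" using U(1) V(1) by auto
  show "saturated_submodule Z c R (saturation ?S)"
  proof (rule saturation_saturated [OF S])
    have "\<zero> = \<zero> \<oplus> \<zero>" by simp
    then show "\<zero> \<in> ?S" using U(2) V(2) by blast
    fix x y assume "x \<in> ?S" "y \<in> ?S"
    then obtain u v u' v' where a: "u \<in> U" "v \<in> V" "x = u \<oplus> v" "u' \<in> U" "v' \<in> V" "y = u' \<oplus> v'" by blast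
    then have "x \<oplus> y = (u \<oplus> u') \<oplus> (v \<oplus> v')" using U(1) V(1) by (simp add: a_ac subset_iff)
    then show "x \<oplus> y \<in> ?S" using a U(3) V(3) by blast
  next
    fix z x assume z: "z \<in> Z" and "x \<in> ?S"
    then obtain u v where a: "u \<in> U" "v \<in> V" "x = u \<oplus> v" by blast
    then have "z \<otimes> x = z \<otimes> u \<oplus> z \<otimes> v" using U(1) V(1) z Z_carrier by (simp add: r_distr subset_iff)
    then show "z \<otimes> x \<in> ?S" using a z U(4) V(4) by blast
  qed
  have "u = u \<oplus> \<zero>" if "u \<in> U" for u using that U(1) by auto
  then have "U \<subseteq> ?S" using V(2) by blast
  then show "U \<subseteq> saturation ?S" using saturation_incl [OF S] by blast
  have "v = \<zero> \<oplus> v" if "v \<in> V" for v using that V(1) by auto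
  then have "V \<subseteq> ?S" using U(2) by blast
  then show "V \<subseteq> saturation ?S" using saturation_incl [OF S] by blast
qed

end

text \<open>The quotient of \<open>R\<close> by this intersection maps onto R/N, and the kernel
  embeds through \<open>f\<close> in R'/N'. Both ends are Noetherian. The map
  \<open>\<sigma>\<close> translates scalars, as the two modules have different scalar
  rings.\<close>

lemma acc_above_vimage_step:
  assumes S1: "scalars R Z c" and S2: "scalars R' Z' c'"
    and f: "f \<in> carrier R \<rightarrow> carrier R'"
      "\<And>x y. x \<in> carrier R \<Longrightarrow> y \<in> carrier R \<Longrightarrow> f (x \<oplus>\<^bsub>R\<^esub> y) = f x \<oplus>\<^bsub>R'\<^esub> f y"
    and \<sigma>: "\<sigma> ` Z' = Z" "\<sigma> c' = c"
      "\<And>z x. z \<in> Z' \<Longrightarrow> x \<in> carrier R \<Longrightarrow> f (\<sigma> z \<otimes>\<^bsub>R\<^esub> x) = z \<otimes>\<^bsub>R'\<^esub> f x"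
    and N: "saturated_submodule Z c R N" "acc_above Z c R N"
    and N': "saturated_submodule Z' c' R' N'" "acc_above Z' c' R' N'"
  shows "acc_above Z c R (N \<inter> {x \<in> carrier R. f x \<in> N'})"
  unfolding acc_above_def
proof -
  interpret R: scalars R Z c by fact
  interpret R': scalars R' Z' c' by fact
  note ND = saturated_submoduleD(1-4) [OF N(1)] and ND' = saturated_submoduleD(1-4) [OF N'(1)]
  have fz: "f \<zero>\<^bsub>R\<^esub> = \<zero>\<^bsub>R'\<^esub>"
  proof -
    have "f \<zero>\<^bsub>R\<^esub> \<oplus>\<^bsub>R'\<^esub> f \<zero>\<^bsub>R\<^esub> = f \<zero>\<^bsub>R\<^esub>" using f(2) [of "\<zero>\<^bsub>R\<^esub>" "\<zero>\<^bsub>R\<^esub>"] by simp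
    moreover have "f \<zero>\<^bsub>R\<^esub> \<in> carrier R'" using f(1) by auto
    ultimately show ?thesis by (simp add: R'.add.l_cancel_one)
  qed
  have fneg: "f (\<ominus>\<^bsub>R\<^esub> x) = \<ominus>\<^bsub>R'\<^esub> f x" if "x \<in> carrier R" for x
  proof -
    have "f (\<ominus>\<^bsub>R\<^esub> x) \<oplus>\<^bsub>R'\<^esub> f x = \<zero>\<^bsub>R'\<^esub>" using f(2) [of "\<ominus>\<^bsub>R\<^esub> x" x] that fz by (simp add: R.l_neg)
    moreover have "f (\<ominus>\<^bsub>R\<^esub> x) \<in> carrier R'" "f x \<in> carrier R'" using f(1) that by auto
    ultimately show ?thesis by (simp add: R'.minus_equality)
  qed
  have fpow: "f (c [^]\<^bsub>R\<^esub> (n::nat) \<otimes>\<^bsub>R\<^esub> x) = c' [^]\<^bsub>R'\<^esub> n \<otimes>\<^bsub>R'\<^esub> f x" if x: "x \<in> carrier R" for n x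
  proof (induction n)
    case 0
    have "f x \<in> carrier R'" using f(1) x by auto
    then show ?case using x by simp
  next
    case (Suc n)
    have fx: "f x \<in> carrier R'" using f(1) x by auto
    have "c [^]\<^bsub>R\<^esub> Suc n \<otimes>\<^bsub>R\<^esub> x = c \<otimes>\<^bsub>R\<^esub> (c [^]\<^bsub>R\<^esub> n \<otimes>\<^bsub>R\<^esub> x)"
      using R.cpow_add [OF x, of 1 n] R.c_carrier by simp
    then have "f (c [^]\<^bsub>R\<^esub> Suc n \<otimes>\<^bsub>R\<^esub> x) = c' \<otimes>\<^bsub>R'\<^esub> f (c [^]\<^bsub>R\<^esub> n \<otimes>\<^bsub>R\<^esub> x)"
      using \<sigma>(3) [OF R'.cZ, of "c [^]\<^bsub>R\<^esub> n \<otimes>\<^bsub>R\<^esub> x"] \<sigma>(2) R.cpow x by simp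
    also have "\<dots> = c' [^]\<^bsub>R'\<^esub> Suc n \<otimes>\<^bsub>R'\<^esub> f x"
      unfolding Suc using R'.cpow_add [OF fx, of 1 n] R'.c_carrier by simp
    finally show ?case .
  qed
  \<comment> \<open>The two invariants of U: the saturated sum of U and \<open>N\<close>, and the
    saturated sum of \<open>N'\<close> with the image of U \<inter> N.\<close>
  define g where "g U = R.saturation {u \<oplus>\<^bsub>R\<^esub> v |u v. u \<in> U \<and> v \<in> N}" for U
  define h where "h U = R'.saturation {u \<oplus>\<^bsub>R'\<^esub> v |u v. u \<in> f ` (U \<inter> N) \<and> v \<in> N'}" for U
  show "ascending_chain_condition {U. saturated_submodule Z c R U \<and> N \<inter> {x \<in> carrier R. f x \<in> N'} \<subseteq> U}"
  proof (rule acc_pair [OF N(2) [unfolded acc_above_def] N'(2) [unfolded acc_above_def], where f = g and g = h])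
    fix U assume "U \<in> {U. saturated_submodule Z c R U \<and> N \<inter> {x \<in> carrier R. f x \<in> N'} \<subseteq> U}"
    then have U: "saturated_submodule Z c R U" and sub: "N \<inter> {x \<in> carrier R. f x \<in> N'} \<subseteq> U" by auto
    note D = saturated_submoduleD(1-4) [OF U]
    have fU: "f ` (U \<inter> N) \<subseteq> carrier R'" using f(1) D(1) by auto
    have z: "z \<otimes>\<^bsub>R'\<^esub> x \<in> f ` (U \<inter> N)" if z: "z \<in> Z'" and x: "x \<in> f ` (U \<inter> N)" for z x
    proof -
      obtain u where u: "u \<in> U" "u \<in> N" "x = f u" using x by blast
      then have "z \<otimes>\<^bsub>R'\<^esub> x = f (\<sigma> z \<otimes>\<^bsub>R\<^esub> u)" using \<sigma>(3) [OF z] D(1) by auto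
      moreover have "\<sigma> z \<in> Z" using z \<sigma>(1) by blast
      ultimately show ?thesis using u D(4) ND(4) by blast
    qed
    have a: "x \<oplus>\<^bsub>R'\<^esub> y \<in> f ` (U \<inter> N)" if x: "x \<in> f ` (U \<inter> N)" and y: "y \<in> f ` (U \<inter> N)" for x y
    proof -
      obtain u v where u: "u \<in> U" "u \<in> N" "x = f u" and v: "v \<in> U" "v \<in> N" "y = f v" using x y by blast
      then have "x \<oplus>\<^bsub>R'\<^esub> y = f (u \<oplus>\<^bsub>R\<^esub> v)" using f(2) [of u v] subsetD [OF D(1)] by simp
      then show ?thesis using u v D(3) ND(3) by blast
    qed
    have zero: "\<zero>\<^bsub>R'\<^esub> \<in> f ` (U \<inter> N)" using fz D(2) ND(2) by (metis IntI imageI)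
    show "g U \<in> {U. saturated_submodule Z c R U \<and> N \<subseteq> U}"
      unfolding g_def using R.sum_submodule_saturated(1,3) [OF D ND] by blast
    show "h U \<in> {U. saturated_submodule Z' c' R' U \<and> N' \<subseteq> U}"
      unfolding h_def using R'.sum_submodule_saturated(1,3) [OF fU zero a z ND'] by blast
    fix V assume "V \<in> {U. saturated_submodule Z c R U \<and> N \<inter> {x \<in> carrier R. f x \<in> N'} \<subseteq> U}"
      and UV: "U \<subseteq> V" and g: "g U = g V" and h: "h U = h V"
    then have V: "saturated_submodule Z c R V" by auto
    note E = saturated_submoduleD(1-4) [OF V]
    show "V \<subseteq> U"
    proof
      fix v assume v: "v \<in> V"
      then have vR: "v \<in> carrier R" using E(1) by blast
      have "V \<subseteq> g V" unfolding g_def by (rule R.sum_submodule_saturated(2) [OF E ND])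
      then have "v \<in> g U" using g v by blast
      \<comment> \<open>Up to a power of c, v is a sum of u in U and w in \<open>N\<close>, and w
        belongs to V as well. Comparing f w with f t for some t in U \<inter> N leaves, after
        another power of c, a difference in \<open>N\<close> that \<open>f\<close> sends into
        \<open>N'\<close>. Such elements lie in U, so w and then v do.\<close>
      then obtain n :: nat and u w where u: "u \<in> U" "w \<in> N" "c [^]\<^bsub>R\<^esub> n \<otimes>\<^bsub>R\<^esub> v = u \<oplus>\<^bsub>R\<^esub> w"
        unfolding g_def R.saturation_def by blast
      have c: "u \<in> carrier R" "w \<in> carrier R" using u D(1) ND(1) by auto
      have "w = (c [^]\<^bsub>R\<^esub> n \<otimes>\<^bsub>R\<^esub> v) \<ominus>\<^bsub>R\<^esub> u" unfolding u(3) using c by (simp add: R.add_minus_cancel)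
      moreover have "(c [^]\<^bsub>R\<^esub> n \<otimes>\<^bsub>R\<^esub> v) \<ominus>\<^bsub>R\<^esub> u \<in> V"
        using R.saturated_submodule_minus [OF V R.sZ] E(4) [OF R.cpow(1) v] u(1) UV by blast
      ultimately have w: "w \<in> V" by simp
      have "f w \<in> h V"
      proof -
        have fV: "f ` (V \<inter> N) \<subseteq> carrier R'" using f(1) E(1) by auto
        have "f w \<in> carrier R'" using f(1) c(2) by auto
        then have "f w = f w \<oplus>\<^bsub>R'\<^esub> \<zero>\<^bsub>R'\<^esub>" by simp
        then have "f w \<in> {u \<oplus>\<^bsub>R'\<^esub> v |u v. u \<in> f ` (V \<inter> N) \<and> v \<in> N'}"
          using w u(2) ND'(2) by blast
        moreover have "{u \<oplus>\<^bsub>R'\<^esub> v |u v. u \<in> f ` (V \<inter> N) \<and> v \<in> N'} \<subseteq> carrier R'"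
          using fV ND'(1) by auto
        ultimately show ?thesis unfolding h_def using R'.saturation_incl by blast
      qed
      then have "f w \<in> h U" using h by simp
      then obtain j :: nat and t s where t: "t \<in> U" "t \<in> N" "s \<in> N'" "c' [^]\<^bsub>R'\<^esub> j \<otimes>\<^bsub>R'\<^esub> f w = f t \<oplus>\<^bsub>R'\<^esub> s"
        unfolding h_def R'.saturation_def by blast
      have tc: "t \<in> carrier R" "s \<in> carrier R'" "f t \<in> carrier R'" using t D(1) ND'(1) f(1) by auto
      let ?d = "(c [^]\<^bsub>R\<^esub> j \<otimes>\<^bsub>R\<^esub> w) \<ominus>\<^bsub>R\<^esub> t"
      have dN: "?d \<in> N" using R.saturated_submodule_minus [OF N(1) R.sZ] ND(4) [OF R.cpow(1) u(2)] t(2) by blast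
      have "f ?d = s"
        using f(2) fneg fpow [OF c(2), of j] t(4) tc c R.cpow R'.add_minus_cancel [OF tc(3,2)]
        by (simp add: R.minus_eq R'.minus_eq)
      then have "?d \<in> U" using dN t(3) ND(1) sub by blast
      then have "?d \<oplus>\<^bsub>R\<^esub> t \<in> U" using D(3) t(1) by blast
      moreover have "?d \<oplus>\<^bsub>R\<^esub> t = c [^]\<^bsub>R\<^esub> j \<otimes>\<^bsub>R\<^esub> w"
        using c tc R.cpow by (simp add: R.minus_eq R.a_assoc R.l_neg)
      ultimately have "w \<in> U" using R.saturated_pow [OF U c(2)] by simp
      then have "c [^]\<^bsub>R\<^esub> n \<otimes>\<^bsub>R\<^esub> v \<in> U" unfolding u(3) using D(3) u(1) by blast
      then show "v \<in> U" using R.saturated_pow [OF U vR] by blast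
    qed
  next
    fix U V :: "'a set" assume "U \<subseteq> V"
    then show "g U \<subseteq> g V" "h U \<subseteq> h V"
      unfolding g_def h_def by (auto intro!: R.saturation_mono R'.saturation_mono)
  qed
qed

text \<open>Iterating over the finite index set amounts to embedding the quotient of
  \<open>R\<close> in a finite power of R'/N'.\<close>

lemma acc_above_vimage:
  assumes S1: "scalars R Z c" and S2: "scalars R' Z' c'" and X: "finite X"
    and f: "\<And>i. i \<in> X \<Longrightarrow> f i \<in> carrier R \<rightarrow> carrier R'"
      "\<And>i x y. i \<in> X \<Longrightarrow> x \<in> carrier R \<Longrightarrow> y \<in> carrier R \<Longrightarrow> f i (x \<oplus>\<^bsub>R\<^esub> y) = f i x \<oplus>\<^bsub>R'\<^esub> f i y"
    and \<sigma>: "\<sigma> ` Z' = Z" "\<sigma> c' = c"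
      "\<And>i z x. i \<in> X \<Longrightarrow> z \<in> Z' \<Longrightarrow> x \<in> carrier R \<Longrightarrow> f i (\<sigma> z \<otimes>\<^bsub>R\<^esub> x) = z \<otimes>\<^bsub>R'\<^esub> f i x"
    and N': "saturated_submodule Z' c' R' N'" "acc_above Z' c' R' N'"
  shows "saturated_submodule Z c R {x \<in> carrier R. \<forall>i\<in>X. f i x \<in> N'} \<and>
    acc_above Z c R {x \<in> carrier R. \<forall>i\<in>X. f i x \<in> N'}"
  using X f \<sigma>(3)
proof (induction X)
  case empty
  interpret R: scalars R Z c by fact
  show ?case
    using acc_above_carrier [of Z c R] R.saturated_submodule_carrier [OF subringE(1) [OF R.sZ]] by simp
next
  case (insert i X)
  interpret R: scalars R Z c by fact
  interpret R': scalars R' Z' c' by fact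
  let ?N = "{x \<in> carrier R. \<forall>i\<in>X. f i x \<in> N'}"
  note ND' = saturated_submoduleD(1-4) [OF N'(1)]
  have IH: "saturated_submodule Z c R ?N" "acc_above Z c R ?N" using insert by auto
  note ND = saturated_submoduleD(1-4) [OF IH(1)]
  have fi: "f i \<in> carrier R \<rightarrow> carrier R'"
    "\<And>x y. x \<in> carrier R \<Longrightarrow> y \<in> carrier R \<Longrightarrow> f i (x \<oplus>\<^bsub>R\<^esub> y) = f i x \<oplus>\<^bsub>R'\<^esub> f i y"
    "\<And>z x. z \<in> Z' \<Longrightarrow> x \<in> carrier R \<Longrightarrow> f i (\<sigma> z \<otimes>\<^bsub>R\<^esub> x) = z \<otimes>\<^bsub>R'\<^esub> f i x"
    using insert by auto
  have eq: "{x \<in> carrier R. \<forall>j\<in>insert i X. f j x \<in> N'} = ?N \<inter> {x \<in> carrier R. f i x \<in> N'}" by auto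
  have "saturated_submodule Z c R {x \<in> carrier R. f i x \<in> N'}"
  proof (rule saturated_submoduleI)
    have "f i \<zero>\<^bsub>R\<^esub> \<oplus>\<^bsub>R'\<^esub> f i \<zero>\<^bsub>R\<^esub> = f i \<zero>\<^bsub>R\<^esub>" using fi(2) [of "\<zero>\<^bsub>R\<^esub>" "\<zero>\<^bsub>R\<^esub>"] by simp
    moreover have "f i \<zero>\<^bsub>R\<^esub> \<in> carrier R'" using fi(1) by auto
    ultimately have "f i \<zero>\<^bsub>R\<^esub> = \<zero>\<^bsub>R'\<^esub>" by (simp add: R'.add.l_cancel_one)
    then show "\<zero>\<^bsub>R\<^esub> \<in> {x \<in> carrier R. f i x \<in> N'}" using ND'(2) by simp
  next
    fix z x assume z: "z \<in> Z" and x: "x \<in> {x \<in> carrier R. f i x \<in> N'}"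
    obtain z' where z': "z' \<in> Z'" "z = \<sigma> z'" using z \<sigma>(1) by blast
    then have "f i (z \<otimes>\<^bsub>R\<^esub> x) \<in> N'" using fi(3) [OF z'(1)] x ND'(4) by auto
    then show "z \<otimes>\<^bsub>R\<^esub> x \<in> {x \<in> carrier R. f i x \<in> N'}" using x z R.Z_carrier by simp
  next
    fix x assume x: "x \<in> carrier R" "c \<otimes>\<^bsub>R\<^esub> x \<in> {x \<in> carrier R. f i x \<in> N'}"
    then have "c' \<otimes>\<^bsub>R'\<^esub> f i x \<in> N'" using fi(3) [OF R'.cZ x(1)] \<sigma>(2) by simp
    then have "f i x \<in> N'"
      by (rule saturated_submoduleD(5) [OF N'(1), rotated]) (use fi(1) x in auto)
    then show "x \<in> {x \<in> carrier R. f i x \<in> N'}" using x by simp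
  qed (use fi ND' in auto)
  then have "saturated_submodule Z c R (?N \<inter> {x \<in> carrier R. f i x \<in> N'})"
    by (rule saturated_submodule_Int [OF IH(1)])
  then show ?case
    unfolding eq using acc_above_vimage_step [OF S1 S2 fi(1,2) \<sigma>(1,2) fi(3) IH N'] by blast
qed

lemma saturated_submodule_Inter:
  assumes F: "\<F> \<noteq> {}" "\<And>N. N \<in> \<F> \<Longrightarrow> saturated_submodule Z c R N"
  shows "saturated_submodule Z c R (\<Inter>\<F>)"
proof (rule saturated_submoduleI)
  note D = saturated_submoduleD [OF F(2)]
  show "\<Inter>\<F> \<subseteq> carrier R" using F(1) D(1) by blast
  show "\<zero>\<^bsub>R\<^esub> \<in> \<Inter>\<F>" using D(2) by blast
  show "x \<oplus>\<^bsub>R\<^esub> y \<in> \<Inter>\<F>" if "x \<in> \<Inter>\<F>" "y \<in> \<Inter>\<F>" for x y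
    using that D(3) by blast
  show "z \<otimes>\<^bsub>R\<^esub> x \<in> \<Inter>\<F>" if "z \<in> Z" "x \<in> \<Inter>\<F>" for z x
    using that D(4) by blast
  show "x \<in> \<Inter>\<F>" if x: "x \<in> carrier R" "c \<otimes>\<^bsub>R\<^esub> x \<in> \<Inter>\<F>" for x
  proof
    fix N assume "N \<in> \<F>"
    then show "x \<in> N" using D(5) [of N x] x by blast
  qed
qed

context scalars
begin

text \<open>The saturated form of the fact that finitely generated modules over the Noetherian ring
  Z/J are Noetherian. In the induction one generator x is added to \<open>N\<close>; a submodule U
  is then controlled by the saturated sum U + Z x and by the colon ideal of x, which contains
  \<open>J\<close>.\<close>

lemma acc_above_generated:
  assumes X: "finite X" "X \<subseteq> carrier R"
    and J: "J \<subseteq> Z" "acc_above Z c (R\<lparr>carrier := Z\<rparr>) J"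
    and N: "saturated_submodule Z c R N" "\<And>z x. z \<in> J \<Longrightarrow> x \<in> X \<Longrightarrow> z \<otimes> x \<in> N"
    and gen: "\<And>N'. saturated_submodule Z c R N' \<Longrightarrow> N \<subseteq> N' \<Longrightarrow> X \<subseteq> N' \<Longrightarrow> N' = carrier R"
  shows "acc_above Z c R N"
  using X N gen
proof (induction X arbitrary: N)
  case empty
  then have "N = carrier R" by blast
  then show ?case using acc_above_carrier by simp
next
  case (insert x X)
  note ND = saturated_submoduleD(1-4) [OF insert.prems(2)]
  have x: "x \<in> carrier R" using insert by blast
  let ?X = "(\<lambda>z. z \<otimes> x) ` Z"
  have X: "?X \<subseteq> carrier R" using x Z_carrier by auto
  have X0: "\<zero> \<in> ?X" by (rule image_eqI [of _ _ \<zero>]) (use x subringE(2) [OF sZ] in auto)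
  have Xa: "p \<oplus> q \<in> ?X" if p: "p \<in> ?X" and q: "q \<in> ?X" for p q
  proof -
    obtain a b where ab: "a \<in> Z" "p = a \<otimes> x" "b \<in> Z" "q = b \<otimes> x" using p q by blast
    then have "p \<oplus> q = (a \<oplus> b) \<otimes> x" using x Z_carrier by (simp add: l_distr)
    then show ?thesis using ab subringE(7) [OF sZ] by blast
  qed
  have Xm: "z \<otimes> p \<in> ?X" if z: "z \<in> Z" and p: "p \<in> ?X" for z p
  proof -
    obtain a where a: "a \<in> Z" "p = a \<otimes> x" using p by blast
    then have "z \<otimes> p = (z \<otimes> a) \<otimes> x" using x z Z_carrier by (simp add: m_assoc)
    then show ?thesis using a z subringE(6) [OF sZ] by blast
  qed
  have x1: "x \<in> ?X" by (rule image_eqI [of _ _ \<one>]) (use x subringE(3) [OF sZ] in auto)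
  define f where "f U = saturation {u \<oplus> v |u v. u \<in> U \<and> v \<in> ?X}" for U
  have fU: "saturated_submodule Z c R (f U)" "U \<subseteq> f U" "?X \<subseteq> f U" if "saturated_submodule Z c R U" for U
    unfolding f_def using sum_submodule_saturated [OF saturated_submoduleD(1-4) [OF that] X X0 Xa Xm] by blast+
  have fmono: "f U \<subseteq> f V" if "U \<subseteq> V" for U V
    unfolding f_def using that by (intro saturation_mono) blast
  have "acc_above Z c R (f N)"
  proof (rule insert.IH)
    show "X \<subseteq> carrier R" "saturated_submodule Z c R (f N)" using insert.prems(1) fU(1) [OF insert.prems(2)] by blast+
    show "z \<otimes> y \<in> f N" if "z \<in> J" "y \<in> X" for z y
      using insert.prems(3) [OF that(1), of y] that(2) fU(2) [OF insert.prems(2)] by blast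
    fix N' assume N': "saturated_submodule Z c R N'" "f N \<subseteq> N'" "X \<subseteq> N'"
    then have "N \<subseteq> N'" "insert x X \<subseteq> N'"
      using fU(2,3) [OF insert.prems(2)] x1 by blast+
    then show "N' = carrier R" using insert.prems(4) N'(1) by blast
  qed
  then have acc: "ascending_chain_condition {U. saturated_submodule Z c R U \<and> f N \<subseteq> U}"
    by (simp add: acc_above_def)
  have accJ: "ascending_chain_condition {V. saturated_submodule Z c (R\<lparr>carrier := Z\<rparr>) V \<and> J \<subseteq> V}"
    using J(2) by (simp add: acc_above_def)
  show ?case
    unfolding acc_above_def
  proof (rule acc_pair [OF acc accJ, where f = f and g = "\<lambda>U. {z \<in> Z. z \<otimes> x \<in> U}"])
    fix U assume "U \<in> {U. saturated_submodule Z c R U \<and> N \<subseteq> U}"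
    then have U: "saturated_submodule Z c R U" and NU: "N \<subseteq> U" by auto
    note D = saturated_submoduleD(1-4) [OF U]
    show "f U \<in> {U. saturated_submodule Z c R U \<and> f N \<subseteq> U}" using fU(1) [OF U] fmono [OF NU] by blast
    have "saturated_submodule Z c (R\<lparr>carrier := Z\<rparr>) {z \<in> Z. z \<otimes> x \<in> U}"
    proof (rule saturated_submoduleI)
      show "\<zero>\<^bsub>R\<lparr>carrier := Z\<rparr>\<^esub> \<in> {z \<in> Z. z \<otimes> x \<in> U}" using x subringE(2) [OF sZ] D(2) by simp
      fix y z assume "y \<in> {z \<in> Z. z \<otimes> x \<in> U}" "z \<in> {z \<in> Z. z \<otimes> x \<in> U}"
      then show "y \<oplus>\<^bsub>R\<lparr>carrier := Z\<rparr>\<^esub> z \<in> {z \<in> Z. z \<otimes> x \<in> U}"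
        using x Z_carrier subringE(7) [OF sZ] D(3) by (simp add: l_distr)
    next
      fix z y assume "z \<in> Z" "y \<in> {z \<in> Z. z \<otimes> x \<in> U}"
      then show "z \<otimes>\<^bsub>R\<lparr>carrier := Z\<rparr>\<^esub> y \<in> {z \<in> Z. z \<otimes> x \<in> U}"
        using x Z_carrier subringE(6) [OF sZ] D(4) by (simp add: m_assoc)
    next
      fix y assume y: "y \<in> carrier (R\<lparr>carrier := Z\<rparr>)" "c \<otimes>\<^bsub>R\<lparr>carrier := Z\<rparr>\<^esub> y \<in> {z \<in> Z. z \<otimes> x \<in> U}"
      then have "c \<otimes> (y \<otimes> x) \<in> U" using x c_carrier Z_carrier by (simp add: m_assoc)
      then have "y \<otimes> x \<in> U"
        by (rule saturated_submoduleD(5) [OF U, rotated]) (use x y Z_carrier in simp)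
      then show "y \<in> {z \<in> Z. z \<otimes> x \<in> U}" using y by simp
    qed auto
    moreover have "J \<subseteq> {z \<in> Z. z \<otimes> x \<in> U}" using J(1) insert.prems(3) NU by blast
    ultimately show "{z \<in> Z. z \<otimes> x \<in> U} \<in> {V. saturated_submodule Z c (R\<lparr>carrier := Z\<rparr>) V \<and> J \<subseteq> V}" by blast
    fix V assume "V \<in> {U. saturated_submodule Z c R U \<and> N \<subseteq> U}" and UV: "U \<subseteq> V"
      and f: "f U = f V" and g: "{z \<in> Z. z \<otimes> x \<in> U} = {z \<in> Z. z \<otimes> x \<in> V}"
    then have V: "saturated_submodule Z c R V" by auto
    note E = saturated_submoduleD(1-4) [OF V]
    show "V \<subseteq> U"
    proof
      fix v assume v: "v \<in> V"
      then have vR: "v \<in> carrier R" using E(1) by blast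
      have "v \<in> f U" using fU(2) [OF V] f v by blast
      then obtain n :: nat and u z where u: "u \<in> U" "z \<in> Z" "c [^] n \<otimes> v = u \<oplus> z \<otimes> x"
        unfolding f_def saturation_def by blast
      have cc: "u \<in> carrier R" "z \<otimes> x \<in> carrier R" using u D(1) x Z_carrier by auto
      have "z \<otimes> x = (c [^] n \<otimes> v) \<ominus> u" unfolding u(3) using cc by (simp add: add_minus_cancel)
      moreover have "(c [^] n \<otimes> v) \<ominus> u \<in> V"
        using saturated_submodule_minus [OF V sZ] E(4) [OF cpow(1) v] u(1) UV by blast
      ultimately have "z \<otimes> x \<in> V" by simp
      then have "z \<otimes> x \<in> U" using g u(2) by blast
      then have "c [^] n \<otimes> v \<in> U" unfolding u(3) using D(3) u(1) by blast
      then show "v \<in> U" by (rule saturated_pow [OF U vR])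
    qed
  qed (use fmono in auto)
qed

end

section \<open>Centers and the relative Eakin-Nagata-Formanek theorem\<close>

lemma (in ring) ring_center_subring: "subring (ring_center R) R"
proof (rule subringI)
  show "ring_center R \<subseteq> carrier R" "\<one> \<in> ring_center R" by (auto simp: ring_center_def)
  fix a b assume ab: "a \<in> ring_center R" "b \<in> ring_center R"
  then have c: "a \<in> carrier R" "b \<in> carrier R"
    and z: "\<And>x. x \<in> carrier R \<Longrightarrow> a \<otimes> x = x \<otimes> a" "\<And>x. x \<in> carrier R \<Longrightarrow> b \<otimes> x = x \<otimes> b"
    by (auto simp: ring_center_def)
  have "(a \<oplus> b) \<otimes> x = x \<otimes> (a \<oplus> b)" if x: "x \<in> carrier R" for x
    using c x z(1) [OF x] z(2) [OF x] by (simp add: l_distr r_distr)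
  then show "a \<oplus> b \<in> ring_center R" using c by (simp add: ring_center_def)
  have "(a \<otimes> b) \<otimes> x = x \<otimes> (a \<otimes> b)" if x: "x \<in> carrier R" for x
  proof -
    have "(a \<otimes> b) \<otimes> x = a \<otimes> (x \<otimes> b)" using c x z(2) [OF x] by (simp add: m_assoc)
    also have "\<dots> = (a \<otimes> x) \<otimes> b" using c x by (simp add: m_assoc)
    also have "\<dots> = x \<otimes> (a \<otimes> b)" unfolding z(1) [OF x] using c x by (simp add: m_assoc)
    finally show ?thesis .
  qed
  then show "a \<otimes> b \<in> ring_center R" using c by (simp add: ring_center_def)
next
  fix a assume "a \<in> ring_center R"
  then show "\<ominus> a \<in> ring_center R" by (auto simp: ring_center_def l_minus r_minus)
qed

lemma (in ring) subring_center_subring: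
  assumes "subring W R"
  shows "subring (ring_center (R\<lparr>carrier := W\<rparr>)) R"
proof -
  interpret W: ring "R\<lparr>carrier := W\<rparr>" by (rule subring_is_ring [OF assms])
  let ?C = "ring_center (R\<lparr>carrier := W\<rparr>)"
  have "ring (R\<lparr>carrier := ?C\<rparr>)"
    using W.subring_is_ring [OF W.ring_center_subring] by simp
  moreover have "?C \<subseteq> carrier R" using subringE(1) [OF assms] by (auto simp: ring_center_def)
  ultimately show ?thesis using subring_iff by simp
qed

text \<open>A relative form of Formanek's proof of the Eakin-Nagata theorem: among the submodules
  \<open>B R\<close>, for ideals \<open>B\<close> of \<open>W\<close>, take a maximal one with non-Noetherian quotient, and enlarge it to
  a submodule maximal with the same annihilator.\<close>

theorem (in ring) eakin_nagata_formanek: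
  assumes sW: "subring W R" and wn: "weakly_noetherian (R\<lparr>carrier := W\<rparr>)"
    and C: "C = ring_center (R\<lparr>carrier := W\<rparr>)" and c: "c \<in> C" "regular_element R c"
    and X: "finite X" "X \<subseteq> carrier R"
    and gen: "\<And>N. saturated_submodule C c R N \<Longrightarrow> X \<subseteq> N \<Longrightarrow> N = carrier R"
  shows "scalars R C c" "ascending_chain_condition {U. saturated_submodule C c R U}"
proof -
  note WR = subringE(1) [OF sW]
  have Cmem: "z \<in> C \<longleftrightarrow> z \<in> W \<and> (\<forall>w\<in>W. z \<otimes> w = w \<otimes> z)" for z by (simp add: C ring_center_def)
  have Ccomm: "z \<otimes> w = w \<otimes> z" if "z \<in> C" "w \<in> W" for z w using that by (simp add: Cmem)
  have CW: "C \<subseteq> W" using Cmem by blast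
  have sC: "subring C R" unfolding C by (rule subring_center_subring [OF sW])
  have comm: "a \<otimes> b = b \<otimes> a" if "a \<in> C" "b \<in> C" for a b
    using Ccomm [OF that(1)] that(2) CW by blast
  show sc: "scalars R C c"
    by (intro scalars.intro scalars_axioms.intro ring_axioms sC comm c(1))
  interpret scalars R C c by (rule sc)
  let ?W = "R\<lparr>carrier := W\<rparr>"
  interpret W: ring ?W by (rule subring_is_ring [OF sW])
  \<comment> \<open>The saturation of the submodule B R, obtained as an intersection so that B R
    itself need not be built.\<close>
  define NB where "NB B = \<Inter>{N. saturated_submodule C c R N \<and> (\<forall>b\<in>B. \<forall>r\<in>carrier R. b \<otimes> r \<in> N)}" for B
  have carsat: "saturated_submodule C c R (carrier R)"
    using saturated_submodule_carrier Z_carrier by blast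
  have NBsat: "saturated_submodule C c R (NB B)" if "B \<subseteq> W" for B
  proof -
    have "b \<otimes> r \<in> carrier R" if "b \<in> B" "r \<in> carrier R" for b r
      using that \<open>B \<subseteq> W\<close> WR by (meson m_closed subsetD)
    then have "carrier R \<in> {N. saturated_submodule C c R N \<and> (\<forall>b\<in>B. \<forall>r\<in>carrier R. b \<otimes> r \<in> N)}"
      using carsat by blast
    then show ?thesis
      unfolding NB_def by (intro saturated_submodule_Inter) blast+
  qed
  have NBmem: "b \<otimes> r \<in> NB B" if "b \<in> B" "r \<in> carrier R" for b r B
    using that unfolding NB_def by blast
  have NBle: "NB B \<subseteq> N" if "saturated_submodule C c R N" "\<And>b r. b \<in> B \<Longrightarrow> r \<in> carrier R \<Longrightarrow> b \<otimes> r \<in> N" for B N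
    using that unfolding NB_def by blast
  show "ascending_chain_condition {U. saturated_submodule C c R U}"
  proof (rule ccontr)
    assume nacc: "\<not> ascending_chain_condition {U. saturated_submodule C c R U}"
    define Bad where "Bad = {B. ideal B ?W \<and> \<not> acc_above C c R (NB B)}"
    \<comment> \<open>Regularity of \<open>c\<close> makes the zero submodule saturated, so the zero
      ideal is bad if the chain condition fails.\<close>
    have Bad0: "{\<zero>} \<in> Bad"
    proof -
      have "saturated_submodule C c R {\<zero>}"
      proof (rule saturated_submoduleI)
        fix x assume x: "x \<in> carrier R" "c \<otimes> x \<in> {\<zero>}"
        then have "x = \<zero>" using c(2) unfolding regular_element_def by blast
        then show "x \<in> {\<zero>}" by simp
      qed (use Z_carrier in auto)
      then have "NB {\<zero>} \<subseteq> {\<zero>}" by (rule NBle) auto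
      then have "NB {\<zero>} \<subseteq> U" if "saturated_submodule C c R U" for U
        using saturated_submoduleD(2) [OF that] by blast
      then have "{U. saturated_submodule C c R U \<and> NB {\<zero>} \<subseteq> U} = {U. saturated_submodule C c R U}" by blast
      then show ?thesis using nacc W.zeroideal by (simp add: Bad_def acc_above_def)
    qed
    have "\<exists>B\<in>Bad. \<forall>B'\<in>Bad. B \<subseteq> B' \<longrightarrow> B' = B"
      by (rule acc_maximal [OF wn [unfolded weakly_noetherian_def]]) (use Bad0 in \<open>auto simp: Bad_def\<close>)
    then obtain B where B: "B \<in> Bad" and Bmax: "\<And>B'. B' \<in> Bad \<Longrightarrow> B \<subseteq> B' \<Longrightarrow> B' = B" by blast
    have Bid: "ideal B ?W" and Bacc: "\<not> acc_above C c R (NB B)" using B by (simp_all add: Bad_def)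
    interpret B: ideal B ?W by (rule Bid)
    have BW: "B \<subseteq> W" using B.Icarr by auto
    note N1 = NBsat [OF BW]
    \<comment> \<open>The annihilator in \<open>C\<close> of R modulo \<open>NB B\<close>. The aim
      is to show that C/J is Noetherian: the quotient by \<open>NB B\<close> is finitely generated
      over it, which contradicts the choice of \<open>B\<close>.\<close>
    define J where "J = {z \<in> C. \<forall>r\<in>carrier R. z \<otimes> r \<in> NB B}"
    have ann: "saturated_submodule C c R {r \<in> carrier R. z \<otimes> r \<in> N}"
      if z: "z \<in> C" and N: "saturated_submodule C c R N" for z N
    proof (rule saturated_submoduleI)
      note D = saturated_submoduleD(1-4) [OF N]
      have zR: "z \<in> carrier R" using z Z_carrier by blast
      show "\<zero> \<in> {r \<in> carrier R. z \<otimes> r \<in> N}" using zR D(2) by simp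
      show "x \<oplus> y \<in> {r \<in> carrier R. z \<otimes> r \<in> N}"
        if "x \<in> {r \<in> carrier R. z \<otimes> r \<in> N}" "y \<in> {r \<in> carrier R. z \<otimes> r \<in> N}" for x y
        using that zR D(3) by (simp add: r_distr)
      have lc: "z \<otimes> (a \<otimes> x) = a \<otimes> (z \<otimes> x)" if "a \<in> C" "x \<in> carrier R" for a x
        using that zR comm [OF z that(1)] Z_carrier by (simp add: m_assoc [symmetric])
      show "a \<otimes> x \<in> {r \<in> carrier R. z \<otimes> r \<in> N}"
        if "a \<in> C" "x \<in> {r \<in> carrier R. z \<otimes> r \<in> N}" for a x
        using that Z_carrier D(4) lc by simp
      fix x assume x: "x \<in> carrier R" "c \<otimes> x \<in> {r \<in> carrier R. z \<otimes> r \<in> N}"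
      then have "c \<otimes> (z \<otimes> x) \<in> N" using lc [OF c(1)] by simp
      then have "z \<otimes> x \<in> N" by (rule saturated_submoduleD(5) [OF N, rotated]) (use x zR in simp)
      then show "x \<in> {r \<in> carrier R. z \<otimes> r \<in> N}" using x by simp
    qed auto
    have annX: "z \<otimes> r \<in> N"
      if "z \<in> C" "saturated_submodule C c R N" "\<And>x. x \<in> X \<Longrightarrow> z \<otimes> x \<in> N" "r \<in> carrier R" for z N r
      using gen [OF ann [OF that(1,2)]] that X(2) by blast
    define FF where "FF = {N. saturated_submodule C c R N \<and> NB B \<subseteq> N \<and>
      (\<forall>z\<in>C. (\<forall>r\<in>carrier R. z \<otimes> r \<in> N) \<longrightarrow> z \<in> J)}"
    have "\<exists>M\<in>FF. \<forall>V\<in>FF. M \<subseteq> V \<longrightarrow> V = M"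
    proof (rule subset_Zorn_nonempty)
      show "FF \<noteq> {}" using N1 unfolding FF_def J_def by blast
      fix \<C> assume ch: "\<C> \<noteq> {}" "subset.chain FF \<C>"
      then have F: "saturated_submodule C c R N" "NB B \<subseteq> N"
        "\<And>z. z \<in> C \<Longrightarrow> (\<forall>r\<in>carrier R. z \<otimes> r \<in> N) \<Longrightarrow> z \<in> J" if "N \<in> \<C>" for N
        using that unfolding subset_chain_def FF_def by blast+
      have common: "\<exists>N\<in>\<C>. x \<in> N \<and> y \<in> N" if xy: "x \<in> \<Union>\<C>" "y \<in> \<Union>\<C>" for x y
      proof -
        obtain N1 N2 where N: "N1 \<in> \<C>" "x \<in> N1" "N2 \<in> \<C>" "y \<in> N2" using xy by blast
        then have "N1 \<subseteq> N2 \<or> N2 \<subseteq> N1" using ch(2) unfolding subset_chain_def by blast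
        then show ?thesis using N by blast
      qed
      have "saturated_submodule C c R (\<Union>\<C>)"
      proof (rule saturated_submoduleI)
        show "\<Union>\<C> \<subseteq> carrier R" using saturated_submoduleD(1) [OF F(1)] by blast
        show "\<zero> \<in> \<Union>\<C>" using saturated_submoduleD(2) [OF F(1)] ch(1) by blast
        fix x y assume "x \<in> \<Union>\<C>" "y \<in> \<Union>\<C>"
        then obtain N where "N \<in> \<C>" "x \<in> N" "y \<in> N" using common by blast
        then show "x \<oplus> y \<in> \<Union>\<C>" using saturated_submoduleD(3) [OF F(1)] by blast
      next
        fix z x assume "z \<in> C" "x \<in> \<Union>\<C>"
        then show "z \<otimes> x \<in> \<Union>\<C>" using saturated_submoduleD(4) [OF F(1)] by blast
      next
        fix x assume x: "x \<in> carrier R" "c \<otimes> x \<in> \<Union>\<C>"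
        then obtain N where N: "N \<in> \<C>" "c \<otimes> x \<in> N" by blast
        then have "x \<in> N" using saturated_submoduleD(5) [OF F(1) [OF N(1)] x(1)] by blast
        then show "x \<in> \<Union>\<C>" using N by blast
      qed
      moreover have "NB B \<subseteq> \<Union>\<C>" using F(2) ch(1) by blast
      moreover have "z \<in> J" if z: "z \<in> C" "\<forall>r\<in>carrier R. z \<otimes> r \<in> \<Union>\<C>" for z
      proof -
        \<comment> \<open>Finiteness of \<open>X\<close> is what makes Zorn's lemma applicable: if z
          sends all generators into the union of a chain, it sends them into one member, and then it
          sends all of \<open>R\<close> there.\<close>
        have "(\<lambda>x. z \<otimes> x) ` X \<subseteq> \<Union>\<C>" using z X by blast
        then obtain N where N: "N \<in> \<C>" "(\<lambda>x. z \<otimes> x) ` X \<subseteq> N"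
          by (rule finite_subset_Union_chain [OF finite_imageI [OF X(1)] _ ch])
        have "\<forall>r\<in>carrier R. z \<otimes> r \<in> N"
          using annX [OF z(1) F(1) [OF N(1)]] N(2) by blast
        then show ?thesis by (rule F(3) [OF N(1) z(1)])
      qed
      ultimately show "\<Union>\<C> \<in> FF" unfolding FF_def by blast
    qed
    then obtain N0 where N0F: "N0 \<in> FF" and N0max: "\<And>V. V \<in> FF \<Longrightarrow> N0 \<subseteq> V \<Longrightarrow> V = N0" by blast
    have N0: "saturated_submodule C c R N0" "NB B \<subseteq> N0"
      "\<And>z. z \<in> C \<Longrightarrow> (\<forall>r\<in>carrier R. z \<otimes> r \<in> N0) \<Longrightarrow> z \<in> J"
      using N0F unfolding FF_def by blast+
    \<comment> \<open>For each strictly larger U some z in \<open>C\<close> outside \<open>J\<close>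
      sends \<open>R\<close> into U. As z is central in \<open>W\<close>, B + zW is a two-sided
      ideal, and it strictly contains \<open>B\<close>. By the choice of \<open>B\<close> the chain
      condition holds above its saturated product with \<open>R\<close>, hence above U.\<close>
    have N0acc: "acc_above C c R N0"
    proof (rule acc_above_strict)
      fix U assume U: "saturated_submodule C c R U" "N0 \<subseteq> U" "U \<noteq> N0"
      note D = saturated_submoduleD(1-4) [OF U(1)]
      have "U \<notin> FF" using N0max U by blast
      then obtain z where z: "z \<in> C" "\<And>r. r \<in> carrier R \<Longrightarrow> z \<otimes> r \<in> U" "z \<notin> J"
        using U N0(2) unfolding FF_def by blast
      have zW: "z \<in> W" "z \<in> carrier R" using z CW WR by auto
      let ?B = "{b \<oplus> z \<otimes> w |b w. b \<in> B \<and> w \<in> W}"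
      have BI: "b \<oplus> z \<otimes> w \<in> ?B" if "b \<in> B" "w \<in> W" for b w using that by blast
      have B0: "\<zero> \<in> B" using B.zero_closed by simp
      have Ba: "x \<oplus> y \<in> B" if "x \<in> B" "y \<in> B" for x y using B.a_closed that by simp
      have Bl: "w \<otimes> x \<in> B" and Br: "x \<otimes> w \<in> B" if "x \<in> B" "w \<in> W" for x w
        using B.I_l_closed B.I_r_closed that by simp_all
      have Bneg: "\<ominus> x \<in> B" if x: "x \<in> B" for x
      proof -
        have "\<ominus> \<one> \<in> W" using subringE(3,5) [OF sW] by blast
        then have "\<ominus> \<one> \<otimes> x \<in> B" by (rule Bl [OF x])
        then show ?thesis using x BW WR by (auto simp: l_minus subset_iff)
      qed
      have mc: "x \<in> carrier R" if "x \<in> W" for x using that WR by blast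
      have Bc: "x \<in> carrier R" if "x \<in> B" for x using that BW mc by blast
      have lc: "w \<otimes> (z \<otimes> v) = z \<otimes> (w \<otimes> v)" if "w \<in> W" "v \<in> carrier R" for w v
        using that mc zW Ccomm [OF z(1), of w] by (simp add: m_assoc [symmetric])
      have "ideal ?B ?W"
      proof (rule idealI [OF W.ring_axioms])
        have sub: "?B \<subseteq> W" using BW zW subringE(6,7) [OF sW] by blast
        show "subgroup ?B (add_monoid ?W)"
        proof (rule W.add.subgroupI)
          show "?B \<subseteq> carrier ?W" using sub by simp
          show "?B \<noteq> {}" using BI [OF B0] subringE(2) [OF sW] by blast
          fix x y assume "x \<in> ?B" "y \<in> ?B"
          then obtain b w b' w' where a: "b \<in> B" "w \<in> W" "x = b \<oplus> z \<otimes> w" "b' \<in> B" "w' \<in> W" "y = b' \<oplus> z \<otimes> w'" by blast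
          then have "x \<oplus> y = (b \<oplus> b') \<oplus> z \<otimes> (w \<oplus> w')"
            using mc Bc zW by (simp add: r_distr a_ac)
          then have "x \<oplus> y \<in> ?B" using BI [OF Ba [OF a(1,4)] subringE(7) [OF sW a(2,5)]] by simp
          then show "x \<oplus>\<^bsub>?W\<^esub> y \<in> ?B" by simp
        next
          fix x assume x: "x \<in> ?B"
          then obtain b w where a: "b \<in> B" "w \<in> W" "x = b \<oplus> z \<otimes> w" by blast
          have xW: "x \<in> W" using x sub by blast
          have "\<ominus> x = \<ominus> b \<oplus> z \<otimes> (\<ominus> w)" using a mc Bc zW by (simp add: minus_add r_minus)
          then have "\<ominus> x \<in> ?B" using BI [OF Bneg [OF a(1)] subringE(5) [OF sW a(2)]] by simp
          moreover have "\<ominus>\<^bsub>?W\<^esub> x = \<ominus> x"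
            by (rule W.minus_equality) (use xW mc subringE(5) [OF sW] in \<open>auto simp: l_neg\<close>)
          ultimately show "\<ominus>\<^bsub>?W\<^esub> x \<in> ?B" by simp
        qed
        fix x w assume "x \<in> ?B" "w \<in> carrier ?W"
        then obtain b v where a: "b \<in> B" "v \<in> W" "x = b \<oplus> z \<otimes> v" and w: "w \<in> W" by auto
        have "w \<otimes> x = w \<otimes> b \<oplus> z \<otimes> (w \<otimes> v)" using a w mc Bc zW lc [OF w mc [OF a(2)]] by (simp add: r_distr)
        then show "w \<otimes>\<^bsub>?W\<^esub> x \<in> ?B" using BI [OF Bl [OF a(1) w] subringE(6) [OF sW w a(2)]] by simp
        have "x \<otimes> w = b \<otimes> w \<oplus> z \<otimes> (v \<otimes> w)" using a w mc Bc zW by (simp add: l_distr m_assoc)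
        then show "x \<otimes>\<^bsub>?W\<^esub> w \<in> ?B" using BI [OF Br [OF a(1) w] subringE(6) [OF sW a(2) w]] by simp
      qed
      moreover have "B \<subseteq> ?B"
      proof
        fix b assume b: "b \<in> B"
        have "b = b \<oplus> z \<otimes> \<zero>" using Bc [OF b] zW by simp
        then show "b \<in> ?B" using b subringE(2) [OF sW] by blast
      qed
      moreover have "?B \<noteq> B"
      proof
        assume "?B = B"
        moreover have "z = \<zero> \<oplus> z \<otimes> \<one>" using zW by simp
        then have "z \<in> ?B" using B0 subringE(3) [OF sW] by blast
        ultimately have "z \<in> B" by blast
        then show False using z(1,3) NBmem [of z B] unfolding J_def by blast
      qed
      ultimately have "?B \<notin> Bad" using Bmax by blast
      then have "acc_above C c R (NB ?B)" using \<open>ideal ?B ?W\<close> by (simp add: Bad_def)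
      moreover have "NB ?B \<subseteq> U"
      proof (rule NBle [OF U(1)])
        fix x r assume "x \<in> ?B" and r: "r \<in> carrier R"
        then obtain b w where a: "b \<in> B" "w \<in> W" "x = b \<oplus> z \<otimes> w" by blast
        have "x \<otimes> r = b \<otimes> r \<oplus> z \<otimes> (w \<otimes> r)" using a r mc Bc zW by (simp add: l_distr m_assoc)
        moreover have "b \<otimes> r \<in> U" using NBmem [OF a(1) r] N0(2) U(2) by blast
        moreover have "z \<otimes> (w \<otimes> r) \<in> U" using z(2) a(2) r mc by blast
        ultimately show "x \<otimes> r \<in> U" using D(3) by simp
      qed
      ultimately show "acc_above C c R U" by (rule acc_above_mono)
    qed
    have CR: "scalars (R\<lparr>carrier := C\<rparr>) C c"
    proof -
      interpret C: ring "R\<lparr>carrier := C\<rparr>" by (rule subring_is_ring [OF sC])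
      show ?thesis
        using C.carrier_is_subring comm c(1) by (intro scalars.intro scalars_axioms.intro C.ring_axioms) auto
    qed
    \<comment> \<open>Multiplying z with the elements of \<open>X\<close> embeds C/J in a finite
      power of R/N0, where the chain condition is known.\<close>
    have "acc_above C c (R\<lparr>carrier := C\<rparr>) {z \<in> carrier (R\<lparr>carrier := C\<rparr>). \<forall>x\<in>X. z \<otimes> x \<in> N0}"
      by (rule conjunct2 [OF acc_above_vimage [OF CR sc X(1), where f = "\<lambda>x z. z \<otimes> x" and \<sigma> = id, OF _ _ _ _ _ N0(1) N0acc]])
        (use X(2) Z_carrier in \<open>auto simp: l_distr m_assoc subset_iff\<close>)
    moreover have "{z \<in> carrier (R\<lparr>carrier := C\<rparr>). \<forall>x\<in>X. z \<otimes> x \<in> N0} = J"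
    proof (intro equalityI subsetI)
      fix z assume z: "z \<in> {z \<in> carrier (R\<lparr>carrier := C\<rparr>). \<forall>x\<in>X. z \<otimes> x \<in> N0}"
      then show "z \<in> J" using annX [OF _ N0(1)] by (intro N0(3)) auto
    next
      fix z assume "z \<in> J"
      then show "z \<in> {z \<in> carrier (R\<lparr>carrier := C\<rparr>). \<forall>x\<in>X. z \<otimes> x \<in> N0}"
        using N0(2) X(2) unfolding J_def by auto
    qed
    ultimately have "acc_above C c (R\<lparr>carrier := C\<rparr>) J" by simp
    then have "acc_above C c R (NB B)"
      by (intro acc_above_generated [OF X _ _ N1]) (use gen X(2) in \<open>auto simp: J_def\<close>)
    then show False using Bacc by blast
  qed
qed

section \<open>The nilradical of a left Noetherian ring\<close>

context ring
begin

text \<open>Nilpotent ideals are shrinking. This weaker property suffices below, which avoids Levitzki's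
  theorem.\<close>

definition shrinking :: "'a set \<Rightarrow> bool"
  where "shrinking J \<longleftrightarrow> (\<forall>I I'. left_ideal I R \<and> left_ideal I' R \<and> \<not> I' \<subseteq> I \<longrightarrow>
    (\<exists>x\<in>I' - I. \<forall>a\<in>J. a \<otimes> x \<in> I))"

lemma shrinkingD:
  "shrinking J \<Longrightarrow> left_ideal I R \<Longrightarrow> left_ideal I' R \<Longrightarrow> \<not> I' \<subseteq> I \<Longrightarrow> \<exists>x\<in>I' - I. \<forall>a\<in>J. a \<otimes> x \<in> I"
  by (simp add: shrinking_def)

lemma shrinking_subset: "shrinking J \<Longrightarrow> J' \<subseteq> J \<Longrightarrow> shrinking J'"
  unfolding shrinking_def by (meson subsetD)

lemma left_idealD:
  assumes "left_ideal I R"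
  shows "I \<subseteq> carrier R" "\<zero> \<in> I" "\<And>x y. x \<in> I \<Longrightarrow> y \<in> I \<Longrightarrow> x \<oplus> y \<in> I" "\<And>x. x \<in> I \<Longrightarrow> \<ominus> x \<in> I"
    "\<And>r x. r \<in> carrier R \<Longrightarrow> x \<in> I \<Longrightarrow> r \<otimes> x \<in> I"
proof -
  interpret additive_subgroup I R using assms by (simp add: left_ideal_def)
  show "I \<subseteq> carrier R" "\<zero> \<in> I" "\<And>x y. x \<in> I \<Longrightarrow> y \<in> I \<Longrightarrow> x \<oplus> y \<in> I" "\<And>x. x \<in> I \<Longrightarrow> \<ominus> x \<in> I"
    by (auto simp: a_subset a_inv_closed abelian_group_axioms)
  show "\<And>r x. r \<in> carrier R \<Longrightarrow> x \<in> I \<Longrightarrow> r \<otimes> x \<in> I" using assms by (simp add: left_ideal_def)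
qed

lemma left_idealI:
  assumes "I \<subseteq> carrier R" "\<zero> \<in> I" "\<And>x y. x \<in> I \<Longrightarrow> y \<in> I \<Longrightarrow> x \<oplus> y \<in> I"
    "\<And>r x. r \<in> carrier R \<Longrightarrow> x \<in> I \<Longrightarrow> r \<otimes> x \<in> I"
  shows "left_ideal I R"
proof -
  have "\<ominus> x \<in> I" if x: "x \<in> I" for x
  proof -
    have "\<ominus> \<one> \<otimes> x \<in> I" using assms(4) x by simp
    then show ?thesis using x assms(1) by (auto simp: l_minus)
  qed
  then have "subgroup I (add_monoid R)"
    using assms by (intro add.subgroupI) (auto simp: a_inv_def)
  then show ?thesis using assms(4) by (simp add: left_ideal_def additive_subgroup_def)
qed

lemma ideal_left_ideal: "ideal I R \<Longrightarrow> left_ideal I R"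
  by (simp add: left_ideal_def ideal.axioms(1) ideal.I_l_closed)

lemma two_sided_idealI:
  assumes "left_ideal I R" "\<And>x r. x \<in> I \<Longrightarrow> r \<in> carrier R \<Longrightarrow> x \<otimes> r \<in> I"
  shows "ideal I R"
proof (rule idealI [OF ring_axioms])
  show "subgroup I (add_monoid R)" using assms(1) by (simp add: left_ideal_def additive_subgroup_def)
qed (use assms left_idealD(5) in auto)

text \<open>The property of \<open>J\<close> is applied inside I'. The elements of I' that
  \<open>J\<close> sends into I form a left ideal because \<open>J\<close> is closed under right
  multiplication, and the property of \<open>K\<close> is applied inside this left ideal.\<close>

lemma shrinking_sum:
  assumes J: "ideal J R" "shrinking J" and K: "ideal K R" "shrinking K"
  shows "shrinking (J <+>\<^bsub>R\<^esub> K)"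
  unfolding shrinking_def
proof (intro allI impI, elim conjE)
  fix I I' assume I: "left_ideal I R" and I': "left_ideal I' R" and n: "\<not> I' \<subseteq> I"
  note D = left_idealD [OF I] and E = left_idealD [OF I']
  have Jc: "a \<in> carrier R" if "a \<in> J" for a using ideal.Icarr [OF J(1) that] .
  have Kc: "a \<in> carrier R" if "a \<in> K" for a using ideal.Icarr [OF K(1) that] .
  let ?I = "{x \<in> I'. \<forall>a\<in>J. a \<otimes> x \<in> I}"
  have xR: "x \<in> carrier R" if "x \<in> I'" for x using that E(1) by blast
  have "left_ideal ?I R"
  proof (rule left_idealI)
    show "?I \<subseteq> carrier R" using E(1) by blast
    show "\<zero> \<in> ?I" using E(2) D(2) Jc by simp
    show "x \<oplus> y \<in> ?I" if "x \<in> ?I" "y \<in> ?I" for x y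
      using that E(3) D(3) Jc xR by (simp add: r_distr)
    fix r x assume r: "r \<in> carrier R" and x: "x \<in> ?I"
    have "a \<otimes> (r \<otimes> x) \<in> I" if a: "a \<in> J" for a
    proof -
      have "a \<otimes> r \<in> J" using ideal.I_r_closed [OF J(1) a r] .
      then have "(a \<otimes> r) \<otimes> x \<in> I" using x by blast
      then show ?thesis using Jc [OF a] r xR x by (simp add: m_assoc)
    qed
    then show "r \<otimes> x \<in> ?I" using E(5) [OF r] x by blast
  qed
  moreover have "\<not> ?I \<subseteq> I" using shrinkingD [OF J(2) I I' n] by blast
  ultimately obtain x where x: "x \<in> ?I" "x \<notin> I" "\<And>a. a \<in> K \<Longrightarrow> a \<otimes> x \<in> I"
    using shrinkingD [OF K(2) I] by blast
  have "s \<otimes> x \<in> I" if s: "s \<in> J <+>\<^bsub>R\<^esub> K" for s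
  proof -
    obtain a b where ab: "a \<in> J" "b \<in> K" "s = a \<oplus> b" using s unfolding set_add_def' by blast
    have "s \<otimes> x = a \<otimes> x \<oplus> b \<otimes> x" unfolding ab(3) using Jc Kc ab xR x(1) by (simp add: l_distr)
    then show ?thesis using D(3) x ab by simp
  qed
  then show "\<exists>x\<in>I' - I. \<forall>a\<in>J <+>\<^bsub>R\<^esub> K. a \<otimes> x \<in> I" using x by blast
qed

text \<open>Utumi's argument: if \<open>x\<close> has a maximal left annihilator modulo the largest shrinking ideal
  \<open>P\<close>, then \<open>x R x\<close> lies in \<open>P\<close>.\<close>

lemma nil_ideals_shrinking:
  assumes noeth: "left_noetherian R"
  shows "\<exists>P. ideal P R \<and> shrinking P \<and> (\<forall>N. nil_ideal N R \<longrightarrow> N \<subseteq> P)"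
proof -
  note acc = noeth [unfolded left_noetherian_def]
  let ?F = "{P. ideal P R \<and> shrinking P}"
  have "shrinking {\<zero>}"
    unfolding shrinking_def
  proof (intro allI impI, elim conjE)
    fix I I' assume I: "left_ideal I R" "left_ideal I' R" "\<not> I' \<subseteq> I"
    then obtain x where x: "x \<in> I' - I" by blast
    then have "x \<in> carrier R" using left_idealD(1) [OF I(2)] by blast
    then have "\<forall>a\<in>{\<zero>}. a \<otimes> x \<in> I" using left_idealD(2) [OF I(1)] by simp
    then show "\<exists>x\<in>I' - I. \<forall>a\<in>{\<zero>}. a \<otimes> x \<in> I" using x by blast
  qed
  then have F: "?F \<noteq> {}" "?F \<subseteq> {I. left_ideal I R}" using zeroideal ideal_left_ideal by blast+
  have "\<exists>P\<in>?F. \<forall>P'\<in>?F. P \<subseteq> P' \<longrightarrow> P' = P" by (rule acc_maximal [OF acc F(2,1)])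
  then obtain P where P: "ideal P R" "shrinking P"
    and max: "\<And>P'. ideal P' R \<Longrightarrow> shrinking P' \<Longrightarrow> P \<subseteq> P' \<Longrightarrow> P' = P" by blast
  interpret P: ideal P R by (rule P(1))
  note PD = left_idealD [OF ideal_left_ideal [OF P(1)]]
  have "N \<subseteq> P" if nil: "nil_ideal N R" for N
  proof (rule ccontr)
    assume nsub: "\<not> N \<subseteq> P"
    have N: "ideal N R" and Nnil: "\<And>x. x \<in> N \<Longrightarrow> \<exists>n::nat. x [^] n = \<zero>" using nil by (auto simp: nil_ideal_def)
    interpret N: ideal N R by (rule N)
    define l where "l x = {r \<in> carrier R. r \<otimes> x \<in> P}" for x
    have lideal: "left_ideal (l x) R" if x: "x \<in> carrier R" for x
      using x PD by (intro left_idealI) (auto simp: l_def l_distr m_assoc)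
    let ?G = "l ` (N - P)"
    have G: "?G \<subseteq> {I. left_ideal I R}" "?G \<noteq> {}" using lideal N.Icarr nsub by blast+
    have "\<exists>M\<in>?G. \<forall>M'\<in>?G. M \<subseteq> M' \<longrightarrow> M' = M" by (rule acc_maximal [OF acc G])
    then obtain x where x: "x \<in> N" "x \<notin> P" and lmax: "\<And>y. y \<in> N \<Longrightarrow> y \<notin> P \<Longrightarrow> l x \<subseteq> l y \<Longrightarrow> l y = l x" by blast
    have xR: "x \<in> carrier R" using x N.Icarr by blast
    \<comment> \<open>If y = x r is outside \<open>P\<close>, let u be the last power of y outside
      \<open>P\<close>. As u is a right multiple of x, its left annihilator modulo \<open>P\<close>
      contains that of x, so by maximality they agree. Now y kills u modulo \<open>P\<close>, hence
      also x.\<close>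
    have xrx: "(x \<otimes> r) \<otimes> x \<in> P" if r: "r \<in> carrier R" for r
    proof -
      define y where "y = x \<otimes> r"
      have yN: "y \<in> N" and yR: "y \<in> carrier R" using x r N.I_r_closed xR by (simp_all add: y_def)
      show ?thesis
      proof (cases "y \<in> P")
        case True
        then show ?thesis using P.I_r_closed xR unfolding y_def by blast
      next
        case False
        define Q where "Q k \<longleftrightarrow> y [^] (k::nat) \<in> P" for k
        obtain n :: nat where "y [^] n = \<zero>" using Nnil yN by blast
        then have "Q n" using PD(2) by (simp add: Q_def)
        then have L: "Q (LEAST k. Q k)" by (rule LeastI)
        have "\<not> Q 0" unfolding Q_def using P.I_l_closed [of \<one> y] yR False by auto
        moreover have "\<not> Q (Suc 0)" unfolding Q_def using False yR by simp
        \<comment> \<open>The least exponent is at least 2, so the preceding power u has a positive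
          exponent and begins with the factor x.\<close>
        ultimately have "(LEAST k. Q k) \<noteq> 0" "(LEAST k. Q k) \<noteq> Suc 0" using L by metis+
        then obtain j where j: "(LEAST k. Q k) = Suc (Suc j)" by (metis not0_implies_Suc)
        define u where "u = y [^] Suc j"
        have "\<not> Q (Suc j)" using j by (metis lessI not_less_Least)
        then have uP: "u \<notin> P" by (simp add: Q_def u_def)
        have ueq: "u = x \<otimes> (r \<otimes> y [^] j)"
          unfolding u_def nat_pow_Suc2 [OF yR] using xR r yR by (simp add: y_def m_assoc)
        have uN: "u \<in> N" unfolding ueq using x r yR by (intro N.I_r_closed) auto
        have "l x \<subseteq> l u"
        proof
          fix s assume s: "s \<in> l x"
          then have "(s \<otimes> x) \<otimes> (r \<otimes> y [^] j) \<in> P" using r yR by (intro P.I_r_closed [of "s \<otimes> x"]) (auto simp: l_def)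
          then show "s \<in> l u" using s r yR xR unfolding ueq by (simp add: l_def m_assoc)
        qed
        then have "l u = l x" using lmax uN uP by blast
        moreover have "y \<otimes> u \<in> P"
          using L j nat_pow_Suc2 [OF yR, of "Suc j"] unfolding Q_def u_def by simp
        then have "y \<in> l u" using yR by (simp add: l_def)
        ultimately have "y \<in> l x" by simp
        then show ?thesis by (simp add: l_def y_def)
      qed
    qed
    let ?T = "Idl {x}"
    have T: "ideal ?T R" "x \<in> ?T" using xR by (auto intro: genideal_ideal genideal_self')
    interpret T: ideal ?T R by (rule T(1))
    \<comment> \<open>Going from x R x to the product of the generated ideal T with itself takes two
      auxiliary ideals: this one places T R x in \<open>P\<close>, the next one places T T in
      \<open>P\<close>.\<close>
    have "ideal {t \<in> carrier R. \<forall>r\<in>carrier R. t \<otimes> (r \<otimes> x) \<in> P} R" (is "ideal ?K R")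
    proof (rule two_sided_idealI [OF left_idealI])
      show "\<zero> \<in> ?K" using PD(2) xR by simp
      show "a \<oplus> b \<in> ?K" if "a \<in> ?K" "b \<in> ?K" for a b using that PD(3) xR by (simp add: l_distr)
      show "r \<otimes> a \<in> ?K" if "r \<in> carrier R" "a \<in> ?K" for a r
        using that PD(5) xR by (simp add: m_assoc)
      fix a r assume a: "a \<in> ?K" and r: "r \<in> carrier R"
      have "(a \<otimes> r) \<otimes> (s \<otimes> x) \<in> P" if s: "s \<in> carrier R" for s
      proof -
        have "a \<otimes> ((r \<otimes> s) \<otimes> x) \<in> P" using a r s by blast
        then show ?thesis using a r s xR by (simp add: m_assoc)
      qed
      then show "a \<otimes> r \<in> ?K" using a r by simp
    qed auto
    moreover have "{x} \<subseteq> ?K" using xR xrx by (simp add: m_assoc)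
    ultimately have TK: "?T \<subseteq> ?K" by (rule genideal_minimal)
    have "ideal {u \<in> carrier R. \<forall>t\<in>?T. t \<otimes> u \<in> P} R" (is "ideal ?M R")
    proof (rule two_sided_idealI [OF left_idealI])
      show "\<zero> \<in> ?M" using PD(2) T.Icarr by simp
      show "a \<oplus> b \<in> ?M" if "a \<in> ?M" "b \<in> ?M" for a b using that PD(3) T.Icarr by (simp add: r_distr)
      show "a \<otimes> r \<in> ?M" if "a \<in> ?M" "r \<in> carrier R" for a r
      proof -
        have "t \<otimes> (a \<otimes> r) \<in> P" if t: "t \<in> ?T" for t
        proof -
          have "(t \<otimes> a) \<otimes> r \<in> P" using t \<open>a \<in> ?M\<close> \<open>r \<in> carrier R\<close> by (intro P.I_r_closed [of "t \<otimes> a"]) auto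
          then show ?thesis using t \<open>a \<in> ?M\<close> \<open>r \<in> carrier R\<close> T.Icarr by (simp add: m_assoc)
        qed
        then show ?thesis using that by simp
      qed
      fix r a assume r: "r \<in> carrier R" and a: "a \<in> ?M"
      have "t \<otimes> (r \<otimes> a) \<in> P" if t: "t \<in> ?T" for t
      proof -
        have "(t \<otimes> r) \<otimes> a \<in> P" using T.I_r_closed [OF t r] a by blast
        then show ?thesis using t a r T.Icarr by (simp add: m_assoc)
      qed
      then show "r \<otimes> a \<in> ?M" using a r by simp
    qed auto
    moreover have "t \<otimes> x \<in> P" if t: "t \<in> ?T" for t
    proof -
      have "t \<otimes> (\<one> \<otimes> x) \<in> P" using subsetD [OF TK t] by blast
      then show ?thesis using xR by simp
    qed
    then have "{x} \<subseteq> ?M" using xR by blast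
    ultimately have TM: "?T \<subseteq> ?M" by (rule genideal_minimal)
    \<comment> \<open>Since T T lies in \<open>P\<close>, an element v that \<open>P\<close> sends
      into I is either sent into I by T as well, or has a multiple a v outside I, with a in T, that
      T sends into I.\<close>
    have "shrinking ?T"
      unfolding shrinking_def
    proof (intro allI impI, elim conjE)
      fix I I' assume I: "left_ideal I R" and I': "left_ideal I' R" and n: "\<not> I' \<subseteq> I"
      obtain v where v: "v \<in> I'" "v \<notin> I" "\<And>a. a \<in> P \<Longrightarrow> a \<otimes> v \<in> I" using shrinkingD [OF P(2) I I' n] by blast
      have vR: "v \<in> carrier R" using v left_idealD(1) [OF I'] by blast
      show "\<exists>x\<in>I' - I. \<forall>a\<in>?T. a \<otimes> x \<in> I"
      proof (cases "\<forall>a\<in>?T. a \<otimes> v \<in> I")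
        case True
        then show ?thesis using v by blast
      next
        case False
        then obtain a where a: "a \<in> ?T" "a \<otimes> v \<notin> I" by blast
        have "b \<otimes> (a \<otimes> v) \<in> I" if b: "b \<in> ?T" for b
        proof -
          have "b \<otimes> a \<in> P" using subsetD [OF TM a(1)] b by blast
          then have "(b \<otimes> a) \<otimes> v \<in> I" by (rule v(3))
          then show ?thesis using T.Icarr a b vR by (simp add: m_assoc)
        qed
        moreover have "a \<otimes> v \<in> I'" using left_idealD(5) [OF I'] T.Icarr a v by blast
        ultimately show ?thesis using a by blast
      qed
    qed
    then have "shrinking (P <+>\<^bsub>R\<^esub> ?T)" using shrinking_sum P T(1) by blast
    moreover have "ideal (P <+>\<^bsub>R\<^esub> ?T) R" by (rule add_ideals [OF P(1) T(1)])
    moreover have "P \<subseteq> P <+>\<^bsub>R\<^esub> ?T"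
    proof
      fix a assume a: "a \<in> P"
      then have "a = a \<oplus> \<zero>" using P.Icarr by simp
      then show "a \<in> P <+>\<^bsub>R\<^esub> ?T" using a T.zero_closed unfolding set_add_def' by blast
    qed
    ultimately have "P <+>\<^bsub>R\<^esub> ?T = P" using max by blast
    moreover have "x = \<zero> \<oplus> x" using xR by simp
    then have "x \<in> P <+>\<^bsub>R\<^esub> ?T" using P.zero_closed T(2) unfolding set_add_def' by blast
    ultimately show False using x by simp
  qed
  then show ?thesis using P by blast
qed

text \<open>All nil ideals lie in the ideal P of Utumi's argument, hence so does the ideal they
  generate, and the shrinking property passes to subsets.\<close>

lemma nilradical_shrinking:
  assumes "left_noetherian R"
  shows "ideal (nilradical R) R" "shrinking (nilradical R)"
proof -
  obtain P where P: "ideal P R" "shrinking P" "\<And>N. nil_ideal N R \<Longrightarrow> N \<subseteq> P"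
    using nil_ideals_shrinking [OF assms] by blast
  have "\<Union>{I. nil_ideal I R} \<subseteq> P" using P(3) by blast
  then have "nilradical R \<subseteq> P" unfolding nilradical_def by (rule genideal_minimal [OF P(1)])
  then show "shrinking (nilradical R)" using P(2) shrinking_subset by blast
  have "\<Union>{I. nil_ideal I R} \<subseteq> carrier R"
    using P(3) ideal.Icarr [OF P(1)] by blast
  then show "ideal (nilradical R) R" unfolding nilradical_def by (rule genideal_ideal)
qed

text \<open>Take a left ideal I maximal among those contained in finitely generated
  \<open>W\<close>-submodules. If I were proper, there would be x outside I with N x in I. Modulo I
  the left ideal R x is then an image of R/N, generated by the products of \<open>X\<close> with x,
  so I + R x contradicts maximality. This replaces a filtration by powers of a nilpotent
  ideal.\<close>

lemma finitely_generated_mod_shrinking: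
  assumes noeth: "left_noetherian R" and sW: "subring W R"
    and N: "shrinking N" and X: "finite X" "X \<subseteq> carrier R"
    and gen: "\<And>U. saturated_submodule W \<one> R U \<Longrightarrow> X \<subseteq> U \<Longrightarrow> N \<subseteq> U \<Longrightarrow> U = carrier R"
    and NR: "N \<subseteq> carrier R"
  shows "\<exists>Y. finite Y \<and> Y \<subseteq> carrier R \<and>
    (\<forall>U. saturated_submodule W \<one> R U \<longrightarrow> Y \<subseteq> U \<longrightarrow> U = carrier R)"
proof -
  note WR = subringE(1) [OF sW]
  \<comment> \<open>Containment in the \<open>W\<close>-submodule generated by Y is expressed
    through all submodules that contain Y.\<close>
  define FF where "FF = {I. left_ideal I R \<and> (\<exists>Y. finite Y \<and> Y \<subseteq> carrier R \<and>
    (\<forall>U. saturated_submodule W \<one> R U \<longrightarrow> Y \<subseteq> U \<longrightarrow> I \<subseteq> U))}"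
  have "left_ideal {\<zero>} R" by (rule ideal_left_ideal [OF zeroideal])
  moreover have "{\<zero>} \<subseteq> U" if "saturated_submodule W \<one> R U" for U
    using saturated_submoduleD(2) [OF that] by blast
  ultimately have "{\<zero>} \<in> FF" unfolding FF_def by blast
  then have F: "FF \<subseteq> {I. left_ideal I R}" "FF \<noteq> {}" unfolding FF_def by blast+
  have "\<exists>M\<in>FF. \<forall>X\<in>FF. M \<subseteq> X \<longrightarrow> X = M"
    by (rule acc_maximal [OF noeth [unfolded left_noetherian_def] F])
  then obtain I where IF: "I \<in> FF" and max: "\<And>J. J \<in> FF \<Longrightarrow> I \<subseteq> J \<Longrightarrow> J = I" by blast
  obtain Y where I: "left_ideal I R" and Y: "finite Y" "Y \<subseteq> carrier R"
    "\<And>U. saturated_submodule W \<one> R U \<Longrightarrow> Y \<subseteq> U \<Longrightarrow> I \<subseteq> U"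
    using IF unfolding FF_def by blast
  note D = left_idealD [OF I]
  have "I = carrier R"
  proof (rule ccontr)
    assume "I \<noteq> carrier R"
    then have "\<not> carrier R \<subseteq> I" using D(1) by blast
    moreover have "left_ideal (carrier R) R" by (rule left_idealI) auto
    ultimately obtain x where x: "x \<in> carrier R" "x \<notin> I" "\<And>a. a \<in> N \<Longrightarrow> a \<otimes> x \<in> I"
      using shrinkingD [OF N I] by blast
    let ?J = "{i \<oplus> r \<otimes> x |i r. i \<in> I \<and> r \<in> carrier R}"
    have iR: "i \<in> carrier R" if "i \<in> I" for i using that D(1) by blast
    have "left_ideal ?J R"
    proof (rule left_idealI)
      show "?J \<subseteq> carrier R" using x iR by auto
      have "\<zero> = \<zero> \<oplus> \<zero> \<otimes> x" using x by simp
      then show "\<zero> \<in> ?J" using D(2) by blast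
      fix a b assume "a \<in> ?J" "b \<in> ?J"
      then obtain i r j s where ab: "i \<in> I" "r \<in> carrier R" "a = i \<oplus> r \<otimes> x" "j \<in> I" "s \<in> carrier R" "b = j \<oplus> s \<otimes> x" by blast
      then have "a \<oplus> b = (i \<oplus> j) \<oplus> (r \<oplus> s) \<otimes> x" using x iR by (simp add: l_distr a_ac)
      moreover have "i \<oplus> j \<in> I" "r \<oplus> s \<in> carrier R" using ab D(3) by auto
      ultimately show "a \<oplus> b \<in> ?J" by blast
    next
      fix t a assume t: "t \<in> carrier R" and "a \<in> ?J"
      then obtain i r where a: "i \<in> I" "r \<in> carrier R" "a = i \<oplus> r \<otimes> x" by blast
      then have "t \<otimes> a = t \<otimes> i \<oplus> (t \<otimes> r) \<otimes> x" using x iR t by (simp add: r_distr m_assoc)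
      moreover have "t \<otimes> i \<in> I" "t \<otimes> r \<in> carrier R" using a t D(5) by auto
      ultimately show "t \<otimes> a \<in> ?J" by blast
    qed
    moreover have "?J \<subseteq> U"
      if U: "saturated_submodule W \<one> R U" "Y \<union> (\<lambda>y. y \<otimes> x) ` X \<subseteq> U" for U
    proof -
      note E = saturated_submoduleD(1-4) [OF U(1)]
      have IU: "I \<subseteq> U" using Y(3) [OF U(1)] U(2) by blast
      have "saturated_submodule W \<one> R {r \<in> carrier R. r \<otimes> x \<in> U}"
      proof (rule saturated_submoduleI)
        show "\<zero> \<in> {r \<in> carrier R. r \<otimes> x \<in> U}" using x E(2) by simp
        show "a \<oplus> b \<in> {r \<in> carrier R. r \<otimes> x \<in> U}"
          if "a \<in> {r \<in> carrier R. r \<otimes> x \<in> U}" "b \<in> {r \<in> carrier R. r \<otimes> x \<in> U}" for a b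
          using that x E(3) by (simp add: l_distr)
        show "w \<otimes> a \<in> {r \<in> carrier R. r \<otimes> x \<in> U}"
          if w: "w \<in> W" "a \<in> {r \<in> carrier R. r \<otimes> x \<in> U}" for w a
        proof -
          have "w \<in> carrier R" using w WR by blast
          then show ?thesis using w x E(4) by (simp add: m_assoc)
        qed
      qed auto
      moreover have "X \<subseteq> {r \<in> carrier R. r \<otimes> x \<in> U}" using U(2) X(2) by blast
      moreover have "N \<subseteq> {r \<in> carrier R. r \<otimes> x \<in> U}" using x(3) IU NR by blast
      ultimately have "{r \<in> carrier R. r \<otimes> x \<in> U} = carrier R" by (rule gen)
      then show ?thesis using IU E(3) by blast
    qed
    moreover have "finite (Y \<union> (\<lambda>y. y \<otimes> x) ` X)" "Y \<union> (\<lambda>y. y \<otimes> x) ` X \<subseteq> carrier R"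
      using X Y(1,2) x by auto
    ultimately have "?J \<in> FF" unfolding FF_def by blast
    moreover have "I \<subseteq> ?J"
    proof
      fix i assume i: "i \<in> I"
      then have "i = i \<oplus> \<zero> \<otimes> x" using x iR by simp
      then show "i \<in> ?J" using i by blast
    qed
    ultimately have "?J = I" using max by blast
    moreover have "x = \<zero> \<oplus> \<one> \<otimes> x" using x by simp
    then have "x \<in> ?J" using D(2) one_closed by blast
    ultimately show False using x by blast
  qed
  then have "U = carrier R" if "saturated_submodule W \<one> R U" "Y \<subseteq> U" for U
    using Y(3) [OF that] saturated_submoduleD(1) [OF that(1)] by blast
  then show ?thesis using Y by blast
qed

end

section \<open>Generators up to powers of the denominator\<close>

lemma (in abelian_monoid) finsum_mem_subset:
  assumes "D \<subseteq> carrier G" "\<zero> \<in> D" "\<And>x y. x \<in> D \<Longrightarrow> y \<in> D \<Longrightarrow> x \<oplus> y \<in> D" "f \<in> A \<rightarrow> D"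
  shows "finsum G f A \<in> D"
  using assms(4)
proof (induction A rule: infinite_finite_induct)
  case (insert a A)
  have "f \<in> A \<rightarrow> carrier G" "f a \<in> carrier G" using insert.prems assms(1) by auto
  then have "finsum G f (insert a A) = f a \<oplus> finsum G f A" using insert.hyps by simp
  moreover have "f a \<in> D" "finsum G f A \<in> D" using insert by auto
  ultimately show ?case using assms(3) by simp
qed (use assms(2) in simp_all)

text \<open>Replaces explicit linear combinations by the closure form of generation used throughout,
  and lifts the generators from the quotient to \<open>R\<close>.\<close>

lemma (in ring) generators_mod_ideal:
  assumes N: "ideal N R" and WR: "W \<subseteq> carrier R"
    and fg: "fin_gen_left ((\<lambda>w. N +> w) ` W) (R Quot N)"
  obtains X where "finite X" "X \<subseteq> carrier R"
    "\<And>U. saturated_submodule W \<one> R U \<Longrightarrow> X \<subseteq> U \<Longrightarrow> N \<subseteq> U \<Longrightarrow> U = carrier R"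
proof -
  interpret N: ideal N R by (rule N)
  interpret Q: ring "R Quot N" by (rule N.quotient_is_ring)
  note hom = N.rcos_ring_hom
  obtain Y where Y: "finite Y" "Y \<subseteq> carrier (R Quot N)"
    and gen: "\<And>X. X \<in> carrier (R Quot N) \<Longrightarrow>
      \<exists>s. s \<in> Y \<rightarrow> (\<lambda>w. N +> w) ` W \<and> X = (\<Oplus>\<^bsub>R Quot N\<^esub>y\<in>Y. s y \<otimes>\<^bsub>R Quot N\<^esub> y)"
    using fg unfolding fin_gen_left_def by blast
  have "\<exists>r\<in>carrier R. y = N +> r" if "y \<in> Y" for y
    using quot_carrierE [of y N] Y(2) that by blast
  then obtain g where g: "\<And>y. y \<in> Y \<Longrightarrow> g y \<in> carrier R" "\<And>y. y \<in> Y \<Longrightarrow> y = N +> g y" by metis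
  have "U = carrier R" if U: "saturated_submodule W \<one> R U" "g ` Y \<subseteq> U" "N \<subseteq> U" for U
  proof
    note D = saturated_submoduleD(1-4) [OF U(1)]
    show "U \<subseteq> carrier R" by (rule D(1))
    have uR: "u \<in> carrier R" if "u \<in> U" for u using that D(1) by blast
    let ?D = "(\<lambda>u. N +> u) ` U"
    show "carrier R \<subseteq> U"
    proof
      fix r assume r: "r \<in> carrier R"
      obtain s where s: "s \<in> Y \<rightarrow> (\<lambda>w. N +> w) ` W"
        "N +> r = (\<Oplus>\<^bsub>R Quot N\<^esub>y\<in>Y. s y \<otimes>\<^bsub>R Quot N\<^esub> y)"
        using gen [OF ring_hom_closed [OF hom r]] by blast
      have mem: "s y \<otimes>\<^bsub>R Quot N\<^esub> y \<in> ?D" if y: "y \<in> Y" for y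
      proof -
        obtain w where w: "w \<in> W" "s y = N +> w" using s(1) y by blast
        have "s y \<otimes>\<^bsub>R Quot N\<^esub> y = (N +> w) \<otimes>\<^bsub>R Quot N\<^esub> (N +> g y)" using w(2) g(2) [OF y] by metis
        also have "\<dots> = N +> (w \<otimes> g y)"
          using ring_hom_mult [OF hom, of w "g y"] w(1) WR g(1) [OF y] by auto
        finally show ?thesis using D(4) [OF w(1), of "g y"] U(2) y by blast
      qed
      have "(\<Oplus>\<^bsub>R Quot N\<^esub>y\<in>Y. s y \<otimes>\<^bsub>R Quot N\<^esub> y) \<in> ?D"
      proof (rule Q.finsum_mem_subset)
        show "?D \<subseteq> carrier (R Quot N)" using ring_hom_closed [OF hom] uR by blast
        have "N +> \<zero> = \<zero>\<^bsub>R Quot N\<^esub>" using quot_eq_zero_iff [OF N zero_closed] by simp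
        then show "\<zero>\<^bsub>R Quot N\<^esub> \<in> ?D" using D(2) by (metis imageI)
        fix x y assume "x \<in> ?D" "y \<in> ?D"
        then obtain u v where uv: "u \<in> U" "v \<in> U" "x = N +> u" "y = N +> v" by blast
        have "x \<oplus>\<^bsub>R Quot N\<^esub> y = N +> (u \<oplus> v)"
          unfolding uv(3,4) using ring_hom_add [OF hom uR uR] uv by simp
        then show "x \<oplus>\<^bsub>R Quot N\<^esub> y \<in> ?D" using D(3) uv by blast
      qed (use mem in blast)
      then obtain u where u: "u \<in> U" "N +> r = N +> u" unfolding s(2) [symmetric] by blast
      have "r \<ominus> u \<in> N"
        using quotient_eq_iff_same_a_r_cos [OF N r uR [OF u(1)]] u(2) by simp
      then have "(r \<ominus> u) \<oplus> u \<in> U" using U(3) D(3) u by blast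
      then show "r \<in> U" using r uR [OF u(1)] by (simp add: a_minus_def a_assoc l_neg)
    qed
  qed
  moreover have "finite (g ` Y)" "g ` Y \<subseteq> carrier R" using Y(1) g(1) by auto
  ultimately show thesis using that by blast
qed

text \<open>Numerators of the given generators suffice: the denominators of coefficients and
  generators combine to a power of \<open>c\<close>, and saturation removes it.\<close>

lemma (in central_element) generators_up_to_powers:
  assumes reg: "regular_element R c" and fg: "finite_over_center (localization R c)"
  obtains Y where "finite Y" "Y \<subseteq> carrier R"
    "\<And>V. saturated_submodule (ring_center R) c R V \<Longrightarrow> Y \<subseteq> V \<Longrightarrow> V = carrier R"
proof -
  interpret L: ring L by (rule localization_is_ring)
  have cancel: "a = b" if "a \<in> carrier R" "b \<in> carrier R" "c [^] (k::nat) \<otimes> a = c [^] k \<otimes> b" for a b k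
  proof (rule inj_onD [OF localization_inj [OF reg]])
    have "c [^] (k + 0) \<otimes> b = c [^] (k + 0) \<otimes> a" using that by simp
    then show "fraction R c a 0 = fraction R c b 0" using that by (subst fraction_eq_iff) blast+
  qed (use that in auto)
  obtain X where X: "finite X" "X \<subseteq> carrier L"
    and gen: "\<And>x. x \<in> carrier L \<Longrightarrow> \<exists>s. s \<in> X \<rightarrow> ring_center L \<and> x = (\<Oplus>\<^bsub>L\<^esub>y\<in>X. s y \<otimes>\<^bsub>L\<^esub> y)"
    using fg unfolding finite_over_center_def fin_gen_left_def by blast
  have "\<exists>w n. w \<in> carrier R \<and> x = fraction R c w n" if "x \<in> X" for x
    using localizationE [of x] X(2) that by blast
  then obtain g h where g: "\<And>x. x \<in> X \<Longrightarrow> g x \<in> carrier R" "\<And>x. x \<in> X \<Longrightarrow> x = fraction R c (g x) (h x)"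
    by metis
  have "V = carrier R" if V: "saturated_submodule (ring_center R) c R V" "g ` X \<subseteq> V" for V
  proof
    note D = saturated_submoduleD(1-4) [OF V(1)]
    show "V \<subseteq> carrier R" by (rule D(1))
    have vR: "v \<in> carrier R" if "v \<in> V" for v using that D(1) by blast
    have pow: "c [^] (k::nat) \<otimes> v \<in> V" if v: "v \<in> V" for k v
      using v
    proof (induction k arbitrary: v)
      case (Suc k)
      have "c [^] k \<otimes> (c \<otimes> v) \<in> V" using Suc D(4) [OF central] by blast
      then show ?case using vR [OF Suc.prems] by (simp add: m_assoc)
    qed (use vR in simp)
    \<comment> \<open>These fractions are closed under addition because V is stable under
      multiplication by \<open>c\<close>.\<close>
    let ?D = "{fraction R c v n |v n. v \<in> V}"
    show "carrier R \<subseteq> V"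
    proof
      fix w assume w: "w \<in> carrier R"
      obtain s where s: "s \<in> X \<rightarrow> ring_center L" "fraction R c w 0 = (\<Oplus>\<^bsub>L\<^esub>y\<in>X. s y \<otimes>\<^bsub>L\<^esub> y)"
        using gen [OF fraction_closed [OF w]] by blast
      have mem: "s y \<otimes>\<^bsub>L\<^esub> y \<in> ?D" if y: "y \<in> X" for y
      proof -
        have sy: "s y \<in> carrier L" "\<And>x. x \<in> carrier L \<Longrightarrow> s y \<otimes>\<^bsub>L\<^esub> x = x \<otimes>\<^bsub>L\<^esub> s y"
          using s(1) y by (auto simp: ring_center_def)
        obtain z n where z: "z \<in> carrier R" "s y = fraction R c z n" using localizationE [OF sy(1)] .
        \<comment> \<open>A central fraction has a central numerator, because powers of the regular
          element \<open>c\<close> can be cancelled.\<close>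
        have "z \<otimes> x = x \<otimes> z" if x: "x \<in> carrier R" for x
        proof -
          have "fraction R c (z \<otimes> x) n = fraction R c (x \<otimes> z) n"
            using sy(2) [OF fraction_closed [OF x, of 0]] z x by (simp add: mult_fraction)
          then obtain k where "c [^] (k + n) \<otimes> (x \<otimes> z) = c [^] (k + n) \<otimes> (z \<otimes> x)"
            using fraction_eq_iff [of "z \<otimes> x" "x \<otimes> z" n n] z x by auto
          then show ?thesis using cancel [of "x \<otimes> z" "z \<otimes> x" "k + n"] z x by simp
        qed
        then have zC: "z \<in> ring_center R" using z by (simp add: ring_center_def)
        have "s y \<otimes>\<^bsub>L\<^esub> y = fraction R c z n \<otimes>\<^bsub>L\<^esub> fraction R c (g y) (h y)" using z(2) g(2) [OF y] by metis
        also have "\<dots> = fraction R c (z \<otimes> g y) (n + h y)" by (rule mult_fraction [OF z(1) g(1) [OF y]])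
        finally show ?thesis using D(4) [OF zC, of "g y"] V(2) y by blast
      qed
      have "(\<Oplus>\<^bsub>L\<^esub>y\<in>X. s y \<otimes>\<^bsub>L\<^esub> y) \<in> ?D"
      proof (rule L.finsum_mem_subset)
        show "?D \<subseteq> carrier L" using vR by blast
        show "\<zero>\<^bsub>L\<^esub> \<in> ?D" using D(2) zero_localization by blast
        fix x y assume "x \<in> ?D" "y \<in> ?D"
        then obtain u n v m where uv: "u \<in> V" "v \<in> V" "x = fraction R c u n" "y = fraction R c v m" by blast
        have "x \<oplus>\<^bsub>L\<^esub> y = fraction R c (c [^] m \<otimes> u \<oplus> c [^] n \<otimes> v) (n + m)"
          unfolding uv(3,4) by (rule add_fraction [OF vR vR]) (use uv in auto)
        moreover have "c [^] m \<otimes> u \<oplus> c [^] n \<otimes> v \<in> V" using D(3) pow uv by blast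
        ultimately show "x \<oplus>\<^bsub>L\<^esub> y \<in> ?D" by blast
      qed (use mem in blast)
      then obtain v n where v: "v \<in> V" "fraction R c w 0 = fraction R c v n" unfolding s(2) [symmetric] by blast
      then obtain k where k: "c [^] (k + 0) \<otimes> v = c [^] (k + n) \<otimes> w"
        using fraction_eq_iff [OF w vR [OF v(1)], of 0 n] by blast
      then have "c [^] (k + n) \<otimes> w \<in> V" using pow [OF v(1), of "k + 0"] by simp
      then show "w \<in> V" using saturated_submodule_pow [OF V(1) c_closed w] by blast
    qed
  qed
  moreover have "finite (g ` X)" "g ` X \<subseteq> carrier R" using X(1) g(1) by auto
  ultimately show thesis using that by blast
qed

text \<open>For fixed x in \<open>X\<close> the coefficients w with w x in \<open>N\<close> include
  \<open>Y\<close>, hence all of \<open>W\<close>. So the elements r with W r contained in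
  \<open>N\<close> form a \<open>W\<close>-submodule containing \<open>X\<close>, and this is all of
  \<open>R\<close>.\<close>

lemma (in ring) generators_trans:
  assumes sW: "subring W R" and CW: "C \<subseteq> W" and comm: "\<And>z w. z \<in> C \<Longrightarrow> w \<in> W \<Longrightarrow> z \<otimes> w = w \<otimes> z" and c: "c \<in> C"
    and X: "X \<subseteq> carrier R" "\<And>U. saturated_submodule W \<one> R U \<Longrightarrow> X \<subseteq> U \<Longrightarrow> U = carrier R"
    and Y: "Y \<subseteq> W" "\<And>V. saturated_submodule C c (R\<lparr>carrier := W\<rparr>) V \<Longrightarrow> Y \<subseteq> V \<Longrightarrow> V = W"
    and N: "saturated_submodule C c R N" "{y \<otimes> x |y x. y \<in> Y \<and> x \<in> X} \<subseteq> N"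
  shows "N = carrier R"
proof -
  note D = saturated_submoduleD(1-4) [OF N(1)] and W = subringE [OF sW]
  have wR: "w \<in> carrier R" if "w \<in> W" for w using that W(1) by blast
  have mem: "w \<otimes> x \<in> N" if x: "x \<in> X" and w: "w \<in> W" for x w
  proof -
    have xR: "x \<in> carrier R" using x X(1) by blast
    have "saturated_submodule C c (R\<lparr>carrier := W\<rparr>) {w \<in> W. w \<otimes> x \<in> N}"
    proof (rule saturated_submoduleI)
      show "\<zero>\<^bsub>R\<lparr>carrier := W\<rparr>\<^esub> \<in> {w \<in> W. w \<otimes> x \<in> N}" using W(2) D(2) xR by simp
      show "u \<oplus>\<^bsub>R\<lparr>carrier := W\<rparr>\<^esub> v \<in> {w \<in> W. w \<otimes> x \<in> N}"
        if "u \<in> {w \<in> W. w \<otimes> x \<in> N}" "v \<in> {w \<in> W. w \<otimes> x \<in> N}" for u v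
        using that W(7) D(3) xR wR by (simp add: l_distr)
      show "z \<otimes>\<^bsub>R\<lparr>carrier := W\<rparr>\<^esub> v \<in> {w \<in> W. w \<otimes> x \<in> N}"
        if z: "z \<in> C" and v: "v \<in> {w \<in> W. w \<otimes> x \<in> N}" for z v
      proof -
        have "z \<in> W" using z CW by blast
        then show ?thesis using v W(6) D(4) [OF z, of "v \<otimes> x"] xR wR by (simp add: m_assoc)
      qed
      fix v assume v: "v \<in> carrier (R\<lparr>carrier := W\<rparr>)" "c \<otimes>\<^bsub>R\<lparr>carrier := W\<rparr>\<^esub> v \<in> {w \<in> W. w \<otimes> x \<in> N}"
      have cR: "c \<in> carrier R" and vW: "v \<in> W" using c CW wR v by auto
      have "v \<otimes> x \<in> carrier R" "c \<otimes> (v \<otimes> x) \<in> N" using v(2) vW cR wR xR by (simp_all add: m_assoc)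
      then have "v \<otimes> x \<in> N" by (rule saturated_submoduleD(5) [OF N(1)])
      then show "v \<in> {w \<in> W. w \<otimes> x \<in> N}" using vW by simp
    qed auto
    moreover have "Y \<subseteq> {w \<in> W. w \<otimes> x \<in> N}" using Y(1) N(2) x by blast
    ultimately have "{w \<in> W. w \<otimes> x \<in> N} = W" by (rule Y(2))
    then show ?thesis using w by blast
  qed
  have "saturated_submodule W \<one> R {r \<in> carrier R. \<forall>w\<in>W. w \<otimes> r \<in> N}" (is "saturated_submodule W \<one> R ?U")
  proof (rule saturated_submoduleI)
    show "\<zero> \<in> ?U" using D(2) wR by simp
    show "a \<oplus> b \<in> ?U" if "a \<in> ?U" "b \<in> ?U" for a b using that D(3) wR by (simp add: r_distr)
    show "v \<otimes> a \<in> ?U" if v: "v \<in> W" and a: "a \<in> ?U" for v a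
    proof -
      have "w \<otimes> (v \<otimes> a) \<in> N" if w: "w \<in> W" for w
      proof -
        have "(w \<otimes> v) \<otimes> a \<in> N" using a W(6) [OF w v] by blast
        then show ?thesis using a wR v w by (simp add: m_assoc)
      qed
      then show ?thesis using a wR [OF v] by simp
    qed
  qed auto
  moreover have "X \<subseteq> ?U" using X(1) mem by blast
  ultimately have "?U = carrier R" by (rule X(2))
  then have "r \<in> N" if "r \<in> carrier R" for r
  proof -
    have "\<one> \<otimes> r \<in> N" using that \<open>?U = carrier R\<close> W(3) by blast
    then show ?thesis using that by simp
  qed
  then show ?thesis using D(1) by blast
qed

text \<open>Right multiplication embeds \<open>R\<close> into the ring of its endomorphisms over \<open>C\<close>, in which the
  elements of \<open>C\<close> are central.\<close>

lemma (in scalars) saturated_noetherian_representable: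
  assumes reg: "\<And>x. x \<in> carrier R \<Longrightarrow> c \<otimes> x = \<zero> \<Longrightarrow> x = \<zero>" and nz: "\<one> \<noteq> \<zero>"
    and nat: "\<And>n::nat. [n] \<cdot> \<one> = \<zero> \<or> [n] \<cdot> \<one> \<in> Units R"
    and X: "finite X" "X \<subseteq> carrier R" "\<And>N. saturated_submodule Z c R N \<Longrightarrow> X \<subseteq> N \<Longrightarrow> N = carrier R"
    and acc: "ascending_chain_condition {U. saturated_submodule Z c R U}"
  shows "representable R"
proof -
  define \<Phi> where "\<Phi> = (\<lambda>z x. z \<otimes> x) ` Z"
  define E where "E = commutant_ring R \<Phi>"
  \<comment> \<open>Left multiplications by \<open>Z\<close> and right multiplications by
    \<open>R\<close>. Associativity makes the latter \<open>Z\<close>-linear, and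
    \<open>Z\<close>-linearity of all members of \<open>E\<close> makes the former central in
    \<open>E\<close>.\<close>
  define mul where "mul z = (\<lambda>x\<in>carrier R. z \<otimes> x)" for z
  define \<rho> where "\<rho> r = (\<lambda>x\<in>carrier R. x \<otimes> r)" for r
  note zR = Z_carrier and Zs = subringE [OF sZ]
  have "additive_endo R \<phi>" if "\<phi> \<in> \<Phi>" for \<phi>
    using that zR by (auto simp: \<Phi>_def additive_endo_def r_distr)
  then have Ering: "ring E" unfolding E_def by (intro commutant_ring_is_ring abelian_group_axioms)
  interpret E: ring E by (rule Ering)
  note simps = commutant_ring_simps [where G = R and \<Phi> = \<Phi>, folded E_def]
    and app = commutant_ring_app [where G = R and \<Phi> = \<Phi>, folded E_def]
    and eqI = commutant_ring_eqI [where G = R and \<Phi> = \<Phi>, folded E_def]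
  have mem: "f \<in> carrier E \<longleftrightarrow> f \<in> extensional (carrier R) \<and> additive_endo R f \<and>
      (\<forall>z\<in>Z. \<forall>x\<in>carrier R. f (z \<otimes> x) = z \<otimes> f x)" for f
    unfolding E_def commutant_ring_mem \<Phi>_def by blast
  have lin: "f (z \<otimes> x) = z \<otimes> f x" if "f \<in> carrier E" "z \<in> Z" "x \<in> carrier R" for f z x
    using that mem by blast
  have lapp: "mul z x = z \<otimes> x" if "x \<in> carrier R" for z x using that by (simp add: mul_def)
  have rapp: "\<rho> r x = x \<otimes> r" if "x \<in> carrier R" for r x using that by (simp add: \<rho>_def)
  have lcl: "mul z \<in> carrier E" if z: "z \<in> Z" for z
  proof -
    have "z \<otimes> (w \<otimes> x) = w \<otimes> (z \<otimes> x)" if "w \<in> Z" "x \<in> carrier R" for w x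
      using that z zR Z_comm [OF z that(1)] by (simp add: m_assoc [symmetric])
    then show ?thesis
      unfolding mem using zR [OF z] zR by (auto simp: lapp additive_endo_def r_distr) (simp add: mul_def)
  qed
  have rcl: "\<rho> r \<in> carrier E" if r: "r \<in> carrier R" for r
    unfolding mem using r zR by (auto simp: rapp additive_endo_def l_distr m_assoc) (simp add: \<rho>_def)
  have rhom: "\<rho> \<in> ring_hom R E"
  proof (rule ring_hom_memI)
    show "\<rho> (r \<otimes> s) = \<rho> r \<otimes>\<^bsub>E\<^esub> \<rho> s" if "r \<in> carrier R" "s \<in> carrier R" for r s
      by (rule eqI) (use that rcl in \<open>simp_all add: simps rapp m_assoc\<close>)
    show "\<rho> (r \<oplus> s) = \<rho> r \<oplus>\<^bsub>E\<^esub> \<rho> s" if "r \<in> carrier R" "s \<in> carrier R" for r s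
      by (rule eqI) (use that rcl in \<open>simp_all add: simps rapp r_distr\<close>)
    show "\<rho> \<one> = \<one>\<^bsub>E\<^esub>" by (rule eqI) (use rcl in \<open>simp_all add: simps rapp\<close>)
  qed (rule rcl)
  have rinj: "inj_on \<rho> (carrier R)"
  proof (rule inj_onI)
    fix r s assume rs: "r \<in> carrier R" "s \<in> carrier R" "\<rho> r = \<rho> s"
    then have "\<rho> r \<one> = \<rho> s \<one>" by simp
    then show "r = s" using rs(1,2) by (simp add: rapp)
  qed
  interpret rho: ring_hom_ring R E \<rho> by (rule ring_hom_ringI2 [OF ring_axioms Ering rhom])
  interpret Zr: ring "R\<lparr>carrier := Z\<rparr>" by (rule subring_is_ring [OF sZ])
  have "mul \<in> ring_hom (R\<lparr>carrier := Z\<rparr>) E"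
  proof (rule ring_hom_memI)
    show "mul z \<in> carrier E" if "z \<in> carrier (R\<lparr>carrier := Z\<rparr>)" for z using that lcl by simp
    fix z w assume "z \<in> carrier (R\<lparr>carrier := Z\<rparr>)" "w \<in> carrier (R\<lparr>carrier := Z\<rparr>)"
    then have zw: "z \<in> Z" "w \<in> Z" "z \<in> carrier R" "w \<in> carrier R" using zR by auto
    have "mul (z \<otimes> w) = mul z \<otimes>\<^bsub>E\<^esub> mul w"
      by (rule eqI) (use zw lcl Zs(6) Z_comm [OF zw(1,2)] in \<open>simp_all add: simps lapp m_assoc\<close>)
    then show "mul (z \<otimes>\<^bsub>R\<lparr>carrier := Z\<rparr>\<^esub> w) = mul z \<otimes>\<^bsub>E\<^esub> mul w" by simp
    have "mul (z \<oplus> w) = mul z \<oplus>\<^bsub>E\<^esub> mul w"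
      by (rule eqI) (use zw lcl Zs(7) in \<open>simp_all add: simps lapp l_distr\<close>)
    then show "mul (z \<oplus>\<^bsub>R\<lparr>carrier := Z\<rparr>\<^esub> w) = mul z \<oplus>\<^bsub>E\<^esub> mul w" by simp
  next
    have "mul \<one> = \<one>\<^bsub>E\<^esub>" by (rule eqI) (use lcl Zs(3) in \<open>simp_all add: simps lapp\<close>)
    then show "mul \<one>\<^bsub>R\<lparr>carrier := Z\<rparr>\<^esub> = \<one>\<^bsub>E\<^esub>" by simp
  qed
  then have "ring_hom_ring (R\<lparr>carrier := Z\<rparr>) E mul" by (rule ring_hom_ringI2 [OF Zr.ring_axioms Ering])
  from ring_hom_ring.img_is_subring [OF this Zr.carrier_is_subring]
  have sub: "subring (mul ` Z) E" by simp
  have cent: "mul ` Z \<subseteq> ring_center E"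
  proof
    fix e assume "e \<in> mul ` Z"
    then obtain z where z: "z \<in> Z" "e = mul z" by blast
    have "mul z \<otimes>\<^bsub>E\<^esub> f = f \<otimes>\<^bsub>E\<^esub> mul z" if f: "f \<in> carrier E" for f
      by (rule eqI) (use f lcl [OF z(1)] zR [OF z(1)] lin [OF f z(1)] app(1) [OF f] in \<open>simp_all add: simps lapp\<close>)
    then show "e \<in> ring_center E" using lcl [OF z(1)] unfolding ring_center_def z(2) by blast
  qed
  have Ereg: "f = \<zero>\<^bsub>E\<^esub>" if f: "f \<in> carrier E" and 0: "mul c \<otimes>\<^bsub>E\<^esub> f = \<zero>\<^bsub>E\<^esub>" for f
  proof (rule eqI)
    fix x assume x: "x \<in> carrier R"
    have "c \<otimes> f x = (mul c \<otimes>\<^bsub>E\<^esub> f) x" using x lin [OF f cZ x] by (simp add: simps lapp)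
    then have "c \<otimes> f x = \<zero>" using 0 x by (simp add: simps)
    then show "f x = \<zero>\<^bsub>E\<^esub> x" using reg [OF app(1) [OF f x]] x by (simp add: simps)
  qed (use f in simp_all)
  have nzE: "\<one>\<^bsub>E\<^esub> \<noteq> \<zero>\<^bsub>E\<^esub>"
  proof
    assume "\<one>\<^bsub>E\<^esub> = \<zero>\<^bsub>E\<^esub>"
    then have "\<one>\<^bsub>E\<^esub> \<one> = \<zero>\<^bsub>E\<^esub> \<one>" by simp
    then show False using nz by (simp add: simps)
  qed
  have scE: "scalars E (mul ` Z) (mul c)"
  proof (intro scalars.intro scalars_axioms.intro Ering sub)
    show "a \<otimes>\<^bsub>E\<^esub> b = b \<otimes>\<^bsub>E\<^esub> a" if "a \<in> mul ` Z" "b \<in> mul ` Z" for a b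
      using that cent by (auto simp: ring_center_def)
  qed (use cZ in blast)
  have sat0: "saturated_submodule Z c R {\<zero>}"
    by (rule saturated_submoduleI) (use zR reg in auto)
  have "{U. saturated_submodule Z c R U \<and> {\<zero>} \<subseteq> U} = {U. saturated_submodule Z c R U}"
    by (auto dest: saturated_submoduleD(2))
  then have acc0: "acc_above Z c R {\<zero>}" using acc by (simp add: acc_above_def)
  \<comment> \<open>Evaluation at the generators maps \<open>E\<close> to a finite power of
    \<open>R\<close>, which gives the chain condition modulo the endomorphisms that vanish on
    \<open>X\<close>.\<close>
  have "acc_above (mul ` Z) (mul c) E {e \<in> carrier E. \<forall>x\<in>X. e x \<in> {\<zero>}}"
  proof (rule conjunct2 [OF acc_above_vimage [where f = "\<lambda>x e. e x" and \<sigma> = mul and R' = R and Z' = Z and c' = c]])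
    show "scalars R Z c" by (rule scalars_axioms)
    fix x assume "x \<in> X"
    then have x: "x \<in> carrier R" using X(2) by blast
    show "(\<lambda>e. e x) \<in> carrier E \<rightarrow> carrier R" using app(1) x by blast
    show "(e \<oplus>\<^bsub>E\<^esub> f) x = e x \<oplus> f x" for e f using x by (simp add: simps)
    show "(mul z \<otimes>\<^bsub>E\<^esub> e) x = z \<otimes> e x" if "z \<in> Z" "e \<in> carrier E" for z e
      using x that lin by (simp add: simps lapp)
  qed (use scE X(1) sat0 acc0 in auto)
  \<comment> \<open>The kernel of e is saturated because \<open>c\<close> is regular, so if it
    contains \<open>X\<close> it is everything.\<close>
  moreover have "e = \<zero>\<^bsub>E\<^esub>" if e: "e \<in> carrier E" "\<And>x. x \<in> X \<Longrightarrow> e x = \<zero>" for e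
  proof -
    have e0: "e \<zero> = \<zero>" using lin [OF e(1) Zs(2) zero_closed] app(1) [OF e(1) zero_closed] by simp
    have "saturated_submodule Z c R {r \<in> carrier R. e r = \<zero>}"
    proof (rule saturated_submoduleI)
      show "x \<oplus> y \<in> {r \<in> carrier R. e r = \<zero>}"
        if "x \<in> {r \<in> carrier R. e r = \<zero>}" "y \<in> {r \<in> carrier R. e r = \<zero>}" for x y
        using that app(2) [OF e(1)] by simp
      show "z \<otimes> x \<in> {r \<in> carrier R. e r = \<zero>}" if "z \<in> Z" "x \<in> {r \<in> carrier R. e r = \<zero>}" for z x
        using that lin [OF e(1)] zR by simp
      fix x assume x: "x \<in> carrier R" "c \<otimes> x \<in> {r \<in> carrier R. e r = \<zero>}"
      then have "c \<otimes> e x = \<zero>" using lin [OF e(1) cZ x(1)] by simp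
      then show "x \<in> {r \<in> carrier R. e r = \<zero>}" using reg [OF app(1) [OF e(1) x(1)]] x(1) by simp
    qed (use e0 in auto)
    moreover have "X \<subseteq> {r \<in> carrier R. e r = \<zero>}" using X(2) e(2) by blast
    ultimately have "{r \<in> carrier R. e r = \<zero>} = carrier R" by (rule X(3))
    then have "e x = \<zero>" if "x \<in> carrier R" for x using that by blast
    then show ?thesis by (intro eqI) (use e(1) in \<open>simp_all add: simps\<close>)
  qed
  then have "{e \<in> carrier E. \<forall>x\<in>X. e x \<in> {\<zero>}} \<subseteq> {\<zero>\<^bsub>E\<^esub>}" by blast
  then have "U \<supseteq> {e \<in> carrier E. \<forall>x\<in>X. e x \<in> {\<zero>}}"
    if "saturated_submodule (mul ` Z) (mul c) E U" for U
    using saturated_submoduleD(2) [OF that] by blast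
  then have "{U. saturated_submodule (mul ` Z) (mul c) E U \<and> {e \<in> carrier E. \<forall>x\<in>X. e x \<in> {\<zero>}} \<subseteq> U} =
      {U. saturated_submodule (mul ` Z) (mul c) E U}"
    by auto
  ultimately have accE: "ascending_chain_condition {U. saturated_submodule (mul ` Z) (mul c) E U}"
    by (simp only: acc_above_def)
  have "representable E"
    by (rule E.central_saturated_representable [OF sub cent nzE rho.nat_zero_or_unit_hom [OF nat] _ Ereg accE])
      (use cZ in blast)
  then show ?thesis using rhom rinj by (rule representable_embed)
qed

section \<open>The base field and the assembly of the proof\<close>

text \<open>Integer multiples of 1 are scalar multiples of 1, and a nonzero scalar is invertible.
  This is where the base field enters.\<close>

lemma (in assoc_algebra) nat_zero_or_unit:
  "[(n::nat)] \<cdot>\<^bsub>R\<^esub> \<one>\<^bsub>R\<^esub> = \<zero>\<^bsub>R\<^esub> \<or> [n] \<cdot>\<^bsub>R\<^esub> \<one>\<^bsub>R\<^esub> \<in> Units R"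
proof -
  have eq: "[(n::nat)] \<cdot>\<^bsub>R\<^esub> \<one>\<^bsub>R\<^esub> = ([n] \<cdot>\<^bsub>F\<^esub> \<one>\<^bsub>F\<^esub>) \<odot>\<^bsub>R\<^esub> \<one>\<^bsub>R\<^esub>" for n
  proof (induction n)
    case 0
    show ?case using R.one_closed by (simp add: smult_l_null)
  next
    case (Suc n)
    then show ?case
      using R.one_closed F.one_closed F.add.nat_pow_closed [of "\<one>\<^bsub>F\<^esub>" n]
      by (simp add: smult_l_distr add_pow_def smult_one)
  qed
  define a where "a = [n] \<cdot>\<^bsub>F\<^esub> \<one>\<^bsub>F\<^esub>"
  have a: "a \<in> carrier F" unfolding a_def by simp
  show ?thesis
  proof (cases "a = \<zero>\<^bsub>F\<^esub>")
    case True
    then show ?thesis using eq [of n] R.one_closed by (simp add: a_def [symmetric] smult_l_null)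
  next
    case False
    then have u: "a \<in> Units F" using a F.field_Units by simp
    then have inv: "inv\<^bsub>F\<^esub> a \<in> carrier F" "a \<otimes>\<^bsub>F\<^esub> inv\<^bsub>F\<^esub> a = \<one>\<^bsub>F\<^esub>" "inv\<^bsub>F\<^esub> a \<otimes>\<^bsub>F\<^esub> a = \<one>\<^bsub>F\<^esub>" by auto
    have "(b \<odot>\<^bsub>R\<^esub> \<one>\<^bsub>R\<^esub>) \<otimes>\<^bsub>R\<^esub> (d \<odot>\<^bsub>R\<^esub> \<one>\<^bsub>R\<^esub>) = (b \<otimes>\<^bsub>F\<^esub> d) \<odot>\<^bsub>R\<^esub> \<one>\<^bsub>R\<^esub>"
      if "b \<in> carrier F" "d \<in> carrier F" for b d
      using that R.one_closed by (simp add: smult_mult_left smult_assoc1)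
    then have "(inv\<^bsub>F\<^esub> a \<odot>\<^bsub>R\<^esub> \<one>\<^bsub>R\<^esub>) \<otimes>\<^bsub>R\<^esub> (a \<odot>\<^bsub>R\<^esub> \<one>\<^bsub>R\<^esub>) = \<one>\<^bsub>R\<^esub>"
      "(a \<odot>\<^bsub>R\<^esub> \<one>\<^bsub>R\<^esub>) \<otimes>\<^bsub>R\<^esub> (inv\<^bsub>F\<^esub> a \<odot>\<^bsub>R\<^esub> \<one>\<^bsub>R\<^esub>) = \<one>\<^bsub>R\<^esub>"
      using a inv R.one_closed by (simp_all add: smult_one)
    then have "a \<odot>\<^bsub>R\<^esub> \<one>\<^bsub>R\<^esub> \<in> Units R"
      unfolding Units_def using a inv R.one_closed by (auto intro: smult_closed)
    then show ?thesis using eq [of n] by (simp add: a_def)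
  qed
qed

theorem theorem2p1:
  fixes F :: "('f, 'c) ring_scheme"
    and R :: "('f, 'a, 'm) module_scheme"
    and W :: "'a set" and c :: 'a
  assumes "assoc_algebra F R"
    and "\<one>\<^bsub>R\<^esub> \<noteq> \<zero>\<^bsub>R\<^esub>"
    and "left_noetherian R"
    and "assoc_subalgebra W F R"
    and "weakly_noetherian (R\<lparr>carrier := W\<rparr>)"
    and "fin_gen_left ((\<lambda>w. nilradical R +>\<^bsub>R\<^esub> w) ` W) (R Quot nilradical R)"
    and "c \<in> ring_center (R\<lparr>carrier := W\<rparr>)"
    and "regular_element R c"
    and "finite_over_center (localization (R\<lparr>carrier := W\<rparr>) c)"
  shows "representable R"
proof -
  interpret ring R using assms(1) by (simp add: assoc_algebra_def)
  have sW: "subring W R" using assms(4) by (simp add: assoc_subalgebra_def)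
  note WR = subringE(1) [OF sW]
  define C where "C = ring_center (R\<lparr>carrier := W\<rparr>)"
  have cC: "c \<in> C" using assms(7) by (simp add: C_def)
  note nil = nilradical_shrinking [OF assms(3)]
  \<comment> \<open>Generation is lifted in three stages: \<open>X0\<close> generates over
    \<open>W\<close> modulo the nilradical, \<open>X\<close> generates over \<open>W\<close>, and
    the products of \<open>X\<close> with generators \<open>Y\<close> of \<open>W\<close> generate
    over \<open>C\<close> up to powers of \<open>c\<close>.\<close>
  obtain X0 where X0: "finite X0" "X0 \<subseteq> carrier R"
    "\<And>U. saturated_submodule W \<one>\<^bsub>R\<^esub> R U \<Longrightarrow> X0 \<subseteq> U \<Longrightarrow> nilradical R \<subseteq> U \<Longrightarrow> U = carrier R"
    using generators_mod_ideal [OF nil(1) WR assms(6)] by blast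
  have nilR: "nilradical R \<subseteq> carrier R" using ideal.Icarr [OF nil(1)] by blast
  obtain X where X: "finite X" "X \<subseteq> carrier R"
    "\<And>U. saturated_submodule W \<one>\<^bsub>R\<^esub> R U \<Longrightarrow> X \<subseteq> U \<Longrightarrow> U = carrier R"
    using finitely_generated_mod_shrinking [OF assms(3) sW nil(2) X0 nilR] by blast
  interpret W: central_element "R\<lparr>carrier := W\<rparr>" c
    by (intro central_element.intro central_element_axioms.intro subring_is_ring sW assms(7))
  have "regular_element (R\<lparr>carrier := W\<rparr>) c"
    using assms(8) W.c_closed WR unfolding regular_element_def by auto
  then obtain Y where Y: "finite Y" "Y \<subseteq> W"
    "\<And>V. saturated_submodule C c (R\<lparr>carrier := W\<rparr>) V \<Longrightarrow> Y \<subseteq> V \<Longrightarrow> V = W"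
    using W.generators_up_to_powers [OF _ assms(9)] by (auto simp: C_def)
  let ?G = "{y \<otimes>\<^bsub>R\<^esub> x |y x. y \<in> Y \<and> x \<in> X}"
  have "?G = (\<lambda>(y, x). y \<otimes>\<^bsub>R\<^esub> x) ` (Y \<times> X)" by auto
  then have G: "finite ?G" using X(1) Y(1) by simp
  have GR: "?G \<subseteq> carrier R" using X(2) Y(2) WR by (blast intro: m_closed)
  have CW: "C \<subseteq> W" "z \<otimes>\<^bsub>R\<^esub> w = w \<otimes>\<^bsub>R\<^esub> z" if "z \<in> C" "w \<in> W" for z w
    using that by (auto simp: C_def ring_center_def)
  have gen: "N = carrier R" if "saturated_submodule C c R N" "?G \<subseteq> N" for N
    by (rule generators_trans [OF sW _ CW(2) cC X(2,3) Y(2,3) that]) (auto simp: C_def ring_center_def)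
  have "scalars R C c" and acc: "ascending_chain_condition {U. saturated_submodule C c R U}"
    by (rule eakin_nagata_formanek [OF sW assms(5) C_def cC assms(8) G GR]; erule (1) gen)+
  then interpret scalars R C c by simp
  have reg: "x = \<zero>\<^bsub>R\<^esub>" if "x \<in> carrier R" "c \<otimes>\<^bsub>R\<^esub> x = \<zero>\<^bsub>R\<^esub>" for x
    using assms(8) that unfolding regular_element_def by blast
  show ?thesis
  proof (rule saturated_noetherian_representable)
    show "x = \<zero>\<^bsub>R\<^esub>" if "x \<in> carrier R" "c \<otimes>\<^bsub>R\<^esub> x = \<zero>\<^bsub>R\<^esub>" for x using reg that .
    show "N = carrier R" if "saturated_submodule C c R N" "?G \<subseteq> N" for N using gen that .
  qed (rule assms(2) assoc_algebra.nat_zero_or_unit [OF assms(1)] G GR acc)+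
qed

end
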